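(* Let $(X,L)$ be a polarized complexity-one projective rational $T$-variety with corresponding divisorial polytope $\Psi:\Box\to\mathrm{Div}_{\mathbb{Q}}\mathbb{P}^1$. Let $Q\in\mathbb{P}^1$, $m\in\mathbb{N}$, $m\geq 1$, and $v\in N'_{\mathbb{Q}}$ with $mv\in N'$. Then the normalization $\widetilde{\mathcal{X}}_0$ of the special fiber of $\mathcal{X}=\mathcal{X}(Q,v,m)$ is the polarized toric variety given by the polytope $$\Delta_Q=\Big\{(u,a)\in M_{\mathbb{R}}\times\mathbb{R}\;\Big|\;u\in\Box,\ -\sum_{P\ne Q}\Psi_P(u)\le a\le\Psi_Q(u)\Big\}$$ with respect to the lattice $M\times\mathbb{Z}$. The induced $\mathbb{C}^*$-action on $\widetilde{\mathcal{X}}_0$ is given by the one-parameter subgroup $(-m\overline v,m)\in N\times\mathbb{Z}$, where $\overline v$ is the projection of $v\in N'_{\mathbb{Q}}$ to $N_{\mathbb{Q}}$.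
   Context: Everything is over $\mathbb{C}$. $T$ is an algebraic torus with character lattice $M$ and dual lattice $N$. A complexity-one $T$-variety is a normal variety with effective $T$-action whose general orbits have codimension one; polarized means equipped with a ($T$-linearized) ample line bundle $L$. Put $M'=\mathbb{Z}\times M$, $N'=\mathbb{Z}\times N$. **Divisorial polytopes.** Let $\Box\subset M_{\mathbb{R}}$ be a lattice polytope. A divisorial polytope over $\Box$ is a map $\Psi=\sum_{P\in\mathbb{P}^1}\Psi_P\otimes P:\Box\to\mathrm{Div}_{\mathbb{Q}}\mathbb{P}^1$ with each $\Psi_P$ continuous, concave, piecewise affine, $\Psi_P\equiv0$ for all but finitely many $P$, such that $\deg\Psi(u)=\sum_P\Psi_P(u)>0$ for $u$ in the interior of $\Box$, and the graph of each $\Psi_P$ has vertices in $M\times\mathbb{Z}$. It corresponds to $(X,L)$ via $H^0(X,L^{\otimes k})=\bigoplus_{u\in\Box\cap\frac1kM}H^0(\mathbb{P}^1,\mathcal{O}(\lfloor k\Psi(u)\rfloor))$ for all $k\ge0$, as graded rings. **p-divisors.** A polyhedral divisor on $\mathbb{P}^1$ with respect to $N'$ with tail cone $\sigma\subset N'_{\mathbb{R}}$ (a pointed rational polyhedral cone) is a formal sum $\mathfrak{D}=\sum_{P\in\mathbb{P}^1}\mathfrak{D}_P\otimes P$, with $\mathfrak{D}_P\subset N'_{\mathbb{R}}$ rational polyhedra with tail (recession) cone $\sigma$, all but finitely many equal to $\sigma$. For $u\in\sigma^\vee$ put $\mathfrak{D}_P(u)=\min_{w\in\mathfrak{D}_P}\langle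 w,u\rangle$ and $\mathfrak{D}(u)=\sum_P\mathfrak{D}_P(u)\cdot P$. $\mathfrak{D}$ is a p-divisor if the Minkowski sum $\sum_P\mathfrak{D}_P$ is properly contained in $\sigma$. The $M'$-graded section ring of $(X,L)$ is described by the p-divisor $\mathfrak{D}$ with $\sigma^\vee$ the cone generated by $\{1\}\times\Box$ and $\mathfrak{D}((k,u))=k\cdot\Psi(u/k)$: $$\bigoplus_iH^0(X,L^{\otimes i})\cong\bigoplus_{u\in\sigma^\vee\cap M'}H^0(\mathbb{P}^1,\mathcal{O}(\lfloor\mathfrak{D}(u)\rfloor))\cdot\chi^u .$$ **The test configuration $\mathcal{X}(Q,v,m)$.** Let $\widetilde N=N'\times\mathbb{Z}$, $\widetilde M=M'\times\mathbb{Z}$, let $\widetilde\sigma\subset\widetilde N_{\mathbb{R}}$ be the closed convex cone generated by $(v,1/m)+\sum_{P\neq Q}(\mathfrak{D}_P,0)$ and $\sum_{P\in\mathbb{P}^1}(\mathfrak{D}_P,0)$, and $$\widetilde{\mathfrak{D}}=\big(\mathrm{conv}\{(v,1/m),(\mathfrak{D}_Q,0)\}+\widetilde\sigma\big)\otimes Q+\sum_{P\ne Q}\big((\mathfrak{D}_P,0)+\widetilde\sigma\big)\otimes P .$$ Put $\mathcal{A}=\bigoplus_{u\in\widetilde\sigma^\vee\cap\widetilde M}H^0(\mathbb{P}^1,\mathcal{O}(\lfloor\widetilde{\mathfrak{D}}(u)\rfloor))\cdot\chi^u$ and $\mathcal{X}(Q,v,m)=\mathrm{Proj}\,\mathcal{A}$,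 where Proj is with respect to the first $\mathbb{Z}$-factor of $\widetilde M=\mathbb{Z}\times M\times\mathbb{Z}$. Its degree-zero part is $\mathcal{A}_0=\mathbb{C}[t]$, $t=\chi^{(0,0,1)}$, giving a flat family over $\mathbb{A}^1$ with special fiber $\mathrm{Proj}\,\mathcal{A}/(t)$; the $\mathbb{C}^*$-action corresponds to the one-parameter subgroup $(0,1)\in N'\times\mathbb{Z}$, and the polarization is the $\mathbb{Q}$-line bundle $\mathcal{O}(1)$. The polarized toric variety given by a rational polytope $\Delta$ with respect to a lattice $\Lambda$ is $\mathrm{Proj}$ of the semigroup algebra of $C(\Delta)\cap(\mathbb{Z}\times\Lambda)$, $C(\Delta)$ being the cone generated by $\{1\}\times\Delta$. *)

theory Defs
  imports
    "HOL-Analysis.Analysis"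
    "HOL-Algebra.QuotRing"
    "HOL-Algebra.Module"
    "HOL-Computational_Algebra.Computational_Algebra"
    "HOL-Library.Poly_Mapping"
begin

section \<open>Lattices, cones and divisorial polytopes\<close>

text \<open>
  \<open>M\<^sub>\<real>\<close> is a real inner product space that carries a lattice \<open>M\<close> of full rank (rank 0 included);
  the inner product identifies \<open>N\<^sub>\<real>\<close> with \<open>M\<^sub>\<real>\<close>, and \<open>N\<close> becomes the dual lattice.
  The lattices \<open>\<int> \<times> M\<close>, \<open>(\<int> \<times> M) \<times> \<int>\<close>, etc. live in product spaces, whose inner product
  is the sum of the inner products of the components.
\<close>

definition full_lattice :: "'v::real_inner set \<Rightarrow> bool" where
  "full_lattice M \<longleftrightarrow> (\<exists>B. finite B \<and> independent B \<and> span B = UNIV \<and>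
     M = {\<Sum>b\<in>B. of_int (c b) *\<^sub>R b | c :: 'v \<Rightarrow> int. True})"

definition dual_lattice :: "'v::real_inner set \<Rightarrow> 'v set" where
  "dual_lattice M = {w. \<forall>u\<in>M. w \<bullet> u \<in> \<int>}"

definition dual_cone :: "'v::real_inner set \<Rightarrow> 'v set" where
  "dual_cone S = {u. \<forall>w\<in>S. w \<bullet> u \<ge> 0}"

definition closed_convex_cone_hull :: "'v::real_normed_vector set \<Rightarrow> 'v set" where
  "closed_convex_cone_hull S = (\<lambda>T. closed T \<and> convex_cone T) hull S"

definition cone_over :: "'v::real_vector set \<Rightarrow> (real \<times> 'v) set" where
  "cone_over S = convex_cone hull ({1} \<times> S)"

definition lattice_polytope :: "'v::real_vector set \<Rightarrow> 'v set \<Rightarrow> bool" where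
  "lattice_polytope M S \<longleftrightarrow> (\<exists>V. finite V \<and> V \<noteq> {} \<and> V \<subseteq> M \<and> S = convex hull V)"

datatype proj_line = Fin complex | Infinity

text \<open>Sum of a family indexed by points of the projective line, almost all of whose members vanish.\<close>

definition point_sum :: "proj_line set \<Rightarrow> (proj_line \<Rightarrow> real) \<Rightarrow> real" where
  "point_sum A c = (\<Sum>P\<in>{P\<in>A. c P \<noteq> 0}. c P)"

text \<open>
  The last conjunct says that \<open>\<Psi> P\<close> is piecewise affine with the vertices of its graph in
  \<open>M \<times> \<int>\<close>: the part of a graph over a set \<open>C\<close> is a polytope exactly if \<open>C\<close> is a polytope and
  the function is affine on \<open>C\<close>.  The polytope \<open>\<box>\<close> has to be full-dimensional, because
  otherwise \<open>T\<close> does not act effectively and positivity on the interior is void.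
\<close>

definition divisorial_polytope ::
  "'v::real_inner set \<Rightarrow> 'v set \<Rightarrow> (proj_line \<Rightarrow> 'v \<Rightarrow> real) \<Rightarrow> bool" where
  "divisorial_polytope M Box \<Psi> \<longleftrightarrow>
     lattice_polytope M Box \<and> interior Box \<noteq> {} \<and>
     finite {P. \<exists>u\<in>Box. \<Psi> P u \<noteq> 0} \<and>
     (\<forall>u\<in>interior Box. point_sum UNIV (\<lambda>P. \<Psi> P u) > 0) \<and>
     (\<forall>P. continuous_on Box (\<Psi> P) \<and> concave_on Box (\<Psi> P) \<and>
       (\<exists>\<C>. finite \<C> \<and> \<Union>\<C> = Box \<and>
         (\<forall>C\<in>\<C>. lattice_polytope (M \<times> \<int>) {(u, \<Psi> P u) | u. u \<in> C})))"

section \<open>p-divisors on the projective line\<close>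

definition minkowski_sum :: "proj_line set \<Rightarrow> (proj_line \<Rightarrow> 'w::real_vector set) \<Rightarrow> 'w set" where
  "minkowski_sum A \<D> =
     {\<Sum>P\<in>{P\<in>A. w P \<noteq> 0}. w P | w. (\<forall>P\<in>A. w P \<in> \<D> P) \<and> finite {P\<in>A. w P \<noteq> 0}}"

text \<open>
  \<open>polyhedron_with_tail N \<sigma> S\<close>: \<open>S\<close> is a polyhedron with vertices in \<open>N\<^sub>\<rat>\<close> and tail cone \<open>\<sigma>\<close>,
  i.e. the Minkowski sum of a rational polytope and \<open>\<sigma>\<close>.
\<close>

definition polyhedron_with_tail :: "'w::real_vector set \<Rightarrow> 'w set \<Rightarrow> 'w set \<Rightarrow> bool" where
  "polyhedron_with_tail N \<sigma> S \<longleftrightarrow>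
     (\<exists>V. finite V \<and> V \<noteq> {} \<and> (\<forall>x\<in>V. \<exists>k::nat. k > 0 \<and> real k *\<^sub>R x \<in> N) \<and> S = convex hull V + \<sigma>)"

definition pointed_rational_cone :: "'w::real_vector set \<Rightarrow> 'w set \<Rightarrow> bool" where
  "pointed_rational_cone N \<sigma> \<longleftrightarrow>
     (\<exists>G. finite G \<and> G \<subseteq> N \<and> \<sigma> = convex_cone hull G) \<and> (\<forall>x\<in>\<sigma>. - x \<in> \<sigma> \<longrightarrow> x = 0)"

definition p_divisor :: "'w::real_vector set \<Rightarrow> 'w set \<Rightarrow> (proj_line \<Rightarrow> 'w set) \<Rightarrow> bool" where
  "p_divisor N \<sigma> \<D> \<longleftrightarrow> pointed_rational_cone N \<sigma> \<and>
     (\<forall>P. polyhedron_with_tail N \<sigma> (\<D> P)) \<and> finite {P. \<D> P \<noteq> \<sigma>} \<and>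
     minkowski_sum UNIV \<D> \<subset> \<sigma>"

text \<open>For \<open>S = \<D> P\<close> and \<open>u \<in> \<sigma>\<^sup>\<or>\<close> the infimum is a minimum.\<close>

definition polyhedral_value :: "'w::real_inner set \<Rightarrow> 'w \<Rightarrow> real" where
  "polyhedral_value S u = (INF w\<in>S. w \<bullet> u)"

text \<open>The cone and the polyhedral divisor that define the test configuration \<open>\<X>(Q,v,m)\<close>.\<close>

definition tc_cone :: "(proj_line \<Rightarrow> 'w::real_inner set) \<Rightarrow> proj_line \<Rightarrow> 'w \<Rightarrow> nat \<Rightarrow> ('w \<times> real) set" where
  "tc_cone \<D> Q v m = closed_convex_cone_hull
     (({(v, 1 / real m)} + minkowski_sum (- {Q}) \<D> \<times> {0}) \<union> minkowski_sum UNIV \<D> \<times> {0})"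

definition tc_divisor ::
  "(proj_line \<Rightarrow> 'w::real_inner set) \<Rightarrow> proj_line \<Rightarrow> 'w \<Rightarrow> nat \<Rightarrow> proj_line \<Rightarrow> ('w \<times> real) set" where
  "tc_divisor \<D> Q v m P =
     (if P = Q then convex hull (insert (v, 1 / real m) (\<D> Q \<times> {0})) else \<D> P \<times> {0})
       + tc_cone \<D> Q v m"

section \<open>Graded algebras\<close>

text \<open>Algebras over the complex numbers, given by the ring homomorphism \<open>scal\<close>, and graded ones.\<close>

record 'a calg = "'a ring" +
  scal :: "complex \<Rightarrow> 'a"

record 'a gcalg = "'a calg" +
  hcomp :: "nat \<Rightarrow> 'a set"

type_synonym ratfun = "complex poly fract"

definition const_fun :: "complex \<Rightarrow> ratfun" where
  "const_fun c = Fract [:c:] 1"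

definition ord_at :: "proj_line \<Rightarrow> ratfun \<Rightarrow> int" where
  "ord_at P f = (THE k. \<exists>a b. a \<noteq> 0 \<and> b \<noteq> 0 \<and> f = Fract a b \<and>
     k = (case P of
            Fin c \<Rightarrow> int (Polynomial.order c a) - int (Polynomial.order c b)
          | Infinity \<Rightarrow> int (Polynomial.degree b) - int (Polynomial.degree a)))"

text \<open>Global sections of \<open>\<O>(E)\<close> for an integral divisor \<open>E\<close> on the projective line.\<close>

definition H0 :: "(proj_line \<Rightarrow> int) \<Rightarrow> ratfun set" where
  "H0 E = {f. f \<noteq> 0 \<longrightarrow> (\<forall>P. ord_at P f + E P \<ge> 0)}"

text \<open>
  The algebra of finite sums \<open>\<Sum> f\<^sub>w \<chi>\<^sup>w\<close> with \<open>w \<in> W\<close> and \<open>f\<^sub>w \<in> H0 \<lfloor>E w\<rfloor>\<close>, graded by the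
  function \<open>h\<close> on exponents.  Elements are finitely supported functions \<open>w \<mapsto> f\<^sub>w\<close>, multiplied
  by convolution.
\<close>

definition section_alg ::
  "('k::real_vector \<Rightarrow> real) \<Rightarrow> 'k set \<Rightarrow> (proj_line \<Rightarrow> 'k \<Rightarrow> real) \<Rightarrow> ('k \<Rightarrow>\<^sub>0 ratfun) gcalg" where
  "section_alg h W E =
     (let A = {f. \<forall>w\<in>Poly_Mapping.keys f. w \<in> W \<and> Poly_Mapping.lookup f w \<in> H0 (\<lambda>P. \<lfloor>E P w\<rfloor>)}
      in \<lparr>carrier = A, mult = (*), one = 1, zero = 0, add = (+),
          scal = (\<lambda>c. Poly_Mapping.single 0 (const_fun c)),
          hcomp = (\<lambda>i. {f\<in>A. \<forall>w\<in>Poly_Mapping.keys f. h w = real i})\<rparr>)"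

definition semigroup_alg :: "('k::real_vector \<Rightarrow> real) \<Rightarrow> 'k set \<Rightarrow> ('k \<Rightarrow>\<^sub>0 complex) gcalg" where
  "semigroup_alg h W =
     (let A = {f. Poly_Mapping.keys f \<subseteq> W}
      in \<lparr>carrier = A, mult = (*), one = 1, zero = 0, add = (+),
          scal = Poly_Mapping.single 0,
          hcomp = (\<lambda>i. {f\<in>A. \<forall>w\<in>Poly_Mapping.keys f. h w = real i})\<rparr>)"

definition quot_alg :: "'a gcalg \<Rightarrow> 'a set \<Rightarrow> 'a set gcalg" where
  "quot_alg A I =
     \<lparr>carrier = carrier (A Quot I), mult = mult (A Quot I), one = one (A Quot I),
      zero = zero (A Quot I), add = add (A Quot I),
      scal = (\<lambda>c. I +>\<^bsub>A\<^esub> scal A c),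
      hcomp = (\<lambda>i. (\<lambda>x. I +>\<^bsub>A\<^esub> x) ` hcomp A i)\<rparr>"

text \<open>
  The section ring of the polarized \<open>T\<close>-variety belonging to \<open>\<Psi>\<close>; its degree \<open>k\<close> part consists
  of the \<open>H0 \<lfloor>k \<Psi>(u/k)\<rfloor> \<chi>\<^bsup>(k,u)\<^esup>\<close>.
\<close>

definition polytope_alg ::
  "'v::real_inner set \<Rightarrow> 'v set \<Rightarrow> (proj_line \<Rightarrow> 'v \<Rightarrow> real) \<Rightarrow> ((real \<times> 'v) \<Rightarrow>\<^sub>0 ratfun) gcalg" where
  "polytope_alg M Box \<Psi> =
     section_alg fst (cone_over Box \<inter> \<int> \<times> M) (\<lambda>P (k, u). k * \<Psi> P (u /\<^sub>R k))"

text \<open>The algebra \<open>\<A>\<close> with \<open>\<X>(Q,v,m) = Proj \<A>\<close>, and \<open>\<A>/(t)\<close>.\<close>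

definition tc_alg ::
  "'v::real_inner set \<Rightarrow> (proj_line \<Rightarrow> (real \<times> 'v) set) \<Rightarrow> proj_line \<Rightarrow> real \<times> 'v \<Rightarrow> nat
    \<Rightarrow> (((real \<times> 'v) \<times> real) \<Rightarrow>\<^sub>0 ratfun) gcalg" where
  "tc_alg M \<D> Q v m =
     section_alg (fst \<circ> fst) (dual_cone (tc_cone \<D> Q v m) \<inter> (\<int> \<times> M) \<times> \<int>)
       (\<lambda>P. polyhedral_value (tc_divisor \<D> Q v m P))"

definition tc_fiber_alg ::
  "'v::real_inner set \<Rightarrow> (proj_line \<Rightarrow> (real \<times> 'v) set) \<Rightarrow> proj_line \<Rightarrow> real \<times> 'v \<Rightarrow> nat
    \<Rightarrow> (((real \<times> 'v) \<times> real) \<Rightarrow>\<^sub>0 ratfun) set gcalg" where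
  "tc_fiber_alg M \<D> Q v m =
     (let A = tc_alg M \<D> Q v m in quot_alg A (PIdl\<^bsub>A\<^esub> (Poly_Mapping.single ((0, 0), 1) 1)))"

text \<open>The algebra of the toric variety of \<open>\<Delta>\<close> with respect to the lattice \<open>\<Lambda>\<close>.\<close>

definition toric_alg :: "'k::real_vector set \<Rightarrow> 'k set \<Rightarrow> ((real \<times> 'k) \<Rightarrow>\<^sub>0 complex) gcalg" where
  "toric_alg \<Lambda> \<Delta> = semigroup_alg fst (cone_over \<Delta> \<inter> \<int> \<times> \<Lambda>)"

section \<open>Locally ringed spaces over the complex numbers\<close>

record ('x, 's) cspace =
  tp :: "'x topology"
  osec :: "'x set \<Rightarrow> 's calg"
  ores :: "'x set \<Rightarrow> 'x set \<Rightarrow> 's \<Rightarrow> 's"  \<comment> \<open>\<open>ores U V\<close> restricts from \<open>U\<close> to \<open>V\<close>\<close>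

text \<open>A morphism is a map of points together with its pullback of sections.\<close>

type_synonym ('y, 't, 'x, 's) cmorph = "('y \<Rightarrow> 'x) \<times> ('x set \<Rightarrow> 's \<Rightarrow> 't)"

definition preim :: "('y, 't) cspace \<Rightarrow> ('y, 't, 'x, 's) cmorph \<Rightarrow> 'x set \<Rightarrow> 'y set" where
  "preim Y f V = {y \<in> topspace (tp Y). fst f y \<in> V}"

definition unit_near :: "('x, 's) cspace \<Rightarrow> 'x set \<Rightarrow> 's \<Rightarrow> 'x \<Rightarrow> bool" where
  "unit_near X V s x \<longleftrightarrow>
     (\<exists>W. openin (tp X) W \<and> x \<in> W \<and> W \<subseteq> V \<and> ores X V W s \<in> Units (osec X W))"

text \<open>
  The last condition is locality: the germ of a section at a point of a locally ringed space lies
  in the maximal ideal if and only if the section is not a unit near that point.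
\<close>

definition morphism ::
  "('y, 't) cspace \<Rightarrow> ('x, 's) cspace \<Rightarrow> ('y, 't, 'x, 's) cmorph \<Rightarrow> bool" where
  "morphism Y X f \<longleftrightarrow>
     continuous_map (tp Y) (tp X) (fst f) \<and>
     (\<forall>V. openin (tp X) V \<longrightarrow>
        snd f V \<in> ring_hom (osec X V) (osec Y (preim Y f V)) \<and>
        (\<forall>c. snd f V (scal (osec X V) c) = scal (osec Y (preim Y f V)) c)) \<and>
     (\<forall>V W. openin (tp X) V \<and> openin (tp X) W \<and> W \<subseteq> V \<longrightarrow>
        (\<forall>s\<in>carrier (osec X V).
           snd f W (ores X V W s) = ores Y (preim Y f V) (preim Y f W) (snd f V s))) \<and>
     (\<forall>V y. openin (tp X) V \<and> y \<in> preim Y f V \<longrightarrow>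
        (\<forall>s\<in>carrier (osec X V).
           unit_near Y (preim Y f V) (snd f V s) y \<longrightarrow> unit_near X V s (fst f y)))"

definition isomorphism ::
  "('y, 't) cspace \<Rightarrow> ('x, 's) cspace \<Rightarrow> ('y, 't, 'x, 's) cmorph \<Rightarrow> bool" where
  "isomorphism Y X f \<longleftrightarrow> morphism Y X f \<and> homeomorphic_map (tp Y) (tp X) (fst f) \<and>
     (\<forall>V. openin (tp X) V \<longrightarrow>
        bij_betw (snd f V) (carrier (osec X V)) (carrier (osec Y (preim Y f V))))"

text \<open>\<open>intertwines Y X g f h\<close>: the morphisms \<open>f \<circ> g\<close> and \<open>h \<circ> f\<close> agree, where \<open>f\<close> maps \<open>Y\<close> to
  \<open>X\<close> and \<open>g\<close>, \<open>h\<close> are endomorphisms of \<open>Y\<close> and \<open>X\<close>.\<close>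

definition intertwines ::
  "('y, 't) cspace \<Rightarrow> ('x, 's) cspace \<Rightarrow> ('y, 't, 'y, 't) cmorph \<Rightarrow> ('y, 't, 'x, 's) cmorph
    \<Rightarrow> ('x, 's, 'x, 's) cmorph \<Rightarrow> bool" where
  "intertwines Y X g f h \<longleftrightarrow>
     (\<forall>y\<in>topspace (tp Y). fst f (fst g y) = fst h (fst f y)) \<and>
     (\<forall>V. openin (tp X) V \<longrightarrow> (\<forall>s\<in>carrier (osec X V).
        snd g (preim Y f V) (snd f V s) = snd f (preim X h V) (snd h V s)))"

text \<open>Sheaves of modules.  The fields \<open>mult\<close> and \<open>one\<close> of the module records play no role.\<close>

record ('x, 's, 'l) omod =
  lsec :: "'x set \<Rightarrow> ('s, 'l) module"
  lres :: "'x set \<Rightarrow> 'x set \<Rightarrow> 'l \<Rightarrow> 'l"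

definition generates ::
  "('x, 's) cspace \<Rightarrow> ('x, 's, 'l) omod \<Rightarrow> 'x set \<Rightarrow> 'l \<Rightarrow> bool" where
  "generates X L V e \<longleftrightarrow> e \<in> carrier (lsec L V) \<and>
     (\<forall>W. openin (tp X) W \<and> W \<subseteq> V \<longrightarrow>
        bij_betw (\<lambda>r. r \<odot>\<^bsub>lsec L W\<^esub> lres L V W e) (carrier (osec X W)) (carrier (lsec L W)))"

definition invertible_sheaf :: "('x, 's) cspace \<Rightarrow> ('x, 's, 'l) omod \<Rightarrow> bool" where
  "invertible_sheaf X L \<longleftrightarrow>
     (\<forall>x\<in>topspace (tp X). \<exists>V e. openin (tp X) V \<and> x \<in> V \<and> generates X L V e)"

text \<open>
  For an invertible sheaf \<open>L\<close> on \<open>X\<close>, an isomorphism from \<open>f\<^sup>*L\<close> to \<open>L'\<close> is the same as a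
  semilinear map \<open>\<Phi>\<close> from \<open>L\<close> to \<open>f\<^sub>*L'\<close> that sends local generators to local generators.
\<close>

definition pullback_sheaf ::
  "('y, 't) cspace \<Rightarrow> ('x, 's) cspace \<Rightarrow> ('y, 't, 'x, 's) cmorph
    \<Rightarrow> ('x, 's, 'l) omod \<Rightarrow> ('y, 't, 'k) omod \<Rightarrow> bool" where
  "pullback_sheaf Y X f L L' \<longleftrightarrow> invertible_sheaf X L \<and> invertible_sheaf Y L' \<and>
     (\<exists>\<Phi>. \<forall>V. openin (tp X) V \<longrightarrow>
        \<Phi> V \<in> carrier (lsec L V) \<rightarrow> carrier (lsec L' (preim Y f V)) \<and>
        (\<forall>s\<in>carrier (lsec L V). \<forall>s'\<in>carrier (lsec L V).
           \<Phi> V (s \<oplus>\<^bsub>lsec L V\<^esub> s') = \<Phi> V s \<oplus>\<^bsub>lsec L' (preim Y f V)\<^esub> \<Phi> V s') \<and>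
        (\<forall>r\<in>carrier (osec X V). \<forall>s\<in>carrier (lsec L V).
           \<Phi> V (r \<odot>\<^bsub>lsec L V\<^esub> s) = snd f V r \<odot>\<^bsub>lsec L' (preim Y f V)\<^esub> \<Phi> V s) \<and>
        (\<forall>W. openin (tp X) W \<and> W \<subseteq> V \<longrightarrow> (\<forall>s\<in>carrier (lsec L V).
           \<Phi> W (lres L V W s) = lres L' (preim Y f V) (preim Y f W) (\<Phi> V s))) \<and>
        (\<forall>e. generates X L V e \<longrightarrow> generates Y L' (preim Y f V) (\<Phi> V e)))"

section \<open>Spec and Proj\<close>

text \<open>
  Both are spaces of prime ideals with sheaves of functions that are locally given by fractions.
  \<open>Fr\<close> is the set of admissible pairs of a numerator and a denominator; the value of a fraction at
  \<open>p\<close> is its class in the localization at \<open>p\<close>, viewed as a set of pairs.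
\<close>

definition frac_class ::
  "('a, 'b) ring_scheme \<Rightarrow> ('a \<times> 'a) set \<Rightarrow> 'a set \<Rightarrow> 'a \<times> 'a \<Rightarrow> ('a \<times> 'a) set" where
  "frac_class B Fr p = (\<lambda>(a, f). {(b, g) \<in> Fr. g \<notin> p \<and>
     (\<exists>h\<in>carrier B - p. h \<otimes>\<^bsub>B\<^esub> (a \<otimes>\<^bsub>B\<^esub> g) = h \<otimes>\<^bsub>B\<^esub> (b \<otimes>\<^bsub>B\<^esub> f))})"

definition frac_add ::
  "('a, 'b) ring_scheme \<Rightarrow> ('a \<times> 'a) set \<Rightarrow> 'a set \<Rightarrow> ('a \<times> 'a) set \<Rightarrow> ('a \<times> 'a) set
    \<Rightarrow> ('a \<times> 'a) set" where
  "frac_add B Fr p x y =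
     (\<Union>(a, f)\<in>x. \<Union>(b, g)\<in>y.
        frac_class B Fr p (a \<otimes>\<^bsub>B\<^esub> g \<oplus>\<^bsub>B\<^esub> b \<otimes>\<^bsub>B\<^esub> f, f \<otimes>\<^bsub>B\<^esub> g))"

definition frac_mult ::
  "('a, 'b) ring_scheme \<Rightarrow> ('a \<times> 'a) set \<Rightarrow> 'a set \<Rightarrow> ('a \<times> 'a) set \<Rightarrow> ('a \<times> 'a) set
    \<Rightarrow> ('a \<times> 'a) set" where
  "frac_mult B Fr p x y =
     (\<Union>(a, f)\<in>x. \<Union>(b, g)\<in>y. frac_class B Fr p (a \<otimes>\<^bsub>B\<^esub> b, f \<otimes>\<^bsub>B\<^esub> g))"

definition zariski :: "('a, 'b) ring_scheme \<Rightarrow> 'a set set \<Rightarrow> 'a set topology" where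
  "zariski B Pts = topology_generated_by {{p\<in>Pts. f \<notin> p} | f. f \<in> carrier B}"

definition frac_sections ::
  "('a, 'b) ring_scheme \<Rightarrow> 'a set set \<Rightarrow> ('a \<times> 'a) set \<Rightarrow> 'a set set
    \<Rightarrow> ('a set \<Rightarrow> ('a \<times> 'a) set) set" where
  "frac_sections B Pts Fr U = {s \<in> extensional U.
     \<forall>p\<in>U. \<exists>V a f. openin (zariski B Pts) V \<and> p \<in> V \<and> V \<subseteq> U \<and> (a, f) \<in> Fr \<and>
       (\<forall>q\<in>V. f \<notin> q \<and> s q = frac_class B Fr q (a, f))}"

definition frac_space ::
  "('a, 'b) calg_scheme \<Rightarrow> 'a set set \<Rightarrow> ('a \<times> 'a) set
    \<Rightarrow> ('a set, 'a set \<Rightarrow> ('a \<times> 'a) set) cspace" where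
  "frac_space B Pts Fr =
     \<lparr>tp = zariski B Pts,
      osec = (\<lambda>U. \<lparr>carrier = frac_sections B Pts Fr U,
        mult = (\<lambda>s s'. \<lambda>p\<in>U. frac_mult B Fr p (s p) (s' p)),
        one = (\<lambda>p\<in>U. frac_class B Fr p (\<one>\<^bsub>B\<^esub>, \<one>\<^bsub>B\<^esub>)),
        zero = (\<lambda>p\<in>U. frac_class B Fr p (\<zero>\<^bsub>B\<^esub>, \<one>\<^bsub>B\<^esub>)),
        add = (\<lambda>s s'. \<lambda>p\<in>U. frac_add B Fr p (s p) (s' p)),
        scal = (\<lambda>c. \<lambda>p\<in>U. frac_class B Fr p (scal B c, \<one>\<^bsub>B\<^esub>))\<rparr>),
      ores = (\<lambda>U V s. restrict s V)\<rparr>"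

definition Spec :: "('a, 'b) calg_scheme \<Rightarrow> ('a set, 'a set \<Rightarrow> ('a \<times> 'a) set) cspace" where
  "Spec R = frac_space R {p. primeideal p R} (carrier R \<times> carrier R)"

definition proj_points :: "'a gcalg \<Rightarrow> 'a set set" where
  "proj_points B = {p. primeideal p B \<and> p = Idl\<^bsub>B\<^esub> (p \<inter> (\<Union>i. hcomp B i)) \<and>
     \<not> (\<Union>i\<in>{0<..}. hcomp B i) \<subseteq> p}"

definition proj_fracs :: "'a gcalg \<Rightarrow> nat \<Rightarrow> ('a \<times> 'a) set" where
  "proj_fracs B d = (\<Union>e. hcomp B (d + e) \<times> hcomp B e)"

definition Proj :: "'a gcalg \<Rightarrow> ('a set, 'a set \<Rightarrow> ('a \<times> 'a) set) cspace" where
  "Proj B = frac_space B (proj_points B) (proj_fracs B 0)"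

text \<open>The sheaf \<open>\<O>(d)\<close> on \<open>Proj B\<close>.\<close>

definition twist :: "'a gcalg \<Rightarrow> nat
    \<Rightarrow> ('a set, 'a set \<Rightarrow> ('a \<times> 'a) set, 'a set \<Rightarrow> ('a \<times> 'a) set) omod" where
  "twist B d =
     \<lparr>lsec = (\<lambda>U. \<lparr>carrier = frac_sections B (proj_points B) (proj_fracs B d) U,
        mult = undefined, one = undefined,
        zero = (\<lambda>p\<in>U. frac_class B (proj_fracs B d) p (\<zero>\<^bsub>B\<^esub>, \<one>\<^bsub>B\<^esub>)),
        add = (\<lambda>s s'. \<lambda>p\<in>U. frac_add B (proj_fracs B d) p (s p) (s' p)),
        smult = (\<lambda>r s. \<lambda>p\<in>U. frac_mult B (proj_fracs B d) p (r p) (s p))\<rparr>),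
      lres = (\<lambda>U V s. restrict s V)\<rparr>"

text \<open>
  The automorphism of \<open>Proj B\<close> whose pullback of functions is induced by the graded automorphism
  \<open>g\<close> of \<open>B\<close>.
\<close>

definition proj_map :: "'a gcalg \<Rightarrow> ('a \<Rightarrow> 'a)
    \<Rightarrow> ('a set, 'a set \<Rightarrow> ('a \<times> 'a) set, 'a set, 'a set \<Rightarrow> ('a \<times> 'a) set) cmorph" where
  "proj_map B g =
     (let \<phi> = (\<lambda>p. {x \<in> carrier B. g x \<in> p})
      in (\<phi>, \<lambda>V s. \<lambda>p\<in>{p \<in> proj_points B. \<phi> p \<in> V}. map_prod g g ` s (\<phi> p)))"

text \<open>
  The element \<open>z\<close> of the multiplicative group acts through the one-parameter subgroup \<open>l\<close> on
  functions by \<open>\<chi>\<^sup>w \<mapsto> z\<^bsup>\<langle>l,w\<rangle>\<^esup> \<chi>\<^sup>w\<close>; \<open>\<iota>\<close> embeds the complex numbers into the coefficients.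
\<close>

definition ops_act ::
  "(complex \<Rightarrow> 'c::comm_ring_1) \<Rightarrow> 'k::real_inner \<Rightarrow> complex \<Rightarrow> ('k \<Rightarrow>\<^sub>0 'c) \<Rightarrow> ('k \<Rightarrow>\<^sub>0 'c)" where
  "ops_act \<iota> l z = Poly_Mapping.mapp (\<lambda>w c. \<iota> (z powi \<lfloor>l \<bullet> w\<rfloor>) * c)"

section \<open>Normalization\<close>

definition affine_open :: "('x, 's) cspace \<Rightarrow> 'x set \<Rightarrow> bool" where
  "affine_open X V \<longleftrightarrow> openin (tp X) V \<and>
     (\<exists>f. isomorphism (X\<lparr>tp := subtopology (tp X) V\<rparr>) (Spec (osec X V)) f)"

definition integral_scheme :: "('x, 's) cspace \<Rightarrow> bool" where
  "integral_scheme X \<longleftrightarrow> topspace (tp X) \<noteq> {} \<and>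
     (\<forall>x\<in>topspace (tp X). \<exists>V. x \<in> V \<and> affine_open X V) \<and>
     (\<forall>U. openin (tp X) U \<and> U \<noteq> {} \<longrightarrow> domain (osec X U))"

text \<open>
  \<open>integral_closure_map A B g\<close>: via \<open>g\<close>, the domain \<open>B\<close> is the integral closure of the domain \<open>A\<close>
  in the field of fractions of \<open>A\<close>.  In the last condition, a fraction \<open>a/c\<close> satisfies a monic
  equation over \<open>A\<close>, written with cleared denominators.
\<close>

definition integral_closure_map ::
  "('a, 'm) ring_scheme \<Rightarrow> ('b, 'n) ring_scheme \<Rightarrow> ('a \<Rightarrow> 'b) \<Rightarrow> bool" where
  "integral_closure_map A B g \<longleftrightarrow>
     domain A \<and> domain B \<and> g \<in> ring_hom A B \<and> inj_on g (carrier A) \<and>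
     (\<forall>b\<in>carrier B. \<exists>a\<in>carrier A. \<exists>c\<in>carrier A - {\<zero>\<^bsub>A\<^esub>}. g c \<otimes>\<^bsub>B\<^esub> b = g a) \<and>
     (\<forall>b\<in>carrier B. \<exists>n::nat. \<exists>r\<in>{..<n} \<rightarrow> carrier A.
        b [^]\<^bsub>B\<^esub> n \<oplus>\<^bsub>B\<^esub> (\<Oplus>\<^bsub>B\<^esub>i\<in>{..<n}. g (r i) \<otimes>\<^bsub>B\<^esub> b [^]\<^bsub>B\<^esub> i) = \<zero>\<^bsub>B\<^esub>) \<and>
     (\<forall>a\<in>carrier A. \<forall>c\<in>carrier A - {\<zero>\<^bsub>A\<^esub>}.
        (\<exists>n::nat. \<exists>r\<in>{..<n} \<rightarrow> carrier A.
           a [^]\<^bsub>A\<^esub> n \<oplus>\<^bsub>A\<^esub>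
             (\<Oplus>\<^bsub>A\<^esub>i\<in>{..<n}. r i \<otimes>\<^bsub>A\<^esub> a [^]\<^bsub>A\<^esub> i \<otimes>\<^bsub>A\<^esub> c [^]\<^bsub>A\<^esub> (n - i)) = \<zero>\<^bsub>A\<^esub>)
        \<longrightarrow> (\<exists>b\<in>carrier B. g c \<otimes>\<^bsub>B\<^esub> b = g a))"

text \<open>
  \<open>\<nu>\<close> is the normalization of the integral scheme \<open>X\<close>: over the members \<open>Spec A\<close> of an affine
  open cover it is the spectrum of the integral closure of \<open>A\<close> in its field of fractions.
\<close>

definition normalization ::
  "('y, 't) cspace \<Rightarrow> ('x, 's) cspace \<Rightarrow> ('y, 't, 'x, 's) cmorph \<Rightarrow> bool" where
  "normalization Y X \<nu> \<longleftrightarrow> integral_scheme X \<and> morphism Y X \<nu> \<and>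
     (\<forall>x\<in>topspace (tp X). \<exists>V. x \<in> V \<and> affine_open X V \<and> affine_open Y (preim Y \<nu> V) \<and>
        integral_closure_map (osec X V) (osec Y (preim Y \<nu> V)) (snd \<nu> V))"

text \<open>
  On \<open>Proj\<close> of an algebra that need not be generated in degree one, \<open>\<O>(1)\<close> is the \<open>\<rat>\<close>-line
  bundle \<open>(1/d) \<O>(d)\<close> for sufficiently divisible \<open>d\<close>.
\<close>

definition pullback_polarization ::
  "'c gcalg \<Rightarrow> 'b gcalg
    \<Rightarrow> ('c set, 'c set \<Rightarrow> ('c \<times> 'c) set, 'b set, 'b set \<Rightarrow> ('b \<times> 'b) set) cmorph \<Rightarrow> bool" where
  "pullback_polarization C B f \<longleftrightarrow>
     (\<exists>d\<^sub>0>0. \<forall>d>0. d\<^sub>0 dvd d \<longrightarrow> pullback_sheaf (Proj C) (Proj B) f (twist B d) (twist C d))"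

section \<open>Polarized varieties with torus action\<close>

text \<open>
  The space \<open>X\<close> with the line bundle \<open>L\<close> and the action of \<open>T\<close> (\<open>act n z\<close> is the action of \<open>z\<close>
  through the one-parameter subgroup \<open>n \<in> N\<close>) is, equivariantly, \<open>Proj\<close> of the section ring
  determined by \<open>\<Psi>\<close>, with \<open>\<O>(1)\<close>.
\<close>

definition corresponds_to ::
  "('x, 's) cspace \<Rightarrow> ('x, 's, 'l) omod \<Rightarrow> ('v::real_inner \<Rightarrow> complex \<Rightarrow> ('x, 's, 'x, 's) cmorph)
    \<Rightarrow> 'v set \<Rightarrow> 'v set \<Rightarrow> (proj_line \<Rightarrow> 'v \<Rightarrow> real) \<Rightarrow> bool" where
  "corresponds_to X L act M Box \<Psi> \<longleftrightarrow>
     (let R = polytope_alg M Box \<Psi>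
      in \<exists>f. isomorphism X (Proj R) f \<and> pullback_sheaf X (Proj R) f (twist R 1) L \<and>
           (\<forall>n\<in>dual_lattice M. \<forall>z. z \<noteq> 0 \<longrightarrow>
              intertwines X (Proj R) (act n z) f (proj_map R (ops_act const_fun (0, n) z))))"

text \<open>The action on the special fiber, by a one-parameter subgroup in \<open>N' \<times> \<int>\<close>.\<close>

definition tc_fiber_action where
  "tc_fiber_action M \<D> Q v m l z =
     proj_map (tc_fiber_alg M \<D> Q v m) ((`) (ops_act const_fun l z))"

text \<open>The action on a toric variety, by a one-parameter subgroup of its torus; the first
  coordinate of an exponent is the degree.\<close>

definition toric_action where
  "toric_action \<Lambda> \<Delta> l z = proj_map (toric_alg \<Lambda> \<Delta>) (ops_act id (0, l) z)"

definition Delta :: "'v set \<Rightarrow> (proj_line \<Rightarrow> 'v \<Rightarrow> real) \<Rightarrow> proj_line \<Rightarrow> ('v \<times> real) set" where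
  "Delta Box \<Psi> Q =
     {(u, a). u \<in> Box \<and> - point_sum (- {Q}) (\<lambda>P. \<Psi> P u) \<le> a \<and> a \<le> \<Psi> Q u}"

end

theory Submission
  imports Defs
begin

text \<open>
  Let \<open>W\<close> be the monoid of lattice points of the cone over \<open>\<Delta>\<^sub>Q\<close>.  Modulo \<open>t\<close>, a homogeneous section of
  \<open>\<A>\<close> is determined by its leading coefficient at \<open>Q\<close>, which identifies \<open>\<A>/(t)\<close> with the monoid algebra
  of the set \<open>S\<close> of those \<open>(y,j) \<in> W\<close> for which \<open>j Q + \<Sum>\<^bsub>P \<noteq> Q\<^esub> \<lfloor>\<D>\<^sub>P(y)\<rfloor> P\<close> has nonnegative degree.  Because
  of the roundings \<open>S\<close> may be smaller than \<open>W\<close>, but it contains a multiple \<open>n W\<close> and a translate \<open>c + W\<close>.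
  Hence \<open>\<complex>[W]\<close> is integral over \<open>\<complex>[S]\<close> and has the same field of fractions, and it is integrally
  closed since \<open>W\<close> is cut out of a lattice by linear inequalities.  The inclusion \<open>\<complex>[S] \<subseteq> \<complex>[W]\<close> is
  compatible with the gradings by the character lattices, so it induces the equivariant
  normalization \<open>Proj \<complex>[W] \<rightarrow> Proj \<complex>[S]\<close>.
\<close>

section \<open>Spaces of rational functions\<close>

text \<open>For an exponent \<open>(y,a)\<close> put \<open>j = \<langle>v,y\<rangle> + a/m\<close>.
  Since \<open>m v\<close> is integral, every \<open>y\<close> in \<open>M'\<close> and integer
  \<open>j\<close> come from exactly one integer \<open>a = m j - m \<langle>v,y\<rangle>\<close>.
  This is the source of the lattice \<open>M \<times> \<int>\<close> and of the subgroup
  \<open>(- m v, m)\<close>; the part of \<open>v\<close> in the degree direction only rescales each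
  degree and acts trivially on \<open>Proj\<close>. Each rounding loses less than one unit, at
  finitely many points. A common denominator \<open>n\<close> of the vertices of the
  \<open>\<D>\<^sub>P\<close> removes the loss. A lattice point \<open>c\<close> on the upper
  boundary of the cone, over a multiple of the sum of the vertices of the box, has enough surplus
  degree to cover it, because the degree of \<open>\<Psi>\<close> is positive in the interior. The
  obstacle is that \<open>Proj\<close> is given by prime ideals and classes of fractions. Its
  points, functions and line bundles are therefore read in one field, the fractions of a Laurent
  polynomial ring: a section over an open set is a field element that lies in all local rings
  there.\<close>

locale fun_space =
  fixes Z :: "('x, 's) cspace" and \<eta> :: 'x and sect :: "'x set \<Rightarrow> 'k::field \<Rightarrow> 's"
    and loc :: "'x \<Rightarrow> 'k set" and \<iota> :: "complex \<Rightarrow> 'k"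
  assumes generic_in: "\<eta> \<in> topspace (tp Z)"
    and generic: "openin (tp Z) U \<Longrightarrow> U \<noteq> {} \<Longrightarrow> \<eta> \<in> U"
    and loc_1: "x \<in> topspace (tp Z) \<Longrightarrow> 1 \<in> loc x"
    and loc_add: "x \<in> topspace (tp Z) \<Longrightarrow> \<phi> \<in> loc x \<Longrightarrow> \<psi> \<in> loc x \<Longrightarrow> \<phi> + \<psi> \<in> loc x"
    and loc_mult: "x \<in> topspace (tp Z) \<Longrightarrow> \<phi> \<in> loc x \<Longrightarrow> \<psi> \<in> loc x \<Longrightarrow> \<phi> * \<psi> \<in> loc x"
    and loc_uminus: "x \<in> topspace (tp Z) \<Longrightarrow> \<phi> \<in> loc x \<Longrightarrow> - \<phi> \<in> loc x"
    and loc_scal: "x \<in> topspace (tp Z) \<Longrightarrow> \<iota> c \<in> loc x"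
    and spread: "x \<in> topspace (tp Z) \<Longrightarrow> \<phi> \<in> loc x \<Longrightarrow> \<exists>U. openin (tp Z) U \<and> x \<in> U \<and> (\<forall>y\<in>U. \<phi> \<in> loc y)"
    and carrier_osec: "openin (tp Z) U \<Longrightarrow> carrier (osec Z U) = sect U ` (\<Inter>x\<in>U. loc x)"
    and sect_inj: "openin (tp Z) U \<Longrightarrow> U \<noteq> {} \<Longrightarrow> inj_on (sect U) (\<Inter>x\<in>U. loc x)"
    and sect_empty: "sect {} \<phi> = sect {} \<psi>"
    and osec_mult: "openin (tp Z) U \<Longrightarrow> \<phi> \<in> (\<Inter>x\<in>U. loc x) \<Longrightarrow> \<psi> \<in> (\<Inter>x\<in>U. loc x) \<Longrightarrow>
      sect U \<phi> \<otimes>\<^bsub>osec Z U\<^esub> sect U \<psi> = sect U (\<phi> * \<psi>)"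
    and osec_add: "openin (tp Z) U \<Longrightarrow> \<phi> \<in> (\<Inter>x\<in>U. loc x) \<Longrightarrow> \<psi> \<in> (\<Inter>x\<in>U. loc x) \<Longrightarrow>
      sect U \<phi> \<oplus>\<^bsub>osec Z U\<^esub> sect U \<psi> = sect U (\<phi> + \<psi>)"
    and osec_one: "openin (tp Z) U \<Longrightarrow> \<one>\<^bsub>osec Z U\<^esub> = sect U 1"
    and osec_zero: "openin (tp Z) U \<Longrightarrow> \<zero>\<^bsub>osec Z U\<^esub> = sect U 0"
    and osec_scal: "openin (tp Z) U \<Longrightarrow> scal (osec Z U) c = sect U (\<iota> c)"
    and osec_res: "openin (tp Z) U \<Longrightarrow> openin (tp Z) V \<Longrightarrow> V \<subseteq> U \<Longrightarrow> \<phi> \<in> (\<Inter>x\<in>U. loc x) \<Longrightarrow>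
      ores Z U V (sect U \<phi>) = sect V \<phi>"
begin

definition regular :: "'x set \<Rightarrow> 'k set" where
  "regular U = (\<Inter>x\<in>U. loc x)"

text \<open>Over a nonempty open set a section determines its field element. Over the empty set any
  choice will do, since there \<open>sect_empty\<close> gives all field elements the same
  section.\<close>

definition val :: "'x set \<Rightarrow> 's \<Rightarrow> 'k" where
  "val U s = (SOME \<phi>. \<phi> \<in> regular U \<and> s = sect U \<phi>)"

lemma in_topspace: "openin (tp Z) U \<Longrightarrow> x \<in> U \<Longrightarrow> x \<in> topspace (tp Z)"
  using openin_subset by blast

lemma loc_0: "x \<in> topspace (tp Z) \<Longrightarrow> 0 \<in> loc x"
  using loc_add[OF _ loc_1 loc_uminus[OF _ loc_1]] by simp

lemma regularI: "(\<And>x. x \<in> U \<Longrightarrow> \<phi> \<in> loc x) \<Longrightarrow> \<phi> \<in> regular U"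
  by (simp add: regular_def)

lemma regularD: "\<phi> \<in> regular U \<Longrightarrow> x \<in> U \<Longrightarrow> \<phi> \<in> loc x"
  by (simp add: regular_def)

lemma regular_antimono: "V \<subseteq> U \<Longrightarrow> \<phi> \<in> regular U \<Longrightarrow> \<phi> \<in> regular V"
  by (auto simp: regular_def)

lemma regular_closed:
  assumes "openin (tp Z) U"
  shows "0 \<in> regular U" "1 \<in> regular U" "\<iota> c \<in> regular U"
    "\<phi> \<in> regular U \<Longrightarrow> \<psi> \<in> regular U \<Longrightarrow> \<phi> + \<psi> \<in> regular U"
    "\<phi> \<in> regular U \<Longrightarrow> \<psi> \<in> regular U \<Longrightarrow> \<phi> * \<psi> \<in> regular U"
    "\<phi> \<in> regular U \<Longrightarrow> - \<phi> \<in> regular U"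
  using assms in_topspace[OF assms]
  by (auto simp: regular_def loc_0 loc_1 loc_scal loc_add loc_mult loc_uminus)

lemma regular_power: "openin (tp Z) U \<Longrightarrow> \<phi> \<in> regular U \<Longrightarrow> \<phi> ^ n \<in> regular U"
  by (induction n) (auto simp: regular_closed)

lemma regular_sum:
  "openin (tp Z) U \<Longrightarrow> (\<And>i. i \<in> I \<Longrightarrow> f i \<in> regular U) \<Longrightarrow> sum f I \<in> regular U"
  by (induction I rule: infinite_finite_induct) (auto simp: regular_closed)

lemma carrier_sect: "openin (tp Z) U \<Longrightarrow> carrier (osec Z U) = sect U ` regular U"
  by (simp add: carrier_osec regular_def)

lemma sect_ops:
  assumes "openin (tp Z) U" "\<phi> \<in> regular U" "\<psi> \<in> regular U"
  shows "sect U \<phi> \<otimes>\<^bsub>osec Z U\<^esub> sect U \<psi> = sect U (\<phi> * \<psi>)"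
    "sect U \<phi> \<oplus>\<^bsub>osec Z U\<^esub> sect U \<psi> = sect U (\<phi> + \<psi>)"
  using assms osec_mult osec_add by (auto simp: regular_def)

lemma sect_eq_iff:
  "openin (tp Z) U \<Longrightarrow> U \<noteq> {} \<Longrightarrow> \<phi> \<in> regular U \<Longrightarrow> \<psi> \<in> regular U \<Longrightarrow>
    sect U \<phi> = sect U \<psi> \<longleftrightarrow> \<phi> = \<psi>"
  using sect_inj[of U] by (auto simp: regular_def dest: inj_onD)

lemma val_sect:
  assumes "openin (tp Z) U" "U \<noteq> {}" "\<phi> \<in> regular U"
  shows "val U (sect U \<phi>) = \<phi>"
  unfolding val_def by (rule some_equality) (use assms sect_eq_iff in auto)

lemma val_in:
  assumes "openin (tp Z) U" "s \<in> carrier (osec Z U)"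
  shows "val U s \<in> regular U" "sect U (val U s) = s"
proof -
  have "\<exists>\<phi>. \<phi> \<in> regular U \<and> s = sect U \<phi>" using assms carrier_sect by auto
  from someI_ex[OF this] show "val U s \<in> regular U" "sect U (val U s) = s"
    by (simp_all add: val_def)
qed

lemma osec_cring: assumes U: "openin (tp Z) U" shows "cring (osec Z U)"
proof (rule cringI)
  note [simp] = sect_ops[OF U] osec_zero[OF U] osec_one[OF U] regular_closed[OF U] carrier_sect[OF U]
  show "abelian_group (osec Z U)"
  proof (rule abelian_groupI)
    fix x assume "x \<in> carrier (osec Z U)"
    then obtain \<phi> where \<phi>: "\<phi> \<in> regular U" "x = sect U \<phi>" by auto
    then have "sect U (-\<phi>) \<oplus>\<^bsub>osec Z U\<^esub> x = \<zero>\<^bsub>osec Z U\<^esub>" by simp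
    then show "\<exists>y\<in>carrier (osec Z U). y \<oplus>\<^bsub>osec Z U\<^esub> x = \<zero>\<^bsub>osec Z U\<^esub>"
      using \<phi> by (intro bexI[of _ "sect U (-\<phi>)"]) auto
  qed (auto simp: algebra_simps)
  show "Group.comm_monoid (osec Z U)"
    by (rule comm_monoidI) (auto simp: algebra_simps)
qed (auto simp: sect_ops[OF U] regular_closed[OF U] carrier_sect[OF U] algebra_simps)

lemma osec_domain:
  assumes U: "openin (tp Z) U" and ne: "U \<noteq> {}"
  shows "domain (osec Z U)"
proof -
  interpret cring "osec Z U" by (rule osec_cring[OF U])
  show ?thesis
  proof (intro domain.intro domain_axioms.intro)
    show "\<one>\<^bsub>osec Z U\<^esub> \<noteq> \<zero>\<^bsub>osec Z U\<^esub>"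
      using sect_eq_iff[OF U ne, of 1 0] by (simp add: osec_one osec_zero U regular_closed)
    fix a b assume "a \<otimes>\<^bsub>osec Z U\<^esub> b = \<zero>\<^bsub>osec Z U\<^esub>" "a \<in> carrier (osec Z U)" "b \<in> carrier (osec Z U)"
    then show "a = \<zero>\<^bsub>osec Z U\<^esub> \<or> b = \<zero>\<^bsub>osec Z U\<^esub>"
      using sect_eq_iff[OF U ne]
      by (auto simp: carrier_sect U sect_ops osec_zero regular_closed)
  qed (rule is_cring)
qed

lemma sect_units:
  assumes U: "openin (tp Z) U" and ne: "U \<noteq> {}" and \<phi>: "\<phi> \<in> regular U"
  shows "sect U \<phi> \<in> Units (osec Z U) \<longleftrightarrow> \<phi> \<noteq> 0 \<and> inverse \<phi> \<in> regular U"
proof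
  interpret cring "osec Z U" by (rule osec_cring[OF U])
  assume "sect U \<phi> \<in> Units (osec Z U)"
  then obtain y where "y \<in> carrier (osec Z U)" "y \<otimes>\<^bsub>osec Z U\<^esub> sect U \<phi> = \<one>\<^bsub>osec Z U\<^esub>"
    by (auto simp: Units_def)
  then obtain \<psi> where "\<psi> \<in> regular U" "\<psi> * \<phi> = 1"
    using sect_eq_iff[OF U ne] \<phi> by (auto simp: carrier_sect U sect_ops osec_one regular_closed)
  then show "\<phi> \<noteq> 0 \<and> inverse \<phi> \<in> regular U"
    by (metis inverse_unique inverse_inverse_eq mult_zero_right zero_neq_one)
next
  assume a: "\<phi> \<noteq> 0 \<and> inverse \<phi> \<in> regular U"
  have "sect U (inverse \<phi>) \<otimes>\<^bsub>osec Z U\<^esub> sect U \<phi> = \<one>\<^bsub>osec Z U\<^esub>"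
    "sect U \<phi> \<otimes>\<^bsub>osec Z U\<^esub> sect U (inverse \<phi>) = \<one>\<^bsub>osec Z U\<^esub>"
    using a by (simp_all add: sect_ops U \<phi> osec_one)
  then show "sect U \<phi> \<in> Units (osec Z U)"
    using a \<phi> unfolding Units_def by (auto simp: carrier_sect U)
qed

text \<open>An element of a local ring extends to a neighbourhood by \<open>spread\<close>, so an
  inverse at the point is an inverse nearby. This turns the locality condition for morphisms into a
  statement on elements of the field.\<close>

lemma unit_near_iff:
  assumes V: "openin (tp Z) V" and x: "x \<in> V" and \<phi>: "\<phi> \<in> regular V"
  shows "unit_near Z V (sect V \<phi>) x \<longleftrightarrow> \<phi> \<noteq> 0 \<and> inverse \<phi> \<in> loc x"
proof
  assume "unit_near Z V (sect V \<phi>) x"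
  then obtain W where W: "openin (tp Z) W" "x \<in> W" "W \<subseteq> V" "ores Z V W (sect V \<phi>) \<in> Units (osec Z W)"
    unfolding unit_near_def by blast
  then have "sect W \<phi> \<in> Units (osec Z W)" using osec_res[OF V W(1) W(3)] \<phi> by (simp add: regular_def)
  then show "\<phi> \<noteq> 0 \<and> inverse \<phi> \<in> loc x"
    using sect_units[OF W(1) _ regular_antimono[OF W(3) \<phi>]] W(2) by (auto dest: regularD)
next
  assume a: "\<phi> \<noteq> 0 \<and> inverse \<phi> \<in> loc x"
  obtain U where U: "openin (tp Z) U" "x \<in> U" "\<forall>y\<in>U. inverse \<phi> \<in> loc y"
    using spread[OF in_topspace[OF V x]] a by blast
  define W where "W = U \<inter> V"
  have W: "openin (tp Z) W" "x \<in> W" "W \<subseteq> V" using U V x by (auto simp: W_def)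
  have "inverse \<phi> \<in> regular W" using U by (auto simp: W_def intro!: regularI)
  then have "sect W \<phi> \<in> Units (osec Z W)"
    using a sect_units[OF W(1) _ regular_antimono[OF W(3) \<phi>]] W(2) by blast
  moreover have "ores Z V W (sect V \<phi>) = sect W \<phi>"
    using osec_res[OF V W(1) W(3)] \<phi> by (simp add: regular_def)
  ultimately show "unit_near Z V (sect V \<phi>) x" unfolding unit_near_def using W by auto
qed

lemma sect_pow:
  assumes U: "openin (tp Z) U" and \<phi>: "\<phi> \<in> regular U"
  shows "sect U \<phi> [^]\<^bsub>osec Z U\<^esub> (n::nat) = sect U (\<phi> ^ n)"
  by (induction n) (auto simp: U \<phi> osec_one sect_ops regular_power mult.commute nat_pow_def)

lemma sect_finsum:
  assumes U: "openin (tp Z) U" and "finite I" "\<And>i. i \<in> I \<Longrightarrow> f i \<in> regular U"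
  shows "(\<Oplus>\<^bsub>osec Z U\<^esub>i\<in>I. sect U (f i)) = sect U (sum f I)"
proof -
  interpret cring "osec Z U" by (rule osec_cring[OF U])
  show ?thesis using assms(2,3)
  proof (induction I)
    case (insert a I)
    then have "(\<lambda>i. sect U (f i)) \<in> I \<rightarrow> carrier (osec Z U)" "sect U (f a) \<in> carrier (osec Z U)"
      by (auto simp: carrier_sect U)
    with insert show ?case by (simp add: sect_ops U regular_sum)
  qed (simp add: osec_zero U)
qed

text \<open>\<open>affine_open\<close> restricts the topology of a space and leaves its sheaf alone;
  the restricted space must again fit the pattern before it can be compared with a spectrum.\<close>

lemma fun_space_subtopology:
  assumes V: "openin (tp Z) V" and ne: "V \<noteq> {}"
  shows "fun_space (Z\<lparr>tp := subtopology (tp Z) V\<rparr>) \<eta> sect loc \<iota>"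
proof -
  have t: "topspace (tp Z) \<inter> V = V" using V openin_subset by fastforce
  have o: "openin (subtopology (tp Z) V) U \<longleftrightarrow> openin (tp Z) U \<and> U \<subseteq> V" for U
    using V by (simp add: openin_open_subtopology)
  note V' = in_topspace[OF V]
  have sp: "\<exists>U. openin (tp Z) U \<and> U \<subseteq> V \<and> x \<in> U \<and> (\<forall>y\<in>U. \<phi> \<in> loc y)"
    if x: "x \<in> V" and \<phi>: "\<phi> \<in> loc x" for x \<phi>
  proof -
    from spread[OF V'[OF x] \<phi>] obtain U where "openin (tp Z) U" "x \<in> U" "\<forall>y\<in>U. \<phi> \<in> loc y" by blast
    then show ?thesis using V x by (intro exI[of _ "U \<inter> V"]) auto
  qed
  show ?thesis
  proof (unfold_locales, goal_cases)
    case (11 \<phi> \<psi>) show ?case by (rule sect_empty)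
  qed (simp_all add: t o generic[OF V ne] generic loc_1 V' loc_add loc_mult loc_uminus loc_scal sp carrier_osec
        sect_inj osec_mult osec_add osec_one osec_zero osec_scal osec_res)
qed

end

text \<open>Source and target share one function field: pulling back keeps the field element and
  only reads it as a section over the preimage.\<close>

definition dense_map ::
  "('y \<Rightarrow> 'x) \<Rightarrow> ('y, 't) cspace \<Rightarrow> ('y set \<Rightarrow> 'k \<Rightarrow> 't) \<Rightarrow> ('x set \<Rightarrow> 's \<Rightarrow> 'k) \<Rightarrow> ('y, 't, 'x, 's) cmorph" where
  "dense_map h Y sectY valX = (h, \<lambda>V s. sectY {y \<in> topspace (tp Y). h y \<in> V} (valX V s))"

text \<open>A dominant birational map in terms of local rings. \<open>generic_map\<close> keeps
  preimages of nonempty open sets nonempty, and \<open>loc_local\<close> is locality: an element of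
  the lower local ring that becomes invertible upstairs was already invertible.\<close>

locale dense_fun_spaces =
  Y: fun_space Y \<eta>Y sectY locY \<iota> + X: fun_space X \<eta>X sectX locX \<iota>
  for Y :: "('y, 't) cspace" and \<eta>Y and sectY :: "'y set \<Rightarrow> 'k::field \<Rightarrow> 't" and locY and \<iota>
    and X :: "('x, 's) cspace" and \<eta>X and sectX :: "'x set \<Rightarrow> 'k \<Rightarrow> 's" and locX +
  fixes h :: "'y \<Rightarrow> 'x"
  assumes cont: "continuous_map (tp Y) (tp X) h"
    and generic_map: "h \<eta>Y = \<eta>X"
    and loc_map: "y \<in> topspace (tp Y) \<Longrightarrow> locX (h y) \<subseteq> locY y"
    and loc_local: "y \<in> topspace (tp Y) \<Longrightarrow> \<phi> \<in> locX (h y) \<Longrightarrow> \<phi> \<noteq> 0 \<Longrightarrow> inverse \<phi> \<in> locY y \<Longrightarrow>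
      inverse \<phi> \<in> locX (h y)"
begin

definition mor where "mor = dense_map h Y sectY X.val"

lemma fst_mor: "fst mor = h"
  by (simp add: mor_def dense_map_def)

lemma preim_mor: "preim Y mor V = {y \<in> topspace (tp Y). h y \<in> V}"
  by (simp add: preim_def fst_mor)

lemma open_preim: "openin (tp X) V \<Longrightarrow> openin (tp Y) (preim Y mor V)"
  using cont by (simp add: preim_mor continuous_map_def)

lemma preim_empty: "preim Y mor {} = {}"
  by (simp add: preim_mor)

lemma preim_ne: "openin (tp X) V \<Longrightarrow> V \<noteq> {} \<Longrightarrow> preim Y mor V \<noteq> {}"
  using X.generic generic_map Y.generic_in by (force simp: preim_mor)

lemma regular_map: "\<phi> \<in> X.regular V \<Longrightarrow> \<phi> \<in> Y.regular (preim Y mor V)"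
  using loc_map by (auto simp: preim_mor intro!: Y.regularI dest: X.regularD)

lemma mor_sect:
  assumes V: "openin (tp X) V" and \<phi>: "\<phi> \<in> X.regular V"
  shows "snd mor V (sectX V \<phi>) = sectY (preim Y mor V) \<phi>"
proof (cases "V = {}")
  case True then show ?thesis
    using Y.sect_empty by (simp add: mor_def dense_map_def preim_def)
next
  case False then show ?thesis
    using X.val_sect[OF V False \<phi>] by (simp add: mor_def dense_map_def preim_def)
qed

lemma mor_hom:
  assumes V: "openin (tp X) V"
  shows "snd mor V \<in> ring_hom (osec X V) (osec Y (preim Y mor V))"
  by (rule ring_hom_memI)
    (auto simp: X.carrier_sect V Y.carrier_sect open_preim mor_sect X.sect_ops Y.sect_ops regular_map
      X.regular_closed X.osec_one Y.osec_one)

lemma mor_morphism: "morphism Y X mor"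
  unfolding morphism_def
proof (intro conjI allI impI ballI)
  show "continuous_map (tp Y) (tp X) (fst mor)" by (simp add: fst_mor cont)
next
  fix V assume V: "openin (tp X) V"
  note V' = open_preim[OF V]
  show "snd mor V \<in> ring_hom (osec X V) (osec Y (preim Y mor V))" by (rule mor_hom[OF V])
  show "snd mor V (scal (osec X V) c) = scal (osec Y (preim Y mor V)) c" for c
    by (simp add: X.osec_scal Y.osec_scal V V' mor_sect X.regular_closed)
next
  fix V W s assume a: "openin (tp X) V \<and> openin (tp X) W \<and> W \<subseteq> V" and s: "s \<in> carrier (osec X V)"
  obtain \<phi> where \<phi>: "\<phi> \<in> X.regular V" "s = sectX V \<phi>" using s a by (auto simp: X.carrier_sect)
  have s: "preim Y mor W \<subseteq> preim Y mor V" using a by (auto simp: preim_mor)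
  show "snd mor W (ores X V W s) = ores Y (preim Y mor V) (preim Y mor W) (snd mor V s)"
    using a \<phi> s X.regular_antimono[of W V \<phi>] X.osec_res[of V W \<phi>]
      Y.osec_res[OF open_preim open_preim s, of \<phi>] regular_map[of \<phi> V]
    by (simp add: mor_sect X.regular_def[symmetric] Y.regular_def[symmetric])
next
  fix V y s assume a: "openin (tp X) V \<and> y \<in> preim Y mor V" and s: "s \<in> carrier (osec X V)"
    and u: "unit_near Y (preim Y mor V) (snd mor V s) y"
  obtain \<phi> where \<phi>: "\<phi> \<in> X.regular V" "s = sectX V \<phi>" using s a by (auto simp: X.carrier_sect)
  have y: "y \<in> topspace (tp Y)" "h y \<in> V" using a by (auto simp: preim_mor)
  have "\<phi> \<noteq> 0 \<and> inverse \<phi> \<in> locY y"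
    using u a \<phi> Y.unit_near_iff[OF open_preim _ regular_map[OF \<phi>(1)]] by (simp add: mor_sect)
  then have "\<phi> \<noteq> 0 \<and> inverse \<phi> \<in> locX (h y)" using loc_local[OF y(1)] \<phi> y by (auto dest: X.regularD)
  then show "unit_near X V s (fst mor y)"
    using X.unit_near_iff[of V "h y" \<phi>] a \<phi> y by (simp add: fst_mor)
qed

text \<open>Rings of functions are intersections of local rings. Once the points match, equality of
  the local rings forces equality of the functions over every open set.\<close>

lemma mor_isomorphism:
  assumes hom: "homeomorphic_map (tp Y) (tp X) h"
    and eq: "\<And>y. y \<in> topspace (tp Y) \<Longrightarrow> locX (h y) = locY y"
  shows "isomorphism Y X mor"
  unfolding isomorphism_def
proof (intro conjI allI impI)
  show "morphism Y X mor" by (rule mor_morphism)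
  show "homeomorphic_map (tp Y) (tp X) (fst mor)" by (simp add: fst_mor hom)
  fix V assume V: "openin (tp X) V"
  note V' = open_preim[OF V]
  show "bij_betw (snd mor V) (carrier (osec X V)) (carrier (osec Y (preim Y mor V)))"
  proof (cases "V = {}")
    \<comment> \<open>Over the empty set field elements are no longer determined by sections, but
      both section rings have a single element.\<close>
    case True
    have "sectX V \<phi> = sectX V 0" for \<phi> unfolding True by (rule X.sect_empty)
    then have "carrier (osec X V) = {sectX V 0}"
      using X.carrier_sect[OF V] X.regular_closed(1)[OF V] by auto
    then obtain a where a: "carrier (osec X V) = {a}" by blast
    have "sectY (preim Y mor V) \<phi> = sectY (preim Y mor V) 0" for \<phi>
      unfolding True preim_empty by (rule Y.sect_empty)
    then have "carrier (osec Y (preim Y mor V)) = {sectY (preim Y mor V) 0}"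
      using Y.carrier_sect[OF V'] Y.regular_closed(1)[OF V'] by auto
    then obtain b where b: "carrier (osec Y (preim Y mor V)) = {b}" by blast
    have "snd mor V a \<in> carrier (osec Y (preim Y mor V))"
      using ring_hom_closed[OF mor_hom[OF V]] a by simp
    then show ?thesis using a b by (auto simp: bij_betw_def)
  next
    case False
    have r: "Y.regular (preim Y mor V) = X.regular V"
    proof
      show "X.regular V \<subseteq> Y.regular (preim Y mor V)" using regular_map by blast
      show "Y.regular (preim Y mor V) \<subseteq> X.regular V"
      proof
        fix \<phi> assume p: "\<phi> \<in> Y.regular (preim Y mor V)"
        show "\<phi> \<in> X.regular V"
        proof (rule X.regularI)
          fix x assume x: "x \<in> V"
          have "x \<in> h ` topspace (tp Y)"
            using X.in_topspace[OF V x] by (simp add: homeomorphic_imp_surjective_map[OF hom])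
          then obtain y where y: "y \<in> topspace (tp Y)" "h y = x" by blast
          have "\<phi> \<in> locY y" by (rule Y.regularD[OF p]) (use x y in \<open>simp add: preim_mor\<close>)
          then show "\<phi> \<in> locX x" using eq[OF y(1)] y(2) by simp
        qed
      qed
    qed
    show ?thesis unfolding bij_betw_def X.carrier_sect[OF V] Y.carrier_sect[OF V'] r
    proof
      show "inj_on (snd mor V) (sectX V ` X.regular V)"
        using Y.sect_eq_iff[OF V' preim_ne[OF V False]]
        by (auto simp: inj_on_def mor_sect[OF V] r)
      show "snd mor V ` sectX V ` X.regular V = sectY (preim Y mor V) ` X.regular V"
        by (auto simp: mor_sect[OF V] image_image)
    qed
  qed
qed

text \<open>Over a nonempty open set all ring operations can be carried out in the field, so the
  clauses of \<open>integral_closure_map\<close> reduce to conditions on two subrings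
  \<open>A\<close> and \<open>B\<close>. In the last one the fraction with cleared denominators
  becomes the field element \<open>a / c\<close>.\<close>

lemma integral_closure_mor:
  assumes V: "openin (tp X) V" and ne: "V \<noteq> {}"
    and A: "X.regular V = A" and B: "Y.regular (preim Y mor V) = B"
    and fr: "\<And>b. b \<in> B \<Longrightarrow> \<exists>a\<in>A. \<exists>c\<in>A. c \<noteq> 0 \<and> c * b = a"
    and int: "\<And>b. b \<in> B \<Longrightarrow> \<exists>(n::nat) r. (\<forall>i<n. r i \<in> A) \<and> b ^ n + (\<Sum>i<n. r i * b ^ i) = 0"
    and clo: "\<And>a c (n::nat) r. a \<in> A \<Longrightarrow> c \<in> A \<Longrightarrow> c \<noteq> 0 \<Longrightarrow> (\<And>i. i < n \<Longrightarrow> r i \<in> A) \<Longrightarrow>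
      a ^ n + (\<Sum>i<n. r i * a ^ i * c ^ (n - i)) = 0 \<Longrightarrow> a / c \<in> B"
  shows "integral_closure_map (osec X V) (osec Y (preim Y mor V)) (snd mor V)"
proof -
  let ?V = "preim Y mor V" and ?g = "snd mor V"
  note V' = open_preim[OF V] and ne' = preim_ne[OF V ne]
  have AB: "a \<in> B" if "a \<in> A" for a using regular_map A B that by blast
  have cX: "carrier (osec X V) = sectX V ` A" by (simp add: X.carrier_sect V A)
  have cY: "carrier (osec Y ?V) = sectY ?V ` B" by (simp add: Y.carrier_sect V' B)
  have g: "?g (sectX V a) = sectY ?V a" if "a \<in> A" for a using mor_sect[OF V] A that by simp
  have eqX: "sectX V a = sectX V b \<longleftrightarrow> a = b" if "a \<in> A" "b \<in> A" for a b
    using X.sect_eq_iff[OF V ne] that A by simp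
  have eqY: "sectY ?V a = sectY ?V b \<longleftrightarrow> a = b" if "a \<in> B" "b \<in> B" for a b
    using Y.sect_eq_iff[OF V' ne'] that B by simp
  note clX = X.regular_closed[OF V, unfolded A] X.regular_power[OF V, unfolded A]
  note clY = Y.regular_closed[OF V', unfolded B] Y.regular_power[OF V', unfolded B]
  note opX = X.sect_ops[OF V, unfolded A] X.sect_pow[OF V, unfolded A] X.osec_zero[OF V]
  note opY = Y.sect_ops[OF V', unfolded B] Y.sect_pow[OF V', unfolded B] Y.osec_zero[OF V']
  have finX: "(\<Oplus>\<^bsub>osec X V\<^esub>i\<in>{..<n}. s i) = sectX V (sum f {..<n})"
    if "\<And>i. i < n \<Longrightarrow> f i \<in> A" "\<And>i. i < n \<Longrightarrow> s i = sectX V (f i)" for s f and n :: nat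
  proof -
    interpret cring "osec X V" by (rule X.osec_cring[OF V])
    have "(\<Oplus>\<^bsub>osec X V\<^esub>i\<in>{..<n}. s i) = (\<Oplus>\<^bsub>osec X V\<^esub>i\<in>{..<n}. sectX V (f i))"
      by (rule finsum_cong') (use that cX in auto)
    then show ?thesis using X.sect_finsum[OF V, of "{..<n}" f] that A by simp
  qed
  have finY: "(\<Oplus>\<^bsub>osec Y ?V\<^esub>i\<in>{..<n}. s i) = sectY ?V (sum f {..<n})"
    if "\<And>i. i < n \<Longrightarrow> f i \<in> B" "\<And>i. i < n \<Longrightarrow> s i = sectY ?V (f i)" for s f and n :: nat
  proof -
    interpret cring "osec Y ?V" by (rule Y.osec_cring[OF V'])
    have "(\<Oplus>\<^bsub>osec Y ?V\<^esub>i\<in>{..<n}. s i) = (\<Oplus>\<^bsub>osec Y ?V\<^esub>i\<in>{..<n}. sectY ?V (f i))"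
      by (rule finsum_cong') (use that cY in auto)
    then show ?thesis using Y.sect_finsum[OF V', of "{..<n}" f] that B by simp
  qed
  show ?thesis unfolding integral_closure_map_def
  proof (intro conjI ballI impI)
    show "domain (osec X V)" "domain (osec Y ?V)"
      by (rule X.osec_domain[OF V ne], rule Y.osec_domain[OF V' ne'])
    show "?g \<in> ring_hom (osec X V) (osec Y ?V)" by (rule mor_hom[OF V])
    show "inj_on ?g (carrier (osec X V))" by (auto simp: inj_on_def cX g eqY AB)
  next
    fix b assume "b \<in> carrier (osec Y ?V)"
    then obtain \<beta> where \<beta>: "\<beta> \<in> B" "b = sectY ?V \<beta>" using cY by auto
    from fr[OF \<beta>(1)] obtain a c where ac: "a \<in> A" "c \<in> A" "c \<noteq> 0" "c * \<beta> = a" by blast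
    have "sectX V c \<noteq> \<zero>\<^bsub>osec X V\<^esub>" "?g (sectX V c) \<otimes>\<^bsub>osec Y ?V\<^esub> b = ?g (sectX V a)"
      using ac \<beta> by (simp_all add: opX eqX clX g opY AB)
    then show "\<exists>a\<in>carrier (osec X V). \<exists>c\<in>carrier (osec X V) - {\<zero>\<^bsub>osec X V\<^esub>}. ?g c \<otimes>\<^bsub>osec Y ?V\<^esub> b = ?g a"
      using ac by (intro bexI[of _ "sectX V a"] bexI[of _ "sectX V c"]) (auto simp: cX)
  next
    fix b assume "b \<in> carrier (osec Y ?V)"
    then obtain \<beta> where \<beta>: "\<beta> \<in> B" "b = sectY ?V \<beta>" using cY by auto
    from int[OF \<beta>(1)] obtain n r where r: "\<forall>i<n. r i \<in> A" "\<beta> ^ n + (\<Sum>i<n. r i * \<beta> ^ i) = 0" by blast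
    have "(\<Oplus>\<^bsub>osec Y ?V\<^esub>i\<in>{..<n}. ?g (sectX V (r i)) \<otimes>\<^bsub>osec Y ?V\<^esub> b [^]\<^bsub>osec Y ?V\<^esub> i) =
        sectY ?V (\<Sum>i<n. r i * \<beta> ^ i)"
      by (rule finY) (simp_all add: r(1) AB \<beta> clY g opY)
    moreover have "(\<Sum>i<n. r i * \<beta> ^ i) \<in> Y.regular ?V"
      by (rule Y.regular_sum[OF V']) (simp add: B r(1) AB \<beta> clY)
    ultimately have "b [^]\<^bsub>osec Y ?V\<^esub> n \<oplus>\<^bsub>osec Y ?V\<^esub>
        (\<Oplus>\<^bsub>osec Y ?V\<^esub>i\<in>{..<n}. ?g (sectX V (r i)) \<otimes>\<^bsub>osec Y ?V\<^esub> b [^]\<^bsub>osec Y ?V\<^esub> i) = \<zero>\<^bsub>osec Y ?V\<^esub>"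
      using r(2) \<beta> by (simp add: B opY clY)
    moreover have "(\<lambda>i. sectX V (r i)) \<in> {..<n} \<rightarrow> carrier (osec X V)" using r(1) by (auto simp: cX)
    ultimately show "\<exists>n::nat. \<exists>r\<in>{..<n} \<rightarrow> carrier (osec X V).
        b [^]\<^bsub>osec Y ?V\<^esub> n \<oplus>\<^bsub>osec Y ?V\<^esub> (\<Oplus>\<^bsub>osec Y ?V\<^esub>i\<in>{..<n}. ?g (r i) \<otimes>\<^bsub>osec Y ?V\<^esub> b [^]\<^bsub>osec Y ?V\<^esub> i) = \<zero>\<^bsub>osec Y ?V\<^esub>"
      by (rule_tac exI[of _ n], rule_tac bexI[of _ "\<lambda>i. sectX V (r i)"])
  next
    fix a c assume a: "a \<in> carrier (osec X V)" and c: "c \<in> carrier (osec X V) - {\<zero>\<^bsub>osec X V\<^esub>}"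
      and "\<exists>n::nat. \<exists>r\<in>{..<n} \<rightarrow> carrier (osec X V).
           a [^]\<^bsub>osec X V\<^esub> n \<oplus>\<^bsub>osec X V\<^esub>
             (\<Oplus>\<^bsub>osec X V\<^esub>i\<in>{..<n}. r i \<otimes>\<^bsub>osec X V\<^esub> a [^]\<^bsub>osec X V\<^esub> i \<otimes>\<^bsub>osec X V\<^esub> c [^]\<^bsub>osec X V\<^esub> (n - i)) = \<zero>\<^bsub>osec X V\<^esub>"
    then show "\<exists>b\<in>carrier (osec Y ?V). ?g c \<otimes>\<^bsub>osec Y ?V\<^esub> b = ?g a"
    proof (elim exE bexE)
    fix n :: nat and r assume r: "r \<in> {..<n} \<rightarrow> carrier (osec X V)"
      and e: "a [^]\<^bsub>osec X V\<^esub> n \<oplus>\<^bsub>osec X V\<^esub>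
             (\<Oplus>\<^bsub>osec X V\<^esub>i\<in>{..<n}. r i \<otimes>\<^bsub>osec X V\<^esub> a [^]\<^bsub>osec X V\<^esub> i \<otimes>\<^bsub>osec X V\<^esub> c [^]\<^bsub>osec X V\<^esub> (n - i)) = \<zero>\<^bsub>osec X V\<^esub>"
    obtain \<alpha> where \<alpha>: "\<alpha> \<in> A" "a = sectX V \<alpha>" using a cX by auto
    obtain \<gamma> where \<gamma>: "\<gamma> \<in> A" "c = sectX V \<gamma>" using c cX by auto
    have \<gamma>0: "\<gamma> \<noteq> 0" using c \<gamma> by (auto simp: opX)
    have "\<forall>i\<in>{..<n}. \<exists>\<rho>. \<rho> \<in> A \<and> r i = sectX V \<rho>" using r cX by (auto simp: Pi_iff)
    then obtain \<rho> where "\<forall>i\<in>{..<n}. \<rho> i \<in> A \<and> r i = sectX V (\<rho> i)" by (rule bchoice[THEN exE])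
    then have \<rho>: "\<And>i. i < n \<Longrightarrow> \<rho> i \<in> A" "\<And>i. i < n \<Longrightarrow> r i = sectX V (\<rho> i)" by auto
    have "(\<Oplus>\<^bsub>osec X V\<^esub>i\<in>{..<n}. r i \<otimes>\<^bsub>osec X V\<^esub> a [^]\<^bsub>osec X V\<^esub> i \<otimes>\<^bsub>osec X V\<^esub> c [^]\<^bsub>osec X V\<^esub> (n - i)) =
        sectX V (\<Sum>i<n. \<rho> i * \<alpha> ^ i * \<gamma> ^ (n - i))"
      by (rule finX) (simp_all add: \<rho> \<alpha> \<gamma> clX opX)
    moreover have "(\<Sum>i<n. \<rho> i * \<alpha> ^ i * \<gamma> ^ (n - i)) \<in> X.regular V"
      by (rule X.regular_sum[OF V]) (simp add: A \<rho> \<alpha> \<gamma> clX)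
    ultimately have "sectX V (\<alpha> ^ n + (\<Sum>i<n. \<rho> i * \<alpha> ^ i * \<gamma> ^ (n - i))) = sectX V 0"
      using e \<alpha> by (simp add: A opX clX)
    then have "\<alpha> ^ n + (\<Sum>i<n. \<rho> i * \<alpha> ^ i * \<gamma> ^ (n - i)) = 0"
      using \<open>_ \<in> X.regular V\<close> \<alpha> by (subst (asm) eqX) (simp_all add: A clX)
    from clo[OF \<alpha>(1) \<gamma>(1) \<gamma>0 \<rho>(1) this] have q: "\<alpha> / \<gamma> \<in> B" by blast
    then have "?g c \<otimes>\<^bsub>osec Y ?V\<^esub> sectY ?V (\<alpha> / \<gamma>) = ?g a"
      using \<alpha> \<gamma> \<gamma>0 by (simp add: g opY AB)
    then show "\<exists>b\<in>carrier (osec Y ?V). ?g c \<otimes>\<^bsub>osec Y ?V\<^esub> b = ?g a"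
      using q cY by blast
    qed
  qed
qed

end

section \<open>Spaces of prime ideals of a domain\<close>

locale embedded_domain = cring B for B :: "('a, 'b) calg_scheme" (structure) +
  fixes \<rho> :: "'a \<Rightarrow> 'k::field"
  assumes \<rho>_inj: "inj_on \<rho> (carrier B)"
    and \<rho>_mult: "a \<in> carrier B \<Longrightarrow> b \<in> carrier B \<Longrightarrow> \<rho> (a \<otimes> b) = \<rho> a * \<rho> b"
    and \<rho>_add: "a \<in> carrier B \<Longrightarrow> b \<in> carrier B \<Longrightarrow> \<rho> (a \<oplus> b) = \<rho> a + \<rho> b"
    and \<rho>_one: "\<rho> \<one> = 1"
begin

lemma \<rho>_zero: "\<rho> \<zero> = 0"
proof -
  have "\<rho> \<zero> = \<rho> \<zero> + \<rho> \<zero>" using \<rho>_add[of \<zero> \<zero>] by (simp only: zero_closed r_zero simp_thms)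
  then show ?thesis by (simp only: add_cancel_right_right)
qed

lemma \<rho>_minus: "a \<in> carrier B \<Longrightarrow> \<rho> (\<ominus> a) = - \<rho> a"
  using \<rho>_add[of "\<ominus> a" a] by (simp add: l_neg \<rho>_zero eq_neg_iff_add_eq_0)

lemma \<rho>_eq_iff: "a \<in> carrier B \<Longrightarrow> b \<in> carrier B \<Longrightarrow> \<rho> a = \<rho> b \<longleftrightarrow> a = b"
  using \<rho>_inj by (auto dest: inj_onD)

lemma \<rho>_eq_0: "a \<in> carrier B \<Longrightarrow> \<rho> a = 0 \<longleftrightarrow> a = \<zero>"
  using \<rho>_eq_iff[of a \<zero>] by (simp add: \<rho>_zero)

lemma is_domain: "domain B"
proof (intro domain.intro domain_axioms.intro)
  show "\<one> \<noteq> \<zero>" using \<rho>_one \<rho>_zero by auto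
  fix a b assume "a \<otimes> b = \<zero>" "a \<in> carrier B" "b \<in> carrier B"
  then show "a = \<zero> \<or> b = \<zero>" using \<rho>_mult[of a b] \<rho>_eq_0 by (auto simp: \<rho>_zero)
qed (rule is_cring)

lemma primeideal_facts:
  assumes "primeideal p B"
  shows "p \<subseteq> carrier B" "\<zero> \<in> p" "\<one> \<notin> p" "a \<in> carrier B \<Longrightarrow> b \<in> p \<Longrightarrow> a \<otimes> b \<in> p"
    "a \<in> carrier B \<Longrightarrow> b \<in> carrier B \<Longrightarrow> a \<otimes> b \<in> p \<longleftrightarrow> a \<in> p \<or> b \<in> p"
    "a \<in> p \<Longrightarrow> b \<in> p \<Longrightarrow> a \<oplus> b \<in> p"
proof -
  interpret primeideal p B by fact
  show "p \<subseteq> carrier B" by (rule a_subset)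
  show "\<zero> \<in> p" by (rule additive_subgroup.zero_closed) (rule is_additive_subgroup)
  show "a \<otimes> b \<in> p" if "a \<in> carrier B" "b \<in> p" using I_l_closed[OF that(2,1)] .
  show "a \<oplus> b \<in> p" if "a \<in> p" "b \<in> p" using a_closed[OF that] .
  show "\<one> \<notin> p" using one_imp_carrier I_notcarr by metis
  show "a \<otimes> b \<in> p \<longleftrightarrow> a \<in> p \<or> b \<in> p" if "a \<in> carrier B" "b \<in> carrier B"
    using I_prime[OF that] I_l_closed[of b a] I_r_closed[of a b] that by metis
qed

text \<open>The intended form of \<open>frac_class\<close>: in a domain, two fractions agree in a
  localization exactly if they have the same value in the field. The set is nonempty precisely for
  the values in \<open>floc\<close>.\<close>

definition fcls :: "('a \<times> 'a) set \<Rightarrow> 'a set \<Rightarrow> 'k \<Rightarrow> ('a \<times> 'a) set" where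
  "fcls Fr p \<phi> = {(b, g) \<in> Fr. g \<notin> p \<and> \<rho> b = \<phi> * \<rho> g}"

definition fsect :: "('a \<times> 'a) set \<Rightarrow> 'a set set \<Rightarrow> 'k \<Rightarrow> 'a set \<Rightarrow> ('a \<times> 'a) set" where
  "fsect Fr U \<phi> = (\<lambda>p\<in>U. fcls Fr p \<phi>)"

definition floc :: "('a \<times> 'a) set \<Rightarrow> 'a set \<Rightarrow> 'k set" where
  "floc Fr p = {\<phi>. \<exists>(a, f)\<in>Fr. f \<notin> p \<and> \<rho> a = \<phi> * \<rho> f}"

lemma flocI: "(a, f) \<in> Fr \<Longrightarrow> f \<notin> p \<Longrightarrow> \<rho> a = \<phi> * \<rho> f \<Longrightarrow> \<phi> \<in> floc Fr p"
  unfolding floc_def by blast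

lemma flocE: assumes "\<phi> \<in> floc Fr p" obtains a f where "(a, f) \<in> Fr" "f \<notin> p" "\<rho> a = \<phi> * \<rho> f"
  using assms unfolding floc_def by blast

lemma \<rho>_notin_prime: "primeideal p B \<Longrightarrow> f \<in> carrier B \<Longrightarrow> f \<notin> p \<Longrightarrow> \<rho> f \<noteq> 0"
  using primeideal_facts(2) \<rho>_eq_0 by blast

text \<open>The auxiliary factor \<open>h\<close> lies outside the prime, hence has nonzero image in
  the field and cancels; conversely \<open>h = \<one>\<close> is always available.\<close>

lemma frac_class_eq:
  assumes Fr: "Fr \<subseteq> carrier B \<times> carrier B" and p: "primeideal p B"
    and "(a, f) \<in> Fr" "f \<notin> p" "\<rho> a = \<phi> * \<rho> f"
  shows "frac_class B Fr p (a, f) = fcls Fr p \<phi>"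
proof -
  have af: "a \<in> carrier B" "f \<in> carrier B" using assms by auto
  have f0: "\<rho> f \<noteq> 0" using \<rho>_notin_prime[OF p af(2)] assms by blast
  have "(\<exists>h\<in>carrier B - p. h \<otimes> (a \<otimes> g) = h \<otimes> (b \<otimes> f)) \<longleftrightarrow> \<rho> b = \<phi> * \<rho> g"
    if "(b, g) \<in> Fr" for b g
  proof -
    have bg: "b \<in> carrier B" "g \<in> carrier B" using Fr that by auto
    have "h \<otimes> (a \<otimes> g) = h \<otimes> (b \<otimes> f) \<longleftrightarrow> \<rho> b = \<phi> * \<rho> g" if h: "h \<in> carrier B - p" for h
    proof -
      have "\<rho> h \<noteq> 0" using \<rho>_notin_prime[OF p] h by blast
      moreover have "h \<otimes> (a \<otimes> g) = h \<otimes> (b \<otimes> f) \<longleftrightarrow> \<rho> (h \<otimes> (a \<otimes> g)) = \<rho> (h \<otimes> (b \<otimes> f))"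
        using h bg af by (subst \<rho>_eq_iff) auto
      ultimately show ?thesis using h bg af f0 assms(5) by (auto simp: \<rho>_mult)
    qed
    moreover have "\<one> \<in> carrier B - p" using primeideal_facts(3)[OF p] by simp
    ultimately show ?thesis by blast
  qed
  then show ?thesis unfolding frac_class_def fcls_def by auto
qed

text \<open>Three sets of fractions are kept apart because the module structure of
  \<open>\<O>(d)\<close> multiplies a fraction of degree 0 by one of degree
  \<open>d\<close>.\<close>

lemma frac_mult_eq:
  assumes Fr: "Fr1 \<subseteq> carrier B \<times> carrier B" "Fr2 \<subseteq> carrier B \<times> carrier B" "Fr3 \<subseteq> carrier B \<times> carrier B"
    and p: "primeideal p B"
    and cl: "\<And>a f b g. (a, f) \<in> Fr1 \<Longrightarrow> (b, g) \<in> Fr2 \<Longrightarrow> (a \<otimes> b, f \<otimes> g) \<in> Fr3"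
    and "\<phi> \<in> floc Fr1 p" "\<psi> \<in> floc Fr2 p"
  shows "frac_mult B Fr3 p (fcls Fr1 p \<phi>) (fcls Fr2 p \<psi>) = fcls Fr3 p (\<phi> * \<psi>)"
proof -
  have *: "frac_class B Fr3 p (a \<otimes> b, f \<otimes> g) = fcls Fr3 p (\<phi> * \<psi>)"
    if "(a, f) \<in> fcls Fr1 p \<phi>" "(b, g) \<in> fcls Fr2 p \<psi>" for a f b g
  proof (rule frac_class_eq[OF Fr(3) p])
    have c: "a \<in> carrier B" "f \<in> carrier B" "b \<in> carrier B" "g \<in> carrier B"
      using that Fr by (auto simp: fcls_def)
    show "(a \<otimes> b, f \<otimes> g) \<in> Fr3" using that cl by (auto simp: fcls_def)
    show "f \<otimes> g \<notin> p" using that c primeideal_facts(5)[OF p] by (auto simp: fcls_def)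
    show "\<rho> (a \<otimes> b) = \<phi> * \<psi> * \<rho> (f \<otimes> g)" using that c by (auto simp: fcls_def \<rho>_mult)
  qed
  obtain a f b g where "(a, f) \<in> fcls Fr1 p \<phi>" "(b, g) \<in> fcls Fr2 p \<psi>"
    using assms(6,7) by (auto simp: floc_def fcls_def)
  then show ?thesis unfolding frac_mult_def using * by fast
qed

lemma frac_add_eq:
  assumes Fr: "Fr \<subseteq> carrier B \<times> carrier B" and p: "primeideal p B"
    and cl: "\<And>a f b g. (a, f) \<in> Fr \<Longrightarrow> (b, g) \<in> Fr \<Longrightarrow> (a \<otimes> g \<oplus> b \<otimes> f, f \<otimes> g) \<in> Fr"
    and "\<phi> \<in> floc Fr p" "\<psi> \<in> floc Fr p"
  shows "frac_add B Fr p (fcls Fr p \<phi>) (fcls Fr p \<psi>) = fcls Fr p (\<phi> + \<psi>)"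
proof -
  have *: "frac_class B Fr p (a \<otimes> g \<oplus> b \<otimes> f, f \<otimes> g) = fcls Fr p (\<phi> + \<psi>)"
    if "(a, f) \<in> fcls Fr p \<phi>" "(b, g) \<in> fcls Fr p \<psi>" for a f b g
  proof (rule frac_class_eq[OF Fr p])
    have c: "a \<in> carrier B" "f \<in> carrier B" "b \<in> carrier B" "g \<in> carrier B"
      using that Fr by (auto simp: fcls_def)
    show "(a \<otimes> g \<oplus> b \<otimes> f, f \<otimes> g) \<in> Fr" using that cl by (auto simp: fcls_def)
    show "f \<otimes> g \<notin> p" using that c primeideal_facts(5)[OF p] by (auto simp: fcls_def)
    show "\<rho> (a \<otimes> g \<oplus> b \<otimes> f) = (\<phi> + \<psi>) * \<rho> (f \<otimes> g)"
      using that c by (auto simp: fcls_def \<rho>_mult \<rho>_add algebra_simps)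
  qed
  obtain a f b g where "(a, f) \<in> fcls Fr p \<phi>" "(b, g) \<in> fcls Fr p \<psi>"
    using assms(4,5) by (auto simp: floc_def fcls_def)
  then show ?thesis unfolding frac_add_def using * by fast
qed

end

locale frac_points = embedded_domain B \<rho> for B :: "('a, 'b) calg_scheme" (structure) and \<rho> :: "'a \<Rightarrow> 'k::field" +
  fixes Pts :: "'a set set"
  assumes Pts_prime: "p \<in> Pts \<Longrightarrow> primeideal p B" and zero_Pts: "{\<zero>} \<in> Pts"
begin

lemma topspace_zariski: "topspace (zariski B Pts) = Pts"
  unfolding zariski_def topology_generated_by_topspace using primeideal_facts(3)[OF Pts_prime] by blast

lemma open_basic: "f \<in> carrier B \<Longrightarrow> openin (zariski B Pts) {p \<in> Pts. f \<notin> p}"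
  unfolding zariski_def by (rule topology_generated_by_Basis) auto

lemma open_generic:
  assumes "openin (zariski B Pts) U" "U \<noteq> {}"
  shows "{\<zero>} \<in> U"
proof -
  have "generate_topology_on {{p\<in>Pts. f \<notin> p} | f. f \<in> carrier B} U"
    using assms(1) unfolding zariski_def by (rule openin_topology_generated_by)
  then have "U \<noteq> {} \<longrightarrow> {\<zero>} \<in> U"
  proof induction
    case (Basis s)
    then show ?case using zero_Pts primeideal_facts(2)[OF Pts_prime] by auto
  qed auto
  then show ?thesis using assms(2) by blast
qed

text \<open>The sets \<open>f \<notin> p\<close> are only given as generators of the topology. They
  form a basis because a product avoids a prime exactly if both factors do.\<close>

lemma open_nbhd:
  assumes "openin (zariski B Pts) U" "p \<in> U"
  obtains f where "f \<in> carrier B" "f \<notin> p" "{q \<in> Pts. f \<notin> q} \<subseteq> U"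
proof -
  have "generate_topology_on {{p\<in>Pts. f \<notin> p} | f. f \<in> carrier B} U"
    using assms(1) unfolding zariski_def by (rule openin_topology_generated_by)
  then have "\<forall>p\<in>U. \<exists>f\<in>carrier B. f \<notin> p \<and> {q \<in> Pts. f \<notin> q} \<subseteq> U"
  proof induction
    case (Int a b)
    have ab: "a \<subseteq> Pts" using Int(1) openin_subset[of "zariski B Pts" a]
      by (simp add: topspace_zariski) (simp add: zariski_def openin_topology_generated_by_iff)
    show ?case
    proof
      fix p assume p: "p \<in> a \<inter> b"
      then have pa: "p \<in> a" and pb: "p \<in> b" by auto
      obtain f where f: "f \<in> carrier B" "f \<notin> p" "{q \<in> Pts. f \<notin> q} \<subseteq> a"
        using bspec[OF Int(3) pa] by blast
      obtain g where g: "g \<in> carrier B" "g \<notin> p" "{q \<in> Pts. g \<notin> q} \<subseteq> b"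
        using bspec[OF Int(4) pb] by blast
      have "f \<otimes> g \<notin> p" using primeideal_facts(5)[OF Pts_prime] f g p ab by blast
      moreover have "{q \<in> Pts. f \<otimes> g \<notin> q} \<subseteq> a \<inter> b"
        using primeideal_facts(5)[OF Pts_prime] f g by blast
      ultimately show "\<exists>f\<in>carrier B. f \<notin> p \<and> {q \<in> Pts. f \<notin> q} \<subseteq> a \<inter> b" using f g by blast
    qed
  next
    case (UN K)
    show ?case
    proof
      fix p assume "p \<in> \<Union>K"
      then obtain k where k: "k \<in> K" "p \<in> k" by auto
      from bspec[OF UN(2)[OF k(1)] k(2)] obtain f
        where f: "f \<in> carrier B" "f \<notin> p" "{q \<in> Pts. f \<notin> q} \<subseteq> k" by auto
      show "\<exists>f\<in>carrier B. f \<notin> p \<and> {q \<in> Pts. f \<notin> q} \<subseteq> \<Union>K"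
        using f subset_trans[OF f(3) Union_upper[OF k(1)]] by (intro bexI[of _ f] conjI)
    qed
  qed auto
  then show ?thesis using assms(2) that by blast
qed

text \<open>A section is locally a fraction, and the local fractions may differ from point to point.
  All of them are valid at the generic point \<open>{\<zero>}\<close>, which lies in every nonempty
  open set, so they share one value in the field.\<close>

lemma frac_sections_eq:
  assumes Fr: "Fr \<subseteq> carrier B \<times> carrier B" and U: "openin (zariski B Pts) U"
  shows "frac_sections B Pts Fr U = fsect Fr U ` (\<Inter>p\<in>U. floc Fr p)"
proof
  have UP: "U \<subseteq> Pts" using openin_subset[OF U] by (simp add: topspace_zariski)
  show "frac_sections B Pts Fr U \<subseteq> fsect Fr U ` (\<Inter>p\<in>U. floc Fr p)"
  proof
    fix s assume s: "s \<in> frac_sections B Pts Fr U"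
    then have ext: "s \<in> extensional U" by (simp add: frac_sections_def)
    \<comment> \<open>Each local fraction is recorded together with its validity at the generic
      point, where all of them are compared.\<close>
    have "\<forall>p\<in>U. \<exists>w. w \<in> Fr \<and> snd w \<notin> p \<and> s p = frac_class B Fr p w \<and>
        {\<zero>} \<in> U \<and> snd w \<notin> {\<zero>} \<and> s {\<zero>} = frac_class B Fr {\<zero>} w"
    proof
      fix p assume "p \<in> U"
      then obtain V a f where v: "openin (zariski B Pts) V" "p \<in> V" "V \<subseteq> U" "(a, f) \<in> Fr"
       "\<forall>q\<in>V. f \<notin> q \<and> s q = frac_class B Fr q (a, f)" using s unfolding frac_sections_def by blast
      have z: "{\<zero>} \<in> V" using open_generic[OF v(1)] v(2) by blast
      show "\<exists>w. w \<in> Fr \<and> snd w \<notin> p \<and> s p = frac_class B Fr p w \<and>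
        {\<zero>} \<in> U \<and> snd w \<notin> {\<zero>} \<and> s {\<zero>} = frac_class B Fr {\<zero>} w"
        using v(4) bspec[OF v(5) v(2)] bspec[OF v(5) z] subsetD[OF v(3) z]
        by (intro exI[of _ "(a, f)"]) simp
    qed
    from bchoice[OF this] obtain w where w: "\<And>p. p \<in> U \<Longrightarrow> w p \<in> Fr \<and> snd (w p) \<notin> p \<and> s p = frac_class B Fr p (w p) \<and>
        {\<zero>} \<in> U \<and> snd (w p) \<notin> {\<zero>} \<and> s {\<zero>} = frac_class B Fr {\<zero>} (w p)" by auto
    define a f where "a = fst \<circ> w" and "f = snd \<circ> w"
    have af: "\<And>p. p \<in> U \<Longrightarrow> (a p, f p) \<in> Fr"
      "\<And>p. p \<in> U \<Longrightarrow> f p \<notin> p \<and> s p = frac_class B Fr p (a p, f p)"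
      "\<And>p. p \<in> U \<Longrightarrow> {\<zero>} \<in> U \<and> f p \<notin> {\<zero>} \<and> s {\<zero>} = frac_class B Fr {\<zero>} (a p, f p)"
      using w unfolding a_def f_def comp_def prod.collapse by blast+
    have carr: "a p \<in> carrier B" "f p \<in> carrier B" if "p \<in> U" for p using af(1)[OF that] Fr by auto
    define \<phi> where "\<phi> = \<rho> (a {\<zero>}) / \<rho> (f {\<zero>})"
    have key: "\<rho> (a p) = \<phi> * \<rho> (f p)" if p: "p \<in> U" for p
    proof -
      have z: "{\<zero>} \<in> U" using af(3)[OF p] by blast
      have "\<rho> (f {\<zero>}) \<noteq> 0" using af(3)[OF z] carr[OF z] \<rho>_eq_0 by auto
      then have 1: "s {\<zero>} = fcls Fr {\<zero>} \<phi>"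
        using frac_class_eq[OF Fr Pts_prime[OF zero_Pts] af(1)[OF z], of \<phi>] af(3)[OF z] by (auto simp: \<phi>_def)
      have "\<rho> (f p) \<noteq> 0" using af(3)[OF p] carr[OF p] \<rho>_eq_0 by auto
      then have "s {\<zero>} = fcls Fr {\<zero>} (\<rho> (a p) / \<rho> (f p))"
        using frac_class_eq[OF Fr Pts_prime[OF zero_Pts] af(1)[OF p], of "\<rho> (a p) / \<rho> (f p)"] af(3)[OF p] by auto
      moreover have "(a p, f p) \<in> fcls Fr {\<zero>} (\<rho> (a p) / \<rho> (f p))"
        using af(1)[OF p] af(3)[OF p] \<open>\<rho> (f p) \<noteq> 0\<close> by (auto simp: fcls_def)
      ultimately have "(a p, f p) \<in> fcls Fr {\<zero>} \<phi>" using 1 by simp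
      then show ?thesis by (simp add: fcls_def)
    qed
    have "s = fsect Fr U \<phi>"
    proof (rule extensionalityI[OF ext])
      show "fsect Fr U \<phi> \<in> extensional U" by (simp add: fsect_def)
      fix p assume p: "p \<in> U"
      then show "s p = fsect Fr U \<phi> p"
        using af(2)[OF p] frac_class_eq[OF Fr Pts_prime af(1) _ key] UP by (auto simp: fsect_def)
    qed
    moreover have "\<phi> \<in> (\<Inter>p\<in>U. floc Fr p)" using flocI[OF af(1) _ key] af(2) by blast
    ultimately show "s \<in> fsect Fr U ` (\<Inter>p\<in>U. floc Fr p)" by blast
  qed
  show "fsect Fr U ` (\<Inter>p\<in>U. floc Fr p) \<subseteq> frac_sections B Pts Fr U"
  proof
    fix s assume "s \<in> fsect Fr U ` (\<Inter>p\<in>U. floc Fr p)"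
    then obtain \<phi> where \<phi>: "s = fsect Fr U \<phi>" "\<And>p. p \<in> U \<Longrightarrow> \<phi> \<in> floc Fr p" by auto
    have "\<exists>V a f. openin (zariski B Pts) V \<and> p \<in> V \<and> V \<subseteq> U \<and> (a, f) \<in> Fr \<and>
       (\<forall>q\<in>V. f \<notin> q \<and> s q = frac_class B Fr q (a, f))" if p: "p \<in> U" for p
    proof -
      obtain a f where af: "(a, f) \<in> Fr" "f \<notin> p" "\<rho> a = \<phi> * \<rho> f" using \<phi>(2)[OF p] by (rule flocE)
      define V where "V = {q \<in> Pts. f \<notin> q} \<inter> U"
      have "openin (zariski B Pts) V" unfolding V_def
        using open_basic af(1) Fr U by (intro openin_Int) auto
      moreover have "f \<notin> q \<and> s q = frac_class B Fr q (a, f)" if "q \<in> V" for q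
         using frac_class_eq[OF Fr Pts_prime af(1) _ af(3)] that by (auto simp: V_def \<phi> fsect_def)
      then have "\<forall>q\<in>V. f \<notin> q \<and> s q = frac_class B Fr q (a, f)" by (rule ballI)
      moreover have "p \<in> V" "V \<subseteq> U" using af(2) p UP by (auto simp: V_def)
      ultimately show ?thesis using af(1) by (intro exI[of _ V] exI[of _ a] exI[of _ f] conjI)
    qed
    moreover have "s \<in> extensional U" using \<phi>(1) by (simp add: fsect_def)
    ultimately show "s \<in> frac_sections B Pts Fr U" by (simp add: frac_sections_def)
  qed
qed

text \<open>The value can be read off at the generic point.\<close>

lemma fsect_inj:
  assumes "openin (zariski B Pts) U" "U \<noteq> {}" and Fr: "Fr \<subseteq> carrier B \<times> carrier B"
  shows "inj_on (fsect Fr U) (\<Inter>p\<in>U. floc Fr p)"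
proof (rule inj_onI)
  have z: "{\<zero>} \<in> U" using open_generic assms by blast
  fix \<phi> \<psi> assume a: "\<phi> \<in> (\<Inter>p\<in>U. floc Fr p)" "fsect Fr U \<phi> = fsect Fr U \<psi>"
  then have "fcls Fr {\<zero>} \<phi> = fcls Fr {\<zero>} \<psi>" using z by (auto simp: fsect_def dest!: fun_cong[of _ _ "{\<zero>}"])
  moreover have "\<phi> \<in> floc Fr {\<zero>}" using a(1) z by blast
  then obtain b f where f: "(b, f) \<in> Fr" "f \<notin> {\<zero>}" "\<rho> b = \<phi> * \<rho> f" by (rule flocE)
  moreover have "(b, f) \<in> fcls Fr {\<zero>} \<phi>" using f by (simp add: fcls_def)
  ultimately have "(b, f) \<in> fcls Fr {\<zero>} \<psi>" by simp
  moreover have "\<rho> f \<noteq> 0" using f Fr \<rho>_eq_0 by auto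
  ultimately show "\<phi> = \<psi>" using f(3) by (simp add: fcls_def)
qed

end

locale frac_model = frac_points B \<rho> Pts for B :: "('a, 'b) calg_scheme" (structure) and \<rho> :: "'a \<Rightarrow> 'k::field" and Pts +
  fixes Fr :: "('a \<times> 'a) set" and \<iota> :: "complex \<Rightarrow> 'k"
  assumes Fr_carr: "Fr \<subseteq> carrier B \<times> carrier B"
    and Fr_mult: "(a, f) \<in> Fr \<Longrightarrow> (b, g) \<in> Fr \<Longrightarrow> (a \<otimes> b, f \<otimes> g) \<in> Fr"
    and Fr_add: "(a, f) \<in> Fr \<Longrightarrow> (b, g) \<in> Fr \<Longrightarrow> (a \<otimes> g \<oplus> b \<otimes> f, f \<otimes> g) \<in> Fr"
    and Fr_minus: "(a, f) \<in> Fr \<Longrightarrow> (\<ominus> a, f) \<in> Fr"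
    and Fr_one: "(\<one>, \<one>) \<in> Fr" and Fr_zero: "(\<zero>, \<one>) \<in> Fr"
    and Fr_scal: "(scal B c, \<one>) \<in> Fr"
    and \<rho>_scal: "\<rho> (scal B c) = \<iota> c"
begin

sublocale FS: fun_space "frac_space B Pts Fr" "{\<zero>}" "fsect Fr" "floc Fr" \<iota>
proof -
  have t: "tp (frac_space B Pts Fr) = zariski B Pts" by (simp add: frac_space_def)
  have P: "primeideal p B" if "p \<in> Pts" for p using Pts_prime[OF that] .
  have UP: "p \<in> Pts" if "openin (zariski B Pts) U" "p \<in> U" for p U
    using openin_subset[OF that(1)] that(2) by (auto simp: topspace_zariski)
  have one: "\<one> \<notin> p" if "p \<in> Pts" for p using primeideal_facts(3)[OF P[OF that]] .
  have fm: "frac_mult B Fr p (fcls Fr p \<phi>) (fcls Fr p \<psi>) = fcls Fr p (\<phi> * \<psi>)"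
    if "p \<in> Pts" "\<phi> \<in> floc Fr p" "\<psi> \<in> floc Fr p" for p \<phi> \<psi>
    by (rule frac_mult_eq[OF Fr_carr Fr_carr Fr_carr P[OF that(1)] Fr_mult that(2,3)])
  have fa: "frac_add B Fr p (fcls Fr p \<phi>) (fcls Fr p \<psi>) = fcls Fr p (\<phi> + \<psi>)"
    if "p \<in> Pts" "\<phi> \<in> floc Fr p" "\<psi> \<in> floc Fr p" for p \<phi> \<psi>
    by (rule frac_add_eq[OF Fr_carr P[OF that(1)] Fr_add that(2,3)])
  have ne: "\<exists>a f. (a, f) \<in> fcls Fr p \<phi>" if "\<phi> \<in> floc Fr p" for p \<phi>
    using that by (auto simp: floc_def fcls_def)
  show "fun_space (frac_space B Pts Fr) {\<zero>} (fsect Fr) (floc Fr) \<iota>"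
  proof (unfold_locales, unfold t topspace_zariski)
    show "{\<zero>} \<in> Pts" by (rule zero_Pts)
  next
    fix U assume "openin (zariski B Pts) U" "U \<noteq> {}"
    then show "{\<zero>} \<in> U" by (rule open_generic)
  next
    fix p assume p: "p \<in> Pts"
    show "1 \<in> floc Fr p" using flocI[OF Fr_one one[OF p]] \<rho>_one by simp
    show "\<iota> c \<in> floc Fr p" for c using flocI[OF Fr_scal one[OF p]] by (simp add: \<rho>_one \<rho>_scal)
    fix \<phi> assume "\<phi> \<in> floc Fr p"
    then obtain a f where af: "(a, f) \<in> Fr" "f \<notin> p" "\<rho> a = \<phi> * \<rho> f" by (rule flocE)
    have afc: "a \<in> carrier B" "f \<in> carrier B" using af Fr_carr by auto
    show "- \<phi> \<in> floc Fr p" using flocI[OF Fr_minus[OF af(1)] af(2)] af afc by (simp add: \<rho>_minus)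
    show "\<exists>U. openin (zariski B Pts) U \<and> p \<in> U \<and> (\<forall>y\<in>U. \<phi> \<in> floc Fr y)"
      using af afc p by (intro exI[of _ "{q \<in> Pts. f \<notin> q}"]) (auto intro: flocI open_basic)
    fix \<psi> assume "\<psi> \<in> floc Fr p"
    then obtain b g where bg: "(b, g) \<in> Fr" "g \<notin> p" "\<rho> b = \<psi> * \<rho> g" by (rule flocE)
    have bgc: "b \<in> carrier B" "g \<in> carrier B" using bg Fr_carr by auto
    have fg: "f \<otimes> g \<notin> p" using primeideal_facts(5)[OF P[OF p]] af bg afc bgc by blast
    show "\<phi> + \<psi> \<in> floc Fr p" using af bg afc bgc
      by (intro flocI[OF Fr_add[OF af(1) bg(1)] fg]) (simp add: \<rho>_add \<rho>_mult algebra_simps)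
    show "\<phi> * \<psi> \<in> floc Fr p" using af bg afc bgc
      by (intro flocI[OF Fr_mult[OF af(1) bg(1)] fg]) (simp add: \<rho>_mult)
  next
    fix U assume U: "openin (zariski B Pts) U"
    show "carrier (osec (frac_space B Pts Fr) U) = fsect Fr U ` (\<Inter>x\<in>U. floc Fr x)"
      by (simp add: frac_space_def frac_sections_eq[OF Fr_carr U])
    show "\<one>\<^bsub>osec (frac_space B Pts Fr) U\<^esub> = fsect Fr U 1"
      using frac_class_eq[OF Fr_carr P[OF UP[OF U]] Fr_one one[OF UP[OF U]], of _ 1]
      by (auto simp: frac_space_def fsect_def \<rho>_one intro: restrict_ext)
    show "\<zero>\<^bsub>osec (frac_space B Pts Fr) U\<^esub> = fsect Fr U 0"
      using frac_class_eq[OF Fr_carr P[OF UP[OF U]] Fr_zero one[OF UP[OF U]], of _ 0]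
      by (auto simp: frac_space_def fsect_def \<rho>_zero \<rho>_one intro: restrict_ext)
    show "scal (osec (frac_space B Pts Fr) U) c = fsect Fr U (\<iota> c)" for c
      using frac_class_eq[OF Fr_carr P[OF UP[OF U]] Fr_scal one[OF UP[OF U]], of _ c "\<iota> c"]
      by (auto simp: frac_space_def fsect_def \<rho>_scal \<rho>_one intro: restrict_ext)
    {
      fix \<phi> \<psi> assume a: "\<phi> \<in> (\<Inter>x\<in>U. floc Fr x)" "\<psi> \<in> (\<Inter>x\<in>U. floc Fr x)"
      show "fsect Fr U \<phi> \<otimes>\<^bsub>osec (frac_space B Pts Fr) U\<^esub> fsect Fr U \<psi> = fsect Fr U (\<phi> * \<psi>)"
        using a UP[OF U] fm by (auto simp: frac_space_def fsect_def restrict_def fun_eq_iff)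
      show "fsect Fr U \<phi> \<oplus>\<^bsub>osec (frac_space B Pts Fr) U\<^esub> fsect Fr U \<psi> = fsect Fr U (\<phi> + \<psi>)"
        using a UP[OF U] fa by (auto simp: frac_space_def fsect_def restrict_def fun_eq_iff)
    }
    show "inj_on (fsect Fr U) (\<Inter>x\<in>U. floc Fr x)" if "U \<noteq> {}"
      by (rule fsect_inj[OF U that Fr_carr])
    fix V \<phi> assume "V \<subseteq> U"
    then show "ores (frac_space B Pts Fr) U V (fsect Fr U \<phi>) = fsect Fr V \<phi>"
      by (auto simp: frac_space_def fsect_def restrict_def fun_eq_iff)
  qed (simp add: fsect_def restrict_def)
qed

end

section \<open>Affine open subspaces\<close>

definition prime_in :: "'k::field set \<Rightarrow> 'k set \<Rightarrow> bool" where
  "prime_in A P \<longleftrightarrow> P \<subseteq> A \<and> 0 \<in> P \<and> 1 \<notin> P \<and> (\<forall>a\<in>P. \<forall>b\<in>P. a + b \<in> P) \<and> (\<forall>a\<in>A. \<forall>b\<in>P. a * b \<in> P) \<and>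
    (\<forall>a\<in>A. \<forall>b\<in>A. a * b \<in> P \<longrightarrow> a \<in> P \<or> b \<in> P)"

definition subring_in :: "'k::field set \<Rightarrow> bool" where
  "subring_in A \<longleftrightarrow> 0 \<in> A \<and> 1 \<in> A \<and> (\<forall>a\<in>A. \<forall>b\<in>A. a + b \<in> A \<and> a * b \<in> A) \<and> (\<forall>a\<in>A. - a \<in> A)"

text \<open>By Zorn's lemma there is an ideal maximal among those that contain \<open>J\<close> and
  avoid 1, and it is prime. The later use is with the ideal of denominators of a function that is
  regular on a chart.\<close>

lemma exists_prime_in:
  fixes A J :: "'k::field set"
  assumes A: "subring_in A" and J: "J \<subseteq> A" "0 \<in> J" "1 \<notin> J" "\<And>a b. a \<in> J \<Longrightarrow> b \<in> J \<Longrightarrow> a + b \<in> J"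
    "\<And>a b. a \<in> A \<Longrightarrow> b \<in> J \<Longrightarrow> a * b \<in> J"
  shows "\<exists>P. prime_in A P \<and> J \<subseteq> P"
proof -
  define Id where "Id = {I. J \<subseteq> I \<and> I \<subseteq> A \<and> 1 \<notin> I \<and> (\<forall>a\<in>I. \<forall>b\<in>I. a + b \<in> I) \<and> (\<forall>a\<in>A. \<forall>b\<in>I. a * b \<in> I)}"
  have "\<exists>P\<in>Id. \<forall>I\<in>Id. P \<subseteq> I \<longrightarrow> I = P"
  proof (rule subset_Zorn_nonempty)
    have "J \<in> Id" unfolding Id_def mem_Collect_eq using J by (intro conjI ballI) simp_all
    then show "Id \<noteq> {}" by blast
    fix C assume C: "C \<noteq> {}" "subset.chain Id C"
    then have CI: "C \<subseteq> Id" by (simp add: subset.chain_def)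
    show "\<Union>C \<in> Id" unfolding Id_def mem_Collect_eq
    proof (intro conjI ballI)
      show "J \<subseteq> \<Union>C" "\<Union>C \<subseteq> A" "1 \<notin> \<Union>C" using C(1) CI unfolding Id_def by blast+
      fix a b assume "a \<in> \<Union>C" "b \<in> \<Union>C"
      then obtain X Y where XY: "X \<in> C" "Y \<in> C" "a \<in> X" "b \<in> Y" by blast
      then have "X \<subseteq> Y \<or> Y \<subseteq> X" using C(2) by (auto simp: subset.chain_def)
      then show "a + b \<in> \<Union>C" using XY CI unfolding Id_def by blast
    next
      fix a b assume "a \<in> A" "b \<in> \<Union>C"
      then show "a * b \<in> \<Union>C" using CI unfolding Id_def by blast
    qed
  qed
  then obtain P where P: "P \<in> Id" and max: "\<And>I. I \<in> Id \<Longrightarrow> P \<subseteq> I \<Longrightarrow> I = P" by blast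
  \<comment> \<open>Maximality: the ideal generated by \<open>P\<close> and an outside element must
    contain 1.\<close>
  have ext: "\<exists>x\<in>P. \<exists>y\<in>A. x + y * a = 1" if a: "a \<in> A" "a \<notin> P" for a
  proof (rule ccontr)
    assume n: "\<not> ?thesis"
    define I where "I = {x + y * a | x y. x \<in> P \<and> y \<in> A}"
    have "x \<in> I" if "x \<in> P" for x
      unfolding I_def using that A by (intro CollectI exI[of _ x] exI[of _ 0]) (simp add: subring_in_def)
    then have PI: "P \<subseteq> I" by blast
    have "I \<in> Id" unfolding Id_def mem_Collect_eq
    proof (intro conjI ballI)
      show "J \<subseteq> I" using P PI by (auto simp: Id_def)
      show "I \<subseteq> A" using P A a(1) by (auto simp: I_def Id_def subring_in_def)
      show "1 \<notin> I" using n by (auto simp: I_def)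
      fix b c assume "b \<in> I" "c \<in> I"
      then obtain x y x' y' where "b = x + y * a" "c = x' + y' * a" "x \<in> P" "x' \<in> P" "y \<in> A" "y' \<in> A"
        by (auto simp: I_def)
      then show "b + c \<in> I" unfolding I_def using P A
        by (intro CollectI exI[of _ "x + x'"] exI[of _ "y + y'"]) (auto simp: Id_def subring_in_def algebra_simps)
    next
      fix b c assume b: "b \<in> A" "c \<in> I"
      then obtain x y where "c = x + y * a" "x \<in> P" "y \<in> A" by (auto simp: I_def)
      then show "b * c \<in> I" unfolding I_def using P A b(1)
        by (intro CollectI exI[of _ "b * x"] exI[of _ "b * y"]) (auto simp: Id_def subring_in_def algebra_simps)
    qed
    from max[OF this PI] have "I = P" .
    moreover have "0 \<in> P" using P J(2) by (auto simp: Id_def)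
    then have "a \<in> I" unfolding I_def using A by (intro CollectI exI[of _ 0] exI[of _ 1]) (simp add: subring_in_def)
    ultimately show False using a(2) by blast
  qed
  have "prime_in A P" unfolding prime_in_def
  proof (intro conjI ballI impI)
    show "P \<subseteq> A" "0 \<in> P" "1 \<notin> P" using P J(2) by (auto simp: Id_def)
    show "a + b \<in> P" if "a \<in> P" "b \<in> P" for a b using P that by (auto simp: Id_def)
    show "a * b \<in> P" if "a \<in> A" "b \<in> P" for a b using P that by (auto simp: Id_def)
    fix a b assume ab: "a \<in> A" "b \<in> A" "a * b \<in> P"
    show "a \<in> P \<or> b \<in> P"
    proof (rule disjCI)
      assume "b \<notin> P"
      from ext[OF ab(2) this] obtain x y where xy: "x \<in> P" "y \<in> A" "x + y * b = 1" by blast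
      have "a = a * (x + y * b)" by (simp add: xy)
      also have "\<dots> = a * x + y * (a * b)" by (simp add: algebra_simps)
      also have "\<dots> \<in> P" using P xy ab by (auto simp: Id_def)
      finally show "a \<in> P" .
    qed
  qed
  then show ?thesis using P by (auto simp: Id_def)
qed

section \<open>Recognizing affine open sets\<close>

context fun_space
begin

context
  fixes V
  assumes V: "openin (tp Z) V" and V_ne: "V \<noteq> {}"
begin

lemma val_ops:
  assumes "s \<in> carrier (osec Z V)" "t \<in> carrier (osec Z V)"
  shows "val V (s \<otimes>\<^bsub>osec Z V\<^esub> t) = val V s * val V t" "val V (s \<oplus>\<^bsub>osec Z V\<^esub> t) = val V s + val V t"
  using assms by (auto simp: carrier_sect V sect_ops val_sect V_ne regular_closed)

lemma frac_model_Spec: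
  "frac_model (osec Z V) (val V) {p. primeideal p (osec Z V)} (carrier (osec Z V) \<times> carrier (osec Z V)) \<iota>"
proof -
  interpret R: cring "osec Z V" by (rule osec_cring[OF V])
  interpret R: embedded_domain "osec Z V" "val V"
  proof
    show "inj_on (val V) (carrier (osec Z V))"
      by (rule inj_on_inverseI[of _ "sect V"]) (simp add: val_in V)
    show "val V \<one>\<^bsub>osec Z V\<^esub> = 1" by (simp add: osec_one V val_sect V_ne regular_closed)
  qed (simp_all add: val_ops)
  have sc: "scal (osec Z V) c = sect V (\<iota> c)" for c by (rule osec_scal[OF V])
  show ?thesis
  proof (intro frac_model.intro frac_points.intro frac_points_axioms.intro frac_model_axioms.intro)
    show "embedded_domain (osec Z V) (val V)" by (rule R.embedded_domain_axioms)
    show "{\<zero>\<^bsub>osec Z V\<^esub>} \<in> {p. primeideal p (osec Z V)}"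
      using domain.zeroprimeideal[OF R.is_domain] by simp
    show "val V (scal (osec Z V) c) = \<iota> c" for c by (simp add: sc val_sect V V_ne regular_closed)
    show "(scal (osec Z V) c, \<one>\<^bsub>osec Z V\<^esub>) \<in> carrier (osec Z V) \<times> carrier (osec Z V)" for c
      by (simp add: sc carrier_sect V regular_closed osec_one)
  qed auto
qed

lemma prime_of_primeideal:
  assumes "primeideal p (osec Z V)"
  shows "prime_in (regular V) (val V ` p)"
proof -
  interpret R: cring "osec Z V" by (rule osec_cring[OF V])
  interpret frac_model "osec Z V" "val V" "{p. primeideal p (osec Z V)}" "carrier (osec Z V) \<times> carrier (osec Z V)" \<iota>
    by (rule frac_model_Spec)
  note pf = primeideal_facts[OF assms]
  have mem: "sect V a \<in> p \<longleftrightarrow> a \<in> val V ` p" if "a \<in> regular V" for a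
  proof
    show "sect V a \<in> p \<Longrightarrow> a \<in> val V ` p" using that val_sect[OF V V_ne, of a] by force
    show "a \<in> val V ` p \<Longrightarrow> sect V a \<in> p" using pf(1) val_in(2)[OF V] by auto
  qed
  show ?thesis unfolding prime_in_def
  proof (intro conjI ballI impI)
    show A: "val V ` p \<subseteq> regular V" using pf(1) val_in(1)[OF V] by auto
    show "0 \<in> val V ` p" using mem[of 0] pf(2) by (simp add: osec_zero V regular_closed)
    show "1 \<notin> val V ` p" using mem[of 1] pf(3) by (simp add: osec_one V regular_closed)
    show "a + b \<in> val V ` p" if "a \<in> val V ` p" "b \<in> val V ` p" for a b
      using that A mem[of a] mem[of b] mem[of "a + b"] pf(6)[of "sect V a" "sect V b"]
      by (auto simp: sect_ops V regular_closed subset_iff)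
    show "a * b \<in> val V ` p" if "a \<in> regular V" "b \<in> val V ` p" for a b
      using that A mem[of b] mem[of "a * b"] pf(4)[of "sect V a" "sect V b"]
      by (auto simp: sect_ops V regular_closed subset_iff carrier_sect)
    show "a \<in> val V ` p \<or> b \<in> val V ` p" if "a \<in> regular V" "b \<in> regular V" "a * b \<in> val V ` p" for a b
      using that A mem[of a] mem[of b] mem[of "a * b"] pf(5)[of "sect V a" "sect V b"]
      by (auto simp: sect_ops V regular_closed subset_iff carrier_sect)
  qed
qed

lemma primeideal_of_prime:
  assumes P: "prime_in (regular V) P"
  shows "primeideal (sect V ` P) (osec Z V)"
proof -
  interpret R: cring "osec Z V" by (rule osec_cring[OF V])
  have A: "P \<subseteq> regular V" using P by (simp add: prime_in_def)
  have mem: "sect V a \<in> sect V ` P \<longleftrightarrow> a \<in> P" if "a \<in> regular V" for a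
    using sect_eq_iff[OF V V_ne that] A by (auto simp: subset_iff)
  show ?thesis
  proof (rule primeidealI)
    show "ideal (sect V ` P) (osec Z V)"
    proof (rule idealI)
      show "subgroup (sect V ` P) (add_monoid (osec Z V))"
      proof (rule group.subgroupI)
        show "group (add_monoid (osec Z V))" by (rule R.add.is_group)
        show "sect V ` P \<subseteq> carrier (add_monoid (osec Z V))" using A by (auto simp: carrier_sect V)
        show "sect V ` P \<noteq> {}" using P by (auto simp: prime_in_def)
        fix a assume "a \<in> sect V ` P"
        then obtain x where x: "x \<in> P" "a = sect V x" by blast
        have "(-1) * x \<in> P" using P x regular_closed[OF V] by (simp only: prime_in_def)
        moreover have "inv\<^bsub>add_monoid (osec Z V)\<^esub> a = sect V (- x)"
        proof -
          have "sect V (- x) \<oplus>\<^bsub>osec Z V\<^esub> a = \<zero>\<^bsub>osec Z V\<^esub>"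
            using x A by (auto simp: sect_ops V regular_closed osec_zero)
          moreover have "a \<in> carrier (osec Z V)" "sect V (- x) \<in> carrier (osec Z V)"
            using x A by (auto simp: carrier_sect V regular_closed)
          ultimately show ?thesis unfolding a_inv_def[symmetric] by (rule R.minus_equality)
        qed
        ultimately show "inv\<^bsub>add_monoid (osec Z V)\<^esub> a \<in> sect V ` P" by simp
      next
        fix a b assume "a \<in> sect V ` P" "b \<in> sect V ` P"
        then obtain x y where xy: "x \<in> P" "a = sect V x" "y \<in> P" "b = sect V y" by blast
        moreover have "x + y \<in> P" using P xy by (simp add: prime_in_def)
        ultimately show "a \<otimes>\<^bsub>add_monoid (osec Z V)\<^esub> b \<in> sect V ` P"
          using A by (auto simp: sect_ops V subset_iff)
      qed
      fix a x assume "a \<in> sect V ` P" "x \<in> carrier (osec Z V)"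
      then obtain y z where yz: "y \<in> P" "a = sect V y" "z \<in> regular V" "x = sect V z"
        by (auto simp: carrier_sect V)
      then have "z * y \<in> P" using P by (simp add: prime_in_def)
      then show "x \<otimes>\<^bsub>osec Z V\<^esub> a \<in> sect V ` P" "a \<otimes>\<^bsub>osec Z V\<^esub> x \<in> sect V ` P"
        using yz A by (auto simp: sect_ops V subset_iff mult.commute)
    qed (rule R.ring_axioms)
    show "carrier (osec Z V) \<noteq> sect V ` P"
      using mem[of 1] P regular_closed(2)[OF V] by (auto simp: prime_in_def carrier_sect V)
    fix a b assume "a \<in> carrier (osec Z V)" "b \<in> carrier (osec Z V)" "a \<otimes>\<^bsub>osec Z V\<^esub> b \<in> sect V ` P"
    then obtain y z where yz: "y \<in> regular V" "a = sect V y" "z \<in> regular V" "b = sect V z" "y * z \<in> P"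
    proof -
      obtain y z where yz: "y \<in> regular V" "a = sect V y" "z \<in> regular V" "b = sect V z"
        using \<open>a \<in> _\<close> \<open>b \<in> _\<close> by (auto simp: carrier_sect V)
      then have "y * z \<in> P"
        using \<open>_ \<in> sect V ` P\<close> mem[of "y * z"] by (simp add: sect_ops V regular_closed)
      with yz show ?thesis by (rule that)
    qed
    then have "y \<in> P \<or> z \<in> P" using P unfolding prime_in_def by blast
    then show "a \<in> sect V ` P \<or> b \<in> sect V ` P" using yz by blast
  qed (rule R.is_cring)
qed

text \<open>Plays the role of the contraction to \<open>regular V\<close> of the maximal ideal of
  \<open>loc x\<close>, that is, of the prime attached to \<open>x\<close>.\<close>

definition nonunits :: "'x \<Rightarrow> 'k set" where
  "nonunits x = {\<phi> \<in> regular V. \<phi> = 0 \<or> inverse \<phi> \<notin> loc x}"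

text \<open>If points correspond to primes, local rings to localizations and the topology to the
  Zariski topology, then sending a point to its prime is a homeomorphism onto the spectrum under
  which the local rings coincide.\<close>

lemma affine_openI:
  assumes fracs: "\<And>x \<phi>. x \<in> V \<Longrightarrow> \<phi> \<in> loc x \<Longrightarrow> \<exists>a\<in>regular V. \<exists>b\<in>regular V. b \<notin> nonunits x \<and> \<phi> = a / b"
    and surj: "\<And>P. prime_in (regular V) P \<Longrightarrow> \<exists>x\<in>V. nonunits x = P"
    and inj: "\<And>x y. x \<in> V \<Longrightarrow> y \<in> V \<Longrightarrow> nonunits x = nonunits y \<Longrightarrow> x = y"
    and prime: "\<And>x. x \<in> V \<Longrightarrow> prime_in (regular V) (nonunits x)"
    and basis: "\<And>U x. openin (tp Z) U \<Longrightarrow> U \<subseteq> V \<Longrightarrow> x \<in> U \<Longrightarrow>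
      \<exists>b\<in>regular V. b \<notin> nonunits x \<and> {y \<in> V. b \<notin> nonunits y} \<subseteq> U"
  shows "affine_open Z V"
proof -
  let ?R = "osec Z V" and ?ZV = "Z\<lparr>tp := subtopology (tp Z) V\<rparr>"
  interpret M: frac_model ?R "val V" "{p. primeideal p ?R}" "carrier ?R \<times> carrier ?R" \<iota>
    by (rule frac_model_Spec)
  interpret ZV: fun_space ?ZV \<eta> sect loc \<iota> by (rule fun_space_subtopology[OF V V_ne])
  define h where "h x = sect V ` nonunits x" for x
  have tV: "topspace (tp ?ZV) = V" using V openin_subset by fastforce
  have oV: "openin (tp ?ZV) U \<longleftrightarrow> openin (tp Z) U \<and> U \<subseteq> V" for U
    using V by (simp add: openin_open_subtopology)
  have S: "Spec ?R = frac_space ?R {p. primeideal p ?R} (carrier ?R \<times> carrier ?R)" by (simp add: Spec_def)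
  have tS: "tp (Spec ?R) = zariski ?R {p. primeideal p ?R}" by (simp add: S frac_space_def)
  have hp: "h x \<in> {p. primeideal p ?R}" if "x \<in> V" for x
    unfolding h_def using primeideal_of_prime[OF prime[OF that]] by simp
  have mem: "sect V b \<in> h x \<longleftrightarrow> b \<in> nonunits x" if "b \<in> regular V" for b x
    using sect_eq_iff[OF V V_ne that] by (auto simp: h_def nonunits_def)
  have hsurj: "\<exists>x\<in>V. h x = p" if p: "primeideal p ?R" for p
  proof -
    from surj[OF prime_of_primeideal[OF p]] obtain x where x: "x \<in> V" "nonunits x = val V ` p" by blast
    have "h x = p" unfolding h_def x(2) image_image
      using M.primeideal_facts(1)[OF p] val_in(2)[OF V] by (auto simp: subset_iff image_iff) 
    then show ?thesis using x(1) by blast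
  qed
  have hinj: "inj_on h V"
  proof (rule inj_onI)
    fix x y assume xy: "x \<in> V" "y \<in> V" "h x = h y"
    have "nonunits x \<subseteq> regular V" "nonunits y \<subseteq> regular V" by (auto simp: nonunits_def)
    moreover have "b \<in> nonunits x \<longleftrightarrow> b \<in> nonunits y" if "b \<in> regular V" for b
      using mem[OF that, of x] mem[OF that, of y] xy by simp
    ultimately have "nonunits x = nonunits y" by blast
    then show "x = y" by (rule inj[OF xy(1,2)])
  qed
  have himg: "h ` V = {p. primeideal p ?R}" using hp hsurj by auto
  have basic: "openin (tp Z) {y \<in> V. b \<notin> nonunits y}" if b: "b \<in> regular V" for b
  proof (subst openin_subopen, intro ballI)
    fix y assume "y \<in> {y \<in> V. b \<notin> nonunits y}"
    then have y: "y \<in> V" "b \<noteq> 0" "inverse b \<in> loc y" using b by (auto simp: nonunits_def)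
    obtain U where U: "openin (tp Z) U" "y \<in> U" "\<forall>z\<in>U. inverse b \<in> loc z"
      using spread[OF in_topspace[OF V y(1)] y(3)] by blast
    show "\<exists>T. openin (tp Z) T \<and> y \<in> T \<and> T \<subseteq> {y \<in> V. b \<notin> nonunits y}"
      using U y V by (intro exI[of _ "U \<inter> V"]) (auto simp: nonunits_def)
  qed
  have cont: "continuous_map (tp ?ZV) (tp (Spec ?R)) h"
    unfolding tS zariski_def
  proof (rule continuous_on_generated_topo)
    fix U assume "U \<in> {{p \<in> {p. primeideal p ?R}. f \<notin> p} |f. f \<in> carrier ?R}"
    then obtain f where f: "f \<in> carrier ?R" "U = {p \<in> {p. primeideal p ?R}. f \<notin> p}" by blast
    obtain b where b: "b \<in> regular V" "f = sect V b" using f(1) by (auto simp: carrier_sect V)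
    have "h -` U \<inter> topspace (tp ?ZV) = {y \<in> V. b \<notin> nonunits y}"
      unfolding tV using mem[OF b(1)] hp f(2) b(2) by auto
    then show "openin (tp ?ZV) (h -` U \<inter> topspace (tp ?ZV))" using basic[OF b(1)] V by (auto simp: openin_open_subtopology)
  next
    have "topspace (zariski ?R {p. primeideal p ?R}) = {p. primeideal p ?R}" by (rule M.topspace_zariski)
    then show "h ` topspace (tp ?ZV) \<subseteq> \<Union>{{p \<in> {p. primeideal p ?R}. f \<notin> p} |f. f \<in> carrier ?R}"
      unfolding tV himg zariski_def topology_generated_by_topspace by simp
  qed
  have hom: "homeomorphic_map (tp ?ZV) (tp (Spec ?R)) h"
  proof (rule bijective_open_imp_homeomorphic_map[OF cont])
    show "h ` topspace (tp ?ZV) = topspace (tp (Spec ?R))"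
      unfolding tV himg tS by (rule M.topspace_zariski[symmetric])
    show "inj_on h (topspace (tp ?ZV))" unfolding tV by (rule hinj)
    show "open_map (tp ?ZV) (tp (Spec ?R)) h" unfolding open_map_def
    proof (intro allI impI)
      fix U assume "openin (tp ?ZV) U"
      then have U: "openin (tp Z) U" "U \<subseteq> V" using oV by blast+
      show "openin (tp (Spec ?R)) (h ` U)"
      proof (subst openin_subopen, intro ballI)
        fix p assume "p \<in> h ` U"
        then obtain x where x: "x \<in> U" "p = h x" by blast
        from basis[OF U x(1)] obtain b where b: "b \<in> regular V" "b \<notin> nonunits x" "{y \<in> V. b \<notin> nonunits y} \<subseteq> U"
          by blast
        let ?T = "{p \<in> {p. primeideal p ?R}. sect V b \<notin> p}"
        have "openin (tp (Spec ?R)) ?T" unfolding tS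
          by (rule M.open_basic) (use b in \<open>simp add: carrier_sect V\<close>)
        moreover have "p \<in> ?T" using x hp U(2) mem[OF b(1)] b(2) by auto
        moreover have "?T \<subseteq> h ` U"
        proof
          fix q assume q: "q \<in> ?T"
          then obtain y where y: "y \<in> V" "h y = q" using hsurj by blast
          then have "y \<in> U" using q mem[OF b(1), of y] b(3) by blast
          then show "q \<in> h ` U" using y by blast
        qed
        ultimately show "\<exists>T. openin (tp (Spec ?R)) T \<and> p \<in> T \<and> T \<subseteq> h ` U" by blast
      qed
    qed
  qed
  have loceq: "M.floc (carrier ?R \<times> carrier ?R) (h x) = loc x" if x: "x \<in> V" for x
  proof (intro equalityI subsetI)
    fix \<phi> assume "\<phi> \<in> M.floc (carrier ?R \<times> carrier ?R) (h x)"
    then obtain a f where "(a, f) \<in> carrier ?R \<times> carrier ?R" "f \<notin> h x" "val V a = \<phi> * val V f" by (rule M.flocE)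
    then obtain \<alpha> \<beta> where ab: "\<alpha> \<in> regular V" "\<beta> \<in> regular V" "\<beta> \<notin> nonunits x" "\<alpha> = \<phi> * \<beta>"
      by (auto simp: carrier_sect V val_sect V_ne mem)
    then have "\<beta> \<noteq> 0" "inverse \<beta> \<in> loc x" by (auto simp: nonunits_def)
    moreover have "\<phi> = \<alpha> * inverse \<beta>" using ab calculation(1) by simp
    ultimately show "\<phi> \<in> loc x" using loc_mult[OF in_topspace[OF V x]] regularD[OF ab(1) x] by simp
  next
    fix \<phi> assume "\<phi> \<in> loc x"
    from fracs[OF x this] obtain a b where ab: "a \<in> regular V" "b \<in> regular V" "b \<notin> nonunits x" "\<phi> = a / b" by blast
    have "b \<noteq> 0" using ab by (auto simp: nonunits_def)
    then show "\<phi> \<in> M.floc (carrier ?R \<times> carrier ?R) (h x)"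
      using ab by (intro M.flocI[of "sect V a" "sect V b"]) (auto simp: carrier_sect V val_sect V_ne mem)
  qed
  have \<eta>V: "\<eta> \<in> V" by (rule generic[OF V V_ne])
  \<comment> \<open>Let \<open>y\<close> be the point over the zero ideal. A nonzero
    \<open>b\<close> is a unit at \<open>y\<close>, so its basic open set is nonempty and therefore
    contains \<open>\<eta>\<close>; hence only 0 fails to be a unit at
    \<open>\<eta>\<close>.\<close>
  have gen: "h \<eta> = {\<zero>\<^bsub>?R\<^esub>}"
  proof -
    obtain y where y: "y \<in> V" "h y = {\<zero>\<^bsub>?R\<^esub>}" using hsurj M.zero_Pts by blast
    have "openin (tp (Spec ?R)) (h ` {z \<in> V. True})" using hom V
      by (metis (no_types, lifting) Collect_mem_eq homeomorphic_imp_open_map oV open_map_def order_refl Collect_cong)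
    have "nonunits \<eta> \<subseteq> {0}"
    proof
      fix b assume b: "b \<in> nonunits \<eta>"
      show "b \<in> {0}"
      proof (rule ccontr)
        assume b0: "b \<notin> {0}"
        have br: "b \<in> regular V" using b by (simp add: nonunits_def)
        have "b \<notin> nonunits y" using mem[OF br, of y] y b0 sect_eq_iff[OF V V_ne br regular_closed(1)[OF V]]
          by (auto simp: osec_zero V)
        then have "\<eta> \<in> {y \<in> V. b \<notin> nonunits y}" using generic[OF basic[OF br]] y(1) by blast
        then show False using b by simp
      qed
    qed
    moreover have "0 \<in> nonunits \<eta>" by (simp add: nonunits_def regular_closed V)
    ultimately show ?thesis by (auto simp: h_def osec_zero V)
  qed
  interpret D: dense_fun_spaces ?ZV \<eta> sect loc \<iota> "Spec ?R" "{\<zero>\<^bsub>?R\<^esub>}" "M.fsect (carrier ?R \<times> carrier ?R)"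
    "M.floc (carrier ?R \<times> carrier ?R)" h
    unfolding S
  proof unfold_locales
    show "continuous_map (tp ?ZV) (tp (frac_space ?R {p. primeideal p ?R} (carrier ?R \<times> carrier ?R))) h"
      using cont by (simp add: S)
    show "h \<eta> = {\<zero>\<^bsub>?R\<^esub>}" by (rule gen)
  qed (simp_all only: tV loceq order_refl)
  have "isomorphism ?ZV (Spec ?R) D.mor"
    by (rule D.mor_isomorphism[OF hom]) (simp only: tV loceq)
  then show ?thesis unfolding affine_open_def using V by blast
qed

end

end

section \<open>Finitely supported functions on a group\<close>

text \<open>Convolution is determined by products of monomials, so a map that is additive on each
  coefficient set \<open>C w\<close> and multiplicative on monomials extends to a multiplicative
  map. Twists by characters, changes of the exponent group and the reduction modulo \<open>t\<close>
  all arise in this way.\<close>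

locale graded_ext =
  fixes C :: "'k::comm_monoid_add \<Rightarrow> 'c::comm_ring_1 set" and H :: "'k \<Rightarrow> 'c \<Rightarrow> 'r::comm_ring_1"
  assumes C_0: "0 \<in> C w" and C_add: "x \<in> C w \<Longrightarrow> y \<in> C w \<Longrightarrow> x + y \<in> C w"
    and C_mult: "x \<in> C u \<Longrightarrow> y \<in> C v \<Longrightarrow> x * y \<in> C (u + v)"
    and H_0: "H w 0 = 0" and H_add: "x \<in> C w \<Longrightarrow> y \<in> C w \<Longrightarrow> H w (x + y) = H w x + H w y"
    and H_mult: "x \<in> C u \<Longrightarrow> y \<in> C v \<Longrightarrow> H (u + v) (x * y) = H u x * H v y"
begin

definition allowed :: "('k \<Rightarrow>\<^sub>0 'c) set" where
  "allowed = {f. \<forall>w. Poly_Mapping.lookup f w \<in> C w}"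

definition ext :: "('k \<Rightarrow>\<^sub>0 'c) \<Rightarrow> 'r" where
  "ext f = (\<Sum>w\<in>Poly_Mapping.keys f. H w (Poly_Mapping.lookup f w))"

lemma ext_superset:
  assumes "finite K" "Poly_Mapping.keys f \<subseteq> K"
  shows "ext f = (\<Sum>w\<in>K. H w (Poly_Mapping.lookup f w))"
  unfolding ext_def by (rule sum.mono_neutral_left) (use assms in \<open>auto simp: in_keys_iff H_0\<close>)

lemma ext_add:
  assumes "f \<in> allowed" "g \<in> allowed"
  shows "ext (f + g) = ext f + ext g"
proof -
  let ?K = "Poly_Mapping.keys f \<union> Poly_Mapping.keys g"
  have "ext (f + g) = (\<Sum>w\<in>?K. H w (Poly_Mapping.lookup (f + g) w))"
    by (rule ext_superset) (use Poly_Mapping.keys_add[of f g] in auto)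
  also have "\<dots> = (\<Sum>w\<in>?K. H w (Poly_Mapping.lookup f w)) + (\<Sum>w\<in>?K. H w (Poly_Mapping.lookup g w))"
    using assms by (simp add: lookup_add H_add allowed_def sum.distrib)
  also have "\<dots> = ext f + ext g" by (simp add: ext_superset[symmetric])
  finally show ?thesis .
qed

lemma ext_0: "ext 0 = 0"
  by (simp add: ext_def)

lemma ext_single: "ext (Poly_Mapping.single w c) = H w c"
  by (simp add: ext_def H_0)

lemma allowed_0: "0 \<in> allowed" by (simp add: allowed_def C_0)

lemma allowed_add: "f \<in> allowed \<Longrightarrow> g \<in> allowed \<Longrightarrow> f + g \<in> allowed"
  by (simp add: allowed_def lookup_add C_add)

lemma allowed_single: "c \<in> C w \<Longrightarrow> Poly_Mapping.single w c \<in> allowed"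
  by (simp add: allowed_def lookup_single when_def C_0)

lemma allowed_sum: "(\<And>i. i \<in> I \<Longrightarrow> F i \<in> allowed) \<Longrightarrow> sum F I \<in> allowed"
  by (induction I rule: infinite_finite_induct) (auto simp: allowed_0 allowed_add)

lemma ext_sum: "(\<And>i. i \<in> I \<Longrightarrow> F i \<in> allowed) \<Longrightarrow> ext (sum F I) = (\<Sum>i\<in>I. ext (F i))"
  by (induction I rule: infinite_finite_induct) (auto simp: ext_0 ext_add allowed_sum)

end

lemma pm_expand: "f = (\<Sum>w\<in>Poly_Mapping.keys f. Poly_Mapping.single w (Poly_Mapping.lookup f w))"
  by (rule poly_mapping_eqI)
    (auto simp: lookup_sum lookup_single when_def in_keys_iff)

lemma pm_mult_expand:
  fixes f g :: "'k::comm_monoid_add \<Rightarrow>\<^sub>0 'c::comm_ring_1"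
  shows "f * g = (\<Sum>u\<in>Poly_Mapping.keys f. \<Sum>v\<in>Poly_Mapping.keys g.
    Poly_Mapping.single (u + v) (Poly_Mapping.lookup f u * Poly_Mapping.lookup g v))"
  by (subst pm_expand[of f], subst pm_expand[of g]) (simp add: sum_product mult_single)

context graded_ext
begin

lemma allowed_mult:
  assumes "f \<in> allowed" "g \<in> allowed"
  shows "f * g \<in> allowed"
  unfolding pm_mult_expand[of f g]
  by (intro allowed_sum allowed_single C_mult) (use assms in \<open>auto simp: allowed_def\<close>)

lemma ext_mult:
  assumes "f \<in> allowed" "g \<in> allowed"
  shows "ext (f * g) = ext f * ext g"
proof -
  have fg: "Poly_Mapping.lookup f u \<in> C u" "Poly_Mapping.lookup g u \<in> C u" for u
    using assms by (auto simp: allowed_def)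
  have "ext (f * g) = (\<Sum>u\<in>Poly_Mapping.keys f. \<Sum>v\<in>Poly_Mapping.keys g.
      H (u + v) (Poly_Mapping.lookup f u * Poly_Mapping.lookup g v))"
    unfolding pm_mult_expand[of f g]
    by (simp add: ext_sum ext_single allowed_sum allowed_single C_mult fg)
  also have "\<dots> = ext f * ext g"
    by (simp add: ext_def sum_product H_mult fg)
  finally show ?thesis .
qed

end

section \<open>Functions supported in a monoid\<close>

definition supp_on :: "'k set \<Rightarrow> ('k \<Rightarrow>\<^sub>0 'c::zero) set" where
  "supp_on S = {f. Poly_Mapping.keys f \<subseteq> S}"

definition submonoid_set :: "'k::comm_monoid_add set \<Rightarrow> bool" where
  "submonoid_set S \<longleftrightarrow> 0 \<in> S \<and> (\<forall>a\<in>S. \<forall>b\<in>S. a + b \<in> S)"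

lemma single_1_neq_0: "Poly_Mapping.single w (1 :: 'c::zero_neq_one) \<noteq> 0"
  by (metis lookup_single_eq lookup_zero zero_neq_one)

lemma supp_on_mono: "S \<subseteq> T \<Longrightarrow> f \<in> supp_on S \<Longrightarrow> f \<in> supp_on T"
  by (auto simp: supp_on_def)

lemma supp_onD: "f \<in> supp_on S \<Longrightarrow> w \<in> Poly_Mapping.keys f \<Longrightarrow> w \<in> S"
  by (auto simp: supp_on_def)

lemma supp_on_closed:
  fixes f g :: "'k::comm_monoid_add \<Rightarrow>\<^sub>0 'c::comm_ring_1"
  shows "f \<in> supp_on S \<Longrightarrow> g \<in> supp_on S \<Longrightarrow> f + g \<in> supp_on S" "0 \<in> supp_on S"
    "f \<in> supp_on S \<Longrightarrow> - f \<in> supp_on S" "f \<in> supp_on S \<Longrightarrow> g \<in> supp_on S \<Longrightarrow> f - g \<in> supp_on S"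
proof -
  show 1: "f + g \<in> supp_on S" if "f \<in> supp_on S" "g \<in> supp_on S" for f g :: "'k \<Rightarrow>\<^sub>0 'c"
    using that Poly_Mapping.keys_add[of f g] by (auto simp: supp_on_def)
  show 2: "- f \<in> supp_on S" if "f \<in> supp_on S" for f :: "'k \<Rightarrow>\<^sub>0 'c"
    using that by (auto simp: supp_on_def in_keys_iff)
  show "f \<in> supp_on S \<Longrightarrow> g \<in> supp_on S \<Longrightarrow> f - g \<in> supp_on S"
    using 1[of f "- g"] 2[of g] by simp
  show "0 \<in> supp_on S" by (simp add: supp_on_def)
qed

lemma supp_on_single: "w \<in> S \<Longrightarrow> Poly_Mapping.single w c \<in> supp_on S"
  by (auto simp: supp_on_def)

lemma supp_on_mult:
  fixes f g :: "'k::comm_monoid_add \<Rightarrow>\<^sub>0 'c::comm_ring_1"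
  assumes "f \<in> supp_on S" "g \<in> supp_on T" "\<And>a b. a \<in> S \<Longrightarrow> b \<in> T \<Longrightarrow> a + b \<in> U"
  shows "f * g \<in> supp_on U"
  using Poly_Mapping.keys_mult[of f g] assms by (auto simp: supp_on_def subset_iff)

lemma supp_on_monoid:
  fixes f g :: "'k::comm_monoid_add \<Rightarrow>\<^sub>0 'c::comm_ring_1"
  assumes S: "submonoid_set S"
  shows "f \<in> supp_on S \<Longrightarrow> g \<in> supp_on S \<Longrightarrow> f * g \<in> supp_on S" "(1 :: 'k \<Rightarrow>\<^sub>0 'c) \<in> supp_on S"
    "f \<in> supp_on S \<Longrightarrow> f ^ n \<in> supp_on S" "(of_nat n :: 'k \<Rightarrow>\<^sub>0 'c) \<in> supp_on S"
proof -
  show 1: "f * g \<in> supp_on S" if "f \<in> supp_on S" "g \<in> supp_on S" for f g :: "'k \<Rightarrow>\<^sub>0 'c"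
    by (rule supp_on_mult[OF that]) (use S in \<open>auto simp: submonoid_set_def\<close>)
  show 2: "(1 :: 'k \<Rightarrow>\<^sub>0 'c) \<in> supp_on S" using S by (simp add: submonoid_set_def supp_on_def)
  show "f \<in> supp_on S \<Longrightarrow> f ^ n \<in> supp_on S" by (induction n) (auto simp: 1 2)
  show "(of_nat n :: 'k \<Rightarrow>\<^sub>0 'c) \<in> supp_on S" by (induction n) (simp_all add: 2 supp_on_closed(2) supp_on_closed(1)[OF 2])
qed

lemma supp_on_sum:
  fixes F :: "'i \<Rightarrow> 'k::comm_monoid_add \<Rightarrow>\<^sub>0 'c::comm_ring_1"
  shows "(\<And>i. i \<in> I \<Longrightarrow> F i \<in> supp_on S) \<Longrightarrow> sum F I \<in> supp_on S"
  by (induction I rule: infinite_finite_induct) (auto simp: supp_on_closed)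

section \<open>Restricting the support\<close>

definition restr :: "('k \<Rightarrow> bool) \<Rightarrow> ('k \<Rightarrow>\<^sub>0 'c::zero) \<Rightarrow> 'k \<Rightarrow>\<^sub>0 'c" where
  "restr P f = Poly_Mapping.mapp (\<lambda>w c. if P w then c else 0) f"

lemma lookup_restr: "Poly_Mapping.lookup (restr P f) w = (if P w then Poly_Mapping.lookup f w else 0)"
  by (auto simp: restr_def lookup_mapp when_def in_keys_iff)

lemma keys_restr: "Poly_Mapping.keys (restr P f) = {w \<in> Poly_Mapping.keys f. P w}"
  by (auto simp: in_keys_iff lookup_restr split: if_splits)

lemma restr_add:
  fixes f g :: "'k \<Rightarrow>\<^sub>0 'c::comm_monoid_add"
  shows "restr P (f + g) = restr P f + restr P g"
  by (rule poly_mapping_eqI) (simp add: lookup_restr lookup_add)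

lemma restr_minus:
  fixes f g :: "'k \<Rightarrow>\<^sub>0 'c::ab_group_add"
  shows "restr P (f - g) = restr P f - restr P g"
  by (rule poly_mapping_eqI) (simp add: lookup_restr lookup_minus)

lemma restr_self: "(\<And>w. w \<in> Poly_Mapping.keys f \<Longrightarrow> P w) \<Longrightarrow> restr P f = f"
  by (rule poly_mapping_eqI) (auto simp: lookup_restr in_keys_iff)

lemma restr_none: "(\<And>w. w \<in> Poly_Mapping.keys f \<Longrightarrow> \<not> P w) \<Longrightarrow> restr P f = 0"
  by (rule poly_mapping_eqI) (auto simp: lookup_restr in_keys_iff)

lemma restr_split:
  fixes f :: "'k \<Rightarrow>\<^sub>0 'c::comm_monoid_add"
  shows "f = restr P f + restr (\<lambda>w. \<not> P w) f"
  by (rule poly_mapping_eqI) (simp add: lookup_restr lookup_add)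

section \<open>Laurent polynomials\<close>

text \<open>One fixed free abelian group of countable rank: Laurent polynomial rings in any finite
  number of variables are subrings of one domain, so both algebras can be compared inside the same
  field of fractions.\<close>

type_synonym grp = "nat \<Rightarrow>\<^sub>0 int"
type_synonym laurent = "grp \<Rightarrow>\<^sub>0 complex"

definition additive_fun :: "(grp \<Rightarrow> 'b::ab_group_add) \<Rightarrow> bool" where
  "additive_fun l \<longleftrightarrow> (\<forall>a b. l (a + b) = l a + l b)"

lemma additive_fun_add: "additive_fun l \<Longrightarrow> l (a + b) = l a + l b"
  by (simp add: additive_fun_def)

lemma additive_fun_0: "additive_fun l \<Longrightarrow> l 0 = 0"
  using additive_fun_add[of l 0 0] by simp

lemma additive_fun_uminus: "additive_fun l \<Longrightarrow> l (- a) = - l a"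
  using additive_fun_add[of l "- a" a] by (simp add: additive_fun_0 eq_neg_iff_add_eq_0)

lemma additive_fun_minus: "additive_fun l \<Longrightarrow> l (a - b) = l a - l b"
  using additive_fun_add[of l a "- b"] by (simp add: additive_fun_uminus)

lemma additive_fun_uminus_fun: "additive_fun l \<Longrightarrow> additive_fun (\<lambda>w. - l w)"
  by (simp add: additive_fun_def)

lemma frag_cmul_Suc: "frag_cmul (int (Suc n)) s = frag_cmul (int n) s + s"
  by (rule poly_mapping_eqI) (simp add: lookup_add algebra_simps)

lemma additive_fun_cmul:
  fixes l :: "grp \<Rightarrow> 'b::ring_1"
  assumes "additive_fun l"
  shows "l (frag_cmul (int n) s) = of_nat n * l s"
  by (induction n) (simp_all only: frag_cmul_Suc additive_fun_add[OF assms], simp_all add: additive_fun_0[OF assms] algebra_simps)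

text \<open>With the lower bounds \<open>t\<close> and \<open>u\<close>, an exponent of level
  \<open>t + u\<close> in the product can only be a sum of one exponent of level \<open>t\<close>
  and one of level \<open>u\<close>.\<close>

lemma part_mult:
  fixes f g :: laurent and l :: "grp \<Rightarrow> 'b::linordered_ab_group_add"
  assumes l: "additive_fun l" and f: "\<And>w. w \<in> Poly_Mapping.keys f \<Longrightarrow> t \<le> l w"
    and g: "\<And>w. w \<in> Poly_Mapping.keys g \<Longrightarrow> u \<le> l w"
  shows "restr (\<lambda>w. l w = t + u) (f * g) = restr (\<lambda>w. l w = t) f * restr (\<lambda>w. l w = u) g"
proof -
  let ?f0 = "restr (\<lambda>w. l w = t) f" and ?f1 = "restr (\<lambda>w. l w \<noteq> t) f"
  let ?g0 = "restr (\<lambda>w. l w = u) g" and ?g1 = "restr (\<lambda>w. l w \<noteq> u) g"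
  let ?R = "restr (\<lambda>w. l w = t + u) :: laurent \<Rightarrow> laurent"
  have fg: "f * g = ?f0 * ?g0 + (?f0 * ?g1 + ?f1 * g)"
  proof -
    have "f * g = (?f0 + ?f1) * g" using restr_split[of f "\<lambda>w. l w = t"] by simp
    also have "\<dots> = ?f0 * (?g0 + ?g1) + ?f1 * g"
      using restr_split[of g "\<lambda>w. l w = u"] by (simp add: algebra_simps)
    finally show ?thesis by (simp add: algebra_simps)
  qed
  have 0: "?R (?f0 * ?g0) = ?f0 * ?g0"
    by (rule restr_self) (use keys_mult[of ?f0 ?g0] in \<open>auto simp: keys_restr additive_fun_add[OF l]\<close>)
  have 1: "?R (?f0 * ?g1) = 0"
  proof (rule restr_none)
    fix w assume "w \<in> Poly_Mapping.keys (?f0 * ?g1)"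
    then obtain a b where "w = a + b" "l a = t" "b \<in> Poly_Mapping.keys g" "l b \<noteq> u"
      using keys_mult[of ?f0 ?g1] by (auto simp: keys_restr)
    then show "l w \<noteq> t + u" by (simp add: additive_fun_add[OF l])
  qed
  have 2: "?R (?f1 * g) = 0"
  proof (rule restr_none)
    fix w assume "w \<in> Poly_Mapping.keys (?f1 * g)"
    then obtain a b where w: "w = a + b" "a \<in> Poly_Mapping.keys f" "l a \<noteq> t" "b \<in> Poly_Mapping.keys g"
      using keys_mult[of ?f1 g] by (auto simp: keys_restr)
    then have "t < l a" "u \<le> l b" using f[of a] g[of b] by auto
    then have "t + u < l a + l b" by (rule add_less_le_mono)
    then show "l w \<noteq> t + u" using w by (simp add: additive_fun_add[OF l])
  qed
  show ?thesis unfolding fg restr_add by (simp add: 0 1 2)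
qed

text \<open>The monomial valuation with weight \<open>l\<close>, meaningful for
  \<open>f \<noteq> 0\<close>; \<open>lbot\<close> below is the initial form.\<close>

definition lmin :: "(grp \<Rightarrow> 'b::linordered_ab_group_add) \<Rightarrow> laurent \<Rightarrow> 'b" where
  "lmin l f = Min (l ` Poly_Mapping.keys f)"

definition lbot :: "(grp \<Rightarrow> 'b::linordered_ab_group_add) \<Rightarrow> laurent \<Rightarrow> laurent" where
  "lbot l f = restr (\<lambda>w. l w = lmin l f) f"

lemma lmin_le: "w \<in> Poly_Mapping.keys f \<Longrightarrow> lmin l f \<le> l w"
  by (simp add: lmin_def)

lemma lmin_in: "f \<noteq> 0 \<Longrightarrow> \<exists>w\<in>Poly_Mapping.keys f. l w = lmin l f"
proof -
  assume "f \<noteq> 0"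
  then have "lmin l f \<in> l ` Poly_Mapping.keys f" unfolding lmin_def by (intro Min_in) auto
  then show ?thesis by auto
qed

lemma lmin_eqI: "w \<in> Poly_Mapping.keys f \<Longrightarrow> (\<And>w. w \<in> Poly_Mapping.keys f \<Longrightarrow> l w0 \<le> l w) \<Longrightarrow> w = w0 \<Longrightarrow> lmin l f = l w0"
  unfolding lmin_def by (rule Min_eqI) auto

lemma lbot_ne: "f \<noteq> 0 \<Longrightarrow> lbot l f \<noteq> 0"
  using lmin_in[of f l] keys_restr[of "\<lambda>w. l w = lmin l f" f] by (auto simp: lbot_def)

text \<open>The product of the two initial forms is nonzero because the ring is a domain, so the sum
  of the minima is attained.\<close>

lemma lmin_lbot_mult:
  assumes l: "additive_fun l" and fg: "f \<noteq> 0" "g \<noteq> 0"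
  shows "lmin l (f * g) = lmin l f + lmin l g" "lbot l (f * g) = lbot l f * lbot l g"
proof -
  have pm: "restr (\<lambda>w. l w = lmin l f + lmin l g) (f * g) = lbot l f * lbot l g"
    unfolding lbot_def by (rule part_mult[OF l]) (simp_all add: lmin_le)
  moreover have "lbot l f * lbot l g \<noteq> 0" using lbot_ne fg by auto
  ultimately have "Poly_Mapping.keys (restr (\<lambda>w. l w = lmin l f + lmin l g) (f * g)) \<noteq> {}" by simp
  then obtain w where w: "w \<in> Poly_Mapping.keys (f * g)" "l w = lmin l f + lmin l g"
    unfolding keys_restr by blast
  have "l w \<le> l v" if v: "v \<in> Poly_Mapping.keys (f * g)" for v
  proof -
    obtain a b where "v = a + b" "a \<in> Poly_Mapping.keys f" "b \<in> Poly_Mapping.keys g"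
      using v keys_mult[of f g] by auto
    then show ?thesis using w(2) lmin_le[of a f l] lmin_le[of b g l] by (simp add: additive_fun_add[OF l] add_mono)
  qed
  then show m: "lmin l (f * g) = lmin l f + lmin l g" using lmin_eqI[OF w(1)] w(2) by metis
  show "lbot l (f * g) = lbot l f * lbot l g" using pm by (simp add: lbot_def m)
qed

lemma lmin_1: "additive_fun l \<Longrightarrow> lmin l 1 = 0"
  by (simp add: lmin_def additive_fun_0)

lemma lmin_pow:
  fixes l :: "grp \<Rightarrow> 'b::linordered_idom"
  assumes "additive_fun l" "f \<noteq> 0"
  shows "lmin l (f ^ n) = of_nat n * lmin l f"
  by (induction n) (simp_all add: lmin_1 assms lmin_lbot_mult algebra_simps)

section \<open>Complete integral closedness of Laurent polynomial rings\<close>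

definition coord_grp :: "nat \<Rightarrow> grp set" where
  "coord_grp r = {g. Poly_Mapping.keys g \<subseteq> {..<r}}"

lemma coord_grp_monoid: "submonoid_set (coord_grp r)"
  using Poly_Mapping.keys_add by (fastforce simp: submonoid_set_def coord_grp_def)

text \<open>
  Complete integral closedness: cancelling the top coefficients in the last variable shortens
  \<open>a\<close>, and the quotient of the top coefficients exists by induction on the number of variables.
\<close>

lemma laurent_completely_integrally_closed:
  fixes a c d :: laurent
  assumes "a \<in> supp_on (coord_grp r)" "c \<in> supp_on (coord_grp r)" "d \<in> supp_on (coord_grp r)"
    "c \<noteq> 0" "d \<noteq> 0" "\<And>i. \<exists>e\<in>supp_on (coord_grp r). d * a ^ i = c ^ i * e"
  shows "\<exists>q\<in>supp_on (coord_grp r). a = c * q"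
  using assms
proof (induction r arbitrary: a c d)
  case 0
  have c0: "f = Poly_Mapping.single 0 (Poly_Mapping.lookup f 0)" if "f \<in> supp_on (coord_grp 0)" for f :: laurent
  proof -
    have "Poly_Mapping.keys f \<subseteq> {0}" using that by (simp add: supp_on_def coord_grp_def)
    then show ?thesis by (intro poly_mapping_eqI) (auto simp: lookup_single when_def in_keys_iff subset_iff)
  qed
  let ?q = "Poly_Mapping.single 0 (Poly_Mapping.lookup a 0 / Poly_Mapping.lookup c 0) :: laurent"
  have "Poly_Mapping.lookup c 0 \<noteq> 0" using c0[OF 0(2)] 0(4) by force
  then have "Poly_Mapping.single 0 (Poly_Mapping.lookup c 0) * ?q = Poly_Mapping.single 0 (Poly_Mapping.lookup a 0)"
    by (simp add: mult_single)
  then have "a = c * ?q" using c0[OF 0(1)] c0[OF 0(2)] by simp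
  moreover have "?q \<in> supp_on (coord_grp 0)" by (rule supp_on_single) (simp add: coord_grp_def)
  ultimately show ?case by blast
next
  case (Suc r)
  define x :: "grp \<Rightarrow> int" where "x w = Poly_Mapping.lookup w r" for w
  define y where "y w = - x w" for w
  have ax: "additive_fun x" by (simp add: additive_fun_def x_def lookup_add)
  have ay: "additive_fun y" unfolding y_def by (rule additive_fun_uminus_fun[OF ax])
  \<comment> \<open>The width of \<open>f\<close> in the last variable: top exponent minus bottom
    exponent. As \<open>y = - x\<close>, \<open>lmin y f\<close> is minus the top exponent.\<close>
  define wd where "wd f = - lmin y f - lmin x f" for f
  have wd_mult: "wd (f * g) = wd f + wd g" if "f \<noteq> 0" "g \<noteq> 0" for f g
    using that by (simp add: wd_def lmin_lbot_mult ax ay)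
  have wd_pow: "wd (f ^ n) = int n * wd f" if "f \<noteq> 0" for f n
    using that by (simp add: wd_def lmin_pow ax ay algebra_simps)
  have wd_ge: "0 \<le> wd f" if f: "f \<noteq> 0" for f
  proof -
    obtain w where w: "w \<in> Poly_Mapping.keys f" using f by fastforce
    show ?thesis using lmin_le[OF w, of x] lmin_le[OF w, of y] by (simp add: wd_def y_def)
  qed
  define sh :: "int \<Rightarrow> laurent" where "sh k = Poly_Mapping.single (Poly_Mapping.single r k) 1" for k
  have sh_mult: "sh j * sh k = sh (j + k)" for j k by (simp add: sh_def mult_single single_add)
  have sh_0: "sh 0 = 1" by (simp add: sh_def)
  have sh_supp: "sh k \<in> supp_on (coord_grp (Suc r))" for k
    unfolding sh_def by (rule supp_on_single) (auto simp: coord_grp_def)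
  \<comment> \<open>The top coefficient in the last variable, shifted to exponent 0 so that it is a
    Laurent polynomial in the remaining variables.\<close>
  define lc where "lc f = lbot y f * sh (lmin y f)" for f
  have lc_mult: "lc (f * g) = lc f * lc g" if "f \<noteq> 0" "g \<noteq> 0" for f g
    using that by (simp add: lc_def lmin_lbot_mult ay sh_mult[symmetric] algebra_simps)
  have lc_1: "lc 1 = 1" by (simp add: lc_def lmin_1 ay sh_0 lbot_def) (rule restr_self, simp add: additive_fun_0[OF ay])
  have lc_pow: "lc (f ^ n) = lc f ^ n" if "f \<noteq> 0" for f n
    using that by (induction n) (simp_all add: lc_1 lc_mult)
  have lc_ne: "lc f \<noteq> 0" if "f \<noteq> 0" for f using lbot_ne[OF that, of y] by (auto simp: lc_def sh_def single_1_neq_0)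
  have lc_supp: "lc f \<in> supp_on (coord_grp r)" if f: "f \<in> supp_on (coord_grp (Suc r))" for f
  proof -
    have "Poly_Mapping.keys (lc f) \<subseteq> coord_grp r"
    proof
      fix w assume "w \<in> Poly_Mapping.keys (lc f)"
      then obtain u where u: "u \<in> Poly_Mapping.keys f" "y u = lmin y f" "w = u + Poly_Mapping.single r (lmin y f)"
        using keys_mult[of "lbot y f" "sh (lmin y f)"] by (auto simp: lc_def lbot_def keys_restr sh_def)
      have "i < r" if "i \<in> Poly_Mapping.keys w" for i
      proof -
        have "i \<in> Poly_Mapping.keys u \<or> i = r"
          using that u(3) by (auto simp: in_keys_iff lookup_add lookup_single when_def split: if_splits)
        moreover have "u \<in> coord_grp (Suc r)" using f u(1) by (rule supp_onD)
        ultimately have "i \<le> r" by (auto simp: coord_grp_def subset_iff less_Suc_eq_le)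
        moreover have "i \<noteq> r" using that u(2,3) by (auto simp: in_keys_iff lookup_add x_def y_def)
        ultimately show ?thesis by simp
      qed
      then show "w \<in> coord_grp r" by (auto simp: coord_grp_def)
    qed
    then show ?thesis by (simp add: supp_on_def)
  qed
  have lbot_lc: "lbot y f = lc f * sh (- lmin y f)" for f
    by (simp add: lc_def mult.assoc sh_mult sh_0)
  note mon = supp_on_monoid[OF coord_grp_monoid[of "Suc r"]]
  have up: "f \<in> supp_on (coord_grp (Suc r))" if "f \<in> supp_on (coord_grp r)" for f :: laurent
    using that by (rule supp_on_mono[rotated]) (auto simp: coord_grp_def)
  note cd = Suc.prems(2-5)
  have "\<exists>q\<in>supp_on (coord_grp (Suc r)). a = c * q"
    if "a \<in> supp_on (coord_grp (Suc r))" "\<And>i. \<exists>e\<in>supp_on (coord_grp (Suc r)). d * a ^ i = c ^ i * e" for a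
    using that
  proof (induction "nat (wd a)" arbitrary: a rule: less_induct)
    case less
    show ?case
    proof (cases "a = 0")
      case True then show ?thesis by (intro bexI[of _ 0]) (simp_all add: supp_on_closed)
    next
      case a0: False
      from less.prems(2) have "\<forall>i. \<exists>e. e \<in> supp_on (coord_grp (Suc r)) \<and> d * a ^ i = c ^ i * e" by blast
      from choice[OF this] obtain e where e: "\<And>i. e i \<in> supp_on (coord_grp (Suc r))" "\<And>i. d * a ^ i = c ^ i * e i" by blast
      have e0: "e i \<noteq> 0" for i using e(2)[of i] a0 cd(4) by auto
      \<comment> \<open>Widths add up under multiplication. If \<open>c\<close> were wider than
        \<open>a\<close>, the width of \<open>c ^ i * e i\<close> would outgrow that of
        \<open>d * a ^ i\<close>.\<close>
      have wle: "wd c \<le> wd a"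
      proof (rule ccontr)
        assume "\<not> wd c \<le> wd a"
        then have lt: "wd a + 1 \<le> wd c" by simp
        \<comment> \<open>Each power costs at least one unit of width and only \<open>wd d\<close>
          units are available.\<close>
        define i where "i = nat (wd d) + 1"
        have "wd d + int i * wd a = wd (d * a ^ i)" using cd a0 by (simp add: wd_mult wd_pow)
        also have "\<dots> = int i * wd c + wd (e i)" unfolding e(2) using cd e0 by (simp add: wd_mult wd_pow)
        also have "\<dots> \<ge> int i * (wd a + 1)" using lt wd_ge[OF e0[of i]] by (simp add: add_increasing2 mult_left_mono)
        finally have "int i \<le> wd d" by (simp add: algebra_simps)
        then show False using wd_ge[OF cd(4)] by (simp add: i_def)
      qed
      have "\<exists>q\<in>supp_on (coord_grp r). lc a = lc c * q"
      proof (rule Suc.IH[of "lc a" "lc c" "lc d"])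
        show "\<exists>e\<in>supp_on (coord_grp r). lc d * lc a ^ i = lc c ^ i * e" for i
        proof (rule bexI[OF _ lc_supp[OF e(1)[of i]]])
          have "lc (d * a ^ i) = lc (c ^ i * e i)" by (simp only: e(2))
          then show "lc d * lc a ^ i = lc c ^ i * lc (e i)" using cd a0 e0 by (simp add: lc_mult lc_pow)
        qed
      qed (use less.prems cd lc_supp lc_ne in auto)
      then obtain q0 where q0: "q0 \<in> supp_on (coord_grp r)" "lc a = lc c * q0" by blast
      \<comment> \<open>The top exponent of \<open>a\<close> minus that of \<open>c\<close>, the
        exponent at which the quotient of the top coefficients has to be placed.\<close>
      define k where "k = lmin y c - lmin y a"
      define q1 where "q1 = q0 * sh k"
      have q1: "q1 \<in> supp_on (coord_grp (Suc r))" unfolding q1_def using up[OF q0(1)] sh_supp by (rule mon)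
      have q1x: "x w = k" if w: "w \<in> Poly_Mapping.keys q1" for w
      proof -
        obtain u where u: "u \<in> Poly_Mapping.keys q0" "w = u + Poly_Mapping.single r k"
          using w keys_mult[of q0 "sh k"] by (auto simp: q1_def sh_def)
        have "r \<notin> Poly_Mapping.keys u" using supp_onD[OF q0(1) u(1)] by (auto simp: coord_grp_def)
        then show ?thesis using u(2) by (simp add: x_def lookup_add in_keys_iff)
      qed
      have top: "lbot y a = lbot y c * q1"
        unfolding lbot_lc q0(2) q1_def k_def by (simp add: sh_mult[symmetric] mult.assoc mult.left_commute)
           (simp add: mult.assoc[symmetric] sh_mult)
      define a' where "a' = a - c * q1"
      have a': "a' \<in> supp_on (coord_grp (Suc r))"
        unfolding a'_def by (intro supp_on_closed mon less.prems cd q1)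
      \<comment> \<open>Subtracting \<open>c * q1\<close> removes the top layer of \<open>a\<close>.
        By \<open>wle\<close> it adds nothing below the bottom layer of \<open>a\<close>, so the
        width drops.\<close>
      have a'x: "lmin x a \<le> x w" "x w < - lmin y a" if w: "w \<in> Poly_Mapping.keys a'" for w
      proof -
        have wc: "w \<in> Poly_Mapping.keys a \<or> w \<in> Poly_Mapping.keys (c * q1)"
          using w by (auto simp: a'_def in_keys_iff lookup_minus)
        have cq: "lmin x a \<le> x w \<and> lmin y a \<le> y w" if w: "w \<in> Poly_Mapping.keys (c * q1)"
        proof -
          obtain u v where uv: "w = u + v" "u \<in> Poly_Mapping.keys c" "v \<in> Poly_Mapping.keys q1"
            using w keys_mult[of c q1] by auto
          have "x w = x u + k" using uv q1x by (simp add: additive_fun_add[OF ax])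
          then show ?thesis using lmin_le[OF uv(2), of x] lmin_le[OF uv(2), of y] wle by (simp add: y_def k_def wd_def)
        qed
        have ge: "lmin x a \<le> x w" "lmin y a \<le> y w" using wc cq lmin_le[of w a] by auto
        then show "lmin x a \<le> x w" by simp
        have "restr (\<lambda>w. y w = lmin y a) (c * q1) = restr (\<lambda>w. y w = lmin y c) c * restr (\<lambda>w. y w = - k) q1"
        proof -
          have "restr (\<lambda>w. y w = lmin y c + - k) (c * q1) = restr (\<lambda>w. y w = lmin y c) c * restr (\<lambda>w. y w = - k) q1"
          proof (rule part_mult[OF ay])
            show "- k \<le> y w" if "w \<in> Poly_Mapping.keys q1" for w using q1x[OF that] by (simp add: y_def)
          qed (rule lmin_le)
          then show ?thesis by (simp add: k_def)
        qed
        also have "\<dots> = lbot y c * q1"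
          using restr_self[of q1 "\<lambda>w. y w = - k"] q1x by (simp add: lbot_def y_def)
        finally have "restr (\<lambda>w. y w = lmin y a) a' = 0" using top by (simp add: a'_def restr_minus lbot_def)
        then have "y w \<noteq> lmin y a" using w keys_restr[of "\<lambda>w. y w = lmin y a" a'] by auto
        then show "x w < - lmin y a" using ge by (simp add: y_def)
      qed
      show ?thesis
      proof (cases "a' = 0")
        case True
        then have "a = c * q1" by (simp add: a'_def)
        then show ?thesis using q1 by blast
      next
        case a'0: False
        have "wd a' < wd a"
        proof -
          obtain u where u: "u \<in> Poly_Mapping.keys a'" "x u = lmin x a'" using lmin_in[OF a'0, of x] by blast
          obtain v where v: "v \<in> Poly_Mapping.keys a'" "y v = lmin y a'" using lmin_in[OF a'0, of y] by blast
          show ?thesis using a'x[OF u(1)] a'x[OF v(1)] u(2) v(2) by (simp add: wd_def y_def)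
        qed
        then have lt: "nat (wd a') < nat (wd a)" using wd_ge[OF a'0] by simp
        \<comment> \<open>The difference inherits the hypothesis on \<open>a\<close>: in the
          binomial expansion of \<open>d * a' ^ i\<close> every term is divisible by
          \<open>c ^ i\<close>.\<close>
        have "\<exists>q\<in>supp_on (coord_grp (Suc r)). a' = c * q"
        proof (rule less.hyps[OF lt a'])
          fix i
          have "d * a' ^ i = d * (a + - (c * q1)) ^ i" by (simp add: a'_def)
          also have "\<dots> = (\<Sum>j\<le>i. of_nat (i choose j) * (d * a ^ j) * (- (c * q1)) ^ (i - j))"
            by (simp only: binomial_ring sum_distrib_left ac_simps)
          also have "\<dots> = (\<Sum>j\<le>i. c ^ i * (of_nat (i choose j) * e j * (- q1) ^ (i - j)))"
          proof (rule sum.cong[OF refl])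
            fix j assume j: "j \<in> {..i}"
            have "(- (c * q1)) ^ (i - j) = c ^ (i - j) * (- q1) ^ (i - j)" by (simp flip: power_mult_distrib)
            moreover have "c ^ i = c ^ j * c ^ (i - j)" using j by (simp flip: power_add)
            ultimately show "of_nat (i choose j) * (d * a ^ j) * (- (c * q1)) ^ (i - j) =
                c ^ i * (of_nat (i choose j) * e j * (- q1) ^ (i - j))"
              by (simp add: e(2) algebra_simps)
          qed
          also have "\<dots> = c ^ i * (\<Sum>j\<le>i. of_nat (i choose j) * e j * (- q1) ^ (i - j))"
            by (simp add: sum_distrib_left)
          finally have "d * a' ^ i = c ^ i * (\<Sum>j\<le>i. of_nat (i choose j) * e j * (- q1) ^ (i - j))" .
          moreover have "(\<Sum>j\<le>i. of_nat (i choose j) * e j * (- q1) ^ (i - j)) \<in> supp_on (coord_grp (Suc r))"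
            by (intro supp_on_sum mon supp_on_closed e q1)
          ultimately show "\<exists>e\<in>supp_on (coord_grp (Suc r)). d * a' ^ i = c ^ i * e" by blast
        qed
        then obtain q where q: "q \<in> supp_on (coord_grp (Suc r))" "a' = c * q" by blast
        have "a = c * (q1 + q)" using q(2) by (simp add: a'_def algebra_simps)
        moreover have "q1 + q \<in> supp_on (coord_grp (Suc r))" by (intro supp_on_closed q q1)
        ultimately show ?thesis by blast
      qed
    qed
  qed
  from this[OF Suc.prems(1,6)] show ?case .
qed

section \<open>Degree zero localizations of monoids and their normality\<close>

lemma coord_grp_minus: "a \<in> coord_grp r \<Longrightarrow> b \<in> coord_grp r \<Longrightarrow> a - b \<in> coord_grp r"
  using keys_diff[of a b] by (auto simp: coord_grp_def)

lemma coord_grp_cmul: "a \<in> coord_grp r \<Longrightarrow> frag_cmul k a \<in> coord_grp r"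
  by (auto simp: coord_grp_def in_keys_iff subset_iff)

text \<open>The exponents of the degree zero part of \<open>\<complex>[W]\<close> localized at
  \<open>\<chi>\<^sup>s\<close>, that is, of the functions on the chart of \<open>s\<close>.\<close>

definition localized :: "(grp \<Rightarrow> int) \<Rightarrow> grp \<Rightarrow> grp set \<Rightarrow> grp set" where
  "localized deg s W = {w. deg w = 0 \<and> (\<exists>n. w + frag_cmul (int n) s \<in> W)}"

lemma submonoid_cmul: "submonoid_set W \<Longrightarrow> s \<in> W \<Longrightarrow> frag_cmul (int n) s \<in> W"
  by (induction n) (simp_all only: frag_cmul_Suc, simp_all add: submonoid_set_def)

lemma localized_monoid:
  assumes W: "submonoid_set W" and deg: "additive_fun deg"
  shows "submonoid_set (localized deg s W)"
  unfolding submonoid_set_def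
proof (intro conjI ballI)
  have "0 + frag_cmul (int 0) s \<in> W" using W by (simp add: submonoid_set_def)
  then show "0 \<in> localized deg s W" unfolding localized_def using additive_fun_0[OF deg] by blast
  fix a b assume "a \<in> localized deg s W" "b \<in> localized deg s W"
  then obtain m n where mn: "deg a = 0" "deg b = 0" "a + frag_cmul (int m) s \<in> W" "b + frag_cmul (int n) s \<in> W"
    by (auto simp: localized_def)
  have "(a + b) + frag_cmul (int (m + n)) s = (a + frag_cmul (int m) s) + (b + frag_cmul (int n) s)"
    by (simp add: frag_cmul_distrib algebra_simps)
  also have "\<dots> \<in> W" using W mn by (simp add: submonoid_set_def)
  finally show "a + b \<in> localized deg s W"
    using mn(1,2) unfolding localized_def mem_Collect_eq additive_fun_add[OF deg] by (intro conjI exI) simp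
qed

text \<open>A term of negative weight in \<open>q\<close> would make the lowest weight of
  \<open>c * q ^ i\<close> decrease linearly in \<open>i\<close> without bound.\<close>

lemma lmin_nonneg_of_powers:
  fixes l :: "grp \<Rightarrow> real" and c q :: laurent
  assumes l: "additive_fun l" and c: "c \<noteq> 0" and q: "q \<noteq> 0"
    and nn: "\<And>i w. w \<in> Poly_Mapping.keys (c * q ^ i) \<Longrightarrow> 0 \<le> l w"
    and w: "w \<in> Poly_Mapping.keys q"
  shows "0 \<le> l w"
proof -
  have "0 \<le> lmin l c + real i * lmin l q" for i
  proof -
    have "c * q ^ i \<noteq> 0" using c q by simp
    then obtain u where "u \<in> Poly_Mapping.keys (c * q ^ i)" "l u = lmin l (c * q ^ i)" using lmin_in by blast
    then have "0 \<le> lmin l (c * q ^ i)" using nn by metis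
    then show ?thesis using c q by (simp add: lmin_lbot_mult lmin_pow l)
  qed
  note ge = this
  have "\<not> lmin l q < 0"
  proof
    assume "lmin l q < 0"
    then obtain i :: nat where "lmin l c < real i * - lmin l q" using reals_Archimedean3[of "- lmin l q"] by auto
    then show False using ge[of i] by simp
  qed
  then show ?thesis using lmin_le[OF w, of l] by simp
qed

text \<open>The equation makes \<open>a / c\<close> almost integral: \<open>c ^ n\<close> times each
  of its powers stays in the ring. The ambient Laurent ring then provides the quotient
  \<open>q\<close>, and the inequalities that cut out the monoid pass to the exponents of
  \<open>q\<close> by the growth of its powers.\<close>

lemma laurent_normal:
  fixes a c :: laurent and \<Lambda> :: "(grp \<Rightarrow> real) set"
  assumes fin: "finite \<Lambda>" and \<Lambda>: "\<And>l. l \<in> \<Lambda> \<Longrightarrow> additive_fun l"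
    and W: "W = {g \<in> coord_grp r. \<forall>l\<in>\<Lambda>. 0 \<le> l g}" and s: "s \<in> W" and deg: "additive_fun deg"
    and a: "a \<in> supp_on (localized deg s W)" and c: "c \<in> supp_on (localized deg s W)" "c \<noteq> 0"
    and \<rho>: "\<And>i. i < n \<Longrightarrow> \<rho> i \<in> supp_on (localized deg s W)"
    and eq: "a ^ n + (\<Sum>i<n. \<rho> i * a ^ i * c ^ (n - i)) = 0"
  shows "\<exists>q\<in>supp_on (localized deg s W). a = c * q"
proof -
  let ?W = "localized deg s W"
  have Wm: "submonoid_set W" unfolding submonoid_set_def
  proof (intro conjI ballI)
    show "0 \<in> W" using coord_grp_monoid[of r] by (auto simp: W submonoid_set_def additive_fun_0 \<Lambda>)
    show "u + v \<in> W" if "u \<in> W" "v \<in> W" for u v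
      using that coord_grp_monoid[of r] by (auto simp: W submonoid_set_def additive_fun_add \<Lambda>)
  qed
  note mon = supp_on_monoid[OF localized_monoid[OF Wm deg, of s]]
  have Wc: "?W \<subseteq> coord_grp r"
  proof
    fix w assume "w \<in> ?W"
    then obtain n where n: "w + frag_cmul (int n) s \<in> W" by (auto simp: localized_def)
    have "w = (w + frag_cmul (int n) s) - frag_cmul (int n) s" by simp
    also have "\<dots> \<in> coord_grp r" using n s by (intro coord_grp_minus coord_grp_cmul) (auto simp: W)
    finally show "w \<in> coord_grp r" .
  qed
  \<comment> \<open>One denominator \<open>c ^ n\<close> serves all powers of \<open>a / c\<close>:
    small powers need nothing else, and larger ones are lowered by the equation.\<close>
  have ex: "\<exists>e\<in>supp_on ?W. c ^ n * a ^ i = c ^ i * e" for i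
  proof (induction i rule: less_induct)
    case (less i)
    show ?case
    proof (cases "i < n")
      case True
      then have "c ^ n = c ^ i * c ^ (n - i)" by (simp flip: power_add)
      then have "c ^ n * a ^ i = c ^ i * (c ^ (n - i) * a ^ i)" by (simp add: algebra_simps)
      moreover have "c ^ (n - i) * a ^ i \<in> supp_on ?W" using a c by (intro mon)
      ultimately show ?thesis by blast
    next
      case False
      have "\<forall>j. \<exists>e. j < n \<longrightarrow> e \<in> supp_on ?W \<and> c ^ n * a ^ (i - n + j) = c ^ (i - n + j) * e"
      proof
        fix j
        show "\<exists>e. j < n \<longrightarrow> e \<in> supp_on ?W \<and> c ^ n * a ^ (i - n + j) = c ^ (i - n + j) * e"
        proof (cases "j < n")
          case True
          have "i - n + j < i" using True False by simp
          from less.IH[OF this] show ?thesis by blast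
        qed simp
      qed
      from choice[OF this] obtain e where e: "\<And>j. j < n \<Longrightarrow> e j \<in> supp_on ?W"
        "\<And>j. j < n \<Longrightarrow> c ^ n * a ^ (i - n + j) = c ^ (i - n + j) * e j" by blast
      have an: "a ^ n = - (\<Sum>j<n. \<rho> j * a ^ j * c ^ (n - j))" using eq by (simp add: eq_neg_iff_add_eq_0)
      have "c ^ n * a ^ i = c ^ n * a ^ (i - n) * a ^ n" using False by (simp add: mult.assoc flip: power_add)
      also have "\<dots> = - (\<Sum>j<n. \<rho> j * c ^ (n - j) * (c ^ n * a ^ (i - n + j)))"
        unfolding an by (simp add: sum_distrib_left algebra_simps power_add)
      also have "(\<Sum>j<n. \<rho> j * c ^ (n - j) * (c ^ n * a ^ (i - n + j))) = (\<Sum>j<n. c ^ i * (\<rho> j * e j))"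
      proof (rule sum.cong[OF refl])
        fix j assume j: "j \<in> {..<n}"
        have "c ^ i = c ^ (n - j) * c ^ (i - n + j)" using j False by (simp flip: power_add)
        then show "\<rho> j * c ^ (n - j) * (c ^ n * a ^ (i - n + j)) = c ^ i * (\<rho> j * e j)"
          using e(2)[of j] j by (simp add: algebra_simps)
      qed
      finally have "c ^ n * a ^ i = c ^ i * (- (\<Sum>j<n. \<rho> j * e j))" by (simp add: sum_distrib_left)
      moreover have "- (\<Sum>j<n. \<rho> j * e j) \<in> supp_on ?W"
        by (intro supp_on_closed(3) supp_on_sum mon) (simp_all add: \<rho> e)
      ultimately show ?thesis by blast
    qed
  qed
  note up = supp_on_mono[OF Wc]
  obtain q where q: "q \<in> supp_on (coord_grp r)" "a = c * q"
  proof -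
    have "\<exists>q\<in>supp_on (coord_grp r). a = c * q"
    proof (rule laurent_completely_integrally_closed)
      show "\<exists>e\<in>supp_on (coord_grp r). c ^ n * a ^ i = c ^ i * e" for i using ex[of i] up by blast
      show "c ^ n \<in> supp_on (coord_grp r)" using c by (intro up mon)
    qed (use a c up in auto)
    then show ?thesis using that by blast
  qed
  have cq: "c ^ n * q ^ i \<in> supp_on ?W" for i
  proof -
    obtain e where "e \<in> supp_on ?W" "c ^ n * a ^ i = c ^ i * e" using ex by blast
    moreover have "c ^ n * a ^ i = c ^ i * (c ^ n * q ^ i)" unfolding q(2) by (simp add: power_mult_distrib algebra_simps)
    ultimately show ?thesis using c by simp
  qed
  have key: "0 \<le> l w" if l: "additive_fun l" "\<And>w. w \<in> ?W \<Longrightarrow> 0 \<le> l w" and w: "w \<in> Poly_Mapping.keys q"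
    for l :: "grp \<Rightarrow> real" and w
  proof (rule lmin_nonneg_of_powers[OF l(1) _ _ _ w])
    show "c ^ n \<noteq> 0" using c by simp
    show "q \<noteq> 0" using w by auto
    show "0 \<le> l u" if "u \<in> Poly_Mapping.keys (c ^ n * q ^ i)" for i u
      using l(2) supp_onD[OF cq that] by blast
  qed
  have "w \<in> ?W" if w: "w \<in> Poly_Mapping.keys q" for w
  proof -
    \<comment> \<open>The equality \<open>deg w = 0\<close> is treated as two inequalities.\<close>
    have "additive_fun (\<lambda>w. real_of_int (deg w))" "additive_fun (\<lambda>w. - real_of_int (deg w))"
      using deg by (simp_all add: additive_fun_def)
    from key[OF this(1) _ w] key[OF this(2) _ w] have d: "deg w = 0" by (auto simp: localized_def)
    have "\<forall>l\<in>\<Lambda>. \<exists>n::nat. 0 \<le> l w + real n * l s"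
    proof
      fix l assume l: "l \<in> \<Lambda>"
      then have ls: "0 \<le> l s" using s by (simp add: W)
      show "\<exists>n::nat. 0 \<le> l w + real n * l s"
      \<comment> \<open>An inequality that is an equality on \<open>s\<close> survives localization
        and must hold on \<open>w\<close> itself; any other one holds after adding a large multiple
        of \<open>s\<close>.\<close>
      proof (cases "l s = 0")
        case True
        have "0 \<le> l w"
        proof (rule key[OF \<Lambda>[OF l] _ w])
          fix v assume "v \<in> ?W"
          then obtain n where "v + frag_cmul (int n) s \<in> W" by (auto simp: localized_def)
          then have "0 \<le> l (v + frag_cmul (int n) s)" using l by (simp add: W)
          then show "0 \<le> l v" using True by (simp add: additive_fun_add additive_fun_cmul \<Lambda>[OF l])
        qed
        then show ?thesis using True by simp
      next
        case False
        then obtain n where "- l w < real n * l s" using ls reals_Archimedean3[of "l s"] by auto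
        then show ?thesis by (intro exI[of _ n]) simp
      qed
    qed
    from bchoice[OF this] obtain N where N: "\<And>l. l \<in> \<Lambda> \<Longrightarrow> 0 \<le> l w + real (N l) * l s" by blast
    \<comment> \<open>A single multiple of \<open>s\<close> for all the finitely many inequalities:
      the sum dominates every \<open>N l\<close>.\<close>
    define m where "m = (\<Sum>l\<in>\<Lambda>. N l)"
    have "0 \<le> l (w + frag_cmul (int m) s)" if l: "l \<in> \<Lambda>" for l
    proof -
      have "N l \<le> m" unfolding m_def using fin l by (simp add: member_le_sum)
      then have "real (N l) * l s \<le> real m * l s" using l s by (intro mult_right_mono) (auto simp: W)
      then show ?thesis using N[OF l] by (simp add: additive_fun_add additive_fun_cmul \<Lambda>[OF l])
    qed
    moreover have "w + frag_cmul (int m) s \<in> coord_grp r"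
      using coord_grp_monoid[of r] supp_onD[OF q(1) w] s by (auto simp: submonoid_set_def W coord_grp_cmul)
    ultimately have "w + frag_cmul (int m) s \<in> W" by (simp add: W)
    then show ?thesis using d unfolding localized_def by blast
  qed
  then have "q \<in> supp_on ?W" by (auto simp: supp_on_def)
  then show ?thesis using q(2) by blast
qed

section \<open>Integral equations from twists by roots of unity\<close>

lemma map_poly_hom_mult:
  fixes h :: "'a::comm_ring_1 \<Rightarrow> 'b::comm_ring_1"
  assumes "h 0 = 0" "\<And>x y. h (x + y) = h x + h y" "\<And>x y. h (x * y) = h x * h y"
  shows "map_poly h (p * q) = map_poly h p * map_poly h q"
proof (rule poly_eqI)
  have hs: "h (sum f I) = (\<Sum>i\<in>I. h (f i))" for f and I :: "nat set"
    by (induction I rule: infinite_finite_induct) (simp_all add: assms)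
  show "coeff (map_poly h (p * q)) n = coeff (map_poly h p * map_poly h q) n" for n
    by (simp add: coeff_map_poly assms coeff_mult hs)
qed

text \<open>The order of this root of unity is exactly \<open>n\<close>; hence invariance under a
  twist detects divisibility of an exponent by \<open>n\<close>.\<close>

lemma cis_powi_eq_1:
  assumes "n > 0"
  shows "cis (2 * pi / real n) powi k = 1 \<longleftrightarrow> int n dvd k"
proof -
  have "cis (2 * pi / real n) powi k = cis (2 * pi * (real_of_int k / real n))"
    by (simp add: cis_power_int algebra_simps)
  also have "\<dots> = 1 \<longleftrightarrow> real_of_int k / real n \<in> \<int>"
  proof -
    have "cis x = 1 \<longleftrightarrow> (\<exists>j::int. x = real_of_int j * 2 * pi)" for x
    proof -
      have "cos x = 1 \<Longrightarrow> sin x = 0" using sin_cos_squared_add[of x] by simp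
      then have "cis x = 1 \<longleftrightarrow> cos x = 1" by (auto simp: complex_eq_iff)
      then show ?thesis by (simp add: cos_one_2pi_int)
    qed
    moreover have "2 * pi * x = real_of_int j * 2 * pi \<longleftrightarrow> x = real_of_int j" for x j
    proof -
      have "real_of_int j * 2 * pi = 2 * pi * real_of_int j" by simp
      then show ?thesis using mult_cancel_left[of "2 * pi" x "real_of_int j"] by (simp del: mult_cancel_left)
    qed
    ultimately show ?thesis by (simp only: Ints_def image_iff) auto
  qed
  also have "\<dots> \<longleftrightarrow> int n dvd k"
  proof
    assume "real_of_int k / real n \<in> \<int>"
    then obtain j where "real_of_int k / real n = real_of_int j" by (auto elim: Ints_cases)
    then have "real_of_int k = real_of_int (int n * j)" using assms by (simp add: field_simps)
    then have "k = int n * j" by (simp only: of_int_eq_iff)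
    then show "int n dvd k" by simp
  next
    assume "int n dvd k"
    then obtain j where "k = int n * j" by blast
    then show "real_of_int k / real n \<in> \<int>" using assms by simp
  qed
  finally show ?thesis .
qed

text \<open>
  An equation of integral dependence with coefficients supported on multiples of \<open>n\<close>: the product
  of all conjugates \<open>X - \<eta> b\<close> under the characters \<open>\<eta>\<close> of order dividing \<open>n\<close>.
\<close>

lemma laurent_integral:
  fixes b :: laurent
  assumes n: "n > 0" and W: "submonoid_set W" "W \<subseteq> coord_grp r" and b: "b \<in> supp_on W"
  shows "\<exists>N \<rho>. (\<forall>i<N. \<rho> i \<in> supp_on {w \<in> W. \<exists>v. w = frag_cmul (int n) v}) \<and> b ^ N + (\<Sum>i<N. \<rho> i * b ^ i) = 0"
proof -
  define \<omega> where "\<omega> = cis (2 * pi / real n)"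
  have \<omega>0: "\<omega> \<noteq> 0" by (simp add: \<omega>_def)
  define ch where "ch j t w = \<omega> powi (int t * Poly_Mapping.lookup w j)" for j t and w :: grp
  \<comment> \<open>\<open>tw j t\<close> multiplies the variable \<open>j\<close> by
    \<open>\<omega> ^ t\<close>, an algebra automorphism of order dividing \<open>n\<close>.\<close>
  define tw where "tw j t = Poly_Mapping.mapp (\<lambda>w c. ch j t w * c)" for j t
  have ltw: "Poly_Mapping.lookup (tw j t f) w = ch j t w * Poly_Mapping.lookup f w" for j t f w
    by (auto simp: tw_def lookup_mapp when_def in_keys_iff)
  have tw_0: "tw j t 0 = 0" for j t by (rule poly_mapping_eqI) (simp add: ltw)
  have tw_add: "tw j t (f + g) = tw j t f + tw j t g" for j t f g
    by (rule poly_mapping_eqI) (simp add: ltw lookup_add algebra_simps)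
  have tw_mult: "tw j t (f * g) = tw j t f * tw j t g" for j t f g
  proof -
    interpret graded_ext "\<lambda>_. UNIV" "\<lambda>w c. Poly_Mapping.single w (ch j t w * c) :: laurent"
      by unfold_locales
        (auto simp: single_add[symmetric] mult_single ch_def lookup_add algebra_simps power_int_add \<omega>0)
    have "ext f = tw j t f" for f
      unfolding ext_def by (subst (2) pm_expand) (rule poly_mapping_eqI, simp add: lookup_sum lookup_single ltw when_def in_keys_iff ch_def)
    then show ?thesis using ext_mult[of f g] by (simp add: allowed_def)
  qed
  have tw_1: "tw j t 1 = 1" for j t by (rule poly_mapping_eqI) (simp add: ltw lookup_one when_def ch_def)
  have tw_id: "tw j 0 f = f" for j f by (rule poly_mapping_eqI) (simp add: ltw ch_def)
  have tw_n: "tw j n f = f" for j f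
    by (rule poly_mapping_eqI) (simp add: ltw ch_def \<omega>_def cis_powi_eq_1[OF n])
  have tw_Suc: "tw j 1 (tw j t f) = tw j (Suc t) f" for j t f
    by (rule poly_mapping_eqI) (simp add: ltw ch_def algebra_simps power_int_add \<omega>0)
  have tw_comm: "tw i s (tw j t f) = tw j t (tw i s f)" for i j s t f
    by (rule poly_mapping_eqI) (simp add: ltw)
  have tw_supp: "tw j t f \<in> supp_on W" if "f \<in> supp_on W" for j t f
    using that by (auto simp: supp_on_def in_keys_iff ltw subset_iff)
  note tws = tw_0 tw_add tw_mult
  have mp_mult: "map_poly (tw j t) (p * q) = map_poly (tw j t) p * map_poly (tw j t) q" for j t p q
    by (rule map_poly_hom_mult) (simp_all add: tws)
  have mp_prod: "map_poly (tw j t) (prod p I) = (\<Prod>i\<in>I. map_poly (tw j t) (p i))" for j t p and I :: "nat set"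
    by (induction I rule: infinite_finite_induct) (simp_all add: mp_mult tw_1)
  have mp_comp: "map_poly (tw i s) (map_poly (tw j t) p) = map_poly (tw i s \<circ> tw j t) p" for i s j t p
    by (rule poly_eqI) (simp add: coeff_map_poly tw_0)
  define csupp where "csupp p \<longleftrightarrow> (\<forall>i. coeff p i \<in> supp_on W)" for p :: "laurent poly"
  have cs_mult: "csupp (p * q)" if "csupp p" "csupp q" for p q
    using that unfolding csupp_def coeff_mult by (intro allI supp_on_sum supp_on_monoid[OF W(1)]) auto
  have cs_prod: "csupp (prod p I)" if "\<And>i. csupp (p i)" for p and I :: "nat set"
    by (induction I rule: infinite_finite_induct)
      (simp_all add: cs_mult that, auto simp: csupp_def supp_on_closed supp_on_monoid[OF W(1)] coeff_1)
  \<comment> \<open>The orbit product is built one variable at a time. Taking the product over the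
    \<open>n\<close> twists in a new variable gives invariance there, and twists commute, so
    invariance in the earlier variables is kept.\<close>
  have "\<exists>p. lead_coeff p = 1 \<and> poly p b = 0 \<and> csupp p \<and> (\<forall>j<k. map_poly (tw j 1) p = p)" for k
  proof (induction k)
    case 0
    show ?case
      by (rule exI[of _ "[:- b, 1:]"])
        (use b in \<open>auto simp: csupp_def coeff_pCons supp_on_closed supp_on_monoid[OF W(1)] split: nat.split\<close>)
  next
    case (Suc k)
    then obtain p where p: "lead_coeff p = 1" "poly p b = 0" "csupp p" "\<And>j. j < k \<Longrightarrow> map_poly (tw j 1) p = p" by blast
    define g where "g t = map_poly (tw k t) p" for t
    let ?P = "\<Prod>t<n. g t"
    have g0: "g 0 = p" "g n = p" by (rule poly_eqI, simp add: g_def coeff_map_poly tw_0 tw_id tw_n)+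
    have lg: "lead_coeff (g t) = 1" for t unfolding g_def
      by (subst lead_coeff_map_poly_nz) (simp_all add: p tw_0 tw_1)
    have lP: "lead_coeff (\<Prod>t\<in>I. g t) = 1" if "finite I" for I using that
    proof (induction I)
      case (insert t I)
      have "lead_coeff (prod g (insert t I)) = lead_coeff (g t) * lead_coeff (prod g I)"
        by (simp only: prod.insert[OF insert.hyps] lead_coeff_mult)
      then show ?case by (simp only: lg insert.IH mult_1_left)
    qed simp
    have shift: "map_poly (tw k 1) ?P = ?P"
    proof -
      have "map_poly (tw k 1) (g t) = g (Suc t)" for t
        unfolding g_def mp_comp by (rule poly_eqI) (simp add: coeff_map_poly tw_0 tw_Suc[simplified])
      then have "map_poly (tw k 1) ?P = (\<Prod>t<n. g (Suc t))" by (simp add: mp_prod)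
      \<comment> \<open>The twist permutes the factors cyclically, since \<open>g n = g 0\<close>;
        afterwards the common factor \<open>p\<close> is cancelled.\<close>
      moreover have "g 0 * (\<Prod>t<n. g (Suc t)) = ?P * g n"
        using prod.lessThan_Suc_shift[of g n] prod.lessThan_Suc[of g n] by simp
      moreover have "p \<noteq> 0" using p(1) by auto
      ultimately show ?thesis by (simp add: g0)
    qed
    have inv: "map_poly (tw j 1) ?P = ?P" if j: "j < k" for j
    proof -
      have "map_poly (tw j 1) (g t) = g t" for t
      proof -
        have "map_poly (tw j 1) (g t) = map_poly (tw k t) (map_poly (tw j 1) p)"
          unfolding g_def mp_comp by (rule poly_eqI) (simp add: coeff_map_poly tw_0 tw_comm[of j])
        then show ?thesis by (simp add: p(4)[OF j, simplified] g_def)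
      qed
      then show ?thesis by (simp add: mp_prod)
    qed
    have "poly ?P b = 0" unfolding poly_prod
      by (rule prod_zero) (use n p(2) g0 in \<open>auto intro!: bexI[of _ 0]\<close>)
    moreover have "csupp ?P"
      by (rule cs_prod) (use p(3) tw_supp in \<open>auto simp: csupp_def g_def coeff_map_poly tw_0\<close>)
    ultimately show ?case using lP[of "{..<n}"] shift inv
      by (intro exI[of _ ?P]) (auto simp: less_Suc_eq)
  qed
  then obtain p where p: "lead_coeff p = 1" "poly p b = 0" "csupp p" "\<And>j. j < r \<Longrightarrow> map_poly (tw j 1) p = p" by blast
  \<comment> \<open>Invariance in all \<open>r\<close> variables leaves only exponents whose
    coordinates are divisible by \<open>n\<close>.\<close>
  have "coeff p i \<in> supp_on {w \<in> W. \<exists>v. w = frag_cmul (int n) v}" for i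
  proof -
    have "\<exists>v. w = frag_cmul (int n) v" if w: "w \<in> Poly_Mapping.keys (coeff p i)" for w
    proof -
      have "int n dvd Poly_Mapping.lookup w j" for j
      proof (cases "j < r")
        case True
        have "tw j 1 (coeff p i) = coeff p i"
          using arg_cong[OF p(4)[OF True], of "\<lambda>p. coeff p i"] by (simp add: coeff_map_poly tw_0)
        then have "ch j 1 w * Poly_Mapping.lookup (coeff p i) w = Poly_Mapping.lookup (coeff p i) w" by (metis ltw)
        then have "ch j 1 w = 1" using w by (simp add: in_keys_iff)
        then show ?thesis using cis_powi_eq_1[OF n] by (simp add: ch_def \<omega>_def)
      next
        case False
        have "w \<in> coord_grp r" using w p(3) W(2) by (auto simp: csupp_def supp_on_def)
        then have "Poly_Mapping.lookup w j = 0" using False by (auto simp: coord_grp_def in_keys_iff subset_iff)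
        then show ?thesis by simp
      qed
      then have "w = frag_cmul (int n) (Poly_Mapping.mapp (\<lambda>_ x. x div int n) w)"
        by (intro poly_mapping_eqI) (auto simp: lookup_mapp when_def in_keys_iff)
      then show ?thesis by blast
    qed
    then show ?thesis using p(3) by (auto simp: csupp_def supp_on_def)
  qed
  moreover have "b ^ degree p + (\<Sum>i<degree p. coeff p i * b ^ i) = 0"
  proof -
    have "0 = (\<Sum>i\<le>degree p. coeff p i * b ^ i)" using p(2) by (simp add: poly_altdef)
    also have "{..degree p} = insert (degree p) {..<degree p}" by auto
    finally show ?thesis using p(1) by simp
  qed
  ultimately show ?thesis by blast
qed

section \<open>Proj of a graded algebra spanned by monomials\<close>

lemma restr_homogeneous_mult:
  fixes f g :: laurent
  assumes l: "additive_fun (l :: grp \<Rightarrow> int)" and f: "\<And>w. w \<in> Poly_Mapping.keys f \<Longrightarrow> l w = j"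
  shows "restr (\<lambda>w. l w = i) (f * g) = f * restr (\<lambda>w. l w = i - j) g"
proof -
  let ?g0 = "restr (\<lambda>w. l w = i - j) g" and ?g1 = "restr (\<lambda>w. l w \<noteq> i - j) g"
  have "f * g = f * ?g0 + f * ?g1" using restr_split[of g "\<lambda>w. l w = i - j"] by (metis distrib_left)
  moreover have "restr (\<lambda>w. l w = i) (f * ?g0) = f * ?g0"
    by (rule restr_self) (use keys_mult[of f ?g0] f in \<open>auto simp: keys_restr additive_fun_add[OF l]\<close>)
  moreover have "restr (\<lambda>w. l w = i) (f * ?g1) = 0"
  proof (rule restr_none)
    fix w assume "w \<in> Poly_Mapping.keys (f * ?g1)"
    then obtain a b where "w = a + b" "a \<in> Poly_Mapping.keys f" "l b \<noteq> i - j"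
      using keys_mult[of f ?g1] by (auto simp: keys_restr)
    then show "l w \<noteq> i" using f by (simp add: additive_fun_add[OF l])
  qed
  ultimately show ?thesis by (simp add: restr_add)
qed

text \<open>A common form for the fiber algebra, whose elements are cosets, and the toric algebra:
  \<open>\<gamma>\<close> presents the algebra as a graded monoid algebra inside the fixed ring of
  Laurent polynomials, so that everything about \<open>Proj\<close> is proved once.\<close>

locale mono_alg = cring B for B :: "'a gcalg" (structure) +
  fixes \<gamma> :: "'a \<Rightarrow> laurent" and S :: "grp set" and deg :: "grp \<Rightarrow> int"
  assumes \<gamma>_bij: "bij_betw \<gamma> (carrier B) (supp_on S)"
    and \<gamma>_mult: "a \<in> carrier B \<Longrightarrow> b \<in> carrier B \<Longrightarrow> \<gamma> (a \<otimes> b) = \<gamma> a * \<gamma> b"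
    and \<gamma>_add: "a \<in> carrier B \<Longrightarrow> b \<in> carrier B \<Longrightarrow> \<gamma> (a \<oplus> b) = \<gamma> a + \<gamma> b"
    and \<gamma>_one: "\<gamma> \<one> = 1"
    and \<gamma>_scal: "\<gamma> (scal B c) = Poly_Mapping.single 0 c" and scal_closed: "scal B c \<in> carrier B"
    and hcomp_eq: "hcomp B i = {b \<in> carrier B. \<forall>w\<in>Poly_Mapping.keys (\<gamma> b). deg w = int i}"
    and S_monoid: "submonoid_set S" and deg_add: "additive_fun deg"
    and S_deg: "s \<in> S \<Longrightarrow> 0 \<le> deg s" and S_pos: "\<exists>s\<in>S. 0 < deg s"
begin

definition \<rho> :: "'a \<Rightarrow> laurent fract" where "\<rho> b = to_fract (\<gamma> b)"

sublocale E: embedded_domain B \<rho>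
proof
  show "inj_on \<rho> (carrier B)" using \<gamma>_bij by (auto simp: inj_on_def \<rho>_def bij_betw_def)
qed (simp_all add: \<rho>_def \<gamma>_mult \<gamma>_add \<gamma>_one)

lemma \<gamma>_supp: "b \<in> carrier B \<Longrightarrow> \<gamma> b \<in> supp_on S"
  using \<gamma>_bij by (auto simp: bij_betw_def)

lemma \<gamma>_eq_iff: "a \<in> carrier B \<Longrightarrow> b \<in> carrier B \<Longrightarrow> \<gamma> a = \<gamma> b \<longleftrightarrow> a = b"
  using \<gamma>_bij by (auto simp: bij_betw_def dest: inj_onD)

lemma \<gamma>_zero: "\<gamma> \<zero> = 0"
  using \<gamma>_add[of \<zero> \<zero>] by (simp del: add_cancel_left_left add_cancel_right_right add: add_cancel_right_right[symmetric])

lemma \<gamma>_minus: "a \<in> carrier B \<Longrightarrow> \<gamma> (\<ominus> a) = - \<gamma> a"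
  using \<gamma>_add[of "\<ominus> a" a] by (simp add: l_neg \<gamma>_zero eq_neg_iff_add_eq_0)

definition ig :: "laurent \<Rightarrow> 'a" where "ig f = inv_into (carrier B) \<gamma> f"

lemma ig: "f \<in> supp_on S \<Longrightarrow> ig f \<in> carrier B" "f \<in> supp_on S \<Longrightarrow> \<gamma> (ig f) = f"
  using \<gamma>_bij by (auto simp: ig_def bij_betw_def inv_into_into f_inv_into_f)

definition mon :: "grp \<Rightarrow> 'a" where "mon s = ig (Poly_Mapping.single s 1)"

lemma mon: "s \<in> S \<Longrightarrow> mon s \<in> carrier B" "s \<in> S \<Longrightarrow> \<gamma> (mon s) = Poly_Mapping.single s 1"
  by (simp_all add: mon_def ig supp_on_single)

lemma S_add: "s \<in> S \<Longrightarrow> t \<in> S \<Longrightarrow> s + t \<in> S"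
  using S_monoid by (simp add: submonoid_set_def)

lemma S_0: "0 \<in> S"
  using S_monoid by (simp add: submonoid_set_def)

lemma S_cmul: "s \<in> S \<Longrightarrow> frag_cmul (int n) s \<in> S"
  by (rule submonoid_cmul[OF S_monoid])

lemma mon_add: "s \<in> S \<Longrightarrow> t \<in> S \<Longrightarrow> mon (s + t) = mon s \<otimes> mon t"
  by (subst \<gamma>_eq_iff[symmetric]) (simp_all add: mon S_add \<gamma>_mult mult_single)

lemma mon_0: "mon 0 = \<one>"
  by (subst \<gamma>_eq_iff[symmetric]) (simp_all add: mon S_0 \<gamma>_one)

lemma deg_0: "deg 0 = 0" by (rule additive_fun_0[OF deg_add])

lemma deg_cmul: "deg (frag_cmul (int n) s) = int n * deg s"
  using additive_fun_cmul[OF deg_add] by simp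

lemma hcompD: "b \<in> hcomp B i \<Longrightarrow> b \<in> carrier B" "b \<in> hcomp B i \<Longrightarrow> w \<in> Poly_Mapping.keys (\<gamma> b) \<Longrightarrow> deg w = int i"
  by (auto simp: hcomp_eq)

lemma hcomp_zero: "\<zero> \<in> hcomp B i" by (simp add: hcomp_eq \<gamma>_zero)

lemma hcomp_one: "\<one> \<in> hcomp B 0" by (simp add: hcomp_eq \<gamma>_one deg_0)

lemma hcomp_add: "a \<in> hcomp B i \<Longrightarrow> b \<in> hcomp B i \<Longrightarrow> a \<oplus> b \<in> hcomp B i"
  using Poly_Mapping.keys_add[of "\<gamma> a" "\<gamma> b"] by (auto simp: hcomp_eq \<gamma>_add)

lemma hcomp_minus: "a \<in> hcomp B i \<Longrightarrow> \<ominus> a \<in> hcomp B i"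
  by (auto simp: hcomp_eq \<gamma>_minus)

lemma hcomp_mult: "a \<in> hcomp B i \<Longrightarrow> b \<in> hcomp B j \<Longrightarrow> a \<otimes> b \<in> hcomp B (i + j)"
  using keys_mult[of "\<gamma> a" "\<gamma> b"] by (auto simp: hcomp_eq \<gamma>_mult additive_fun_add[OF deg_add])

lemma hcomp_pow: "a \<in> hcomp B i \<Longrightarrow> a [^] (n::nat) \<in> hcomp B (n * i)"
  by (induction n) (auto simp: hcomp_one add.commute dest: hcomp_mult)

lemma hcomp_scal: "scal B c \<in> hcomp B 0"
  by (simp add: hcomp_eq \<gamma>_scal scal_closed deg_0)

lemma hcomp_mon: "s \<in> S \<Longrightarrow> deg s = int i \<Longrightarrow> mon s \<in> hcomp B i"
  by (simp add: hcomp_eq mon)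

section \<open>Homogeneous components\<close>

definition comp :: "nat \<Rightarrow> 'a \<Rightarrow> 'a" where
  "comp i b = ig (restr (\<lambda>w. deg w = int i) (\<gamma> b))"

lemma restr_supp: "f \<in> supp_on S \<Longrightarrow> restr P f \<in> supp_on S"
  by (auto simp: supp_on_def keys_restr)

lemma comp: "b \<in> carrier B \<Longrightarrow> comp i b \<in> carrier B"
    "b \<in> carrier B \<Longrightarrow> \<gamma> (comp i b) = restr (\<lambda>w. deg w = int i) (\<gamma> b)"
  by (simp_all add: comp_def ig restr_supp \<gamma>_supp)

lemma comp_hcomp: "b \<in> carrier B \<Longrightarrow> comp i b \<in> hcomp B i"
  by (simp add: hcomp_eq comp keys_restr)

lemma comp_self: "b \<in> hcomp B i \<Longrightarrow> comp i b = b"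
  by (subst \<gamma>_eq_iff[symmetric]) (auto simp: comp hcomp_eq intro!: restr_self)

lemma comp_other: "b \<in> hcomp B i \<Longrightarrow> i \<noteq> j \<Longrightarrow> comp j b = \<zero>"
  by (subst \<gamma>_eq_iff[symmetric]) (auto simp: comp hcomp_eq \<gamma>_zero intro!: restr_none)

lemma comp_add: "a \<in> carrier B \<Longrightarrow> b \<in> carrier B \<Longrightarrow> comp i (a \<oplus> b) = comp i a \<oplus> comp i b"
  by (subst \<gamma>_eq_iff[symmetric]) (simp_all add: comp \<gamma>_add restr_add)

lemma comp_zero: "comp i \<zero> = \<zero>"
  by (subst \<gamma>_eq_iff[symmetric]) (auto simp: comp \<gamma>_zero intro!: restr_none)

lemma comp_mult:
  assumes "a \<in> hcomp B j" "b \<in> carrier B"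
  shows "comp i (a \<otimes> b) = (if j \<le> i then a \<otimes> comp (i - j) b else \<zero>)"
proof -
  have a: "a \<in> carrier B" using assms by (simp add: hcomp_eq)
  have e: "restr (\<lambda>w. deg w = int i) (\<gamma> a * \<gamma> b) = \<gamma> a * restr (\<lambda>w. deg w = int i - int j) (\<gamma> b)"
    by (rule restr_homogeneous_mult[OF deg_add]) (use assms in \<open>simp add: hcomp_eq\<close>)
  show ?thesis
  proof (cases "j \<le> i")
    case True
    then have "int i - int j = int (i - j)" by simp
    then show ?thesis using True a assms e
      by (subst \<gamma>_eq_iff[symmetric]) (simp_all add: comp \<gamma>_mult del: of_nat_diff)
  next
    case False
    have "restr (\<lambda>w. deg w = int i - int j) (\<gamma> b) = 0"
      by (rule restr_none) (use False \<gamma>_supp[OF assms(2)] S_deg in \<open>force simp: supp_on_def\<close>)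
    then show ?thesis using False a assms e
      by (subst \<gamma>_eq_iff[symmetric]) (simp_all add: comp \<gamma>_mult \<gamma>_zero)
  qed
qed

lemma deg_bounded: "\<exists>n. \<forall>w\<in>Poly_Mapping.keys (f :: laurent). deg w < int n"
proof -
  let ?m = "Max (insert 0 (deg ` Poly_Mapping.keys f))"
  have "(\<forall>w\<in>Poly_Mapping.keys f. deg w \<le> ?m) \<and> 0 \<le> ?m" by auto
  then obtain m where "\<forall>w\<in>Poly_Mapping.keys f. deg w \<le> m" "0 \<le> m" by blast
  then show ?thesis by (intro exI[of _ "nat m + 1"]) auto
qed

text \<open>Degrees in \<open>S\<close> are nonnegative and supports are finite, so splitting off
  the top component lowers the degree bound until nothing is left.\<close>

lemma hom_induct [consumes 1, case_names homogeneous add]: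
  assumes b: "b \<in> carrier B" and h: "\<And>i b. b \<in> hcomp B i \<Longrightarrow> P b"
    and add: "\<And>a b. a \<in> carrier B \<Longrightarrow> b \<in> carrier B \<Longrightarrow> P a \<Longrightarrow> P b \<Longrightarrow> P (a \<oplus> b)"
  shows "P b"
proof -
  have "P b" if "b \<in> carrier B" "\<And>w. w \<in> Poly_Mapping.keys (\<gamma> b) \<Longrightarrow> deg w < int n" for n b
    using that
  proof (induction n arbitrary: b)
    case 0
    have "Poly_Mapping.keys (\<gamma> b) = {}"
      using 0(2) supp_onD[OF \<gamma>_supp[OF 0(1)]] S_deg by fastforce
    then have "b = \<zero>" using 0(1) \<gamma>_eq_iff[of b \<zero>] by (simp add: \<gamma>_zero)
    then show ?case using h[OF hcomp_zero] by simp
  next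
    case (Suc n)
    let ?r = "restr (\<lambda>w. deg w \<noteq> int n) (\<gamma> b)"
    have r: "ig ?r \<in> carrier B" "\<gamma> (ig ?r) = ?r" using Suc.prems by (simp_all add: ig restr_supp \<gamma>_supp)
    have "P (ig ?r)"
    proof (rule Suc.IH[OF r(1)])
      fix w assume "w \<in> Poly_Mapping.keys (\<gamma> (ig ?r))"
      then show "deg w < int n" using Suc.prems(2)[of w] by (simp add: r keys_restr)
    qed
    moreover have "P (comp n b)" by (rule h[OF comp_hcomp[OF Suc.prems(1)]])
    moreover have "b = comp n b \<oplus> ig ?r"
      using restr_split[of "\<gamma> b" "\<lambda>w. deg w = int n"] Suc.prems(1) r
      by (subst \<gamma>_eq_iff[symmetric]) (simp_all add: comp \<gamma>_add)
    ultimately show ?case using add[OF comp(1)[OF Suc.prems(1)] r(1)] by metis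
  qed
  moreover have "\<exists>n. \<forall>w\<in>Poly_Mapping.keys (\<gamma> b). deg w < int n" by (rule deg_bounded)
  ultimately show ?thesis using b by blast
qed

lemma in_ideal_of_comps:
  assumes I: "\<And>a b. a \<in> I \<Longrightarrow> b \<in> I \<Longrightarrow> a \<oplus> b \<in> I" and b: "b \<in> carrier B" "\<And>i. comp i b \<in> I"
  shows "b \<in> I"
proof -
  have "b \<in> I" if "b \<in> carrier B" "\<And>i. comp i b \<in> I" "\<And>w. w \<in> Poly_Mapping.keys (\<gamma> b) \<Longrightarrow> deg w < int n" for n b
    using that
  proof (induction n arbitrary: b)
    case 0
    have "Poly_Mapping.keys (\<gamma> b) = {}"
      using 0(3) supp_onD[OF \<gamma>_supp[OF 0(1)]] S_deg by fastforce
    then have "b = \<zero>" using 0(1) \<gamma>_eq_iff[of b \<zero>] by (simp add: \<gamma>_zero)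
    then show ?case using 0(2)[of 0] by (simp add: comp_zero)
  next
    case (Suc n)
    let ?r = "restr (\<lambda>w. deg w \<noteq> int n) (\<gamma> b)"
    have r: "ig ?r \<in> carrier B" "\<gamma> (ig ?r) = ?r" using Suc.prems by (simp_all add: ig restr_supp \<gamma>_supp)
    have z: "comp 0 \<zero> = \<zero>" by (rule comp_zero)
    \<comment> \<open>Membership of zero is not among the assumptions on \<open>I\<close>; a
      component of \<open>b\<close> beyond its degree bound supplies it.\<close>
    have "\<zero> \<in> I"
    proof -
      obtain j where "\<forall>w\<in>Poly_Mapping.keys (\<gamma> b). deg w < int j" using Suc.prems(3) by blast
      then have "comp j b = \<zero>"
        using Suc.prems(1) by (subst \<gamma>_eq_iff[symmetric]) (auto simp: comp \<gamma>_zero intro!: restr_none)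
      then show ?thesis using Suc.prems(2)[of j] by simp
    qed
    have "ig ?r \<in> I"
    proof (rule Suc.IH[OF r(1)])
      fix w assume "w \<in> Poly_Mapping.keys (\<gamma> (ig ?r))"
      then show "deg w < int n" using Suc.prems(3)[of w] by (simp add: r keys_restr)
    next
      fix i
      have "comp i (ig ?r) = (if i = n then \<zero> else comp i b)"
        using Suc.prems(1) r(1)
        by (subst \<gamma>_eq_iff[symmetric]) (auto simp: comp r \<gamma>_zero intro!: poly_mapping_eqI simp: lookup_restr)
      then show "comp i (ig ?r) \<in> I" using Suc.prems(2)[of i] \<open>\<zero> \<in> I\<close> by simp
    qed
    moreover have "b = comp n b \<oplus> ig ?r"
      using restr_split[of "\<gamma> b" "\<lambda>w. deg w = int n"] Suc.prems(1) r
      by (subst \<gamma>_eq_iff[symmetric]) (simp_all add: comp \<gamma>_add)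
    ultimately show ?case using I[OF Suc.prems(2)[of n]] by metis
  qed
  moreover have "\<exists>n. \<forall>w\<in>Poly_Mapping.keys (\<gamma> b). deg w < int n" by (rule deg_bounded)
  ultimately show ?thesis using b by blast
qed

section \<open>Points of Proj\<close>

lemma pointD: "p \<in> proj_points B \<Longrightarrow> primeideal p B"
  by (simp add: proj_points_def)

text \<open>A point is generated by its homogeneous elements, and these lie in the ideal described
  here; so being an ideal is what makes a point closed under taking components.\<close>

lemma graded_ideal:
  assumes p: "primeideal p B"
  shows "ideal {b \<in> carrier B. \<forall>i. comp i b \<in> p} B"
proof (rule idealI)
  note pf = E.primeideal_facts[OF p]
  show "ring B" by (rule ring_axioms)
  show "subgroup {b \<in> carrier B. \<forall>i. comp i b \<in> p} (add_monoid B)"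
  proof (rule group.subgroupI)
    show "group (add_monoid B)" by (rule add.is_group)
    show "{b \<in> carrier B. \<forall>i. comp i b \<in> p} \<noteq> {}" using pf(2) comp_zero by (auto intro!: exI[of _ \<zero>])
    fix a assume a: "a \<in> {b \<in> carrier B. \<forall>i. comp i b \<in> p}"
    have "comp i (\<ominus> a) = (\<ominus> \<one>) \<otimes> comp i a" for i
    proof -
      have "restr P (- f) = - restr P f" for P and f :: laurent
        by (rule poly_mapping_eqI) (simp add: lookup_restr)
      then show ?thesis using a by (subst \<gamma>_eq_iff[symmetric]) (simp_all add: comp \<gamma>_minus \<gamma>_mult \<gamma>_one)
    qed
    then show "inv\<^bsub>add_monoid B\<^esub> a \<in> {b \<in> carrier B. \<forall>i. comp i b \<in> p}"
      using a pf(4) unfolding a_inv_def[symmetric] by auto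
  next
    fix a b assume "a \<in> {b \<in> carrier B. \<forall>i. comp i b \<in> p}" "b \<in> {b \<in> carrier B. \<forall>i. comp i b \<in> p}"
    then show "a \<otimes>\<^bsub>add_monoid B\<^esub> b \<in> {b \<in> carrier B. \<forall>i. comp i b \<in> p}"
      using pf(6) by (auto simp: comp_add)
  qed auto
  fix b x assume b: "b \<in> {b \<in> carrier B. \<forall>i. comp i b \<in> p}" and x: "x \<in> carrier B"
  show "x \<otimes> b \<in> {b \<in> carrier B. \<forall>i. comp i b \<in> p}" using x
  proof (induction rule: hom_induct)
    case (homogeneous j a)
    then have "a \<in> carrier B" by (rule hcompD)
    then show ?case using b homogeneous pf(2,4) by (auto simp: comp_mult)
  next
    case (add a c)
    then show ?case using b pf(6) by (auto simp: l_distr comp_add)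
  qed
  then show "b \<otimes> x \<in> {b \<in> carrier B. \<forall>i. comp i b \<in> p}" using b x by (simp add: m_comm)
qed

lemma point_comp:
  assumes p: "p \<in> proj_points B" and b: "b \<in> p"
  shows "comp i b \<in> p"
proof -
  have "Idl (p \<inter> (\<Union>i. hcomp B i)) \<subseteq> {b \<in> carrier B. \<forall>i. comp i b \<in> p}"
  proof (rule genideal_minimal[OF graded_ideal[OF pointD[OF p]]])
    show "p \<inter> (\<Union>i. hcomp B i) \<subseteq> {b \<in> carrier B. \<forall>i. comp i b \<in> p}"
    proof
      fix b assume "b \<in> p \<inter> (\<Union>i. hcomp B i)"
      then obtain j where j: "b \<in> p" "b \<in> hcomp B j" by blast
      have "comp i b \<in> p" for i
        using j comp_self[OF j(2)] comp_other[OF j(2), of i] E.primeideal_facts(2)[OF pointD[OF p]]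
        by (cases "i = j") auto
      then show "b \<in> {b \<in> carrier B. \<forall>i. comp i b \<in> p}" using hcompD(1)[OF j(2)] by blast
    qed
  qed
  moreover have "p = Idl (p \<inter> (\<Union>i. hcomp B i))" using p by (simp add: proj_points_def)
  ultimately show ?thesis using b by blast
qed

lemma pointI:
  assumes p: "primeideal p B" and c: "\<And>i b. b \<in> p \<Longrightarrow> comp i b \<in> p"
    and s: "s \<in> S" "0 < deg s" "mon s \<notin> p"
  shows "p \<in> proj_points B"
proof -
  note pf = E.primeideal_facts[OF p]
  have I: "ideal p B" using p by (rule primeideal.axioms)
  let ?J = "Idl (p \<inter> (\<Union>i. hcomp B i))"
  have "?J \<subseteq> p" by (rule genideal_minimal[OF I]) auto
  moreover have "p \<subseteq> ?J"
  proof
    fix b assume b: "b \<in> p"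
    have sub: "p \<inter> (\<Union>i. hcomp B i) \<subseteq> carrier B" using pf(1) by auto
    have J: "ideal ?J B" by (rule genideal_ideal[OF sub])
    show "b \<in> ?J"
    proof (rule in_ideal_of_comps)
      show "x \<oplus> y \<in> ?J" if "x \<in> ?J" "y \<in> ?J" for x y
        using additive_subgroup.a_closed[OF ideal.axioms(1)[OF J] that] .
      show "b \<in> carrier B" using b pf(1) by blast
      show "comp i b \<in> ?J" for i
        using genideal_self[OF sub] c[OF b, of i] comp_hcomp[of b i] b pf(1) by blast
    qed
  qed
  ultimately have pJ: "p = ?J" by blast
  have "mon s \<in> hcomp B (nat (deg s))" using s by (intro hcomp_mon) auto
  moreover have "nat (deg s) \<in> {0<..}" using s by simp
  ultimately have "\<not> (\<Union>i\<in>{0<..}. hcomp B i) \<subseteq> p" using s(3) by blast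
  then show ?thesis using p pJ unfolding proj_points_def by blast
qed

text \<open>If \<open>a\<close> and \<open>b\<close> lie outside \<open>p\<close>, compare the
  lowest components outside \<open>p\<close>: their product is a component of
  \<open>a \<otimes> b\<close> modulo \<open>p\<close>, so the homogeneous case applies to
  it.\<close>

lemma primeideal_homogeneousI:
  assumes I: "ideal p B" and c: "\<And>i b. b \<in> p \<Longrightarrow> comp i b \<in> p" and one: "\<one> \<notin> p"
    and pr: "\<And>i j a b. a \<in> hcomp B i \<Longrightarrow> b \<in> hcomp B j \<Longrightarrow> a \<otimes> b \<in> p \<Longrightarrow> a \<in> p \<or> b \<in> p"
  shows "primeideal p B"
proof (rule primeidealI[OF I is_cring])
  interpret ideal p B by (rule I)
  show "carrier B \<noteq> p" using one by auto
  fix a b assume ab: "a \<in> carrier B" "b \<in> carrier B" "a \<otimes> b \<in> p"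
  show "a \<in> p \<or> b \<in> p"
  proof (rule ccontr)
    assume n: "\<not> ?thesis"
    \<comment> \<open>The components below the first bad index \<open>i\<close> all lie in
      \<open>p\<close>. Discarding them leaves an \<open>x\<close> congruent to \<open>a\<close>
      whose lowest component is outside \<open>p\<close>.\<close>
    have ex: "\<exists>i x. comp i x \<notin> p \<and> x \<in> carrier B \<and> comp i a = comp i x \<and> (\<forall>w\<in>Poly_Mapping.keys (\<gamma> x). int i \<le> deg w) \<and>
        (\<exists>y\<in>p. a = x \<oplus> y)" if a: "a \<in> carrier B" "a \<notin> p" for a
    proof -
      have "\<exists>i. comp i a \<notin> p" using in_ideal_of_comps[of p a] a a_closed by blast
      then obtain i where i: "comp i a \<notin> p" "\<And>j. j < i \<Longrightarrow> comp j a \<in> p" using exists_least_iff[of "\<lambda>i. comp i a \<notin> p"] by blast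
      let ?x = "ig (restr (\<lambda>w. \<not> deg w < int i) (\<gamma> a))" and ?y = "ig (restr (\<lambda>w. deg w < int i) (\<gamma> a))"
      have xy: "?x \<in> carrier B" "\<gamma> ?x = restr (\<lambda>w. \<not> deg w < int i) (\<gamma> a)"
         "?y \<in> carrier B" "\<gamma> ?y = restr (\<lambda>w. deg w < int i) (\<gamma> a)" using a by (simp_all add: ig restr_supp \<gamma>_supp)
      have "?y \<in> p"
      proof (rule in_ideal_of_comps)
        fix j
        have "comp j ?y = (if j < i then comp j a else \<zero>)" using a xy
          by (subst \<gamma>_eq_iff[symmetric]) (auto simp: comp xy \<gamma>_zero intro!: poly_mapping_eqI simp: lookup_restr)
        then show "comp j ?y \<in> p" using i(2) by auto
      qed (use xy a_closed in auto)
      moreover have "a = ?x \<oplus> ?y" using a xy restr_split[of "\<gamma> a" "\<lambda>w. deg w < int i"]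
        by (subst \<gamma>_eq_iff[symmetric]) (simp_all add: \<gamma>_add xy add.commute)
      moreover have "comp i a = comp i ?x" using a xy
        by (subst \<gamma>_eq_iff[symmetric]) (auto simp: comp xy intro!: poly_mapping_eqI simp: lookup_restr)
      moreover have "\<forall>w\<in>Poly_Mapping.keys (\<gamma> ?x). int i \<le> deg w" by (simp add: xy keys_restr)
      ultimately show ?thesis using i(1) xy(1) by (intro exI[of _ i] exI[of _ ?x]) auto
    qed
    obtain i x y where x: "comp i x \<notin> p" "x \<in> carrier B" "\<forall>w\<in>Poly_Mapping.keys (\<gamma> x). int i \<le> deg w" "y \<in> p" "a = x \<oplus> y"
      using ex[OF ab(1)] n by blast
    obtain j x' y' where x': "comp j x' \<notin> p" "x' \<in> carrier B" "\<forall>w\<in>Poly_Mapping.keys (\<gamma> x'). int j \<le> deg w" "y' \<in> p" "b = x' \<oplus> y'"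
      using ex[OF ab(2)] n by blast
    have yc: "y \<in> carrier B" "y' \<in> carrier B" using x(4) x'(4) by auto
    have "a \<otimes> b = x \<otimes> x' \<oplus> (x \<otimes> y' \<oplus> y \<otimes> b)"
      unfolding x(5) x'(5) using x(2) x'(2) yc by (simp add: l_distr r_distr a_ac)
    moreover have k: "x \<otimes> y' \<oplus> y \<otimes> b \<in> p" using x x' ab by (intro a_closed) (auto simp: I_l_closed I_r_closed)
    moreover have "x \<otimes> x' = (x \<otimes> x' \<oplus> (x \<otimes> y' \<oplus> y \<otimes> b)) \<oplus> \<ominus> (x \<otimes> y' \<oplus> y \<otimes> b)"
      using x(2) x'(2) yc ab by (simp add: a_assoc r_neg)
    ultimately have "x \<otimes> x' \<in> p" using ab(3) a_closed a_inv_closed by metis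
    then have "comp (i + j) (x \<otimes> x') \<in> p" by (rule c)
    moreover have "comp (i + j) (x \<otimes> x') = comp i x \<otimes> comp j x'"
      using part_mult[OF deg_add, of "\<gamma> x" "int i" "\<gamma> x'" "int j"] x x'
      by (subst \<gamma>_eq_iff[symmetric]) (simp_all add: comp \<gamma>_mult)
    ultimately show False using pr[OF comp_hcomp comp_hcomp] x x' by metis
  qed
qed

lemma zero_point: "{\<zero>} \<in> proj_points B"
proof -
  obtain s where s: "s \<in> S" "0 < deg s" using S_pos by blast
  show ?thesis
  proof (rule pointI[OF _ _ s])
    show "primeideal {\<zero>} B" using domain.zeroprimeideal[OF E.is_domain] .
    show "mon s \<notin> {\<zero>}" using \<gamma>_eq_iff[of "mon s" \<zero>] s by (simp add: mon \<gamma>_zero single_1_neq_0)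
  qed (simp add: comp_zero)
qed

abbreviation \<iota> :: "complex \<Rightarrow> laurent fract" where "\<iota> c \<equiv> to_fract (Poly_Mapping.single 0 c)"

section \<open>Homogeneous fractions of a given degree\<close>

lemma fracsI: "a \<in> hcomp B (d + e) \<Longrightarrow> f \<in> hcomp B e \<Longrightarrow> (a, f) \<in> proj_fracs B d"
  by (auto simp: proj_fracs_def)

lemma fracsE:
  assumes "(a, f) \<in> proj_fracs B d"
  obtains e where "a \<in> hcomp B (d + e)" "f \<in> hcomp B e"
  using assms by (auto simp: proj_fracs_def)

lemma fracs_carrier: "proj_fracs B d \<subseteq> carrier B \<times> carrier B"
  using hcompD(1) by (auto simp: proj_fracs_def)

lemma fracs_mult:
  assumes "(a, f) \<in> proj_fracs B d" "(b, g) \<in> proj_fracs B d'"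
  shows "(a \<otimes> b, f \<otimes> g) \<in> proj_fracs B (d + d')"
proof -
  obtain e e' where "a \<in> hcomp B (d + e)" "f \<in> hcomp B e" "b \<in> hcomp B (d' + e')" "g \<in> hcomp B e'"
    using assms by (auto elim!: fracsE)
  then show ?thesis using hcomp_mult[of a "d + e" b "d' + e'"] hcomp_mult[of f e g e']
    by (intro fracsI[where e = "e + e'"]) (simp_all add: algebra_simps)
qed

lemma fracs_add:
  assumes "(a, f) \<in> proj_fracs B d" "(b, g) \<in> proj_fracs B d"
  shows "(a \<otimes> g \<oplus> b \<otimes> f, f \<otimes> g) \<in> proj_fracs B d"
proof -
  obtain e e' where h: "a \<in> hcomp B (d + e)" "f \<in> hcomp B e" "b \<in> hcomp B (d + e')" "g \<in> hcomp B e'"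
    using assms by (auto elim!: fracsE)
  have "a \<otimes> g \<oplus> b \<otimes> f \<in> hcomp B (d + (e + e'))"
    using hcomp_mult[OF h(1,4)] hcomp_mult[OF h(3,2)] by (intro hcomp_add) (simp_all add: algebra_simps)
  then show ?thesis using hcomp_mult[OF h(2,4)] by (rule fracsI)
qed

sublocale P: frac_model B \<rho> "proj_points B" "proj_fracs B 0" \<iota>
proof (intro frac_model.intro frac_points.intro frac_points_axioms.intro frac_model_axioms.intro)
  show "embedded_domain B \<rho>" by (rule E.embedded_domain_axioms)
  show "(a \<otimes> b, f \<otimes> g) \<in> proj_fracs B 0" if "(a, f) \<in> proj_fracs B 0" "(b, g) \<in> proj_fracs B 0" for a f b g
    using fracs_mult[OF that] by simp
  show "(\<ominus> a, f) \<in> proj_fracs B 0" if "(a, f) \<in> proj_fracs B 0" for a f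
    using that by (auto elim!: fracsE intro: fracsI[where e = e for e] hcomp_minus)
  show "(\<one>, \<one>) \<in> proj_fracs B 0" by (rule fracsI[where e = 0]) (simp_all add: hcomp_one)
  show "(\<zero>, \<one>) \<in> proj_fracs B 0" by (rule fracsI[where e = 0]) (simp_all add: hcomp_one hcomp_zero)
  show "(scal B c, \<one>) \<in> proj_fracs B 0" for c by (rule fracsI[where e = 0]) (simp_all add: hcomp_one hcomp_scal)
qed (simp_all add: pointD zero_point fracs_carrier fracs_add \<rho>_def \<gamma>_scal)

lemma Proj_frac_space: "Proj B = frac_space B (proj_points B) (proj_fracs B 0)"
  by (simp add: Proj_def)

lemma tp_Proj: "tp (Proj B) = zariski B (proj_points B)"
  by (simp add: Proj_def frac_space_def)

abbreviation ploc :: "'a set \<Rightarrow> laurent fract set" where "ploc p \<equiv> E.floc (proj_fracs B 0) p"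

lemma point_mult: "p \<in> proj_points B \<Longrightarrow> a \<in> carrier B \<Longrightarrow> b \<in> carrier B \<Longrightarrow> a \<otimes> b \<in> p \<longleftrightarrow> a \<in> p \<or> b \<in> p"
  using E.primeideal_facts(5)[OF pointD] by blast

lemma point_pow: "p \<in> proj_points B \<Longrightarrow> a \<in> carrier B \<Longrightarrow> 0 < n \<Longrightarrow> a [^] (n::nat) \<in> p \<longleftrightarrow> a \<in> p"
proof (induction n)
  case (Suc n)
  then show ?case
    by (cases "n = 0") (auto simp: point_mult E.primeideal_facts(3)[OF pointD])
qed simp

lemma point_cmul:
  assumes p: "p \<in> proj_points B" and s: "s \<in> S" "mon s \<notin> p"
  shows "mon (frag_cmul (int n) s) \<notin> p"
proof (induction n)
  case 0 then show ?case using E.primeideal_facts(3)[OF pointD[OF p]] by (simp add: mon_0)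
next
  case (Suc n)
  then show ?case unfolding frag_cmul_Suc using mon_add[OF S_cmul s(1)] s
    by (simp add: point_mult[OF p] mon S_cmul[OF s(1)])
qed

text \<open>A prime that contains all monomials of positive degree contains the irrelevant ideal.\<close>

lemma point_monomial:
  assumes p: "p \<in> proj_points B"
  obtains s where "s \<in> S" "0 < deg s" "mon s \<notin> p"
proof -
  note pf = E.primeideal_facts[OF pointD[OF p]]
  have "\<not> (\<Union>i\<in>{0<..}. hcomp B i) \<subseteq> p" using p by (simp add: proj_points_def)
  then obtain i b where b: "0 < i" "b \<in> hcomp B i" "b \<notin> p" by auto
  show ?thesis
  proof (rule ccontr)
    assume "\<not> thesis"
    then have all: "mon s \<in> p" if "s \<in> S" "0 < deg s" for s using that \<open>\<And>s. s \<in> S \<Longrightarrow> 0 < deg s \<Longrightarrow> mon s \<notin> p \<Longrightarrow> thesis\<close> by blast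
    have "ig (sum (\<lambda>w. Poly_Mapping.single w (c w)) K) \<in> p"
      if "finite K" "\<And>w. w \<in> K \<Longrightarrow> w \<in> S \<and> 0 < deg w" for K c using that
    proof (induction K)
      case empty
      have "ig 0 = \<zero>" using ig[of 0] \<gamma>_eq_iff[of "ig 0" \<zero>] by (simp add: supp_on_closed \<gamma>_zero)
      then show ?case using pf(2) by simp
    next
      case (insert w K)
      let ?f = "sum (\<lambda>w. Poly_Mapping.single w (c w)) K"
      have f: "?f \<in> supp_on S" using insert by (intro supp_on_sum supp_on_single) auto
      have w: "w \<in> S" "mon w \<in> p" using insert all by auto
      have fw: "Poly_Mapping.single w (c w) + ?f \<in> supp_on S" using f w by (intro supp_on_closed supp_on_single)
      have "ig (sum (\<lambda>w. Poly_Mapping.single w (c w)) (insert w K)) = (scal B (c w) \<otimes> mon w) \<oplus> ig ?f"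
        using insert f w fw ig[OF f] ig[OF fw]
        by (subst \<gamma>_eq_iff[symmetric]) (simp_all add: mon scal_closed \<gamma>_add \<gamma>_mult \<gamma>_scal mult_single)
      moreover have "ig ?f \<in> p" using insert by auto
      ultimately show ?case using pf(4)[OF scal_closed w(2)] pf(6) by simp
    qed
    from this[of "Poly_Mapping.keys (\<gamma> b)" "Poly_Mapping.lookup (\<gamma> b)"]
    have "ig (\<gamma> b) \<in> p"
      unfolding pm_expand[symmetric] using b hcompD[OF b(2)] supp_onD[OF \<gamma>_supp] by auto
    moreover have "ig (\<gamma> b) = b"
      using ig[OF \<gamma>_supp[OF hcompD(1)[OF b(2)]]] hcompD(1)[OF b(2)] \<gamma>_eq_iff by metis
    ultimately show False using b(3) by simp
  qed
qed

end

section \<open>Affine charts\<close>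

context mono_alg
begin

definition chart :: "grp \<Rightarrow> 'a set set" where
  "chart s = {p \<in> proj_points B. mon s \<notin> p}"

definition chart_ring :: "grp \<Rightarrow> laurent fract set" where
  "chart_ring s = to_fract ` supp_on (localized deg s S)"

definition chart_nonunits :: "grp \<Rightarrow> 'a set \<Rightarrow> laurent fract set" where
  "chart_nonunits s p = {\<phi> \<in> chart_ring s. \<phi> = 0 \<or> inverse \<phi> \<notin> ploc p}"

lemma subring_chart_ring: "subring_in (chart_ring s)"
proof -
  note mon = supp_on_monoid[OF localized_monoid[OF S_monoid deg_add, of s]]
  have "0 \<in> chart_ring s" "1 \<in> chart_ring s"
    using supp_on_closed(2) mon(2) by (force simp: chart_ring_def image_iff)+
  moreover have "- a \<in> chart_ring s" if "a \<in> chart_ring s" for a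
    using that supp_on_closed(3) by (force simp: chart_ring_def image_iff simp flip: to_fract_uminus)
  moreover have "a + b \<in> chart_ring s \<and> a * b \<in> chart_ring s" if ab: "a \<in> chart_ring s" "b \<in> chart_ring s" for a b
  proof -
    obtain f g where fg: "f \<in> supp_on (localized deg s S)" "g \<in> supp_on (localized deg s S)" "a = to_fract f" "b = to_fract g"
      using ab by (auto simp: chart_ring_def)
    have "a + b = to_fract (f + g)" "a * b = to_fract (f * g)" using fg by simp_all
    then show ?thesis unfolding chart_ring_def using supp_on_closed(1)[OF fg(1,2)] mon(1)[OF fg(1,2)] by blast
  qed
  ultimately show ?thesis unfolding subring_in_def by blast
qed

lemma open_chart: "s \<in> S \<Longrightarrow> openin (zariski B (proj_points B)) (chart s)"
  unfolding chart_def by (rule P.open_basic) (rule mon)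

context
  fixes s :: grp and d :: nat
  assumes s: "s \<in> S" and d: "deg s = int d" "0 < d"
begin

definition ms :: "nat \<Rightarrow> laurent fract" where
  "ms n = \<rho> (mon (frag_cmul (int n) s))"

lemma ms_eq: "ms n = to_fract (Poly_Mapping.single (frag_cmul (int n) s) 1)"
  by (simp add: ms_def \<rho>_def mon S_cmul s)

lemma ms_ne: "ms n \<noteq> 0"
  by (simp add: ms_eq single_1_neq_0)

lemma ms_add: "ms (m + n) = ms m * ms n"
  by (simp add: ms_eq frag_cmul_distrib mult_single flip: to_fract_mult)

lemma ms_0: "ms 0 = 1"
  by (simp add: ms_eq)

lemma mon_hcomp: "mon (frag_cmul (int n) s) \<in> hcomp B (n * d)"
  by (rule hcomp_mon) (simp_all add: S_cmul s deg_cmul d)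

lemma chart_ringI:
  assumes x: "x \<in> hcomp B (n * d)"
  shows "\<rho> x / ms n \<in> chart_ring s"
proof -
  let ?f = "\<gamma> x * Poly_Mapping.single (- frag_cmul (int n) s) 1"
  have "?f * Poly_Mapping.single (frag_cmul (int n) s) 1 = \<gamma> x"
    by (simp add: mult.assoc mult_single del: minus_frag_cmul)
  then have "to_fract ?f * ms n = \<rho> x" by (simp add: ms_eq \<rho>_def flip: to_fract_mult)
  then have "\<rho> x / ms n = to_fract ?f" using ms_ne by (simp add: field_simps)
  moreover have "?f \<in> supp_on (localized deg s S)"
  proof (rule supp_on_mult[where S = "{w \<in> S. deg w = int (n * d)}" and T = "{- frag_cmul (int n) s}"])
    show "\<gamma> x \<in> supp_on {w \<in> S. deg w = int (n * d)}"
      using hcompD[OF x] \<gamma>_supp[of x] by (auto simp: supp_on_def)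
    fix a b assume ab: "a \<in> {w \<in> S. deg w = int (n * d)}" "b \<in> {- frag_cmul (int n) s}"
    have "deg (a + b) = 0" using ab by (simp add: additive_fun_add[OF deg_add] additive_fun_minus[OF deg_add] deg_cmul d del: minus_frag_cmul)
    moreover have "(a + b) + frag_cmul (int n) s \<in> S" using ab by (simp del: minus_frag_cmul)
    ultimately show "a + b \<in> localized deg s S" unfolding localized_def by blast
  qed (simp add: supp_on_single)
  ultimately show ?thesis unfolding chart_ring_def by (simp only: imageI)
qed

text \<open>Each of the finitely many exponents needs some multiple of \<open>s\<close> to get into
  \<open>S\<close>; the sum of these multiples is a common denominator.\<close>

lemma chart_ringE:
  assumes "\<phi> \<in> chart_ring s"
  obtains n x where "x \<in> hcomp B (n * d)" "\<phi> = \<rho> x / ms n"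
proof -
  obtain f where f: "f \<in> supp_on (localized deg s S)" "\<phi> = to_fract f" using assms by (auto simp: chart_ring_def)
  have "\<exists>n. w + frag_cmul (int n) s \<in> S" if "w \<in> Poly_Mapping.keys f" for w
    using supp_onD[OF f(1) that] by (auto simp: localized_def)
  then obtain N where N: "\<And>w. w \<in> Poly_Mapping.keys f \<Longrightarrow> w + frag_cmul (int (N w)) s \<in> S" by metis
  define n where "n = (\<Sum>w\<in>Poly_Mapping.keys f. N w)"
  let ?g = "f * Poly_Mapping.single (frag_cmul (int n) s) 1"
  have g: "?g \<in> supp_on {w \<in> S. deg w = int (n * d)}"
  proof (rule supp_on_mult[where S = "Poly_Mapping.keys f" and T = "{frag_cmul (int n) s}"])
    fix a b assume ab: "a \<in> Poly_Mapping.keys f" "b \<in> {frag_cmul (int n) s}"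
    have "N a \<le> n" unfolding n_def by (rule member_le_sum) (use ab in auto)
    then have "int (N a) + int (n - N a) = int n" by simp
    then have "frag_cmul (int n) s = frag_cmul (int (N a)) s + frag_cmul (int (n - N a)) s"
      by (simp only: frag_cmul_distrib[symmetric])
    then have "a + b = (a + frag_cmul (int (N a)) s) + frag_cmul (int (n - N a)) s"
      using ab(2) by (simp only: add.assoc singleton_iff)
    also have "\<dots> \<in> S" by (rule S_add[OF N[OF ab(1)] S_cmul[OF s]])
    finally have "a + b \<in> S" .
    moreover have "deg a = 0" using supp_onD[OF f(1) ab(1)] by (simp add: localized_def)
    ultimately show "a + b \<in> {w \<in> S. deg w = int (n * d)}" using ab
      by (simp add: additive_fun_add[OF deg_add] deg_cmul d)
  qed (auto simp: supp_on_def)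
  have gS: "?g \<in> supp_on S" by (rule supp_on_mono[OF _ g]) auto
  have "ig ?g \<in> hcomp B (n * d)" unfolding hcomp_eq mem_Collect_eq ig(2)[OF gS]
    using g ig(1)[OF gS] by (auto simp: supp_on_def)
  moreover have "\<phi> = \<rho> (ig ?g) / ms n"
  proof -
    have "\<rho> (ig ?g) = \<phi> * ms n" by (simp add: \<rho>_def ig gS f ms_eq)
    then show ?thesis using ms_ne by simp
  qed
  ultimately show ?thesis by (rule that)
qed

lemma chart_ring_ploc:
  assumes p: "p \<in> chart s" and \<phi>: "\<phi> \<in> chart_ring s"
  shows "\<phi> \<in> ploc p"
proof -
  obtain n x where x: "x \<in> hcomp B (n * d)" "\<phi> = \<rho> x / ms n" using chart_ringE[OF \<phi>] by blast
  have "mon (frag_cmul (int n) s) \<notin> p" using p s by (intro point_cmul) (auto simp: chart_def)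
  moreover have "(x, mon (frag_cmul (int n) s)) \<in> proj_fracs B 0"
    using x mon_hcomp by (intro fracsI[where e = "n * d"]) auto
  moreover have "\<rho> x = \<phi> * \<rho> (mon (frag_cmul (int n) s))"
    using x(2) ms_ne[of n] by (simp add: ms_def[symmetric])
  ultimately show ?thesis by (intro E.flocI)
qed

text \<open>If \<open>x\<close> lies outside \<open>p\<close>, inverting the fraction gives a
  legitimate germ. If \<open>x\<close> lies in \<open>p\<close>, an inverse germ
  \<open>a / f\<close> would put the product of \<open>f\<close> and a power of the monomial into
  \<open>p\<close>, although both factors are outside.\<close>

lemma nonunit_iff:
  assumes p: "p \<in> chart s" and x: "x \<in> hcomp B (n * d)"
  shows "\<rho> x / ms n \<in> chart_nonunits s p \<longleftrightarrow> x \<in> p"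
proof -
  have pp: "p \<in> proj_points B" using p by (simp add: chart_def)
  have mp: "mon (frag_cmul (int n) s) \<notin> p" using p s by (intro point_cmul) (auto simp: chart_def)
  have xc: "x \<in> carrier B" using hcompD[OF x] by blast
  have mc: "mon (frag_cmul (int n) s) \<in> carrier B" by (simp add: mon S_cmul s)
  show ?thesis
  proof
    assume nu: "\<rho> x / ms n \<in> chart_nonunits s p"
    show "x \<in> p"
    proof (rule ccontr)
      assume xp: "x \<notin> p"
      have "\<rho> x \<noteq> 0" using E.\<rho>_notin_prime[OF pointD[OF pp] xc xp] .
      moreover have "inverse (\<rho> x / ms n) \<in> ploc p"
        using xp x mon_hcomp[of n] calculation
        by (intro E.flocI[of "mon (frag_cmul (int n) s)" x] fracsI[where e = "n * d"]) (simp_all add: ms_def)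
      ultimately show False using nu ms_ne by (simp add: chart_nonunits_def)
    qed
  next
    assume xp: "x \<in> p"
    have "\<rho> x / ms n = 0 \<or> inverse (\<rho> x / ms n) \<notin> ploc p"
    proof (rule disjCI)
      assume "\<not> inverse (\<rho> x / ms n) \<notin> ploc p"
      then have "inverse (\<rho> x / ms n) \<in> ploc p" by simp
      then obtain a f where af: "(a, f) \<in> proj_fracs B 0" "f \<notin> p" "\<rho> a = inverse (\<rho> x / ms n) * \<rho> f"
        by (rule E.flocE)
      have afc: "a \<in> carrier B" "f \<in> carrier B" using af(1) fracs_carrier by auto
      show "\<rho> x / ms n = 0"
      proof (rule ccontr)
        assume "\<rho> x / ms n \<noteq> 0"
        then have "\<rho> a * \<rho> x = ms n * \<rho> f" using af(3) by (auto simp: field_simps)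
        then have "a \<otimes> x = mon (frag_cmul (int n) s) \<otimes> f"
          using afc xc mc by (subst E.\<rho>_eq_iff[symmetric]) (simp_all add: E.\<rho>_mult ms_def)
        moreover have "a \<otimes> x \<in> p" using E.primeideal_facts(4)[OF pointD[OF pp] afc(1) xp] .
        ultimately show False using point_mult[OF pp mc afc(2)] mp af(2) by simp
      qed
    qed
    then show "\<rho> x / ms n \<in> chart_nonunits s p" using chart_ringI[OF x] by (simp add: chart_nonunits_def)
  qed
qed

lemma chart_frac:
  assumes p: "p \<in> chart s" and \<phi>: "\<phi> \<in> ploc p"
  shows "\<exists>a\<in>chart_ring s. \<exists>b\<in>chart_ring s. b \<notin> chart_nonunits s p \<and> \<phi> = a / b"
proof -
  have pp: "p \<in> proj_points B" using p by (simp add: chart_def)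
  obtain a f where af: "(a, f) \<in> proj_fracs B 0" "f \<notin> p" "\<rho> a = \<phi> * \<rho> f" using \<phi> by (rule E.flocE)
  obtain e where e: "a \<in> hcomp B e" "f \<in> hcomp B e" using af(1) by (auto elim: fracsE)
  have afc: "a \<in> carrier B" "f \<in> carrier B" using hcompD e by auto
  \<comment> \<open>Fractions on the chart need a denominator of degree divisible by
    \<open>d\<close>; multiplying numerator and denominator by the power \<open>d - 1\<close> of
    \<open>f\<close> achieves this.\<close>
  obtain k where k: "d = Suc k" using d(2) by (cases d) auto
  define x where "x = a \<otimes> f [^] k"
  define y where "y = f \<otimes> f [^] k"
  have "x \<in> hcomp B (e + k * e)" "y \<in> hcomp B (e + k * e)"
    unfolding x_def y_def by (intro hcomp_mult hcomp_pow e)+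
  then have xy: "x \<in> hcomp B (e * d)" "y \<in> hcomp B (e * d)" by (simp_all add: k algebra_simps)
  have y_pow: "y = f [^] d" using afc by (simp add: y_def k m_comm)
  have yp: "y \<notin> p" unfolding y_pow using point_pow[OF pp afc(2) d(2)] af(2) by simp
  have "\<rho> y \<noteq> 0" using E.\<rho>_notin_prime[OF pointD[OF pp] hcompD(1)[OF xy(2)] yp] .
  then have "\<phi> = (\<rho> x / ms e) / (\<rho> y / ms e)"
    using af(3) afc ms_ne by (auto simp: x_def y_def E.\<rho>_mult field_simps)
  moreover have "\<rho> y / ms e \<notin> chart_nonunits s p" using nonunit_iff[OF p xy(2)] yp by simp
  ultimately show ?thesis using chart_ringI[OF xy(1)] chart_ringI[OF xy(2)] by blast
qed

lemma common_den:
  assumes "x \<in> hcomp B (n * d)" "y \<in> hcomp B (m * d)"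
  shows "\<rho> x / ms n + \<rho> y / ms m = \<rho> (x \<otimes> mon (frag_cmul (int m) s) \<oplus> y \<otimes> mon (frag_cmul (int n) s)) / ms (n + m)"
    "x \<otimes> mon (frag_cmul (int m) s) \<oplus> y \<otimes> mon (frag_cmul (int n) s) \<in> hcomp B ((n + m) * d)"
    "(\<rho> x / ms n) * (\<rho> y / ms m) = \<rho> (x \<otimes> y) / ms (n + m)" "x \<otimes> y \<in> hcomp B ((n + m) * d)"
proof -
  have c: "x \<in> carrier B" "y \<in> carrier B" using assms hcompD by auto
  have mc: "mon (frag_cmul (int n) s) \<in> carrier B" for n by (simp add: mon S_cmul s)
  show "\<rho> x / ms n + \<rho> y / ms m = \<rho> (x \<otimes> mon (frag_cmul (int m) s) \<oplus> y \<otimes> mon (frag_cmul (int n) s)) / ms (n + m)"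
    using c mc ms_ne by (simp add: E.\<rho>_add E.\<rho>_mult ms_add ms_def[symmetric] field_simps)
  show "(\<rho> x / ms n) * (\<rho> y / ms m) = \<rho> (x \<otimes> y) / ms (n + m)"
    using c by (simp add: E.\<rho>_mult ms_add)
  show "x \<otimes> y \<in> hcomp B ((n + m) * d)" using hcomp_mult[OF assms] by (simp add: algebra_simps)
  show "x \<otimes> mon (frag_cmul (int m) s) \<oplus> y \<otimes> mon (frag_cmul (int n) s) \<in> hcomp B ((n + m) * d)"
    using hcomp_mult[OF assms(1) mon_hcomp[of m]] hcomp_mult[OF assms(2) mon_hcomp[of n]]
    by (intro hcomp_add) (simp_all add: algebra_simps)
qed

lemma chart_prime:
  assumes p: "p \<in> chart s"
  shows "prime_in (chart_ring s) (chart_nonunits s p)"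
proof -
  have pp: "p \<in> proj_points B" using p by (simp add: chart_def)
  note pf = E.primeideal_facts[OF pointD[OF pp]]
  have mc: "mon (frag_cmul (int n) s) \<in> carrier B" for n by (simp add: mon S_cmul s)
  have nuE: "\<exists>n x. x \<in> hcomp B (n * d) \<and> x \<in> p \<and> \<phi> = \<rho> x / ms n" if "\<phi> \<in> chart_nonunits s p" for \<phi>
  proof -
    have "\<phi> \<in> chart_ring s" using that by (simp add: chart_nonunits_def)
    then obtain n x where "x \<in> hcomp B (n * d)" "\<phi> = \<rho> x / ms n" by (rule chart_ringE)
    then show ?thesis using nonunit_iff[OF p] that by blast
  qed
  show ?thesis unfolding prime_in_def
  proof (intro conjI ballI impI)
    show "chart_nonunits s p \<subseteq> chart_ring s" by (auto simp: chart_nonunits_def)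
    show "0 \<in> chart_nonunits s p" using subring_chart_ring by (simp add: chart_nonunits_def subring_in_def)
    show "1 \<notin> chart_nonunits s p" using P.FS.loc_1[of p] pp by (simp add: chart_nonunits_def frac_space_def P.topspace_zariski)
    fix a b assume "a \<in> chart_nonunits s p" "b \<in> chart_nonunits s p"
    then obtain n x m y where x: "x \<in> hcomp B (n * d)" "x \<in> p" "a = \<rho> x / ms n"
      and y: "y \<in> hcomp B (m * d)" "y \<in> p" "b = \<rho> y / ms m" using nuE by metis
    have "x \<otimes> mon (frag_cmul (int m) s) \<oplus> y \<otimes> mon (frag_cmul (int n) s) \<in> p"
      using x y mc pf(1,5,6) hcompD(1) by (metis)
    then show "a + b \<in> chart_nonunits s p"
      unfolding x y common_den(1)[OF x(1) y(1)] using nonunit_iff[OF p common_den(2)[OF x(1) y(1)]] by simp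
  next
    fix a b assume "a \<in> chart_ring s" "b \<in> chart_nonunits s p"
    then obtain n x m y where x: "x \<in> hcomp B (n * d)" "a = \<rho> x / ms n"
      and y: "y \<in> hcomp B (m * d)" "y \<in> p" "b = \<rho> y / ms m" using nuE chart_ringE by metis
    have "x \<otimes> y \<in> p" using pf(4)[OF hcompD(1)[OF x(1)] y(2)] .
    then show "a * b \<in> chart_nonunits s p"
      unfolding x y common_den(3)[OF x(1) y(1)] using nonunit_iff[OF p common_den(4)[OF x(1) y(1)]] by simp
  next
    fix a b assume ab: "a \<in> chart_ring s" "b \<in> chart_ring s" "a * b \<in> chart_nonunits s p"
    obtain n x where x: "x \<in> hcomp B (n * d)" "a = \<rho> x / ms n" using ab(1) by (rule chart_ringE)
    obtain m y where y: "y \<in> hcomp B (m * d)" "b = \<rho> y / ms m" using ab(2) by (rule chart_ringE)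
    have "a * b = \<rho> (x \<otimes> y) / ms (n + m)" unfolding x y by (rule common_den(3)[OF x(1) y(1)])
    then have "x \<otimes> y \<in> p" using ab(3) nonunit_iff[OF p common_den(4)[OF x(1) y(1)]] by simp
    then have "x \<in> p \<or> y \<in> p" using point_mult[OF pp hcompD(1)[OF x(1)] hcompD(1)[OF y(1)]] by simp
    then show "a \<in> chart_nonunits s p \<or> b \<in> chart_nonunits s p"
      using nonunit_iff[OF p x(1)] nonunit_iff[OF p y(1)] x y by blast
  qed
qed

text \<open>A homogeneous element of degree \<open>i\<close> can be divided by a power of the
  monomial only after raising it to the power \<open>d\<close>. A prime does not notice this
  power.\<close>

lemma hom_nonunit_iff:
  assumes p: "p \<in> chart s" and b: "b \<in> hcomp B i"
  shows "\<rho> (b [^] d) / ms i \<in> chart_nonunits s p \<longleftrightarrow> b \<in> p"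
proof -
  have "b [^] d \<in> hcomp B (i * d)" using hcomp_pow[OF b, of d] by (simp add: mult.commute)
  then show ?thesis using nonunit_iff[OF p] point_pow[OF _ hcompD(1)[OF b] d(2)] p by (auto simp: chart_def)
qed

text \<open>A point is determined by its homogeneous elements, and those are visible on the chart
  through their \<open>d\<close>-th powers.\<close>

lemma chart_inj:
  assumes p: "p \<in> chart s" and q: "q \<in> chart s" and eq: "chart_nonunits s p = chart_nonunits s q"
  shows "p = q"
proof -
  have sub: "p \<subseteq> q" if p: "p \<in> chart s" and q: "q \<in> chart s" and eq: "chart_nonunits s p = chart_nonunits s q" for p q
  proof
    fix b assume b: "b \<in> p"
    have pp: "p \<in> proj_points B" "q \<in> proj_points B" using p q by (simp_all add: chart_def)
    have bc: "b \<in> carrier B" using b E.primeideal_facts(1)[OF pointD[OF pp(1)]] by blast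
    show "b \<in> q"
    proof (rule in_ideal_of_comps[OF _ bc])
      show "a \<oplus> b \<in> q" if "a \<in> q" "b \<in> q" for a b using E.primeideal_facts(6)[OF pointD[OF pp(2)] that] .
      show "comp i b \<in> q" for i
        using hom_nonunit_iff[OF p comp_hcomp[OF bc, of i]] hom_nonunit_iff[OF q comp_hcomp[OF bc, of i]]
          point_comp[OF pp(1) b] eq by simp
    qed
  qed
  show ?thesis using sub[OF p q eq] sub[OF q p eq[symmetric]] by blast
qed

lemma chart_basis:
  assumes U: "openin (zariski B (proj_points B)) U" and p: "p \<in> U" "p \<in> chart s"
  shows "\<exists>b\<in>chart_ring s. b \<notin> chart_nonunits s p \<and> {q \<in> chart s. b \<notin> chart_nonunits s q} \<subseteq> U"
proof -
  have pp: "p \<in> proj_points B" using p by (simp add: chart_def)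
  obtain f where f: "f \<in> carrier B" "f \<notin> p" "{q \<in> proj_points B. f \<notin> q} \<subseteq> U" using P.open_nbhd[OF U p(1)] .
  obtain i where i: "comp i f \<notin> p"
    using in_ideal_of_comps[of p f] f E.primeideal_facts(6)[OF pointD[OF pp]] by blast
  note h = comp_hcomp[OF f(1), of i]
  have "\<rho> (comp i f [^] d) / ms i \<in> chart_ring s"
    using hcomp_pow[OF h, of d] by (intro chart_ringI) (simp add: mult.commute)
  moreover have "\<rho> (comp i f [^] d) / ms i \<notin> chart_nonunits s p" using hom_nonunit_iff[OF p(2) h] i by simp
  moreover have "{q \<in> chart s. \<rho> (comp i f [^] d) / ms i \<notin> chart_nonunits s q} \<subseteq> U"
  proof
    fix q assume "q \<in> {q \<in> chart s. \<rho> (comp i f [^] d) / ms i \<notin> chart_nonunits s q}"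
    then have q: "q \<in> chart s" "comp i f \<notin> q" using hom_nonunit_iff[OF _ h] by auto
    then have "f \<notin> q" using point_comp by (auto simp: chart_def)
    then show "q \<in> U" using q f(3) by (auto simp: chart_def)
  qed
  ultimately show ?thesis by blast
qed

lemma chart_surj:
  assumes P: "prime_in (chart_ring s) P"
  shows "\<exists>p\<in>chart s. chart_nonunits s p = P"
proof -
  have PA: "P \<subseteq> chart_ring s" and P0: "0 \<in> P" and P1: "1 \<notin> P" and Padd: "\<And>a b. a \<in> P \<Longrightarrow> b \<in> P \<Longrightarrow> a + b \<in> P"
    and Pmul: "\<And>a b. a \<in> chart_ring s \<Longrightarrow> b \<in> P \<Longrightarrow> a * b \<in> P"
    and Pprime: "\<And>a b. a \<in> chart_ring s \<Longrightarrow> b \<in> chart_ring s \<Longrightarrow> a * b \<in> P \<Longrightarrow> a \<in> P \<or> b \<in> P"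
    using P by (auto simp: prime_in_def)
  \<comment> \<open>The homogeneous prime over \<open>P\<close>: a component belongs to it when all
    its multiples of degree divisible by \<open>d\<close> give elements of \<open>P\<close> after
    division. Quantifying over all complementary factors \<open>c\<close>, instead of using
    \<open>d\<close>-th powers, makes closure under addition immediate.\<close>
  define p where "p = {b \<in> carrier B. \<forall>i k n c. c \<in> hcomp B k \<longrightarrow> i + k = n * d \<longrightarrow> \<rho> (comp i b \<otimes> c) / ms n \<in> P}"
  have pD: "\<rho> (comp i b \<otimes> c) / ms n \<in> P" if "b \<in> p" "c \<in> hcomp B k" "i + k = n * d" for b i k n c
    using that by (simp add: p_def)
  have ring: "\<rho> (comp i b \<otimes> c) / ms n \<in> chart_ring s" if "b \<in> carrier B" "c \<in> hcomp B k" "i + k = n * d" for b i k n c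
    using hcomp_mult[OF comp_hcomp[OF that(1)] that(2), of i] that(3) by (intro chart_ringI) simp
  have hom_p: "b \<in> p" if b: "b \<in> hcomp B i" and v: "\<And>k n c. c \<in> hcomp B k \<Longrightarrow> i + k = n * d \<Longrightarrow> \<rho> (b \<otimes> c) / ms n \<in> P" for i b
  proof -
    have "\<rho> (comp j b \<otimes> c) / ms n \<in> P" if "c \<in> hcomp B k" "j + k = n * d" for j k n c
      using v that comp_self[OF b] comp_other[OF b, of j] P0 hcompD(1)[OF that(1)]
      by (cases "i = j") (auto simp: E.\<rho>_zero)
    then show ?thesis using hcompD(1)[OF b] by (simp add: p_def)
  qed
  have pc: "p \<subseteq> carrier B" by (auto simp: p_def)
  have padd: "a \<oplus> b \<in> p" if "a \<in> p" "b \<in> p" for a b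
  proof -
    have c: "a \<in> carrier B" "b \<in> carrier B" using that pc by auto
    have "\<rho> (comp i (a \<oplus> b) \<otimes> x) / ms n \<in> P" if x: "x \<in> hcomp B k" "i + k = n * d" for i k n x
      using Padd[OF pD[OF \<open>a \<in> p\<close> x] pD[OF \<open>b \<in> p\<close> x]] c hcompD(1)[OF x(1)]
      by (simp add: comp_add comp l_distr E.\<rho>_add add_divide_distrib)
    then show ?thesis using c by (simp add: p_def)
  qed
  have pmul: "a \<otimes> b \<in> p" if a: "a \<in> carrier B" and bp: "b \<in> p" for a b using a
  proof (induction rule: hom_induct)
    case (homogeneous j a)
    have c: "a \<in> carrier B" "b \<in> carrier B" using homogeneous hcompD bp pc by auto
    have "\<rho> (comp i (a \<otimes> b) \<otimes> x) / ms n \<in> P" if x: "x \<in> hcomp B k" "i + k = n * d" for i k n x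
    proof (cases "j \<le> i")
      case True
      have xc: "x \<in> carrier B" by (rule hcompD(1)[OF x(1)])
      have "\<rho> (comp (i - j) b \<otimes> (a \<otimes> x)) / ms n \<in> P"
        by (rule pD[OF bp hcomp_mult[OF homogeneous x(1)]]) (use True x in simp)
      then show ?thesis using c xc True comp(1)[OF c(2)] comp_mult[OF homogeneous c(2), of i] by (simp add: m_ac)
    next
      case False
      then show ?thesis using comp_mult[OF homogeneous c(2), of i] hcompD(1)[OF x(1)] P0 by (simp add: E.\<rho>_zero)
    qed
    then show ?case using c by (simp add: p_def)
  next
    case (add a c)
    then show ?case using bp pc padd by (auto simp: l_distr)
  qed
  have one: "\<one> \<notin> p"
  proof
    assume "\<one> \<in> p"
    from pD[OF this hcomp_one, of 0 0] show False
      using P1 comp_self[OF hcomp_one] by (simp add: E.\<rho>_one ms_0)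
  qed
  have idl: "ideal p B"
  proof (rule idealI)
    show "ring B" by (rule ring_axioms)
    show "subgroup p (add_monoid B)"
    proof (rule group.subgroupI)
      show "group (add_monoid B)" by (rule add.is_group)
      show "p \<subseteq> carrier (add_monoid B)" using pc by simp
      have "\<zero> \<in> p" using P0 by (intro hom_p[OF hcomp_zero]) (auto simp: E.\<rho>_zero dest: hcompD(1))
      then show "p \<noteq> {}" by blast
      fix a assume a: "a \<in> p"
      have "(\<ominus> \<one>) \<otimes> a \<in> p" using a by (intro pmul) auto
      moreover have "(\<ominus> \<one>) \<otimes> a = \<ominus> a" using a pc by (auto simp: l_minus)
      ultimately show "inv\<^bsub>add_monoid B\<^esub> a \<in> p" by (simp add: a_inv_def[symmetric])
    qed (simp add: padd)
    fix a x assume ax: "a \<in> p" "x \<in> carrier B"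
    show xa: "x \<otimes> a \<in> p" using pmul[OF ax(2,1)] .
    show "a \<otimes> x \<in> p" using m_comm[OF ax(2) subsetD[OF pc ax(1)]] xa by simp
  qed
  have pcomp: "comp i b \<in> p" if b: "b \<in> p" for i b
    using pD[OF b] b pc by (intro hom_p[OF comp_hcomp]) auto
  have prime: "primeideal p B"
  proof (rule primeideal_homogeneousI[OF idl pcomp one])
    fix i j a b assume ab: "a \<in> hcomp B i" "b \<in> hcomp B j" "a \<otimes> b \<in> p"
    note c = hcompD(1)[OF ab(1)] hcompD(1)[OF ab(2)]
    show "a \<in> p \<or> b \<in> p"
    proof (rule ccontr)
      assume "\<not> ?thesis"
      then obtain k n x k' n' x' where x: "x \<in> hcomp B k" "i + k = n * d" "\<rho> (a \<otimes> x) / ms n \<notin> P"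
        and x': "x' \<in> hcomp B k'" "j + k' = n' * d" "\<rho> (b \<otimes> x') / ms n' \<notin> P"
        using hom_p[OF ab(1)] hom_p[OF ab(2)] by metis
      have xc: "x \<in> carrier B" "x' \<in> carrier B" using hcompD x x' by auto
      have ax: "a \<otimes> x \<in> hcomp B (n * d)" "b \<otimes> x' \<in> hcomp B (n' * d)"
        using hcomp_mult[OF ab(1) x(1)] hcomp_mult[OF ab(2) x'(1)] x x' by simp_all
      have "\<rho> (comp (i + j) (a \<otimes> b) \<otimes> (x \<otimes> x')) / ms (n + n') \<in> P"
        by (rule pD[OF ab(3) hcomp_mult[OF x(1) x'(1)]]) (use x(2) x'(2) in \<open>simp add: algebra_simps\<close>)
      also have "comp (i + j) (a \<otimes> b) = a \<otimes> b" by (rule comp_self[OF hcomp_mult[OF ab(1,2)]])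
      also have "\<rho> (a \<otimes> b \<otimes> (x \<otimes> x')) / ms (n + n') = (\<rho> (a \<otimes> x) / ms n) * (\<rho> (b \<otimes> x') / ms n')"
        using c xc by (simp add: E.\<rho>_mult ms_add)
      finally show False using Pprime[OF chart_ringI[OF ax(1)] chart_ringI[OF ax(2)]] x(3) x'(3) by blast
    qed
  qed
  have "mon s \<notin> p"
  proof
    assume a: "mon s \<in> p"
    have h: "mon s \<in> hcomp B d" by (rule hcomp_mon[OF s d(1)])
    have "frag_cmul 1 s = s" by simp
    then have "ms 1 = \<rho> (mon s)" by (simp add: ms_def)
    then have "\<rho> (mon s) / ms 1 = 1" using ms_ne[of 1] by simp
    moreover have "\<rho> (comp d (mon s) \<otimes> \<one>) / ms 1 \<in> P" by (rule pD[OF a hcomp_one]) simp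
    ultimately show False using P1 comp_self[OF h] mon(1)[OF s] by simp
  qed
  then have p: "p \<in> chart s" using pointI[OF prime pcomp s] d by (simp add: chart_def)
  have "\<rho> x / ms n \<in> P \<longleftrightarrow> x \<in> p" if x: "x \<in> hcomp B (n * d)" for x n
  proof
    assume a: "\<rho> x / ms n \<in> P"
    show "x \<in> p"
    proof (rule hom_p[OF x])
      fix k n' c assume c: "c \<in> hcomp B k" "n * d + k = n' * d"
      have "n * d \<le> n * d + k" by (rule le_add1)
      then have le: "n \<le> n'" unfolding c(2) using d(2) by simp
      define j where "j = n' - n"
      have n': "n' = n + j" using le by (simp add: j_def)
      then have kd: "k = j * d" using c(2) by (simp add: algebra_simps)
      have "(\<rho> c / ms j) * (\<rho> x / ms n) \<in> P" using c(1) kd by (intro Pmul[OF chart_ringI a]) simp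
      then show "\<rho> (x \<otimes> c) / ms n' \<in> P" using hcompD(1)[OF x] hcompD(1)[OF c(1)]
        by (simp add: n' ms_add E.\<rho>_mult mult.commute)
    qed
  next
    assume "x \<in> p"
    from pD[OF this hcomp_one, of "n * d" n] show "\<rho> x / ms n \<in> P"
      using comp_self[OF x] hcompD(1)[OF x] by simp
  qed
  then have "\<phi> \<in> chart_nonunits s p \<longleftrightarrow> \<phi> \<in> P" if "\<phi> \<in> chart_ring s" for \<phi>
    using that by (elim chart_ringE) (simp add: nonunit_iff[OF p])
  then have "chart_nonunits s p = P" using PA by (auto simp: chart_nonunits_def)
  then show ?thesis using p by blast
qed

text \<open>If the ideal of denominators of a regular function were proper, a prime containing it
  would be a point of the chart, but at this point the function has a denominator outside the
  prime.\<close>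

lemma regular_chart: "P.FS.regular (chart s) = chart_ring s"
proof
  show "chart_ring s \<subseteq> P.FS.regular (chart s)" using chart_ring_ploc by (auto intro: P.FS.regularI)
  show "P.FS.regular (chart s) \<subseteq> chart_ring s"
  proof
    fix \<phi> assume \<phi>: "\<phi> \<in> P.FS.regular (chart s)"
    define J where "J = {b \<in> chart_ring s. b * \<phi> \<in> chart_ring s}"
    have A: "subring_in (chart_ring s)" by (rule subring_chart_ring)
    have "1 \<in> J"
    proof (rule ccontr)
      assume "1 \<notin> J"
      have "\<exists>P. prime_in (chart_ring s) P \<and> J \<subseteq> P"
        by (rule exists_prime_in[OF A]) (use \<open>1 \<notin> J\<close> A in \<open>auto simp: J_def subring_in_def algebra_simps\<close>)
      then obtain P where P: "prime_in (chart_ring s) P" "J \<subseteq> P" by blast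
      obtain p where p: "p \<in> chart s" "chart_nonunits s p = P" using chart_surj[OF P(1)] by blast
      obtain a b where ab: "a \<in> chart_ring s" "b \<in> chart_ring s" "b \<notin> P" "\<phi> = a / b"
        using chart_frac[OF p(1) P.FS.regularD[OF \<phi> p(1)]] p(2) by blast
      have "b \<noteq> 0" using ab(3) P(1) by (auto simp: prime_in_def)
      then have "b \<in> J" using ab by (simp add: J_def)
      then show False using P(2) ab(3) by blast
    qed
    then show "\<phi> \<in> chart_ring s" by (simp add: J_def)
  qed
qed

lemma nonunits_chart: "P.FS.nonunits (chart s) p = chart_nonunits s p"
proof -
  have "openin (tp (frac_space B (proj_points B) (proj_fracs B 0))) (chart s)"
    using open_chart[OF s] by (simp add: frac_space_def)
  moreover have "chart s \<noteq> {}" using P.open_generic zero_point chart_def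
    E.\<rho>_eq_0[of "mon s"] s by (auto simp: chart_def \<rho>_def mon single_1_neq_0)
  ultimately show ?thesis using P.FS.nonunits_def[of "chart s" p] by (simp add: chart_nonunits_def regular_chart)
qed

lemma chart_ne: "chart s \<noteq> {}"
  using zero_point E.\<rho>_eq_0[of "mon s"] s by (auto simp: chart_def \<rho>_def mon single_1_neq_0)

lemma affine_chart: "affine_open (Proj B) (chart s)"
  unfolding Proj_frac_space
proof (rule P.FS.affine_openI)
  show "openin (tp (frac_space B (proj_points B) (proj_fracs B 0))) (chart s)"
    using open_chart[OF s] by (simp add: frac_space_def)
  show "chart s \<noteq> {}" by (rule chart_ne)
qed (unfold nonunits_chart regular_chart,
    simp_all add: chart_frac chart_surj chart_inj chart_prime,
    rule chart_basis, auto simp: frac_space_def)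

end

end

section \<open>Twisting sheaves\<close>

context mono_alg
begin

abbreviation tloc :: "nat \<Rightarrow> 'a set \<Rightarrow> laurent fract set" where
  "tloc d p \<equiv> E.floc (proj_fracs B d) p"

definition treg :: "nat \<Rightarrow> 'a set set \<Rightarrow> laurent fract set" where
  "treg d V = (\<Inter>p\<in>V. tloc d p)"

lemma lsec_carrier:
  "openin (zariski B (proj_points B)) U \<Longrightarrow>
    carrier (lsec (twist B d) U) = E.fsect (proj_fracs B d) U ` treg d U"
  by (simp add: twist_def treg_def P.frac_sections_eq[OF fracs_carrier])

lemma regular_treg: "P.FS.regular U = treg 0 U"
  by (simp add: P.FS.regular_def treg_def)

lemma in_points: "openin (zariski B (proj_points B)) U \<Longrightarrow> p \<in> U \<Longrightarrow> p \<in> proj_points B"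
  using openin_subset[of "zariski B (proj_points B)" U] by (auto simp: P.topspace_zariski)

lemma lsec_smult:
  assumes U: "openin (zariski B (proj_points B)) U" and \<phi>: "\<phi> \<in> treg 0 U" and \<psi>: "\<psi> \<in> treg d U"
  shows "E.fsect (proj_fracs B 0) U \<phi> \<odot>\<^bsub>lsec (twist B d) U\<^esub> E.fsect (proj_fracs B d) U \<psi> =
    E.fsect (proj_fracs B d) U (\<phi> * \<psi>)"
proof -
  have "frac_mult B (proj_fracs B d) p (E.fcls (proj_fracs B 0) p \<phi>) (E.fcls (proj_fracs B d) p \<psi>) =
      E.fcls (proj_fracs B d) p (\<phi> * \<psi>)" if p: "p \<in> U" for p
  proof (rule E.frac_mult_eq[OF fracs_carrier fracs_carrier fracs_carrier pointD[OF in_points[OF U p]]])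
    show "(a \<otimes> b, f \<otimes> g) \<in> proj_fracs B d" if "(a, f) \<in> proj_fracs B 0" "(b, g) \<in> proj_fracs B d" for a f b g
      using fracs_mult[OF that] by simp
  qed (use \<phi> \<psi> p in \<open>auto simp: treg_def\<close>)
  then show ?thesis by (simp add: twist_def E.fsect_def fun_eq_iff restrict_def)
qed

lemma lsec_add:
  assumes U: "openin (zariski B (proj_points B)) U" and \<phi>: "\<phi> \<in> treg d U" and \<psi>: "\<psi> \<in> treg d U"
  shows "E.fsect (proj_fracs B d) U \<phi> \<oplus>\<^bsub>lsec (twist B d) U\<^esub> E.fsect (proj_fracs B d) U \<psi> =
    E.fsect (proj_fracs B d) U (\<phi> + \<psi>)"
proof -
  have "frac_add B (proj_fracs B d) p (E.fcls (proj_fracs B d) p \<phi>) (E.fcls (proj_fracs B d) p \<psi>) =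
      E.fcls (proj_fracs B d) p (\<phi> + \<psi>)" if p: "p \<in> U" for p
    by (rule E.frac_add_eq[OF fracs_carrier pointD[OF in_points[OF U p]] fracs_add])
      (use \<phi> \<psi> p in \<open>auto simp: treg_def\<close>)
  then show ?thesis by (simp add: twist_def E.fsect_def fun_eq_iff restrict_def)
qed

lemma lsec_res: "V \<subseteq> U \<Longrightarrow> lres (twist B d) U V (E.fsect (proj_fracs B d) U \<phi>) = E.fsect (proj_fracs B d) V \<phi>"
  by (auto simp: twist_def E.fsect_def fun_eq_iff restrict_def)

lemma tsect_eq_iff:
  assumes "openin (zariski B (proj_points B)) U" "U \<noteq> {}" "\<phi> \<in> treg d U" "\<psi> \<in> treg d U"
  shows "E.fsect (proj_fracs B d) U \<phi> = E.fsect (proj_fracs B d) U \<psi> \<longleftrightarrow> \<phi> = \<psi>"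
  using P.fsect_inj[OF assms(1,2) fracs_carrier, of d] assms(3,4) by (auto simp: treg_def dest: inj_onD)

lemma treg_mult: "openin (zariski B (proj_points B)) U \<Longrightarrow> \<phi> \<in> treg 0 U \<Longrightarrow> \<psi> \<in> treg d U \<Longrightarrow> \<phi> * \<psi> \<in> treg d U"
proof -
  assume U: "openin (zariski B (proj_points B)) U" and "\<phi> \<in> treg 0 U" "\<psi> \<in> treg d U"
  then have \<phi>: "\<phi> \<in> tloc 0 p" and \<psi>: "\<psi> \<in> tloc d p" if "p \<in> U" for p using that by (auto simp: treg_def)
  have "\<phi> * \<psi> \<in> tloc d p" if p: "p \<in> U" for p
  proof -
    obtain a f where af: "(a, f) \<in> proj_fracs B 0" "f \<notin> p" "\<rho> a = \<phi> * \<rho> f" using \<phi>[OF p] by (rule E.flocE)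
    obtain b g where bg: "(b, g) \<in> proj_fracs B d" "g \<notin> p" "\<rho> b = \<psi> * \<rho> g" using \<psi>[OF p] by (rule E.flocE)
    have c: "a \<in> carrier B" "f \<in> carrier B" "b \<in> carrier B" "g \<in> carrier B" using af(1) bg(1) fracs_carrier by auto
    show ?thesis
    proof (rule E.flocI)
      show "(a \<otimes> b, f \<otimes> g) \<in> proj_fracs B d" using fracs_mult[OF af(1) bg(1)] by simp
      show "f \<otimes> g \<notin> p" using af bg point_mult[OF in_points[OF U p] c(2,4)] by simp
      show "\<rho> (a \<otimes> b) = \<phi> * \<psi> * \<rho> (f \<otimes> g)" using c af bg by (simp add: E.\<rho>_mult)
    qed
  qed
  then show ?thesis by (simp add: treg_def)
qed

lemma tloc_spread:
  assumes p: "p \<in> proj_points B" and \<phi>: "\<phi> \<in> tloc d p"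
  shows "\<exists>U. openin (zariski B (proj_points B)) U \<and> p \<in> U \<and> \<phi> \<in> treg d U"
proof -
  obtain a f where af: "(a, f) \<in> proj_fracs B d" "f \<notin> p" "\<rho> a = \<phi> * \<rho> f" using \<phi> by (rule E.flocE)
  have "f \<in> carrier B" using af(1) fracs_carrier by auto
  then show ?thesis using af p P.open_basic
    by (intro exI[of _ "{q \<in> proj_points B. f \<notin> q}"]) (auto simp: treg_def intro: E.flocI)
qed

text \<open>Generation is tested on all smaller open sets, the empty one included. There functions
  and sections form singletons, and the description by field elements does not apply.\<close>

lemma generates_empty:
  assumes "e \<in> carrier (lsec (twist B d) {})"
  shows "generates (Proj B) (twist B d) {} e"
  unfolding generates_def
proof (intro conjI allI impI)
  fix W assume "openin (tp (Proj B)) W \<and> W \<subseteq> {}"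
  then have W: "W = {}" by simp
  have 1: "carrier (osec (Proj B) {}) = {\<lambda>_. undefined}"
    unfolding Proj_frac_space using P.FS.carrier_sect[of "{}"] by (auto simp: P.FS.regular_def E.fsect_def restrict_def)
  have 2: "carrier (lsec (twist B d) {}) = {\<lambda>_. undefined}"
    using lsec_carrier[of "{}" d] by (auto simp: treg_def E.fsect_def restrict_def)
  have "(\<lambda>_. undefined) \<odot>\<^bsub>lsec (twist B d) {}\<^esub> lres (twist B d) {} {} e = (\<lambda>_. undefined)"
    by (simp add: twist_def restrict_def)
  then show "bij_betw (\<lambda>r. r \<odot>\<^bsub>lsec (twist B d) W\<^esub> lres (twist B d) {} W e) (carrier (osec (Proj B) W)) (carrier (lsec (twist B d) W))"
    unfolding W 1 2 by (simp add: bij_betw_def)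
qed (rule assms)

text \<open>Everything lies in a field, so multiplication by \<open>\<epsilon>\<close> is injective
  as soon as \<open>\<epsilon> \<noteq> 0\<close>. Surjectivity over all open subsets can be tested
  on germs, because a germ extends to a neighbourhood.\<close>

lemma generates_iff:
  assumes V: "openin (zariski B (proj_points B)) V" and ne: "V \<noteq> {}" and \<epsilon>: "\<epsilon> \<in> treg d V"
  shows "generates (Proj B) (twist B d) V (E.fsect (proj_fracs B d) V \<epsilon>) \<longleftrightarrow>
    \<epsilon> \<noteq> 0 \<and> (\<forall>p\<in>V. \<forall>\<psi>\<in>tloc d p. \<psi> / \<epsilon> \<in> tloc 0 p)"
proof -
  let ?m = "\<lambda>W r. r \<odot>\<^bsub>lsec (twist B d) W\<^esub> lres (twist B d) V W (E.fsect (proj_fracs B d) V \<epsilon>)"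
  have m: "?m W (E.fsect (proj_fracs B 0) W \<phi>) = E.fsect (proj_fracs B d) W (\<phi> * \<epsilon>)"
    if "openin (zariski B (proj_points B)) W" "W \<subseteq> V" "\<phi> \<in> treg 0 W" for W \<phi>
    using lsec_smult[OF that(1,3), of \<epsilon> d] \<epsilon> that(2) by (simp add: lsec_res treg_def subset_iff)
  have co: "carrier (osec (Proj B) W) = E.fsect (proj_fracs B 0) W ` treg 0 W"
    if "openin (zariski B (proj_points B)) W" for W
    unfolding Proj_frac_space using P.FS.carrier_sect[of W] that by (simp add: regular_treg frac_space_def)
  have \<epsilon>W: "\<epsilon> \<in> treg d W" if "W \<subseteq> V" for W using \<epsilon> that by (auto simp: treg_def)
  show ?thesis
  proof
    assume "generates (Proj B) (twist B d) V (E.fsect (proj_fracs B d) V \<epsilon>)"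
    then have bij: "bij_betw (?m W) (carrier (osec (Proj B) W)) (carrier (lsec (twist B d) W))"
      if "openin (zariski B (proj_points B)) W" "W \<subseteq> V" for W
      using that by (simp add: generates_def tp_Proj)
    have r01: "0 \<in> treg 0 V" "1 \<in> treg 0 V"
      using P.FS.regular_closed(1,2)[of V] V by (simp_all add: regular_treg frac_space_def)
    have "\<epsilon> \<noteq> 0"
    proof
      assume e: "\<epsilon> = 0"
      have "inj_on (?m V) (carrier (osec (Proj B) V))" using bij[OF V order_refl] by (simp add: bij_betw_def)
      moreover have "?m V (E.fsect (proj_fracs B 0) V 0) = ?m V (E.fsect (proj_fracs B 0) V 1)"
        using m[OF V order_refl r01(1)] m[OF V order_refl r01(2)] e by simp
      ultimately have "E.fsect (proj_fracs B 0) V 0 = E.fsect (proj_fracs B 0) V 1"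
        using r01 by (auto simp: co V dest: inj_onD)
      then show False using tsect_eq_iff[OF V ne r01] by simp
    qed
    moreover have "\<psi> / \<epsilon> \<in> tloc 0 p" if p: "p \<in> V" "\<psi> \<in> tloc d p" for p \<psi>
    proof -
      obtain U where U: "openin (zariski B (proj_points B)) U" "p \<in> U" "\<psi> \<in> treg d U"
        using tloc_spread[OF in_points[OF V p(1)] p(2)] by blast
      define W where "W = U \<inter> V"
      have W: "openin (zariski B (proj_points B)) W" "W \<subseteq> V" "W \<noteq> {}" "p \<in> W" using U V p by (auto simp: W_def)
      have \<psi>W: "\<psi> \<in> treg d W" using U by (auto simp: W_def treg_def)
      then have "E.fsect (proj_fracs B d) W \<psi> \<in> ?m W ` carrier (osec (Proj B) W)"
        using bij[OF W(1,2)] by (simp add: bij_betw_def lsec_carrier[OF W(1)])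
      then obtain \<phi> where \<phi>: "\<phi> \<in> treg 0 W" "E.fsect (proj_fracs B d) W \<psi> = ?m W (E.fsect (proj_fracs B 0) W \<phi>)"
        by (auto simp: co W)
      then have "\<psi> = \<phi> * \<epsilon>"
        using tsect_eq_iff[OF W(1,3) \<psi>W treg_mult[OF W(1) \<phi>(1) \<epsilon>W[OF W(2)]]] m[OF W(1,2) \<phi>(1)] by simp
      then have "\<psi> / \<epsilon> = \<phi>" using \<open>\<epsilon> \<noteq> 0\<close> by simp
      then show ?thesis using \<phi>(1) W(4) by (auto simp: treg_def)
    qed
    ultimately show "\<epsilon> \<noteq> 0 \<and> (\<forall>p\<in>V. \<forall>\<psi>\<in>tloc d p. \<psi> / \<epsilon> \<in> tloc 0 p)" by blast
  next
    assume a: "\<epsilon> \<noteq> 0 \<and> (\<forall>p\<in>V. \<forall>\<psi>\<in>tloc d p. \<psi> / \<epsilon> \<in> tloc 0 p)"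
    show "generates (Proj B) (twist B d) V (E.fsect (proj_fracs B d) V \<epsilon>)"
      unfolding generates_def
    proof (intro conjI allI impI)
      show "E.fsect (proj_fracs B d) V \<epsilon> \<in> carrier (lsec (twist B d) V)" using \<epsilon> by (simp add: lsec_carrier V)
      fix W assume "openin (tp (Proj B)) W \<and> W \<subseteq> V"
      then have W: "openin (zariski B (proj_points B)) W" "W \<subseteq> V" by (simp_all add: tp_Proj)
      show "bij_betw (?m W) (carrier (osec (Proj B) W)) (carrier (lsec (twist B d) W))"
      proof (cases "W = {}")
        case True
        have "E.fsect (proj_fracs B d) V \<epsilon> \<in> carrier (lsec (twist B d) V)" using \<epsilon> by (simp add: lsec_carrier V)
        have "lres (twist B d) V {} (E.fsect (proj_fracs B d) V \<epsilon>) \<in> carrier (lsec (twist B d) {})"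
          by (simp add: lsec_res lsec_carrier treg_def)
        from generates_empty[OF this] have "bij_betw (\<lambda>r. r \<odot>\<^bsub>lsec (twist B d) {}\<^esub> lres (twist B d) {} {} (lres (twist B d) V {} (E.fsect (proj_fracs B d) V \<epsilon>)))
          (carrier (osec (Proj B) {})) (carrier (lsec (twist B d) {}))"
          by (simp add: generates_def)
        then show ?thesis unfolding True by (simp add: lsec_res)
      next
        case False
        show ?thesis unfolding bij_betw_def
        proof
          show "inj_on (?m W) (carrier (osec (Proj B) W))"
          proof (rule inj_onI)
            fix x y assume xy: "x \<in> carrier (osec (Proj B) W)" "y \<in> carrier (osec (Proj B) W)" "?m W x = ?m W y"
            obtain \<phi> \<psi> where p: "\<phi> \<in> treg 0 W" "x = E.fsect (proj_fracs B 0) W \<phi>" "\<psi> \<in> treg 0 W" "y = E.fsect (proj_fracs B 0) W \<psi>"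
              using xy(1,2) by (auto simp: co W)
            have "\<phi> * \<epsilon> = \<psi> * \<epsilon>"
              using xy(3) m[OF W p(1)] m[OF W p(3)] p(2,4)
                tsect_eq_iff[OF W(1) False treg_mult[OF W(1) p(1) \<epsilon>W[OF W(2)]] treg_mult[OF W(1) p(3) \<epsilon>W[OF W(2)]]] by simp
            then show "x = y" using a p by simp
          qed
          show "?m W ` carrier (osec (Proj B) W) = carrier (lsec (twist B d) W)"
          proof (intro equalityI subsetI)
            fix y assume "y \<in> ?m W ` carrier (osec (Proj B) W)"
            then obtain \<phi> where "\<phi> \<in> treg 0 W" "y = ?m W (E.fsect (proj_fracs B 0) W \<phi>)" by (auto simp: co W)
            then show "y \<in> carrier (lsec (twist B d) W)"
              using m[OF W] treg_mult[OF W(1) _ \<epsilon>W[OF W(2)]] by (simp add: lsec_carrier W)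
          next
            fix y assume "y \<in> carrier (lsec (twist B d) W)"
            then obtain \<psi> where \<psi>: "\<psi> \<in> treg d W" "y = E.fsect (proj_fracs B d) W \<psi>" by (auto simp: lsec_carrier W)
            have r: "\<psi> / \<epsilon> \<in> treg 0 W" using \<psi>(1) a W(2) unfolding treg_def by blast
            have "y = ?m W (E.fsect (proj_fracs B 0) W (\<psi> / \<epsilon>))" using m[OF W r] \<psi>(2) a by simp
            then show "y \<in> ?m W ` carrier (osec (Proj B) W)" using r by (auto simp: co W)
          qed
        qed
      qed
    qed
  qed
qed

text \<open>A monomial of degree exactly \<open>d\<close> shifts fractions of degree
  \<open>d\<close> to degree 0 without leaving the local ring, since it lies outside the points of
  its chart. It thus trivializes \<open>\<O>(d)\<close> there.\<close>

lemma mon_generates: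
  assumes t: "t \<in> S" "deg t = int d"
  shows "\<rho> (mon t) \<noteq> 0" "p \<in> chart t \<Longrightarrow> \<rho> (mon t) \<in> tloc d p"
    "p \<in> chart t \<Longrightarrow> \<psi> \<in> tloc d p \<Longrightarrow> \<psi> / \<rho> (mon t) \<in> tloc 0 p"
proof -
  note h = hcomp_mon[OF t]
  show n: "\<rho> (mon t) \<noteq> 0" using t by (simp add: \<rho>_def mon single_1_neq_0)
  show "\<rho> (mon t) \<in> tloc d p" if "p \<in> chart t"
    using E.primeideal_facts(3)[OF pointD, of p] that h hcomp_one
    by (intro E.flocI[of "mon t" \<one>] fracsI[where e = 0]) (auto simp: E.\<rho>_one chart_def)
  show "\<psi> / \<rho> (mon t) \<in> tloc 0 p" if p: "p \<in> chart t" and \<psi>: "\<psi> \<in> tloc d p"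
  proof -
    have pp: "p \<in> proj_points B" using p by (simp add: chart_def)
    obtain a f where af: "(a, f) \<in> proj_fracs B d" "f \<notin> p" "\<rho> a = \<psi> * \<rho> f" using \<psi> by (rule E.flocE)
    obtain e where e: "a \<in> hcomp B (d + e)" "f \<in> hcomp B e" using af(1) by (rule fracsE)
    have fc: "f \<in> carrier B" "mon t \<in> carrier B" using e h hcompD by auto
    show ?thesis
    proof (rule E.flocI)
      show "(a, mon t \<otimes> f) \<in> proj_fracs B 0" using e hcomp_mult[OF h e(2)] by (intro fracsI[where e = "d + e"]) auto
      show "mon t \<otimes> f \<notin> p" using point_mult[OF pp fc(2,1)] af(2) p by (simp add: chart_def)
      show "\<rho> a = \<psi> / \<rho> (mon t) * \<rho> (mon t \<otimes> f)" using n af(3) fc by (simp add: E.\<rho>_mult)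
    qed
  qed
qed

text \<open>In an algebra not generated in degree one \<open>\<O>(d)\<close> may fail to be
  invertible; the hypothesis provides a trivializing monomial at every point.\<close>

lemma invertible_twist:
  assumes "\<And>p. p \<in> proj_points B \<Longrightarrow> \<exists>t\<in>S. deg t = int d \<and> mon t \<notin> p"
  shows "invertible_sheaf (Proj B) (twist B d)"
  unfolding invertible_sheaf_def tp_Proj P.topspace_zariski
proof
  fix p assume p: "p \<in> proj_points B"
  obtain t where t: "t \<in> S" "deg t = int d" "mon t \<notin> p" using assms[OF p] by blast
  have pc: "p \<in> chart t" using p t by (simp add: chart_def)
  have "generates (Proj B) (twist B d) (chart t) (E.fsect (proj_fracs B d) (chart t) (\<rho> (mon t)))"
    using mon_generates[OF t(1,2)] pc open_chart[OF t(1)]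
    by (subst generates_iff) (auto simp: treg_def)
  then show "\<exists>V e. openin (zariski B (proj_points B)) V \<and> p \<in> V \<and> generates (Proj B) (twist B d) V e"
    using open_chart[OF t(1)] pc by blast
qed

end

section \<open>Enlarging the monoid\<close>

text \<open>Each part of the assumptions carries one aspect of normalization: the multiple
  \<open>n0\<close> gives integrality, the translate by \<open>c0\<close> gives the common field of
  fractions, and the inequalities \<open>\<Lambda>\<close> give integral closedness.\<close>

locale mono_pair = B: mono_alg B \<gamma>B S deg + C: mono_alg C \<gamma>C W deg
  for B :: "'a gcalg" and \<gamma>B and S and deg and C :: "'c gcalg" and \<gamma>C and W +
  fixes r :: nat and \<Lambda> :: "(grp \<Rightarrow> real) set" and n0 :: nat and c0 :: grp
  assumes SW: "S \<subseteq> W" and fin\<Lambda>: "finite \<Lambda>" and add\<Lambda>: "l \<in> \<Lambda> \<Longrightarrow> additive_fun l"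
    and W_eq: "W = {g \<in> coord_grp r. \<forall>l\<in>\<Lambda>. 0 \<le> l g}"
    and n0: "0 < n0" "w \<in> W \<Longrightarrow> frag_cmul (int n0) w \<in> S"
    and c0: "c0 \<in> S" "w \<in> W \<Longrightarrow> c0 + w \<in> S"
begin

definition emb :: "'a \<Rightarrow> 'c" where "emb b = C.ig (\<gamma>B b)"

lemma emb: "b \<in> carrier B \<Longrightarrow> emb b \<in> carrier C" "b \<in> carrier B \<Longrightarrow> \<gamma>C (emb b) = \<gamma>B b"
  using C.ig supp_on_mono[OF SW B.\<gamma>_supp] by (simp_all add: emb_def)

lemma rho_emb: "b \<in> carrier B \<Longrightarrow> C.\<rho> (emb b) = B.\<rho> b"
  by (simp add: C.\<rho>_def B.\<rho>_def emb)

lemma emb_ring_hom: "emb \<in> ring_hom B C"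
  by (rule ring_hom_memI) (auto simp: emb B.\<gamma>_mult B.\<gamma>_add B.\<gamma>_one C.\<gamma>_mult C.\<gamma>_add C.\<gamma>_one
      simp flip: C.\<gamma>_eq_iff)

lemma emb_hcomp: "b \<in> hcomp B i \<Longrightarrow> emb b \<in> hcomp C i"
  by (auto simp: B.hcomp_eq C.hcomp_eq emb)

lemma emb_comp: "b \<in> carrier B \<Longrightarrow> emb (B.comp i b) = C.comp i (emb b)"
  by (subst C.\<gamma>_eq_iff[symmetric]) (simp_all add: emb B.comp C.comp)

lemma emb_mon: "s \<in> S \<Longrightarrow> emb (B.mon s) = C.mon s"
  using SW by (subst C.\<gamma>_eq_iff[symmetric]) (auto simp: emb B.mon C.mon)

definition npt :: "'c set \<Rightarrow> 'a set" where "npt q = {b \<in> carrier B. emb b \<in> q}"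

text \<open>A monomial of \<open>W\<close> outside the prime has its \<open>n0\<close>-th power in
  the small algebra and still outside. So contraction never meets the irrelevant ideal, and the map
  on \<open>Proj\<close> is defined everywhere.\<close>

lemma point_S:
  assumes q: "q \<in> proj_points C"
  obtains s where "s \<in> S" "0 < deg s" "C.mon s \<notin> q"
proof -
  obtain w where w: "w \<in> W" "0 < deg w" "C.mon w \<notin> q" using C.point_monomial[OF q] .
  show ?thesis
    by (rule that[of "frag_cmul (int n0) w"])
      (use w n0 C.point_cmul[OF q w(1,3)] in \<open>auto simp: B.deg_cmul\<close>)
qed

lemma npt_point:
  assumes q: "q \<in> proj_points C"
  shows "npt q \<in> proj_points B"
proof -
  interpret h: ring_hom_ring B C emb
    by (rule ring_hom_ringI2[OF B.ring_axioms C.ring_axioms emb_ring_hom])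
  have p: "primeideal (npt q) B" unfolding npt_def
    using h.primeideal_vimage[OF B.is_cring C.pointD[OF q]] by simp
  obtain s where s: "s \<in> S" "0 < deg s" "C.mon s \<notin> q" using point_S[OF q] .
  show ?thesis
  proof (rule B.pointI[OF p _ s(1,2)])
    show "B.comp i b \<in> npt q" if "b \<in> npt q" for i b
      using that C.point_comp[OF q] by (auto simp: npt_def emb_comp B.comp)
    show "B.mon s \<notin> npt q" using s by (simp add: npt_def emb_mon)
  qed
qed

lemma npt_tloc:
  assumes q: "q \<in> proj_points C"
  shows "B.tloc d (npt q) \<subseteq> C.tloc d q"
proof
  fix \<phi> assume "\<phi> \<in> B.tloc d (npt q)"
  then obtain a f where af: "(a, f) \<in> proj_fracs B d" "f \<notin> npt q" "B.\<rho> a = \<phi> * B.\<rho> f" by (rule B.E.flocE)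
  obtain e where e: "a \<in> hcomp B (d + e)" "f \<in> hcomp B e" using af(1) by (rule B.fracsE)
  have c: "a \<in> carrier B" "f \<in> carrier B" using e B.hcompD by auto
  show "\<phi> \<in> C.tloc d q"
    by (rule C.E.flocI[OF C.fracsI[OF emb_hcomp[OF e(1)] emb_hcomp[OF e(2)]]])
      (use c af in \<open>auto simp: npt_def rho_emb\<close>)
qed

sublocale D: dense_fun_spaces "frac_space C (proj_points C) (proj_fracs C 0)" "{\<zero>\<^bsub>C\<^esub>}" "C.E.fsect (proj_fracs C 0)"
  "C.E.floc (proj_fracs C 0)" "\<lambda>c. to_fract (Poly_Mapping.single 0 c)"
  "frac_space B (proj_points B) (proj_fracs B 0)" "{\<zero>\<^bsub>B\<^esub>}" "B.E.fsect (proj_fracs B 0)"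
  "B.E.floc (proj_fracs B 0)" npt
proof unfold_locales
  have tC: "topspace (tp (frac_space C (proj_points C) (proj_fracs C 0))) = proj_points C"
    by (simp add: frac_space_def C.P.topspace_zariski)
  have tB: "tp (frac_space B (proj_points B) (proj_fracs B 0)) = zariski B (proj_points B)" by (simp add: frac_space_def)
  show "continuous_map (tp (frac_space C (proj_points C) (proj_fracs C 0)))
     (tp (frac_space B (proj_points B) (proj_fracs B 0))) npt"
    unfolding tB zariski_def
  proof (rule continuous_on_generated_topo)
    fix U assume "U \<in> {{p \<in> proj_points B. f \<notin> p} |f. f \<in> carrier B}"
    then obtain f where f: "f \<in> carrier B" "U = {p \<in> proj_points B. f \<notin> p}" by blast
    have "npt -` U \<inter> proj_points C = {q \<in> proj_points C. emb f \<notin> q}"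
      using npt_point f by (auto simp: npt_def)
    then show "openin (tp (frac_space C (proj_points C) (proj_fracs C 0)))
         (npt -` U \<inter> topspace (tp (frac_space C (proj_points C) (proj_fracs C 0))))"
      unfolding tC using C.P.open_basic[OF emb(1)[OF f(1)]] by (simp add: frac_space_def)
  next
    have "\<Union> {{p \<in> proj_points B. f \<notin> p} |f. f \<in> carrier B} = proj_points B"
      using B.P.topspace_zariski unfolding zariski_def topology_generated_by_topspace .
    then show "npt ` topspace (tp (frac_space C (proj_points C) (proj_fracs C 0))) \<subseteq>
        \<Union> {{p \<in> proj_points B. f \<notin> p} |f. f \<in> carrier B}" unfolding tC using npt_point by auto
  qed
  have "emb b = \<zero>\<^bsub>C\<^esub> \<longleftrightarrow> b = \<zero>\<^bsub>B\<^esub>" if "b \<in> carrier B" for b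
    using C.\<gamma>_eq_iff[of "emb b" "\<zero>\<^bsub>C\<^esub>"] B.\<gamma>_eq_iff[of b "\<zero>\<^bsub>B\<^esub>"] that by (simp add: emb C.\<gamma>_zero B.\<gamma>_zero)
  then show "npt {\<zero>\<^bsub>C\<^esub>} = {\<zero>\<^bsub>B\<^esub>}" by (auto simp: npt_def)
  fix q assume "q \<in> topspace (tp (frac_space C (proj_points C) (proj_fracs C 0)))"
  then have q: "q \<in> proj_points C" by (simp add: tC)
  show "B.tloc 0 (npt q) \<subseteq> C.tloc 0 q" by (rule npt_tloc[OF q])
  fix \<phi> assume \<phi>: "\<phi> \<in> B.tloc 0 (npt q)" "\<phi> \<noteq> 0" "inverse \<phi> \<in> C.tloc 0 q"
  obtain a f where af: "(a, f) \<in> proj_fracs B 0" "f \<notin> npt q" "B.\<rho> a = \<phi> * B.\<rho> f" using \<phi>(1) by (rule B.E.flocE)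
  obtain a' f' where af': "(a', f') \<in> proj_fracs C 0" "f' \<notin> q" "C.\<rho> a' = inverse \<phi> * C.\<rho> f'" using \<phi>(3) by (rule C.E.flocE)
  have c: "a \<in> carrier B" "f \<in> carrier B" "a' \<in> carrier C" "f' \<in> carrier C"
    using af(1) af'(1) B.fracs_carrier C.fracs_carrier by auto
  \<comment> \<open>With \<open>\<phi> = a / f\<close> below and
    \<open>inverse \<phi> = a' / f'\<close> above, the products \<open>a a'\<close> and
    \<open>f f'\<close> agree. The second is outside the prime, hence so is \<open>a\<close>, and
    \<open>f / a\<close> is an inverse below.\<close>
  have "C.\<rho> (emb a \<otimes>\<^bsub>C\<^esub> a') = C.\<rho> (emb f \<otimes>\<^bsub>C\<^esub> f')"
    using c af(3) af'(3) \<phi>(2) by (simp add: C.E.\<rho>_mult emb rho_emb)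
  then have "emb a \<otimes>\<^bsub>C\<^esub> a' = emb f \<otimes>\<^bsub>C\<^esub> f'" using c by (subst (asm) C.E.\<rho>_eq_iff) (auto simp: emb)
  moreover have "emb f \<otimes>\<^bsub>C\<^esub> f' \<notin> q" using C.point_mult[OF q emb(1)[OF c(2)] c(4)] af(2) af'(2) c(2) by (simp add: npt_def)
  ultimately have "emb a \<notin> q" using C.point_mult[OF q emb(1)[OF c(1)] c(3)] by auto
  then have "a \<notin> npt q" by (simp add: npt_def)
  moreover have "(f, a) \<in> proj_fracs B 0" using af(1) by (auto elim!: B.fracsE intro: B.fracsI[where e = e for e])
  ultimately show "inverse \<phi> \<in> B.tloc 0 (npt q)" using af(3) \<phi>(2) by (intro B.E.flocI) auto
qed

lemma mor_Proj: "preim (Proj C) D.mor V = {q \<in> proj_points C. npt q \<in> V}"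
  by (simp add: preim_def D.fst_mor C.tp_Proj C.P.topspace_zariski)

lemma preim_chart: "s \<in> S \<Longrightarrow> preim (Proj C) D.mor (B.chart s) = C.chart s"
  using npt_point by (auto simp: mor_Proj B.chart_def C.chart_def npt_def B.mon emb_mon)

lemma conductor:
  assumes "0 < k" "w \<in> W"
  shows "frag_cmul (int k) c0 + w \<in> S"
  using assms
proof (induction k arbitrary: w)
  case (Suc k)
  show ?case
  proof (cases "k = 0")
    case True then show ?thesis using c0(2)[OF Suc.prems(2)] by simp
  next
    case False
    then have "frag_cmul (int k) c0 + (c0 + w) \<in> S"
      using Suc SW c0 by (intro Suc.IH) auto
    then show ?thesis unfolding frag_cmul_Suc by (simp add: add.assoc)
  qed
qed simp

lemma chart_ring_mono: "B.chart_ring s \<subseteq> C.chart_ring s"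
proof -
  have "localized deg s S \<subseteq> localized deg s W" using SW by (auto simp: localized_def)
  then show ?thesis unfolding B.chart_ring_def C.chart_ring_def using supp_on_mono by blast
qed

lemma chart_conductor:
  assumes s: "s \<in> S" "0 < deg s" and b: "b \<in> C.chart_ring s"
  shows "\<exists>a\<in>B.chart_ring s. \<exists>c\<in>B.chart_ring s. c \<noteq> 0 \<and> c * b = a"
proof -
  obtain f where f: "f \<in> supp_on (localized deg s W)" "b = to_fract f" using b by (auto simp: C.chart_ring_def)
  define d where "d = nat (deg s)"
  define k where "k = nat (deg c0)"
  have d: "deg s = int d" "0 < d" using s by (auto simp: d_def)
  have k: "deg c0 = int k" using B.S_deg[OF c0(1)] by (simp add: k_def)
  \<comment> \<open>The chart ring has degree 0, so \<open>c0\<close> itself cannot serve as a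
    denominator there. Taking \<open>deg s\<close> copies of \<open>c0\<close> against
    \<open>deg c0\<close> copies of \<open>s\<close> balances the degrees.\<close>
  define e where "e = frag_cmul (int d) c0 - frag_cmul (int k) s"
  have dege: "deg e = 0" unfolding e_def additive_fun_minus[OF B.deg_add] B.deg_cmul d k by simp
  let ?c = "Poly_Mapping.single e 1 :: laurent"
  have eS: "e \<in> localized deg s S" unfolding localized_def using dege B.S_cmul[OF c0(1), of d]
    by (intro CollectI conjI exI[of _ k]) (simp_all add: e_def)
  have "?c * f \<in> supp_on (localized deg s S)"
  proof (rule supp_on_mult[OF supp_on_single[of e "{e}"] f(1)])
    fix a w assume a: "a \<in> {e}" and "w \<in> localized deg s W"
    then obtain n where n: "deg w = 0" "w + frag_cmul (int n) s \<in> W" by (auto simp: localized_def)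
    have "(a + w) + frag_cmul (int (k + n)) s = frag_cmul (int d) c0 + (w + frag_cmul (int n) s)"
      using a by (simp add: e_def frag_cmul_distrib algebra_simps)
    also have "\<dots> \<in> S" by (rule conductor[OF d(2) n(2)])
    finally have "(a + w) + frag_cmul (int (k + n)) s \<in> S" .
    moreover have "deg (a + w) = 0" using a n dege by (simp add: additive_fun_add[OF B.deg_add])
    ultimately show "a + w \<in> localized deg s S" unfolding localized_def by blast
  qed simp
  then have "to_fract (?c * f) \<in> B.chart_ring s" unfolding B.chart_ring_def by (rule imageI)
  moreover have "to_fract ?c \<in> B.chart_ring s" unfolding B.chart_ring_def by (intro imageI supp_on_single eS)
  moreover have "to_fract ?c \<noteq> 0" by (simp add: single_1_neq_0)
  moreover have "to_fract ?c * b = to_fract (?c * f)" by (simp add: f)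
  ultimately show ?thesis by blast
qed

lemma chart_integral:
  assumes s: "s \<in> S" and b: "b \<in> C.chart_ring s"
  shows "\<exists>(n::nat) \<rho>. (\<forall>i<n. \<rho> i \<in> B.chart_ring s) \<and> b ^ n + (\<Sum>i<n. \<rho> i * b ^ i) = 0"
proof -
  obtain f where f: "f \<in> supp_on (localized deg s W)" "b = to_fract f" using b by (auto simp: C.chart_ring_def)
  have sW: "s \<in> W" using s SW by blast
  have cg: "localized deg s W \<subseteq> coord_grp r"
  proof
    fix w assume "w \<in> localized deg s W"
    then obtain n where n: "w + frag_cmul (int n) s \<in> W" by (auto simp: localized_def)
    have "w = (w + frag_cmul (int n) s) - frag_cmul (int n) s" by simp
    also have "\<dots> \<in> coord_grp r" using n sW by (intro coord_grp_minus coord_grp_cmul) (auto simp: W_eq)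
    finally show "w \<in> coord_grp r" .
  qed
  obtain N \<rho> where \<rho>: "\<forall>i<N. \<rho> i \<in> supp_on {w \<in> localized deg s W. \<exists>v. w = frag_cmul (int n0) v}"
    "f ^ N + (\<Sum>i<N. \<rho> i * f ^ i) = 0"
    using laurent_integral[OF n0(1) localized_monoid[OF C.S_monoid B.deg_add] cg f(1)] by blast
  \<comment> \<open>The equation has coefficients with exponents \<open>n0 v\<close>. If
    \<open>n0 v + n s\<close> satisfies the inequalities of \<open>W\<close>, so does
    \<open>v + n s\<close>, as they are nonnegative on \<open>s\<close>; its \<open>n0\<close>-fold
    multiple then lies in \<open>S\<close>.\<close>
  have sub: "{w \<in> localized deg s W. \<exists>v. w = frag_cmul (int n0) v} \<subseteq> localized deg s S"
  proof
    fix w assume "w \<in> {w \<in> localized deg s W. \<exists>v. w = frag_cmul (int n0) v}"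
    then obtain v n where v: "w = frag_cmul (int n0) v" "deg w = 0" "w + frag_cmul (int n) s \<in> W"
      by (auto simp: localized_def)
    have "w \<in> coord_grp r" using cg v by (auto simp: localized_def)
    then have vc: "v \<in> coord_grp r" using n0(1) by (simp add: v(1) coord_grp_def subset_iff)
    have "0 \<le> l (v + frag_cmul (int n) s)" if l: "l \<in> \<Lambda>" for l
    proof -
      note al = additive_fun_add[OF add\<Lambda>[OF l]] additive_fun_cmul[OF add\<Lambda>[OF l]]
      have ls: "0 \<le> l s" using sW l by (simp add: W_eq)
      have "0 \<le> l (w + frag_cmul (int n) s)" using v(3) l by (simp add: W_eq)
      then have "0 \<le> real n0 * l v + real n * l s" by (simp add: v(1) al)
      moreover have "real n * l s \<le> real n0 * (real n * l s)"
        using n0(1) ls mult_right_mono[of 1 "real n0" "real n * l s"] by simp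
      ultimately have "0 \<le> real n0 * (l v + real n * l s)" by (simp add: algebra_simps)
      then have "0 \<le> l v + real n * l s" using n0(1) by (simp add: zero_le_mult_iff)
      then show ?thesis by (simp add: al)
    qed
    moreover have "v + frag_cmul (int n) s \<in> coord_grp r"
      using vc sW coord_grp_monoid[of r] coord_grp_cmul[of s r] by (auto simp: W_eq submonoid_set_def)
    ultimately have "v + frag_cmul (int n) s \<in> W" by (simp add: W_eq)
    from n0(2)[OF this] have "frag_cmul (int n0) (v + frag_cmul (int n) s) \<in> S" .
    moreover have "frag_cmul (int n0) (v + frag_cmul (int n) s) = w + frag_cmul (int (n0 * n)) s"
      by (simp add: frag_cmul_distrib2 v(1))
    ultimately have "w + frag_cmul (int (n0 * n)) s \<in> S" by (simp only:)
    then show "w \<in> localized deg s S" unfolding localized_def using v(2) by blast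
  qed
  have "b ^ N + (\<Sum>i<N. to_fract (\<rho> i) * b ^ i) = to_fract (f ^ N + (\<Sum>i<N. \<rho> i * f ^ i))"
  proof -
    have pw: "to_fract (f ^ n) = b ^ n" for n by (induction n) (simp_all add: f(2))
    have sm: "to_fract (\<Sum>i<N. \<rho> i * f ^ i) = (\<Sum>i<N. to_fract (\<rho> i) * b ^ i)" for N
      by (induction N) (simp_all add: pw)
    show ?thesis by (simp only: to_fract_add pw sm)
  qed
  then have "b ^ N + (\<Sum>i<N. to_fract (\<rho> i) * b ^ i) = 0" by (simp add: \<rho>(2))
  moreover have "to_fract (\<rho> i) \<in> B.chart_ring s" if "i < N" for i
    unfolding B.chart_ring_def by (rule imageI, rule supp_on_mono[OF sub], rule \<rho>(1)[rule_format, OF that])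
  ultimately show ?thesis by (intro exI[of _ N] exI[of _ "\<lambda>i. to_fract (\<rho> i)"] conjI allI impI)
qed

lemma chart_normal:
  assumes s: "s \<in> S" and a: "a \<in> B.chart_ring s" and c: "c \<in> B.chart_ring s" "c \<noteq> 0"
    and \<rho>: "\<And>i. i < n \<Longrightarrow> \<rho> i \<in> B.chart_ring s"
    and eq: "a ^ n + (\<Sum>i<n. \<rho> i * a ^ i * c ^ (n - i)) = 0"
  shows "a / c \<in> C.chart_ring s"
proof -
  have up: "x \<in> C.chart_ring s" if "x \<in> B.chart_ring s" for x using chart_ring_mono that by blast
  obtain f where f: "f \<in> supp_on (localized deg s W)" "a = to_fract f" using up[OF a] by (auto simp: C.chart_ring_def)
  obtain g where g: "g \<in> supp_on (localized deg s W)" "c = to_fract g" using up[OF c(1)] by (auto simp: C.chart_ring_def)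
  have "\<forall>i\<in>{..<n}. \<exists>h. h \<in> supp_on (localized deg s W) \<and> \<rho> i = to_fract h"
    using up[OF \<rho>] by (auto simp: C.chart_ring_def)
  from bchoice[OF this] obtain h where h: "\<And>i. i < n \<Longrightarrow> h i \<in> supp_on (localized deg s W)" "\<And>i. i < n \<Longrightarrow> \<rho> i = to_fract (h i)"
    by auto
  have pw: "to_fract (f ^ n) = a ^ n" "to_fract (g ^ n) = c ^ n" for n by (induction n) (simp_all add: f(2) g(2))
  have sm: "to_fract (\<Sum>i\<in>I. F i) = (\<Sum>i\<in>I. to_fract (F i))" for F and I :: "nat set"
    by (induction I rule: infinite_finite_induct) simp_all
  have "to_fract (f ^ n + (\<Sum>i<n. h i * f ^ i * g ^ (n - i))) = 0"
    using eq by (simp add: pw sm h(2))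
  then have e: "f ^ n + (\<Sum>i<n. h i * f ^ i * g ^ (n - i)) = 0" by (simp only: to_fract_eq_0_iff)
  have sW: "s \<in> W" using s SW by blast
  have g0: "g \<noteq> 0" using c g by auto
  obtain q where q: "q \<in> supp_on (localized deg s W)" "f = g * q"
    using laurent_normal[OF fin\<Lambda> add\<Lambda> W_eq sW B.deg_add f(1) g(1) g0 h(1) e] by blast
  have "a / c = to_fract q" using c by (simp add: f g q(2))
  then show ?thesis unfolding C.chart_ring_def using q(1) by blast
qed

lemma normalization_Proj: "normalization (Proj C) (Proj B) D.mor"
proof -
  have ch: "\<exists>s\<in>S. 0 < deg s \<and> p \<in> B.chart s" if p: "p \<in> proj_points B" for p
    using B.point_monomial[OF p] p unfolding B.chart_def by blast
  have aff: "affine_open (Proj B) (B.chart s)" "affine_open (Proj C) (C.chart s)" if s: "s \<in> S" "0 < deg s" for s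
    using B.affine_chart[of s "nat (deg s)"] C.affine_chart[of s "nat (deg s)"] s SW by auto
  have icm: "integral_closure_map (osec (Proj B) (B.chart s)) (osec (Proj C) (preim (Proj C) D.mor (B.chart s))) (snd D.mor (B.chart s))"
    if s: "s \<in> S" "0 < deg s" for s
    unfolding B.Proj_frac_space C.Proj_frac_space
  proof (rule D.integral_closure_mor)
    have d: "deg s = int (nat (deg s))" "0 < nat (deg s)" and sW: "s \<in> W" using s SW by auto
    show "openin (tp (frac_space B (proj_points B) (proj_fracs B 0))) (B.chart s)"
      using B.open_chart[OF s(1)] by (simp add: frac_space_def)
    show "B.chart s \<noteq> {}" by (rule B.chart_ne[OF s(1) d])
    show "B.P.FS.regular (B.chart s) = B.chart_ring s" by (rule B.regular_chart[OF s(1) d])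
    show "C.P.FS.regular (preim (frac_space C (proj_points C) (proj_fracs C 0)) D.mor (B.chart s)) = C.chart_ring s"
      using preim_chart[OF s(1)] C.regular_chart[OF sW d] by (simp add: C.Proj_frac_space)
  qed (rule chart_conductor[OF s], assumption, rule chart_integral[OF s(1)], assumption,
      rule chart_normal[OF s(1)], assumption+)
  have dom: "domain (osec (Proj B) U)" if "openin (tp (Proj B)) U" "U \<noteq> {}" for U
    using B.P.FS.osec_domain that unfolding B.Proj_frac_space by blast
  have int: "integral_scheme (Proj B)" unfolding integral_scheme_def B.tp_Proj B.P.topspace_zariski
    using B.zero_point ch aff(1) dom by (auto simp: B.tp_Proj) blast
  show ?thesis unfolding normalization_def B.tp_Proj B.P.topspace_zariski
  proof (intro conjI ballI)
    show "morphism (Proj C) (Proj B) D.mor" using D.mor_morphism by (simp add: B.Proj_frac_space C.Proj_frac_space)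
    fix p assume "p \<in> proj_points B"
    then obtain s where s: "s \<in> S" "0 < deg s" "p \<in> B.chart s" using ch by blast
    show "\<exists>V. p \<in> V \<and> affine_open (Proj B) V \<and> affine_open (Proj C) (preim (Proj C) D.mor V) \<and>
        integral_closure_map (osec (Proj B) V) (osec (Proj C) (preim (Proj C) D.mor V)) (snd D.mor V)"
      using s(3) aff[OF s(1,2)] icm[OF s(1,2)] preim_chart[OF s(1)] by (intro exI[of _ "B.chart s"]) simp
  qed (rule int)
qed

end

section \<open>The polarization\<close>

context mono_pair
begin

lemma treg_map: "\<phi> \<in> B.treg d V \<Longrightarrow> \<phi> \<in> C.treg d (preim (Proj C) D.mor V)"
  using npt_tloc by (fastforce simp: B.treg_def C.treg_def mor_Proj)

text \<open>
  A point of \<open>Proj B\<close> misses some monomial of degree \<open>d\<close>: whether a point misses \<open>\<chi>\<^sup>s\<close> depends only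
  on the face of the cone that contains \<open>s\<close> in its relative interior, and there are finitely many faces.
\<close>

lemma monomials_of_degree:
  "\<exists>d0>0. \<forall>d>0. d0 dvd d \<longrightarrow> (\<forall>p\<in>proj_points B. \<exists>t\<in>S. deg t = int d \<and> B.mon t \<notin> p)"
proof -
  define face where "face w = {l \<in> \<Lambda>. l w = 0}" for w
  \<comment> \<open>One representative of positive degree for every face; the degree
    \<open>d\<close> has to be divisible only by \<open>n0\<close> times the degrees of these
    finitely many elements.\<close>
  define e where "e T = (SOME s. s \<in> S \<and> 0 < deg s \<and> face s = T)" for T
  have e: "e (face s) \<in> S \<and> 0 < deg (e (face s)) \<and> face (e (face s)) = face s" if "s \<in> S" "0 < deg s" for s
    unfolding e_def by (rule someI[of _ s]) (use that in simp)
  \<comment> \<open>For a set \<open>T\<close> that is not the face of any element of positive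
    degree the choice \<open>e T\<close> is arbitrary; \<open>max 1\<close> keeps the product
    positive.\<close>
  define D where "D = (\<Prod>T\<in>Pow \<Lambda>. max 1 (nat (deg (e T))))"
  have D: "0 < D" unfolding D_def by (rule prod_pos) simp
  have "\<exists>t\<in>S. deg t = int d \<and> B.mon t \<notin> p" if d: "0 < d" "n0 * D dvd d" and p: "p \<in> proj_points B" for d p
  proof -
    obtain s where s: "s \<in> S" "0 < deg s" "B.mon s \<notin> p" using B.point_monomial[OF p] .
    define u where "u = e (face s)"
    have u: "u \<in> S" "0 < deg u" "face u = face s" using e[OF s(1,2)] by (simp_all add: u_def)
    have sW: "s \<in> W" "u \<in> W" using s u SW by auto
    have "\<forall>l\<in>\<Lambda>. \<exists>n::nat. l u \<le> real n * l s"
    proof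
      fix l assume l: "l \<in> \<Lambda>"
      have ls: "0 \<le> l s" using sW l by (simp add: W_eq)
      show "\<exists>n::nat. l u \<le> real n * l s"
      proof (cases "l s = 0")
        case True
        then have "l u = 0" using u(3) l by (auto simp: face_def)
        then show ?thesis using True by simp
      next
        case False
        then obtain n where "l u < real n * l s" using ls reals_Archimedean3[of "l s"] by auto
        then show ?thesis by (intro exI[of _ n]) simp
      qed
    qed
    from bchoice[OF this] obtain N where N: "\<And>l. l \<in> \<Lambda> \<Longrightarrow> l u \<le> real (N l) * l s" by blast
    define n where "n = (\<Sum>l\<in>\<Lambda>. N l)"
    \<comment> \<open>Inequalities that vanish on \<open>s\<close> vanish on \<open>u\<close> as
      well, so a large multiple of \<open>s\<close> exceeds \<open>u\<close> in all of them. Hence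
      the monomial of \<open>n0 u\<close> divides a power of the monomial of \<open>s\<close>, and
      \<open>p\<close> misses it too.\<close>
    define w where "w = frag_cmul (int n) s - u"
    have "w \<in> W" unfolding W_eq
    proof (intro CollectI conjI ballI)
      show "w \<in> coord_grp r" unfolding w_def using sW by (intro coord_grp_minus coord_grp_cmul) (auto simp: W_eq)
      fix l assume l: "l \<in> \<Lambda>"
      have "N l \<le> n" unfolding n_def using fin\<Lambda> l by (simp add: member_le_sum)
      then have "real (N l) * l s \<le> real n * l s" using sW l by (intro mult_right_mono) (auto simp: W_eq)
      then show "0 \<le> l w" using N[OF l]
        by (simp add: w_def additive_fun_minus[OF add\<Lambda>[OF l]] additive_fun_cmul[OF add\<Lambda>[OF l]])
    qed
    define x where "x = frag_cmul (int n0) u"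
    have xS: "x \<in> S" "frag_cmul (int n0) w \<in> S" using n0(2)[OF sW(2)] n0(2)[OF \<open>w \<in> W\<close>] by (simp_all add: x_def)
    have "frag_cmul (int (n0 * n)) s = x + frag_cmul (int n0) w"
      by (simp add: x_def w_def flip: frag_cmul_distrib2)
    then have "B.mon x \<otimes>\<^bsub>B\<^esub> B.mon (frag_cmul (int n0) w) \<notin> p"
      using B.point_cmul[OF p s(1,3), of "n0 * n"] by (simp add: B.mon_add xS)
    then have xp: "B.mon x \<notin> p" using B.point_mult[OF p] xS by (simp add: B.mon)
    have "face s \<in> Pow \<Lambda>" by (auto simp: face_def)
    then have "max 1 (nat (deg u)) dvd D" unfolding D_def u_def
      using fin\<Lambda> by (intro dvd_prodI) auto
    then have "n0 * nat (deg u) dvd n0 * D" using u(2) by (simp add: max_def split: if_splits)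
    then have "n0 * nat (deg u) dvd d" using d(2) by (rule dvd_trans)
    then obtain k where k: "d = n0 * nat (deg u) * k" by blast
    have "deg x = int n0 * deg u" unfolding x_def by (rule B.deg_cmul)
    then have "deg (frag_cmul (int k) x) = int d" unfolding B.deg_cmul[of k x] using u(2) by (simp add: k)
    then show ?thesis using B.S_cmul[OF xS(1)] B.point_cmul[OF p xS(1) xp] by blast
  qed
  then show ?thesis using n0(1) D by (intro exI[of _ "n0 * D"]) auto
qed

section \<open>Pulling back sections of the twisting sheaves\<close>

definition tval :: "nat \<Rightarrow> 'a set set \<Rightarrow> ('a set \<Rightarrow> ('a \<times> 'a) set) \<Rightarrow> laurent fract" where
  "tval d V s = (SOME \<phi>. \<phi> \<in> B.treg d V \<and> s = B.E.fsect (proj_fracs B d) V \<phi>)"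

definition pull :: "nat \<Rightarrow> 'a set set \<Rightarrow> ('a set \<Rightarrow> ('a \<times> 'a) set) \<Rightarrow> ('c set \<Rightarrow> ('c \<times> 'c) set)" where
  "pull d V s = C.E.fsect (proj_fracs C d) (preim (Proj C) D.mor V) (tval d V s)"

lemma preim_open: "openin (zariski B (proj_points B)) V \<Longrightarrow> openin (zariski C (proj_points C)) (preim (Proj C) D.mor V)"
  using D.open_preim[of V] by (simp add: B.Proj_frac_space C.Proj_frac_space frac_space_def)

lemma preim_nonempty: "openin (zariski B (proj_points B)) V \<Longrightarrow> V \<noteq> {} \<Longrightarrow> preim (Proj C) D.mor V \<noteq> {}"
  using D.preim_ne[of V] by (simp add: B.Proj_frac_space C.Proj_frac_space frac_space_def)

lemma pull_sect:
  assumes V: "openin (zariski B (proj_points B)) V" and \<phi>: "\<phi> \<in> B.treg d V"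
  shows "pull d V (B.E.fsect (proj_fracs B d) V \<phi>) = C.E.fsect (proj_fracs C d) (preim (Proj C) D.mor V) \<phi>"
proof (cases "V = {}")
  case True
  then have "preim (Proj C) D.mor V = {}" by (simp add: mor_Proj)
  then show ?thesis by (simp add: pull_def C.E.fsect_def restrict_def)
next
  case False
  have "tval d V (B.E.fsect (proj_fracs B d) V \<phi>) = \<phi>"
    unfolding tval_def by (rule some_equality) (use \<phi> B.tsect_eq_iff[OF V False] in auto)
  then show ?thesis by (simp add: pull_def)
qed

lemma polarization: "pullback_polarization C B D.mor"
proof -
  obtain d0 where d0: "0 < d0" "\<And>d p. 0 < d \<Longrightarrow> d0 dvd d \<Longrightarrow> p \<in> proj_points B \<Longrightarrow> \<exists>t\<in>S. deg t = int d \<and> B.mon t \<notin> p"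
    using monomials_of_degree by metis
  have "pullback_sheaf (Proj C) (Proj B) D.mor (twist B d) (twist C d)" if d: "0 < d" "d0 dvd d" for d
  proof -
    note mB = d0(2)[OF d]
    have mC: "\<exists>t\<in>W. deg t = int d \<and> C.mon t \<notin> q" if q: "q \<in> proj_points C" for q
    proof -
      obtain t where t: "t \<in> S" "deg t = int d" "B.mon t \<notin> npt q" using mB[OF npt_point[OF q]] by blast
      then have "C.mon t \<notin> q" by (simp add: npt_def B.mon emb_mon)
      then show ?thesis using t SW by blast
    qed
    have gen: "generates (Proj C) (twist C d) (preim (Proj C) D.mor V) (pull d V e)"
      if V: "openin (zariski B (proj_points B)) V" and e: "generates (Proj B) (twist B d) V e" for V e
    proof -
      have "e \<in> carrier (lsec (twist B d) V)" using e by (simp add: generates_def)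
      then obtain \<epsilon> where \<epsilon>: "\<epsilon> \<in> B.treg d V" "e = B.E.fsect (proj_fracs B d) V \<epsilon>"
        by (auto simp: B.lsec_carrier[OF V])
      note V' = preim_open[OF V]
      show ?thesis
      proof (cases "V = {}")
        case True
        then have pe: "preim (Proj C) D.mor V = {}" by (simp add: mor_Proj)
        show ?thesis unfolding pe
          by (rule C.generates_empty) (use pe in \<open>simp add: pull_def C.lsec_carrier C.treg_def\<close>)
      next
        case False
        have ge: "\<epsilon> \<noteq> 0" "\<And>p \<psi>. p \<in> V \<Longrightarrow> \<psi> \<in> B.tloc d p \<Longrightarrow> \<psi> / \<epsilon> \<in> B.tloc 0 p"
          using e B.generates_iff[OF V False \<epsilon>(1)] \<epsilon>(2) by auto
        \<comment> \<open>A generator downstairs is compared with an arbitrary germ upstairs through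
          a monomial \<open>\<chi>\<^sup>t\<close> of degree \<open>d\<close>: the quotient
          \<open>\<psi> / \<chi>\<^sup>t\<close> is regular upstairs, and
          \<open>\<chi>\<^sup>t / \<epsilon>\<close> is regular already downstairs.\<close>
        have "\<psi> / \<epsilon> \<in> C.tloc 0 q" if q: "q \<in> preim (Proj C) D.mor V" and \<psi>: "\<psi> \<in> C.tloc d q" for q \<psi>
        proof -
          have qp: "q \<in> proj_points C" "npt q \<in> V" using q by (simp_all add: mor_Proj)
          obtain t where t: "t \<in> S" "deg t = int d" "B.mon t \<notin> npt q" using mB[OF npt_point[OF qp(1)]] by blast
          have bc: "npt q \<in> B.chart t" using t npt_point[OF qp(1)] by (simp add: B.chart_def)
          have cc: "q \<in> C.chart t" using t qp by (simp add: C.chart_def npt_def B.mon emb_mon)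
          have tW: "t \<in> W" using t SW by blast
          have rr: "C.\<rho> (C.mon t) = B.\<rho> (B.mon t)" using rho_emb[of "B.mon t"] t by (simp add: B.mon emb_mon)
          have 1: "\<psi> / B.\<rho> (B.mon t) \<in> C.tloc 0 q" using C.mon_generates(3)[OF tW t(2) cc \<psi>] rr by simp
          have "B.\<rho> (B.mon t) / \<epsilon> \<in> B.tloc 0 (npt q)"
            by (rule ge(2)[OF qp(2) B.mon_generates(2)[OF t(1,2) bc]])
          then have 2: "B.\<rho> (B.mon t) / \<epsilon> \<in> C.tloc 0 q" using npt_tloc[OF qp(1)] by blast
          have "(\<psi> / B.\<rho> (B.mon t)) * (B.\<rho> (B.mon t) / \<epsilon>) \<in> C.tloc 0 q"
            using C.P.FS.loc_mult[OF _ 1 2] qp(1) by (simp add: frac_space_def C.P.topspace_zariski)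
          then show ?thesis using B.mon_generates(1)[OF t(1,2)] by simp
        qed
        then show ?thesis unfolding \<epsilon>(2) pull_sect[OF V \<epsilon>(1)]
          using C.generates_iff[OF V' preim_nonempty[OF V False] treg_map[OF \<epsilon>(1)]] ge(1) by simp
      qed
    qed
    have "\<forall>V. openin (tp (Proj B)) V \<longrightarrow>
        pull d V \<in> carrier (lsec (twist B d) V) \<rightarrow> carrier (lsec (twist C d) (preim (Proj C) D.mor V)) \<and>
        (\<forall>s\<in>carrier (lsec (twist B d) V). \<forall>s'\<in>carrier (lsec (twist B d) V).
           pull d V (s \<oplus>\<^bsub>lsec (twist B d) V\<^esub> s') = pull d V s \<oplus>\<^bsub>lsec (twist C d) (preim (Proj C) D.mor V)\<^esub> pull d V s') \<and>
        (\<forall>r\<in>carrier (osec (Proj B) V). \<forall>s\<in>carrier (lsec (twist B d) V).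
           pull d V (r \<odot>\<^bsub>lsec (twist B d) V\<^esub> s) = snd D.mor V r \<odot>\<^bsub>lsec (twist C d) (preim (Proj C) D.mor V)\<^esub> pull d V s) \<and>
        (\<forall>W. openin (tp (Proj B)) W \<and> W \<subseteq> V \<longrightarrow> (\<forall>s\<in>carrier (lsec (twist B d) V).
           pull d W (lres (twist B d) V W s) = lres (twist C d) (preim (Proj C) D.mor V) (preim (Proj C) D.mor W) (pull d V s))) \<and>
        (\<forall>e. generates (Proj B) (twist B d) V e \<longrightarrow> generates (Proj C) (twist C d) (preim (Proj C) D.mor V) (pull d V e))"
      unfolding B.tp_Proj
    proof (intro allI impI conjI ballI)
      fix V assume V: "openin (zariski B (proj_points B)) V"
      note V' = preim_open[OF V]
      have sE: "\<exists>\<phi>. \<phi> \<in> B.treg d V \<and> s = B.E.fsect (proj_fracs B d) V \<phi>" if "s \<in> carrier (lsec (twist B d) V)" for s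
        using that by (auto simp: B.lsec_carrier[OF V])
      show "pull d V \<in> carrier (lsec (twist B d) V) \<rightarrow> carrier (lsec (twist C d) (preim (Proj C) D.mor V))"
        by (auto simp: B.lsec_carrier[OF V] C.lsec_carrier[OF V'] pull_sect[OF V] treg_map)
      {
        fix s s' assume s: "s \<in> carrier (lsec (twist B d) V)" "s' \<in> carrier (lsec (twist B d) V)"
        obtain \<phi> \<psi> where p: "\<phi> \<in> B.treg d V" "s = B.E.fsect (proj_fracs B d) V \<phi>"
          "\<psi> \<in> B.treg d V" "s' = B.E.fsect (proj_fracs B d) V \<psi>" using sE[OF s(1)] sE[OF s(2)] by blast
        have "\<phi> + \<psi> \<in> B.treg d V"
        proof -
          have "\<phi> + \<psi> \<in> B.tloc d p" if pV: "p \<in> V" for p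
          proof -
            have pp: "p \<in> proj_points B" by (rule B.in_points[OF V pV])
            have "\<phi> \<in> B.tloc d p" "\<psi> \<in> B.tloc d p" using p pV by (auto simp: B.treg_def)
            then obtain a f b g where af: "(a, f) \<in> proj_fracs B d" "f \<notin> p" "B.\<rho> a = \<phi> * B.\<rho> f"
              "(b, g) \<in> proj_fracs B d" "g \<notin> p" "B.\<rho> b = \<psi> * B.\<rho> g" by (elim B.E.flocE)
            have c: "a \<in> carrier B" "f \<in> carrier B" "b \<in> carrier B" "g \<in> carrier B" using af B.fracs_carrier by auto
            show ?thesis
            proof (rule B.E.flocI[OF B.fracs_add[OF af(1,4)]])
              show "f \<otimes>\<^bsub>B\<^esub> g \<notin> p" using B.point_mult[OF pp c(2,4)] af by simp
            qed (use c af in \<open>simp add: B.E.\<rho>_add B.E.\<rho>_mult algebra_simps\<close>)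
          qed
          then show ?thesis by (simp add: B.treg_def)
        qed
        then show "pull d V (s \<oplus>\<^bsub>lsec (twist B d) V\<^esub> s') = pull d V s \<oplus>\<^bsub>lsec (twist C d) (preim (Proj C) D.mor V)\<^esub> pull d V s'"
          using p by (simp add: B.lsec_add[OF V] pull_sect[OF V] C.lsec_add[OF V'] treg_map)
      }
      {
        fix x s assume x: "x \<in> carrier (osec (Proj B) V)" and s: "s \<in> carrier (lsec (twist B d) V)"
        have oV: "openin (tp (frac_space B (proj_points B) (proj_fracs B 0))) V" using V by (simp add: frac_space_def)
        obtain \<phi> where \<phi>: "\<phi> \<in> B.treg 0 V" "x = B.E.fsect (proj_fracs B 0) V \<phi>"
          using x B.P.FS.carrier_sect[OF oV] by (auto simp: B.Proj_frac_space B.regular_treg)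
        obtain \<psi> where \<psi>: "\<psi> \<in> B.treg d V" "s = B.E.fsect (proj_fracs B d) V \<psi>" using sE[OF s] by blast
        have "snd D.mor V x = C.E.fsect (proj_fracs C 0) (preim (Proj C) D.mor V) \<phi>"
          using D.mor_sect[OF oV, of \<phi>] \<phi> by (simp add: B.regular_treg C.Proj_frac_space)
        then show "pull d V (x \<odot>\<^bsub>lsec (twist B d) V\<^esub> s) = snd D.mor V x \<odot>\<^bsub>lsec (twist C d) (preim (Proj C) D.mor V)\<^esub> pull d V s"
          using \<phi> \<psi> by (simp add: B.lsec_smult[OF V] pull_sect[OF V] B.treg_mult[OF V] C.lsec_smult[OF V'] treg_map)
      }
      {
        fix W s assume W: "openin (zariski B (proj_points B)) W \<and> W \<subseteq> V" and s: "s \<in> carrier (lsec (twist B d) V)"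
        obtain \<psi> where \<psi>: "\<psi> \<in> B.treg d V" "s = B.E.fsect (proj_fracs B d) V \<psi>" using sE[OF s] by blast
        have "\<psi> \<in> B.treg d W" using \<psi> W by (auto simp: B.treg_def)
        moreover have "preim (Proj C) D.mor W \<subseteq> preim (Proj C) D.mor V" using W by (auto simp: mor_Proj)
        ultimately show "pull d W (lres (twist B d) V W s) = lres (twist C d) (preim (Proj C) D.mor V) (preim (Proj C) D.mor W) (pull d V s)"
          using \<psi> W by (simp add: B.lsec_res C.lsec_res pull_sect V)
      }
      show "generates (Proj C) (twist C d) (preim (Proj C) D.mor V) (pull d V e)"
        if "generates (Proj B) (twist B d) V e" for e by (rule gen[OF V that])
    qed
    then show ?thesis unfolding pullback_sheaf_def
      using B.invertible_twist[OF mB] C.invertible_twist[OF mC] by blast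
  qed
  then show ?thesis unfolding pullback_polarization_def using d0(1) by blast
qed

end

section \<open>Torus actions\<close>

definition char_twist :: "(grp \<Rightarrow> complex) \<Rightarrow> laurent \<Rightarrow> laurent" where
  "char_twist ch f = Poly_Mapping.mapp (\<lambda>w c. ch w * c) f"

lemma lookup_char_twist: "Poly_Mapping.lookup (char_twist ch f) w = ch w * Poly_Mapping.lookup f w"
  by (auto simp: char_twist_def lookup_mapp when_def in_keys_iff)

lemma char_twist_single: "char_twist ch (Poly_Mapping.single w c) = Poly_Mapping.single w (ch w * c)"
  by (rule poly_mapping_eqI) (simp add: lookup_char_twist lookup_single when_def)

lemma lookup_const_mult:
  fixes f :: laurent
  shows "Poly_Mapping.lookup (Poly_Mapping.single 0 c * f) w = c * Poly_Mapping.lookup f w"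
  by (simp add: Poly_Mapping.map.rep_eq when_def flip: mult_map_scale_conv_mult)

lemma keys_char_twist: "(\<And>w. w \<in> Poly_Mapping.keys f \<Longrightarrow> ch w \<noteq> 0) \<Longrightarrow> Poly_Mapping.keys (char_twist ch f) = Poly_Mapping.keys f"
  by (auto simp: in_keys_iff lookup_char_twist)

text \<open>The function \<open>ch\<close> is known to be a character on \<open>S\<close> only, so
  the extension principle is applied with coefficients off \<open>S\<close> forced to be 0.\<close>

lemma char_twist_mult:
  assumes S: "submonoid_set S" and ch: "\<And>s t. s \<in> S \<Longrightarrow> t \<in> S \<Longrightarrow> ch (s + t) = ch s * ch t"
    and f: "f \<in> supp_on S" and g: "g \<in> supp_on S"
  shows "char_twist ch (f * g) = char_twist ch f * char_twist ch g"
proof -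
  interpret graded_ext "\<lambda>w. if w \<in> S then UNIV else {0}" "\<lambda>w c. Poly_Mapping.single w (ch w * c) :: laurent"
    using S by unfold_locales
      (auto simp: single_add[symmetric] mult_single ch algebra_simps submonoid_set_def split: if_splits)
  have "ext f = char_twist ch f" for f
    unfolding ext_def by (rule poly_mapping_eqI) (simp add: lookup_sum lookup_single lookup_char_twist when_def in_keys_iff)
  moreover have "f \<in> allowed" "g \<in> allowed" using f g by (auto simp: allowed_def supp_on_def in_keys_iff)
  ultimately show ?thesis using ext_mult by simp
qed

locale mono_act = mono_alg B \<gamma> S deg for B :: "'a gcalg" (structure) and \<gamma> S deg +
  fixes \<alpha> :: "'a \<Rightarrow> 'a" and ch :: "grp \<Rightarrow> complex"
  assumes ch_add: "s \<in> S \<Longrightarrow> t \<in> S \<Longrightarrow> ch (s + t) = ch s * ch t"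
    and ch_ne: "s \<in> S \<Longrightarrow> ch s \<noteq> 0"
    and \<alpha>_closed: "b \<in> carrier B \<Longrightarrow> \<alpha> b \<in> carrier B"
    and \<gamma>_\<alpha>: "b \<in> carrier B \<Longrightarrow> \<gamma> (\<alpha> b) = char_twist ch (\<gamma> b)"
begin

lemma ch_0: "ch 0 = 1"
  using ch_add[OF S_0 S_0] ch_ne[OF S_0] by simp

lemma keys_\<alpha>: "b \<in> carrier B \<Longrightarrow> Poly_Mapping.keys (\<gamma> (\<alpha> b)) = Poly_Mapping.keys (\<gamma> b)"
  using supp_onD[OF \<gamma>_supp] ch_ne by (simp add: \<gamma>_\<alpha> keys_char_twist)

lemma \<alpha>_hom: "\<alpha> \<in> ring_hom B B"
proof (rule ring_hom_memI)
  show "\<alpha> (a \<otimes> b) = \<alpha> a \<otimes> \<alpha> b" if "a \<in> carrier B" "b \<in> carrier B" for a b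
    using that by (subst \<gamma>_eq_iff[symmetric])
      (simp_all add: \<alpha>_closed \<gamma>_\<alpha> \<gamma>_mult char_twist_mult[OF S_monoid ch_add] \<gamma>_supp)
  show "\<alpha> (a \<oplus> b) = \<alpha> a \<oplus> \<alpha> b" if "a \<in> carrier B" "b \<in> carrier B" for a b
    using that by (subst \<gamma>_eq_iff[symmetric])
      (auto simp add: \<alpha>_closed \<gamma>_\<alpha> \<gamma>_add lookup_char_twist lookup_add algebra_simps intro!: poly_mapping_eqI)
  show "\<alpha> \<one> = \<one>"
    by (subst \<gamma>_eq_iff[symmetric])
      (auto simp add: \<alpha>_closed \<gamma>_\<alpha> \<gamma>_one lookup_char_twist lookup_one when_def ch_0 intro!: poly_mapping_eqI)
qed (rule \<alpha>_closed)

lemma \<alpha>_hcomp: "b \<in> hcomp B i \<Longrightarrow> \<alpha> b \<in> hcomp B i"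
  by (simp add: hcomp_eq \<alpha>_closed keys_\<alpha>)

lemma \<alpha>_surj:
  assumes "b \<in> carrier B"
  obtains a where "a \<in> carrier B" "\<alpha> a = b" "\<And>i. b \<in> hcomp B i \<Longrightarrow> a \<in> hcomp B i"
proof -
  let ?f = "char_twist (\<lambda>w. inverse (ch w)) (\<gamma> b)"
  have k: "Poly_Mapping.keys ?f = Poly_Mapping.keys (\<gamma> b)"
    using supp_onD[OF \<gamma>_supp[OF assms]] ch_ne by (simp add: keys_char_twist)
  then have f: "?f \<in> supp_on S" using \<gamma>_supp[OF assms] by (simp add: supp_on_def)
  have "char_twist ch ?f = \<gamma> b"
  proof (rule poly_mapping_eqI)
    fix w show "Poly_Mapping.lookup (char_twist ch ?f) w = Poly_Mapping.lookup (\<gamma> b) w"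
      using ch_ne[of w] supp_onD[OF \<gamma>_supp[OF assms], of w]
      by (cases "w \<in> Poly_Mapping.keys (\<gamma> b)") (auto simp: lookup_char_twist in_keys_iff)
  qed
  then have "\<alpha> (ig ?f) = b"
    using assms f by (subst \<gamma>_eq_iff[symmetric]) (simp_all add: \<alpha>_closed \<gamma>_\<alpha> ig)
  moreover have "ig ?f \<in> hcomp B i" if "b \<in> hcomp B i" for i
    using that unfolding hcomp_eq mem_Collect_eq ig(2)[OF f] k by (simp add: ig(1)[OF f])
  ultimately show ?thesis using that ig(1)[OF f] by blast
qed

definition apt :: "'a set \<Rightarrow> 'a set" where "apt p = {x \<in> carrier B. \<alpha> x \<in> p}"

lemma comp_\<alpha>: "b \<in> carrier B \<Longrightarrow> comp i (\<alpha> b) = \<alpha> (comp i b)"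
  by (subst \<gamma>_eq_iff[symmetric])
    (auto simp: comp \<alpha>_closed \<gamma>_\<alpha> lookup_restr lookup_char_twist intro!: poly_mapping_eqI)

lemma apt_point:
  assumes p: "p \<in> proj_points B"
  shows "apt p \<in> proj_points B"
proof -
  interpret h: ring_hom_ring B B \<alpha> by (rule ring_hom_ringI2[OF ring_axioms ring_axioms \<alpha>_hom])
  have pr: "primeideal (apt p) B" unfolding apt_def
    using h.primeideal_vimage[OF is_cring pointD[OF p]] by simp
  obtain s where s: "s \<in> S" "0 < deg s" "mon s \<notin> p" using point_monomial[OF p] .
  show ?thesis
  proof (rule pointI[OF pr _ s(1,2)])
    show "comp i b \<in> apt p" if "b \<in> apt p" for i b
      using that point_comp[OF p, of "\<alpha> b" i] by (auto simp: apt_def comp comp_\<alpha>)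
    have "mon s = scal B (inverse (ch s)) \<otimes> \<alpha> (mon s)"
      using s ch_ne[OF s(1)] by (subst \<gamma>_eq_iff[symmetric])
        (simp_all add: mon \<alpha>_closed scal_closed \<gamma>_mult \<gamma>_scal \<gamma>_\<alpha> char_twist_single mult_single)
    then show "mon s \<notin> apt p"
      using s(3) E.primeideal_facts(4)[OF pointD[OF p] scal_closed, of "\<alpha> (mon s)" "inverse (ch s)"] by (auto simp: apt_def)
  qed
qed

lemma apt_open:
  assumes V: "openin (zariski B (proj_points B)) V"
  shows "openin (zariski B (proj_points B)) {p \<in> proj_points B. apt p \<in> V}"
proof -
  have "continuous_map (zariski B (proj_points B)) (zariski B (proj_points B)) apt"
    unfolding zariski_def[of B "proj_points B"]
  proof (rule continuous_on_generated_topo)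
    have un: "\<Union> {{p \<in> proj_points B. f \<notin> p} |f. f \<in> carrier B} = proj_points B"
      using P.topspace_zariski unfolding zariski_def topology_generated_by_topspace .
    fix U assume "U \<in> {{p \<in> proj_points B. f \<notin> p} |f. f \<in> carrier B}"
    then obtain f where f: "f \<in> carrier B" "U = {p \<in> proj_points B. f \<notin> p}" by blast
    have "apt -` U \<inter> proj_points B = {q \<in> proj_points B. \<alpha> f \<notin> q}"
      using apt_point f by (auto simp: apt_def)
    then show "openin (topology_generated_by {{p \<in> proj_points B. f \<notin> p} |f. f \<in> carrier B})
       (apt -` U \<inter> topspace (topology_generated_by {{p \<in> proj_points B. f \<notin> p} |f. f \<in> carrier B}))"
      unfolding topology_generated_by_topspace un using P.open_basic[OF \<alpha>_closed[OF f(1)]] by (simp add: zariski_def)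
  next
    have un: "\<Union> {{p \<in> proj_points B. f \<notin> p} |f. f \<in> carrier B} = proj_points B"
      using P.topspace_zariski unfolding zariski_def topology_generated_by_topspace .
    show "apt ` topspace (topology_generated_by {{p \<in> proj_points B. f \<notin> p} |f. f \<in> carrier B}) \<subseteq>
        \<Union> {{p \<in> proj_points B. f \<notin> p} |f. f \<in> carrier B}"
      unfolding topology_generated_by_topspace un using apt_point by auto
  qed
  then show ?thesis using V by (simp add: continuous_map_def P.topspace_zariski)
qed

text \<open>\<open>\<alpha>\<close> acts on the algebra, not on the field. The new value is read off
  from one fraction \<open>(a, f)\<close>, and injectivity of \<open>\<alpha>\<close> shows that all
  equivalent fractions give the same one.\<close>

lemma fcls_act:
  assumes af: "(a, f) \<in> proj_fracs B 0" "f \<noteq> \<zero>" and \<phi>: "\<rho> a = \<phi> * \<rho> f" and \<psi>: "\<rho> (\<alpha> a) = \<psi> * \<rho> (\<alpha> f)"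
  shows "map_prod \<alpha> \<alpha> ` E.fcls (proj_fracs B 0) (apt p) \<phi> = E.fcls (proj_fracs B 0) p \<psi>"
proof -
  have c: "a \<in> carrier B" "f \<in> carrier B" using af fracs_carrier by auto
  have mlt: "\<alpha> (x \<otimes> y) = \<alpha> x \<otimes> \<alpha> y" if "x \<in> carrier B" "y \<in> carrier B" for x y
    using \<alpha>_hom that by (rule ring_hom_mult)
  have inj: "x = y" if "x \<in> carrier B" "y \<in> carrier B" "\<alpha> x = \<alpha> y" for x y
  proof -
    have "char_twist ch (\<gamma> x) = char_twist ch (\<gamma> y)" using that by (simp flip: \<gamma>_\<alpha>)
    then have e: "ch w * Poly_Mapping.lookup (\<gamma> x) w = ch w * Poly_Mapping.lookup (\<gamma> y) w" for w
      by (metis lookup_char_twist)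
    have "\<gamma> x = \<gamma> y"
    proof (rule poly_mapping_eqI)
      fix w
      have "Poly_Mapping.lookup (\<gamma> z) w = 0" if "w \<notin> S" "z \<in> carrier B" for z
        using that supp_onD[OF \<gamma>_supp[OF that(2)], of w] in_keys_iff[of w "\<gamma> z"] by blast
      then show "Poly_Mapping.lookup (\<gamma> x) w = Poly_Mapping.lookup (\<gamma> y) w"
        using e[of w] ch_ne[of w] that by (cases "w \<in> S") auto
    qed
    then show ?thesis using that \<gamma>_eq_iff by blast
  qed
  have "\<rho> f \<noteq> 0" using af c E.\<rho>_eq_0 by simp
  have "\<alpha> f \<noteq> \<zero>" using inj[OF c(2) zero_closed] af(2) ring_hom_zero[OF \<alpha>_hom ring_axioms ring_axioms] by auto
  then have "\<rho> (\<alpha> f) \<noteq> 0" using c E.\<rho>_eq_0 \<alpha>_closed by simp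
  have key: "\<rho> b = \<phi> * \<rho> g \<longleftrightarrow> \<rho> (\<alpha> b) = \<psi> * \<rho> (\<alpha> g)" if bg: "b \<in> carrier B" "g \<in> carrier B" for b g
  proof -
    have "\<rho> b = \<phi> * \<rho> g \<longleftrightarrow> \<rho> b * \<rho> f = \<rho> a * \<rho> g" using \<open>\<rho> f \<noteq> 0\<close> \<phi> by auto
    also have "\<dots> \<longleftrightarrow> b \<otimes> f = a \<otimes> g" using bg c by (subst E.\<rho>_eq_iff[symmetric]) (simp_all add: E.\<rho>_mult)
    also have "\<dots> \<longleftrightarrow> \<alpha> (b \<otimes> f) = \<alpha> (a \<otimes> g)" using inj[of "b \<otimes> f" "a \<otimes> g"] bg c by auto
    also have "\<dots> \<longleftrightarrow> \<rho> (\<alpha> b) * \<rho> (\<alpha> f) = \<rho> (\<alpha> a) * \<rho> (\<alpha> g)"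
      using bg c \<alpha>_closed by (subst E.\<rho>_eq_iff[symmetric]) (simp_all add: mlt E.\<rho>_mult)
    also have "\<dots> \<longleftrightarrow> \<rho> (\<alpha> b) = \<psi> * \<rho> (\<alpha> g)" using \<open>\<rho> (\<alpha> f) \<noteq> 0\<close> \<psi> by auto
    finally show ?thesis .
  qed
  show ?thesis
  proof (intro equalityI subsetI)
    fix z assume "z \<in> map_prod \<alpha> \<alpha> ` E.fcls (proj_fracs B 0) (apt p) \<phi>"
    then obtain b g where bg: "(b, g) \<in> proj_fracs B 0" "g \<notin> apt p" "\<rho> b = \<phi> * \<rho> g" "z = (\<alpha> b, \<alpha> g)"
      by (auto simp: E.fcls_def)
    have bgc: "b \<in> carrier B" "g \<in> carrier B" using bg fracs_carrier by auto
    have "(\<alpha> b, \<alpha> g) \<in> proj_fracs B 0" using bg(1) by (auto elim!: fracsE intro: fracsI[where e = e for e] \<alpha>_hcomp)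
    then show "z \<in> E.fcls (proj_fracs B 0) p \<psi>" using bg bgc key by (simp add: E.fcls_def apt_def)
  next
    fix z assume "z \<in> E.fcls (proj_fracs B 0) p \<psi>"
    then obtain b g where bg: "(b, g) \<in> proj_fracs B 0" "g \<notin> p" "\<rho> b = \<psi> * \<rho> g" "z = (b, g)"
      by (auto simp: E.fcls_def)
    obtain e where e: "b \<in> hcomp B (0 + e)" "g \<in> hcomp B e" using bg(1) by (rule fracsE)
    obtain b' where b': "b' \<in> carrier B" "\<alpha> b' = b" "\<And>i. b \<in> hcomp B i \<Longrightarrow> b' \<in> hcomp B i"
      by (rule \<alpha>_surj[OF hcompD(1)[OF e(1)]]) blast
    obtain g' where g': "g' \<in> carrier B" "\<alpha> g' = g" "\<And>i. g \<in> hcomp B i \<Longrightarrow> g' \<in> hcomp B i"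
      by (rule \<alpha>_surj[OF hcompD(1)[OF e(2)]]) blast
    have "(b', g') \<in> E.fcls (proj_fracs B 0) (apt p) \<phi>"
      using fracsI[OF b'(3)[OF e(1)] g'(3)[OF e(2)]] bg key[OF b'(1) g'(1)] b' g' by (simp add: E.fcls_def apt_def)
    then show "z \<in> map_prod \<alpha> \<alpha> ` E.fcls (proj_fracs B 0) (apt p) \<phi>" using bg(4) b'(2) g'(2) by force
  qed
qed

lemma fst_proj_map: "fst (proj_map B \<alpha>) = apt"
  by (simp add: proj_map_def Let_def apt_def fun_eq_iff)

lemma proj_map_sect:
  assumes V: "V \<subseteq> proj_points B" and af: "(a, f) \<in> proj_fracs B 0" "f \<noteq> \<zero>" and \<phi>: "\<rho> a = \<phi> * \<rho> f"
    and \<psi>: "\<rho> (\<alpha> a) = \<psi> * \<rho> (\<alpha> f)"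
  shows "snd (proj_map B \<alpha>) V (E.fsect (proj_fracs B 0) V \<phi>) =
    E.fsect (proj_fracs B 0) {p \<in> proj_points B. apt p \<in> V} \<psi>"
proof -
  have "snd (proj_map B \<alpha>) V s = (\<lambda>p\<in>{p \<in> proj_points B. apt p \<in> V}. map_prod \<alpha> \<alpha> ` s (apt p))" for s
    by (simp add: proj_map_def Let_def apt_def)
  then show ?thesis
    by (auto simp: E.fsect_def fcls_act[OF af \<phi> \<psi>] fun_eq_iff restrict_def)
qed

end

text \<open>The two characters may differ by a factor that depends on the degree alone. Such a
  factor cancels in fractions of degree 0 and does not move homogeneous primes, so the induced
  actions on \<open>Proj\<close> still correspond.\<close>

locale mono_pair_act = mono_pair B \<gamma>B S deg C \<gamma>C W r \<Lambda> n0 c0 + BA: mono_act B \<gamma>B S deg \<alpha>B chB + CA: mono_act C \<gamma>C W deg \<alpha>C chC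
  for B :: "'a gcalg" and \<gamma>B and S and deg and C :: "'c gcalg" and \<gamma>C and W and r \<Lambda> n0 c0 \<alpha>B chB \<alpha>C chC +
  fixes \<theta> :: complex
  assumes \<theta>: "\<theta> \<noteq> 0" and ch_eq: "s \<in> S \<Longrightarrow> chB s = chC s * \<theta> ^ nat (deg s)"
begin

lemma emb_act:
  assumes b: "b \<in> hcomp B i"
  shows "emb (\<alpha>B b) = scal C (\<theta> ^ i) \<otimes>\<^bsub>C\<^esub> \<alpha>C (emb b)"
proof -
  have bc: "b \<in> carrier B" using b by (rule B.hcompD)
  have "\<gamma>C (emb (\<alpha>B b)) = \<gamma>C (scal C (\<theta> ^ i) \<otimes>\<^bsub>C\<^esub> \<alpha>C (emb b))"
  proof (rule poly_mapping_eqI)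
    fix w
    have "chB w * Poly_Mapping.lookup (\<gamma>B b) w = \<theta> ^ i * (chC w * Poly_Mapping.lookup (\<gamma>B b) w)"
    proof (cases "w \<in> Poly_Mapping.keys (\<gamma>B b)")
      case True
      then have "w \<in> S" "deg w = int i" using B.hcompD(2)[OF b] supp_onD[OF B.\<gamma>_supp[OF bc]] by auto
      then show ?thesis using ch_eq by simp
    qed (simp add: in_keys_iff)
    then show "Poly_Mapping.lookup (\<gamma>C (emb (\<alpha>B b))) w = Poly_Mapping.lookup (\<gamma>C (scal C (\<theta> ^ i) \<otimes>\<^bsub>C\<^esub> \<alpha>C (emb b))) w"
      using bc by (simp add: emb BA.\<alpha>_closed CA.\<alpha>_closed C.scal_closed C.\<gamma>_mult C.\<gamma>_scal BA.\<gamma>_\<alpha> CA.\<gamma>_\<alpha>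
          lookup_char_twist lookup_const_mult del: mult_cancel_left mult_cancel_right)
  qed
  then show ?thesis using bc by (subst (asm) C.\<gamma>_eq_iff) (auto simp: emb BA.\<alpha>_closed CA.\<alpha>_closed C.scal_closed)
qed

lemma npt_apt:
  assumes q: "q \<in> proj_points C"
  shows "npt (CA.apt q) = BA.apt (npt q)"
proof -
  note pf = C.E.primeideal_facts[OF C.pointD[OF q]]
  have h: "\<alpha>C (emb b) \<in> q \<longleftrightarrow> emb (\<alpha>B b) \<in> q" if b: "b \<in> hcomp B i" for b i
  proof -
    have bc: "b \<in> carrier B" using b by (rule B.hcompD)
    have "scal C (\<theta> ^ i) \<notin> q"
    proof
      assume a: "scal C (\<theta> ^ i) \<in> q"
      have "scal C (inverse (\<theta> ^ i)) \<otimes>\<^bsub>C\<^esub> scal C (\<theta> ^ i) = \<one>\<^bsub>C\<^esub>"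
        using \<theta> by (subst C.\<gamma>_eq_iff[symmetric]) (simp_all add: C.scal_closed C.\<gamma>_mult C.\<gamma>_scal C.\<gamma>_one mult_single)
      then show False using pf(3) pf(4)[OF C.scal_closed a, of "inverse (\<theta> ^ i)"] by simp
    qed
    then show ?thesis unfolding emb_act[OF b]
      using C.point_mult[OF q C.scal_closed CA.\<alpha>_closed[OF emb(1)[OF bc]]] by simp
  qed
  \<comment> \<open>The discrepancy \<open>\<theta> ^ i\<close> varies with the degree, so
    membership in \<open>q\<close> is compared one component at a time.\<close>
  have comps: "x \<in> q \<longleftrightarrow> (\<forall>i. C.comp i x \<in> q)" if "x \<in> carrier C" for x
    using C.point_comp[OF q] C.in_ideal_of_comps[of q x] pf(6) that by blast
  have "\<alpha>C (emb b) \<in> q \<longleftrightarrow> emb (\<alpha>B b) \<in> q" if b: "b \<in> carrier B" for b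
  proof -
    have "C.comp i (\<alpha>C (emb b)) \<in> q \<longleftrightarrow> C.comp i (emb (\<alpha>B b)) \<in> q" for i
      using h[OF B.comp_hcomp[OF b, of i]] b
      by (simp add: CA.comp_\<alpha> emb emb_comp[symmetric] BA.comp_\<alpha> BA.\<alpha>_closed)
    then show ?thesis using comps[of "\<alpha>C (emb b)"] comps[of "emb (\<alpha>B b)"] b
      by (simp add: emb BA.\<alpha>_closed CA.\<alpha>_closed)
  qed
  then show ?thesis using emb BA.\<alpha>_closed by (auto simp: npt_def CA.apt_def BA.apt_def)
qed

lemma intertwines_act: "intertwines (Proj C) (Proj B) (proj_map C \<alpha>C) D.mor (proj_map B \<alpha>B)"
  unfolding intertwines_def
proof (intro conjI ballI allI impI)
  fix q assume "q \<in> topspace (tp (Proj C))"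
  then show "fst D.mor (fst (proj_map C \<alpha>C) q) = fst (proj_map B \<alpha>B) (fst D.mor q)"
    by (simp add: D.fst_mor CA.fst_proj_map BA.fst_proj_map npt_apt C.tp_Proj C.P.topspace_zariski)
next
  fix V x assume oV: "openin (tp (Proj B)) V" and x: "x \<in> carrier (osec (Proj B) V)"
  have V: "openin (zariski B (proj_points B)) V" using oV by (simp add: B.tp_Proj)
  have oV': "openin (tp (frac_space B (proj_points B) (proj_fracs B 0))) V" using V by (simp add: frac_space_def)
  have "\<exists>\<phi> a f. \<phi> \<in> B.P.FS.regular V \<and> x = B.E.fsect (proj_fracs B 0) V \<phi> \<and> (a, f) \<in> proj_fracs B 0 \<and> f \<noteq> \<zero>\<^bsub>B\<^esub> \<and> B.\<rho> a = \<phi> * B.\<rho> f"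
  proof (cases "V = {}")
    \<comment> \<open>There is no generic point from which a fraction could be read, so zero is
      represented as 0/1.\<close>
    case True
    have "x = B.E.fsect (proj_fracs B 0) V 0"
      using x True B.P.FS.carrier_sect[OF oV'] by (auto simp: B.Proj_frac_space B.E.fsect_def restrict_def)
    moreover have "\<one>\<^bsub>B\<^esub> \<noteq> \<zero>\<^bsub>B\<^esub>" using B.E.\<rho>_one B.E.\<rho>_zero by auto
    moreover have "(\<zero>\<^bsub>B\<^esub>, \<one>\<^bsub>B\<^esub>) \<in> proj_fracs B 0" by (rule B.P.Fr_zero)
    moreover have "0 \<in> B.P.FS.regular V" by (rule B.P.FS.regular_closed(1)[OF oV'])
    ultimately show ?thesis by (intro exI[of _ 0] exI[of _ "\<zero>\<^bsub>B\<^esub>"] exI[of _ "\<one>\<^bsub>B\<^esub>"]) (simp add: B.E.\<rho>_zero)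
  next
    case False
    obtain \<phi> where \<phi>: "\<phi> \<in> B.P.FS.regular V" "x = B.E.fsect (proj_fracs B 0) V \<phi>"
      using x B.P.FS.carrier_sect[OF oV'] by (auto simp: B.Proj_frac_space)
    have "\<phi> \<in> B.tloc 0 {\<zero>\<^bsub>B\<^esub>}" using \<phi>(1) B.P.open_generic[OF V False] by (rule B.P.FS.regularD)
    then obtain a f where "(a, f) \<in> proj_fracs B 0" "f \<notin> {\<zero>\<^bsub>B\<^esub>}" "B.\<rho> a = \<phi> * B.\<rho> f" by (rule B.E.flocE)
    then show ?thesis using \<phi> by blast
  qed
  then obtain \<phi> a f where \<phi>: "\<phi> \<in> B.P.FS.regular V" "x = B.E.fsect (proj_fracs B 0) V \<phi>"
    and af: "(a, f) \<in> proj_fracs B 0" "f \<noteq> \<zero>\<^bsub>B\<^esub>" "B.\<rho> a = \<phi> * B.\<rho> f" by blast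
  obtain e where e: "a \<in> hcomp B (0 + e)" "f \<in> hcomp B e" using af(1) by (rule B.fracsE)
  have c: "a \<in> carrier B" "f \<in> carrier B" using e B.hcompD by auto
  have kf: "B.\<rho> (\<alpha>B f) \<noteq> 0"
  proof -
    have "Poly_Mapping.keys (\<gamma>B f) \<noteq> {}" using B.\<gamma>_eq_iff[OF c(2) B.zero_closed] af(2) by (simp add: B.\<gamma>_zero)
    then have "\<gamma>B (\<alpha>B f) \<noteq> 0" using BA.keys_\<alpha>[OF c(2)] by (metis keys_zero)
    then show ?thesis by (simp add: B.\<rho>_def)
  qed
  define \<psi> where "\<psi> = B.\<rho> (\<alpha>B a) / B.\<rho> (\<alpha>B f)"
  have \<psi>: "B.\<rho> (\<alpha>B a) = \<psi> * B.\<rho> (\<alpha>B f)" using kf by (simp add: \<psi>_def)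
  define U where "U = {p \<in> proj_points B. BA.apt p \<in> V}"
  have U: "openin (zariski B (proj_points B)) U" unfolding U_def by (rule BA.apt_open[OF V])
  have VP: "V \<subseteq> proj_points B" using B.in_points[OF V] by blast
  have xB: "snd (proj_map B \<alpha>B) V x = B.E.fsect (proj_fracs B 0) U \<psi>"
    unfolding \<phi>(2) U_def by (rule BA.proj_map_sect[OF VP af \<psi>])
  have regU: "\<psi> \<in> B.P.FS.regular U"
  proof (rule B.P.FS.regularI)
    fix p assume p: "p \<in> U"
    then have "BA.apt p \<in> V" by (simp add: U_def)
    then have "\<phi> \<in> B.tloc 0 (BA.apt p)" using \<phi>(1) by (auto dest: B.P.FS.regularD)
    then obtain b g where "(b, g) \<in> B.E.fcls (proj_fracs B 0) (BA.apt p) \<phi>" by (auto simp: B.E.floc_def B.E.fcls_def)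
    then have "map_prod \<alpha>B \<alpha>B (b, g) \<in> B.E.fcls (proj_fracs B 0) p \<psi>"
      unfolding BA.fcls_act[OF af \<psi>, symmetric] by (rule imageI)
    then show "\<psi> \<in> B.tloc 0 p" by (auto simp: B.E.floc_def B.E.fcls_def)
  qed
  have preU: "preim (Proj B) (proj_map B \<alpha>B) V = U"
    by (simp add: preim_def BA.fst_proj_map U_def B.tp_Proj B.P.topspace_zariski)
  let ?V = "preim (Proj C) D.mor V"
  have xC: "snd D.mor V x = C.E.fsect (proj_fracs C 0) ?V \<phi>"
    using D.mor_sect[OF oV' \<phi>(1)] by (simp add: \<phi>(2) C.Proj_frac_space)
  have eqU: "{q \<in> proj_points C. CA.apt q \<in> ?V} = preim (Proj C) D.mor U"
    using CA.apt_point npt_point by (auto simp: mor_Proj U_def npt_apt)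
  have act: "snd (proj_map C \<alpha>C) ?V (C.E.fsect (proj_fracs C 0) ?V \<phi>) = C.E.fsect (proj_fracs C 0) {q \<in> proj_points C. CA.apt q \<in> ?V} \<psi>"
  proof (rule CA.proj_map_sect)
    show "?V \<subseteq> proj_points C" by (auto simp: mor_Proj)
    show "(emb a, emb f) \<in> proj_fracs C 0" using emb_hcomp[OF e(1)] emb_hcomp[OF e(2)] by (rule C.fracsI)
    show "emb f \<noteq> \<zero>\<^bsub>C\<^esub>" using c af B.E.\<rho>_eq_0[OF c(2)] C.E.\<rho>_zero rho_emb[OF c(2)] by auto
    show "C.\<rho> (emb a) = \<phi> * C.\<rho> (emb f)" using af(3) c by (simp add: rho_emb)
    let ?t = "to_fract (Poly_Mapping.single 0 (\<theta> ^ e)) :: laurent fract"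
    have pr: "B.\<rho> (\<alpha>B b) = ?t * C.\<rho> (\<alpha>C (emb b))" if b: "b \<in> hcomp B e" for b
    proof -
      have bc: "b \<in> carrier B" using b by (rule B.hcompD)
      have "B.\<rho> (\<alpha>B b) = C.\<rho> (emb (\<alpha>B b))" using bc by (simp add: rho_emb BA.\<alpha>_closed)
      also have "\<dots> = C.\<rho> (scal C (\<theta> ^ e)) * C.\<rho> (\<alpha>C (emb b))"
        unfolding emb_act[OF b] using bc by (intro C.E.\<rho>_mult C.scal_closed CA.\<alpha>_closed emb)
      also have "C.\<rho> (scal C (\<theta> ^ e)) = ?t" by (rule C.P.\<rho>_scal)
      finally show ?thesis .
    qed
    have "?t \<noteq> 0" using \<theta> by (metis (no_types) lookup_single_eq lookup_zero power_not_zero to_fract_eq_0_iff)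
    have ea: "a \<in> hcomp B e" using e(1) by simp
    \<comment> \<open>Numerator and denominator have the same degree \<open>e\<close>, so the same
      factor appears on both sides and cancels.\<close>
    have "?t * C.\<rho> (\<alpha>C (emb a)) = ?t * (\<psi> * C.\<rho> (\<alpha>C (emb f)))"
      using \<psi> unfolding pr[OF ea] pr[OF e(2)] by (simp only: mult.left_commute)
    then show "C.\<rho> (\<alpha>C (emb a)) = \<psi> * C.\<rho> (\<alpha>C (emb f))"
      by (rule mult_left_cancel[OF \<open>?t \<noteq> 0\<close>, THEN iffD1])
  qed
  have oU': "openin (tp (frac_space B (proj_points B) (proj_fracs B 0))) U" using U by (simp add: frac_space_def)
  show "snd (proj_map C \<alpha>C) ?V (snd D.mor V x) = snd D.mor (preim (Proj B) (proj_map B \<alpha>B) V) (snd (proj_map B \<alpha>B) V x)"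
    unfolding xB preU xC act eqU using D.mor_sect[OF oU' regU] by (simp add: C.Proj_frac_space)
qed

end

section \<open>Rational functions on the projective line\<close>

definition poly_ord :: "proj_line \<Rightarrow> complex poly \<Rightarrow> int" where
  "poly_ord P a = (case P of Fin c \<Rightarrow> int (Polynomial.order c a) | Infinity \<Rightarrow> - int (Polynomial.degree a))"

lemma poly_ord_mult: "a \<noteq> 0 \<Longrightarrow> b \<noteq> 0 \<Longrightarrow> poly_ord P (a * b) = poly_ord P a + poly_ord P b"
  by (cases P) (simp_all add: poly_ord_def order_mult Polynomial.degree_mult_eq)

lemma poly_ord_add:
  assumes "a \<noteq> 0" "b \<noteq> 0" "a + b \<noteq> 0" "n \<le> poly_ord P a" "n \<le> poly_ord P b"
  shows "n \<le> poly_ord P (a + b)"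
proof (cases P)
  case (Fin c)
  have "[:- c, 1:] ^ nat n dvd a" "[:- c, 1:] ^ nat n dvd b"
    using assms Fin by (auto simp: poly_ord_def order_divides)
  then have "[:- c, 1:] ^ nat n dvd a + b" by (rule dvd_add)
  then show ?thesis using assms(3) Fin by (auto simp: poly_ord_def order_divides)
next
  case Infinity
  then have "Polynomial.degree a \<le> nat (- n)" "Polynomial.degree b \<le> nat (- n)" "n \<le> 0"
    using assms by (simp_all add: poly_ord_def)
  then have "Polynomial.degree (a + b) \<le> nat (- n)" "n \<le> 0" by (simp_all add: Polynomial.degree_add_le)
  then show ?thesis by (simp add: poly_ord_def Infinity)
qed

lemma ratfun_cases:
  fixes f :: ratfun
  assumes "f \<noteq> 0"
  obtains a b where "a \<noteq> 0" "b \<noteq> 0" "f = Fract a b"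
  using assms by (cases f) (auto simp: Zero_fract_def eq_fract)

text \<open>Equal fractions satisfy \<open>a b' = a' b\<close>, and orders of polynomials are
  additive, so the order does not depend on the representation.\<close>

lemma ord_at_Fract:
  assumes "a \<noteq> 0" "b \<noteq> 0"
  shows "ord_at P (Fract a b) = poly_ord P a - poly_ord P b"
  unfolding ord_at_def
proof (rule the_equality)
  have e: "(case P of Fin c \<Rightarrow> int (Polynomial.order c a) - int (Polynomial.order c b)
      | Infinity \<Rightarrow> int (Polynomial.degree b) - int (Polynomial.degree a)) = poly_ord P a - poly_ord P b" for a b
    by (cases P) (simp_all add: poly_ord_def)
  show "\<exists>a' b'. a' \<noteq> 0 \<and> b' \<noteq> 0 \<and> Fract a b = Fract a' b' \<and> poly_ord P a - poly_ord P b =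
      (case P of Fin c \<Rightarrow> int (Polynomial.order c a') - int (Polynomial.order c b')
      | Infinity \<Rightarrow> int (Polynomial.degree b') - int (Polynomial.degree a'))"
    unfolding e using assms by blast
  fix k assume "\<exists>a' b'. a' \<noteq> 0 \<and> b' \<noteq> 0 \<and> Fract a b = Fract a' b' \<and> k =
      (case P of Fin c \<Rightarrow> int (Polynomial.order c a') - int (Polynomial.order c b')
      | Infinity \<Rightarrow> int (Polynomial.degree b') - int (Polynomial.degree a'))"
  then obtain a' b' where h: "a' \<noteq> 0" "b' \<noteq> 0" "Fract a b = Fract a' b'" "k = poly_ord P a' - poly_ord P b'"
    unfolding e by blast
  then have "a * b' = a' * b" using assms by (simp add: eq_fract)
  then have "poly_ord P (a * b') = poly_ord P (a' * b)" by simp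
  then show "k = poly_ord P a - poly_ord P b" using h assms by (simp add: poly_ord_mult)
qed

lemma Fract_eq_0_iff: "b \<noteq> 0 \<Longrightarrow> Fract a b = 0 \<longleftrightarrow> a = 0"
  by (simp add: Zero_fract_def eq_fract)

lemma ord_mult:
  fixes f g :: ratfun
  assumes "f \<noteq> 0" "g \<noteq> 0"
  shows "ord_at P (f * g) = ord_at P f + ord_at P g"
proof -
  obtain a b where f: "a \<noteq> 0" "b \<noteq> 0" "f = Fract a b" using ratfun_cases[OF assms(1)] .
  obtain c d where g: "c \<noteq> 0" "d \<noteq> 0" "g = Fract c d" using ratfun_cases[OF assms(2)] .
  show ?thesis using f g by (simp add: ord_at_Fract poly_ord_mult)
qed

lemma ord_1: "ord_at P 1 = 0"
  using ord_mult[of 1 1 P] by simp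

lemma ord_inverse: "f \<noteq> 0 \<Longrightarrow> ord_at P (inverse f) = - ord_at P f"
  using ord_mult[of f "inverse f" P] by (simp add: ord_1)

lemma ord_power: "f \<noteq> 0 \<Longrightarrow> ord_at P (f ^ n) = int n * ord_at P f"
  by (induction n) (simp_all add: ord_1 ord_mult algebra_simps)

lemma ord_power_int: "f \<noteq> 0 \<Longrightarrow> ord_at P (f powi n) = n * ord_at P f"
  by (cases "n \<ge> 0") (simp_all add: power_int_def ord_power ord_inverse)

lemma ord_prod: "(\<And>i. i \<in> I \<Longrightarrow> f i \<noteq> 0) \<Longrightarrow> ord_at P (prod f I) = (\<Sum>i\<in>I. ord_at P (f i))"
  by (induction I rule: infinite_finite_induct) (simp_all add: ord_1 ord_mult prod_zero_iff)

lemma const_fun_hom: "const_fun 0 = 0" "const_fun 1 = 1" "const_fun (a + b) = const_fun a + const_fun b"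
    "const_fun (a * b) = const_fun a * const_fun b" "const_fun (a - b) = const_fun a - const_fun b"
  by (simp_all add: const_fun_def Zero_fract_def One_fract_def eq_fract)

lemma const_fun_eq_0: "const_fun c = 0 \<longleftrightarrow> c = 0"
  by (simp add: const_fun_def Zero_fract_def eq_fract)

lemma ord_const: "c \<noteq> 0 \<Longrightarrow> ord_at P (const_fun c) = 0"
  by (cases P) (simp_all add: const_fun_def ord_at_Fract poly_ord_def order_0I)

text \<open>A lower bound on the order in which the zero function counts as having infinite order;
  this makes the bounds additive without exceptions.\<close>

definition vge :: "proj_line \<Rightarrow> int \<Rightarrow> ratfun \<Rightarrow> bool" where
  "vge P n f \<longleftrightarrow> (f \<noteq> 0 \<longrightarrow> n \<le> ord_at P f)"

lemma vge_0: "vge P n 0" by (simp add: vge_def)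

lemma vge_add:
  assumes "vge P n f" "vge P n g"
  shows "vge P n (f + g)"
proof (cases "f = 0 \<or> g = 0 \<or> f + g = 0")
  case False
  obtain a b where f: "a \<noteq> 0" "b \<noteq> 0" "f = Fract a b" using ratfun_cases[of f] False by blast
  obtain c d where g: "c \<noteq> 0" "d \<noteq> 0" "g = Fract c d" using ratfun_cases[of g] False by blast
  have fg: "f + g = Fract (a * d + c * b) (b * d)" using f g by simp
  then have ne: "a * d + c * b \<noteq> 0" using False f g by (auto simp: Fract_eq_0_iff)
  have "n + poly_ord P (b * d) \<le> poly_ord P (a * d + c * b)"
    by (rule poly_ord_add[OF _ _ ne])
      (use assms False f g in \<open>auto simp: vge_def ord_at_Fract poly_ord_mult\<close>)
  then show ?thesis using f g ne unfolding fg by (simp add: vge_def ord_at_Fract)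
qed (use assms vge_0 in auto)

lemma vge_mult: "vge P n f \<Longrightarrow> vge P k g \<Longrightarrow> vge P (n + k) (f * g)"
  by (auto simp: vge_def ord_mult)

lemma vge_const: "vge P 0 (const_fun c)"
  by (cases "c = 0") (auto simp: vge_def const_fun_hom ord_const)

lemma vge_mono: "vge P n f \<Longrightarrow> k \<le> n \<Longrightarrow> vge P k f"
  by (auto simp: vge_def)

lemma vge_uminus: "vge P n f \<Longrightarrow> vge P n (- f)"
  using vge_mult[OF vge_const[of P "-1"], of n f] const_fun_hom(5)[of 0 1] by (simp add: const_fun_hom(1,2))

lemma vge_diff: "vge P n f \<Longrightarrow> vge P n g \<Longrightarrow> vge P n (f - g)"
  using vge_add[of P n f "- g"] vge_uminus by simp

section \<open>Uniformizers and leading coefficients\<close>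

definition unif :: "proj_line \<Rightarrow> ratfun" where
  "unif P = (case P of Fin c \<Rightarrow> Fract [:- c, 1:] 1 | Infinity \<Rightarrow> Fract 1 [:0, 1:])"

lemma unif: "unif P \<noteq> 0" "ord_at P (unif P) = 1"
proof -
  show "unif P \<noteq> 0" by (cases P) (simp_all add: unif_def Fract_eq_0_iff)
  have "Polynomial.order c [:- c, 1:] = 1" for c :: complex using order_power_n_n[of c 1] by simp
  then show "ord_at P (unif P) = 1"
    by (cases P) (simp_all add: unif_def ord_at_Fract poly_ord_def)
qed

lemma vge_unif: "vge P (n + k) (f * unif P powi k) \<longleftrightarrow> vge P n f"
  by (auto simp: vge_def ord_mult ord_power_int unif)

text \<open>The residue fields are all \<open>\<complex>\<close>. At a finite point the constant is
  the quotient of the values left after cancelling the common zero; at infinity it is the quotient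
  of the leading coefficients of two polynomials of equal degree.\<close>

lemma residue_exists:
  assumes "vge P 0 f"
  shows "\<exists>c. vge P 1 (f - const_fun c)"
proof (cases "f \<noteq> 0 \<and> ord_at P f = 0")
  case False
  then have "vge P 1 (f - const_fun 0)" using assms by (auto simp: vge_def const_fun_hom)
  then show ?thesis by blast
next
  case True
  obtain a b where f: "a \<noteq> 0" "b \<noteq> 0" "f = Fract a b" using ratfun_cases True by blast
  have e: "poly_ord P a = poly_ord P b" using True f by (simp add: ord_at_Fract)
  have sub: "f - const_fun c = Fract (a - [:c:] * b) b" for c using f by (simp add: const_fun_def)
  have red: "\<exists>c. vge P 1 (f - const_fun c)" if "a - [:c:] * b = 0 \<or> poly_ord P b < poly_ord P (a - [:c:] * b)" for c
    by (rule exI[of _ c]) (use that f(1,2) in \<open>auto simp: sub vge_def ord_at_Fract Fract_eq_0_iff simp del: mult_pCons_left\<close>)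
  show ?thesis
  proof (cases P)
    case (Fin z)
    define k where "k = Polynomial.order z b"
    obtain a' where a': "a = [:- z, 1:] ^ k * a'" "\<not> [:- z, 1:] dvd a'"
      using order_decomp[OF f(1), of z] e Fin by (auto simp: poly_ord_def k_def)
    obtain b' where b': "b = [:- z, 1:] ^ k * b'" "\<not> [:- z, 1:] dvd b'"
      using order_decomp[OF f(2), of z] by (auto simp: k_def)
    have nz: "poly b' z \<noteq> 0" using b'(2) by (simp add: poly_eq_0_iff_dvd)
    let ?c = "poly a' z / poly b' z"
    have "poly (a' - [:?c:] * b') z = 0" using nz by simp
    then have "[:- z, 1:] dvd a' - [:?c:] * b'" by (simp only: poly_eq_0_iff_dvd)
    then have "[:- z, 1:] ^ k * [:- z, 1:] dvd [:- z, 1:] ^ k * (a' - [:?c:] * b')" by (rule mult_dvd_mono[OF dvd_refl])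
    also have "[:- z, 1:] ^ k * (a' - [:?c:] * b') = a - [:?c:] * b" unfolding a'(1) b'(1) by (simp add: algebra_simps)
    finally have "[:- z, 1:] ^ Suc k dvd a - [:?c:] * b" by (simp only: power_Suc2)
    then show ?thesis by (intro red[of ?c]) (simp only: order_divides poly_ord_def Fin k_def proj_line.case, linarith)
  next
    case Infinity
    then have d: "Polynomial.degree a = Polynomial.degree b" using e by (simp add: poly_ord_def)
    let ?c = "lead_coeff a / lead_coeff b"
    have "Polynomial.degree (a - [:?c:] * b) < Polynomial.degree b" if ne: "a - [:?c:] * b \<noteq> 0"
    proof -
      have "Polynomial.degree (a - [:?c:] * b) \<le> Polynomial.degree b"
        by (rule Polynomial.degree_diff_le) (simp_all add: d)
      moreover have "Polynomial.degree (a - [:?c:] * b) \<noteq> Polynomial.degree b"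
      proof
        assume "Polynomial.degree (a - [:?c:] * b) = Polynomial.degree b"
        then have "lead_coeff (a - [:?c:] * b) = Polynomial.coeff (a - [:?c:] * b) (Polynomial.degree b)" by simp
        also have "\<dots> = 0" using f(2) by (simp add: d)
        finally show False using ne by (simp only: leading_coeff_0_iff)
      qed
      ultimately show ?thesis by simp
    qed
    then show ?thesis by (intro red[of ?c]) (auto simp: poly_ord_def Infinity)
  qed
qed

lemma residue_unique:
  assumes "vge P 1 (f - const_fun c)" "vge P 1 (f - const_fun d)"
  shows "c = d"
proof (rule ccontr)
  assume "c \<noteq> d"
  have "vge P 1 (const_fun (c - d))"
    using vge_diff[OF assms(2,1)] by (simp add: const_fun_hom)
  then show False using \<open>c \<noteq> d\<close> ord_const[of "c - d" P] by (simp add: vge_def const_fun_eq_0)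
qed

text \<open>The coefficient of \<open>unif P powi - j\<close> in the expansion of a function with a pole of order at most \<open>j\<close>.\<close>

definition lead_at :: "proj_line \<Rightarrow> int \<Rightarrow> ratfun \<Rightarrow> complex" where
  "lead_at P j f = (THE c. vge P 1 (f * unif P powi j - const_fun c))"

lemma lead_at:
  assumes "vge P (- j) f"
  shows "vge P 1 (f * unif P powi j - const_fun (lead_at P j f))"
proof -
  have "vge P 0 (f * unif P powi j)" using assms vge_unif[of P "- j" j f] by simp
  then have "\<exists>!c. vge P 1 (f * unif P powi j - const_fun c)" using residue_exists residue_unique by blast
  then show ?thesis unfolding lead_at_def by (rule theI')
qed

lemma lead_at_eqI: "vge P (- j) f \<Longrightarrow> vge P 1 (f * unif P powi j - const_fun c) \<Longrightarrow> lead_at P j f = c"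
  using lead_at residue_unique by blast

lemma lead_at_0: "lead_at P j 0 = 0"
  by (rule lead_at_eqI) (simp_all add: vge_0 const_fun_hom)

lemma lead_at_add:
  assumes "vge P (- j) f" "vge P (- j) g"
  shows "lead_at P j (f + g) = lead_at P j f + lead_at P j g"
proof (rule lead_at_eqI[OF vge_add[OF assms]])
  have "(f + g) * unif P powi j - const_fun (lead_at P j f + lead_at P j g) =
      (f * unif P powi j - const_fun (lead_at P j f)) + (g * unif P powi j - const_fun (lead_at P j g))"
    by (simp add: const_fun_hom algebra_simps)
  then show "vge P 1 ((f + g) * unif P powi j - const_fun (lead_at P j f + lead_at P j g))"
    using vge_add[OF lead_at[OF assms(1)] lead_at[OF assms(2)]] by simp
qed

text \<open>After multiplication by powers of the uniformizer both factors are constants up to terms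
  that vanish at \<open>P\<close>, and so are the cross terms of their product.\<close>

lemma lead_at_mult:
  assumes f: "vge P (- i) f" and g: "vge P (- j) g"
  shows "lead_at P (i + j) (f * g) = lead_at P i f * lead_at P j g"
proof (rule lead_at_eqI)
  show "vge P (- (i + j)) (f * g)" using vge_mult[OF f g] by simp
  let ?x = "f * unif P powi i" and ?y = "g * unif P powi j" and ?c = "const_fun (lead_at P i f)" and ?d = "const_fun (lead_at P j g)"
  have y: "vge P 0 ?y" using g vge_unif[of P "- j" j g] by simp
  have "vge P (1 + 0) ((?x - ?c) * ?y)" by (rule vge_mult[OF lead_at[OF f] y])
  moreover have "vge P (0 + 1) (?c * (?y - ?d))" by (rule vge_mult[OF vge_const lead_at[OF g]])
  ultimately have "vge P 1 ((?x - ?c) * ?y + ?c * (?y - ?d))" by (intro vge_add) simp_all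
  also have "(?x - ?c) * ?y + ?c * (?y - ?d) = ?x * ?y - ?c * ?d" by (simp add: algebra_simps)
  also have "?x * ?y = f * g * unif P powi (i + j)" by (simp add: power_int_add unif)
  finally show "vge P 1 (f * g * unif P powi (i + j) - const_fun (lead_at P i f * lead_at P j g))"
    by (simp add: const_fun_hom)
qed

lemma lead_at_eq_0_iff:
  assumes "vge P (- j) f"
  shows "lead_at P j f = 0 \<longleftrightarrow> vge P (1 - j) f"
proof
  assume "lead_at P j f = 0"
  then have "vge P 1 (f * unif P powi j)" using lead_at[OF assms] by (simp add: const_fun_hom)
  then show "vge P (1 - j) f" using vge_unif[of P "1 - j" j f] by simp
next
  assume "vge P (1 - j) f"
  then have "vge P 1 (f * unif P powi j - const_fun 0)" using vge_unif[of P "1 - j" j f] by (simp add: const_fun_hom)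
  then show "lead_at P j f = 0" by (rule lead_at_eqI[OF assms])
qed

lemma lead_at_const: "lead_at P 0 (const_fun c) = c"
  by (rule lead_at_eqI) (simp_all add: vge_const vge_0)

lemma lead_at_scale: "vge P (- j) f \<Longrightarrow> lead_at P j (const_fun c * f) = c * lead_at P j f"
  using lead_at_mult[of P 0 "const_fun c" j f] by (simp add: vge_const lead_at_const)

lemma H0_iff: "f \<in> H0 E \<longleftrightarrow> (\<forall>P. vge P (- E P) f)"
proof -
  have "0 \<le> ord_at P f + E P \<longleftrightarrow> - E P \<le> ord_at P f" for P by linarith
  then show ?thesis unfolding H0_def vge_def mem_Collect_eq by blast
qed

section \<open>Degrees of divisors and existence of sections\<close>

lemma poly_degree_sum_order:
  fixes a :: "complex poly"
  assumes "a \<noteq> 0" "finite R" "{c. poly a c = 0} \<subseteq> R"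
  shows "int (Polynomial.degree a) = (\<Sum>c\<in>R. int (Polynomial.order c a))"
proof -
  have "Polynomial.degree a = size (proots a)" by (simp add: size_proots_complex)
  also have "\<dots> = (\<Sum>c\<in>set_mset (proots a). count (proots a) c)" by (rule size_multiset_overloaded_eq)
  also have "\<dots> = (\<Sum>c\<in>{c. poly a c = 0}. Polynomial.order c a)" using assms(1) by simp
  also have "\<dots> = (\<Sum>c\<in>R. Polynomial.order c a)"
    by (rule sum.mono_neutral_left[OF assms(2,3)]) (use assms(1) in \<open>auto simp: order_0I\<close>)
  finally show ?thesis by simp
qed

text \<open>Principal divisors have degree 0.\<close>

lemma H0_degree:
  assumes f: "f \<in> H0 E" "f \<noteq> 0" and K: "finite K" "\<And>P. P \<notin> K \<Longrightarrow> E P \<le> 0"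
  shows "0 \<le> (\<Sum>P\<in>K. E P)"
proof -
  obtain a b where ab: "a \<noteq> 0" "b \<noteq> 0" "f = Fract a b" using ratfun_cases[OF f(2)] .
  define R where "R = {c. poly a c = 0} \<union> {c. poly b c = 0} \<union> {c. Fin c \<in> K}"
  have "finite (Fin -` K)" by (rule finite_vimageI[OF K(1)]) (auto simp: inj_def)
  then have R: "finite R" using ab poly_roots_finite by (auto simp: R_def vimage_def)
  \<comment> \<open>Contains all zeros and poles of \<open>f\<close> and all of \<open>K\<close>, so
    a sum over it sees the whole divisor of \<open>f\<close>.\<close>
  let ?L = "insert Infinity (Fin ` R)"
  have L: "finite ?L" using R by simp
  have KL: "K \<subseteq> ?L"
  proof
    fix P assume "P \<in> K"
    then show "P \<in> ?L" by (cases P) (auto simp: R_def)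
  qed
  have "(\<Sum>P\<in>?L. ord_at P f) = ord_at Infinity f + (\<Sum>P\<in>Fin ` R. ord_at P f)"
    using R by (subst sum.insert) auto
  also have "(\<Sum>P\<in>Fin ` R. ord_at P f) = (\<Sum>c\<in>R. ord_at (Fin c) f)"
    by (subst sum.reindex) (auto simp: inj_on_def)
  also have "ord_at Infinity f + (\<Sum>c\<in>R. ord_at (Fin c) f) = 0"
  proof -
    have "{c. poly a c = 0} \<subseteq> R" "{c. poly b c = 0} \<subseteq> R" by (auto simp: R_def)
    from poly_degree_sum_order[OF ab(1) R this(1)] poly_degree_sum_order[OF ab(2) R this(2)]
    show ?thesis using ab(1,2) by (simp add: ab(3) ord_at_Fract poly_ord_def sum_subtractf)
  qed
  finally have z: "(\<Sum>P\<in>?L. ord_at P f) = 0" .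
  have "0 \<le> ord_at P f + E P" for P using f unfolding H0_def by blast
  then have "0 \<le> (\<Sum>P\<in>?L. ord_at P f + E P)" by (intro sum_nonneg)
  then have "0 \<le> (\<Sum>P\<in>?L. E P)" using z by (simp add: sum.distrib)
  also have "(\<Sum>P\<in>?L. E P) = (\<Sum>P\<in>K. E P) + (\<Sum>P\<in>?L - K. E P)"
    using sum.subset_diff[OF KL L, of E] by simp
  also have "\<dots> \<le> (\<Sum>P\<in>K. E P)" using sum_nonpos[of "?L - K" E] K(2) by simp
  finally show ?thesis .
qed

text \<open>On the projective line orders at finite points can be prescribed by powers of linear
  factors. The degree condition leaves a nonnegative surplus, which is put into extra zeros away
  from \<open>Q\<close>.\<close>

lemma exists_section:
  assumes K: "finite K" "Q \<notin> K" "\<And>P. P \<notin> K \<Longrightarrow> P \<noteq> Q \<Longrightarrow> E P = 0" and deg: "0 \<le> j + (\<Sum>P\<in>K. E P)"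
  shows "\<exists>f. f \<noteq> 0 \<and> ord_at Q f = - j \<and> (\<forall>P. P \<noteq> Q \<longrightarrow> - E P \<le> ord_at P f)"
proof -
  define lin where "lin c = Fract [:- c, 1:] 1" for c :: complex
  have lin0: "lin c \<noteq> 0" for c by (simp add: lin_def Fract_eq_0_iff)
  have oinf: "ord_at Infinity (lin c) = -1" for c by (simp add: lin_def ord_at_Fract poly_ord_def)
  have ofin: "ord_at (Fin z) (lin c) = (if z = c then 1 else 0)" for z c
  proof -
    have "Polynomial.order c [:- c, 1:] = 1" using order_power_n_n[of c 1] by simp
    moreover have "Polynomial.order z [:- c, 1:] = 0" if "z \<noteq> c" using that by (intro order_0I) simp
    ultimately show ?thesis by (simp add: lin_def ord_at_Fract poly_ord_def)
  qed
  define R where "R = {c. Fin c \<in> K}"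
  have "finite (Fin -` K)" by (rule finite_vimageI[OF K(1)]) (auto simp: inj_def)
  then have R: "finite R" by (simp add: R_def vimage_def)
  define g where "g = (\<Prod>c\<in>R. lin c powi (- E (Fin c)))"
  have g0: "g \<noteq> 0" using R lin0 by (simp add: g_def power_int_eq_0_iff)
  have go: "ord_at P g = (\<Sum>c\<in>R. - E (Fin c) * ord_at P (lin c))" for P
    unfolding g_def using lin0 by (subst ord_prod) (simp_all add: ord_power_int power_int_eq_0_iff)
  have gfin: "ord_at (Fin z) g = (if z \<in> R then - E (Fin z) else 0)" for z
    unfolding go ofin using R by (simp add: if_distrib[of "\<lambda>x. _ * x"] sum.delta' cong: if_cong)
  have ginf: "ord_at Infinity g = (\<Sum>c\<in>R. E (Fin c))" unfolding go oinf by simp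
  have sumR: "(\<Sum>c\<in>R. E (Fin c)) = (\<Sum>P\<in>K - {Infinity}. E P)"
  proof -
    have "K - {Infinity} = Fin ` R"
    proof (intro equalityI subsetI)
      fix P assume "P \<in> K - {Infinity}"
      then show "P \<in> Fin ` R" by (cases P) (auto simp: R_def)
    qed (auto simp: R_def)
    then show ?thesis by (simp add: sum.reindex inj_on_def)
  qed
  show ?thesis
  proof (cases Q)
    case Infinity
    then have KI: "K - {Infinity} = K" using K(2) by auto
    define n where "n = nat (j + (\<Sum>P\<in>K. E P))"
    have n: "int n = j + (\<Sum>P\<in>K. E P)" using deg by (simp add: n_def)
    \<comment> \<open>The factor \<open>lin 0\<close> deepens the pole at infinity to order exactly
      \<open>j\<close>; the compensating zeros go to the point 0, where they do no harm.\<close>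
    let ?f = "g * lin 0 ^ n"
    have "?f \<noteq> 0" using g0 lin0 by simp
    moreover have "ord_at Q ?f = - j" using g0 lin0 n
      by (simp add: Infinity ord_mult ord_power oinf ginf sumR KI)
    moreover have "- E P \<le> ord_at P ?f" if "P \<noteq> Q" for P
    proof (cases P)
      case (Fin z)
      then show ?thesis using g0 lin0 K(3)[of P] that
        by (auto simp: ord_mult ord_power gfin ofin R_def)
    qed (use that Infinity in simp)
    ultimately show ?thesis by blast
  next
    case (Fin q)
    \<comment> \<open>As \<open>Q\<close> is not in \<open>K\<close>, \<open>g\<close> has order 0
      there and the new factor alone fixes the pole order. The surplus shows up at infinity.\<close>
    let ?f = "g * lin q powi (- j)"
    have ne: "?f \<noteq> 0" using g0 lin0 by (simp add: power_int_eq_0_iff)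
    have ord: "ord_at P ?f = ord_at P g - j * ord_at P (lin q)" for P
      using g0 lin0 by (simp add: ord_mult ord_power_int power_int_eq_0_iff)
    have "ord_at Q ?f = - j" using K(2) unfolding ord by (simp add: Fin gfin ofin R_def)
    moreover have "- E P \<le> ord_at P ?f" if PQ: "P \<noteq> Q" for P
    proof (cases P)
      case Fz: (Fin z)
      then have "z \<noteq> q" using PQ Fin by auto
      then show ?thesis using K(3)[of P] PQ unfolding ord by (auto simp: Fz gfin ofin R_def)
    next
      case Infinity
      have "(\<Sum>P\<in>K. E P) = (\<Sum>P\<in>K - {Infinity}. E P) + E Infinity"
      proof (cases "Infinity \<in> K")
        case True then show ?thesis using sum.remove[OF K(1) True, of E] by simp
      next
        case False
        then have "E Infinity = 0" using K(3)[of Infinity] PQ Infinity by auto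
        then show ?thesis using False by simp
      qed
      then show ?thesis using deg unfolding ord by (simp add: Infinity ginf oinf sumR)
    qed
    ultimately show ?thesis using ne by blast
  qed
qed

section \<open>Cones and polyhedral divisors\<close>

text \<open>Minima of a linear form add up under Minkowski sums. This is the bound from below;
  \<open>minkowski_attained\<close> shows that it is reached.\<close>

lemma minkowski_lower:
  assumes c: "\<And>P x. P \<in> A \<Longrightarrow> x \<in> \<D> P \<Longrightarrow> c P \<le> x \<bullet> y" and F: "finite F" "\<And>P. P \<in> A - F \<Longrightarrow> c P = 0"
    and x: "x \<in> minkowski_sum A \<D>"
  shows "(\<Sum>P\<in>A \<inter> F. c P) \<le> x \<bullet> y"
proof -
  obtain w where w: "x = (\<Sum>P\<in>{P\<in>A. w P \<noteq> 0}. w P)" "\<forall>P\<in>A. w P \<in> \<D> P" "finite {P\<in>A. w P \<noteq> 0}"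
    using x by (auto simp: minkowski_sum_def)
  let ?K = "{P\<in>A. w P \<noteq> 0} \<union> A \<inter> F"
  have K: "finite ?K" using w F by simp
  have "(\<Sum>P\<in>A \<inter> F. c P) = (\<Sum>P\<in>?K. c P)"
    by (rule sum.mono_neutral_left[OF K]) (use F in auto)
  also have "\<dots> \<le> (\<Sum>P\<in>?K. w P \<bullet> y)" by (rule sum_mono) (use c w in auto)
  also have "\<dots> = (\<Sum>P\<in>{P\<in>A. w P \<noteq> 0}. w P \<bullet> y)"
    by (rule sum.mono_neutral_right[OF K]) auto
  also have "\<dots> = x \<bullet> y" by (simp add: w(1) inner_sum_left)
  finally show ?thesis .
qed

lemma minkowski_attained:
  assumes c: "\<And>P. P \<in> A \<inter> F \<Longrightarrow> \<exists>x\<in>\<D> P. x \<bullet> y = c P" and F: "finite F" "\<And>P. P \<in> A - F \<Longrightarrow> 0 \<in> \<D> P"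
  shows "\<exists>x\<in>minkowski_sum A \<D>. x \<bullet> y = (\<Sum>P\<in>A \<inter> F. c P)"
proof -
  have "\<forall>P\<in>A \<inter> F. \<exists>x. x \<in> \<D> P \<and> x \<bullet> y = c P" using c by blast
  from bchoice[OF this] obtain f where f: "\<And>P. P \<in> A \<inter> F \<Longrightarrow> f P \<in> \<D> P \<and> f P \<bullet> y = c P" by blast
  define w where "w P = (if P \<in> F then f P else 0)" for P
  let ?x = "\<Sum>P\<in>{P\<in>A. w P \<noteq> 0}. w P"
  have sub: "{P\<in>A. w P \<noteq> 0} \<subseteq> A \<inter> F" by (auto simp: w_def)
  have AF: "finite (A \<inter> F)" using F by simp
  have "\<forall>P\<in>A. w P \<in> \<D> P" using f F by (auto simp: w_def)
  then have "?x \<in> minkowski_sum A \<D>" unfolding minkowski_sum_def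
    using finite_subset[OF sub AF] by blast
  moreover have "?x \<bullet> y = (\<Sum>P\<in>A \<inter> F. w P \<bullet> y)"
    unfolding inner_sum_left by (rule sum.mono_neutral_left[OF AF sub]) auto
  moreover have "(\<Sum>P\<in>A \<inter> F. w P \<bullet> y) = (\<Sum>P\<in>A \<inter> F. c P)"
    by (rule sum.cong) (use f in \<open>auto simp: w_def\<close>)
  ultimately show ?thesis by metis
qed

text \<open>The whole shift is put on one summand. It is used with directions of the tail cone,
  which every summand absorbs.\<close>

lemma minkowski_shift:
  assumes x: "x \<in> minkowski_sum A \<D>" and P0: "P0 \<in> A" "\<And>z. z \<in> \<D> P0 \<Longrightarrow> z + g \<in> \<D> P0"
  shows "x + g \<in> minkowski_sum A \<D>"
proof -
  obtain w where w: "x = (\<Sum>P\<in>{P\<in>A. w P \<noteq> 0}. w P)" "\<forall>P\<in>A. w P \<in> \<D> P" "finite {P\<in>A. w P \<noteq> 0}"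
    using x by (auto simp: minkowski_sum_def)
  define w' where "w' = w(P0 := w P0 + g)"
  let ?K = "insert P0 {P\<in>A. w P \<noteq> 0}"
  have K: "finite ?K" using w by simp
  have sub: "{P\<in>A. w' P \<noteq> 0} \<subseteq> ?K" by (auto simp: w'_def)
  have "(\<Sum>P\<in>{P\<in>A. w' P \<noteq> 0}. w' P) = (\<Sum>P\<in>?K. w' P)"
    by (rule sum.mono_neutral_left[OF K sub]) (use P0 in auto)
  also have "\<dots> = w' P0 + (\<Sum>P\<in>?K - {P0}. w' P)" by (rule sum.remove[OF K]) simp
  also have "(\<Sum>P\<in>?K - {P0}. w' P) = (\<Sum>P\<in>?K - {P0}. w P)" by (rule sum.cong) (auto simp: w'_def)
  also have "w' P0 + (\<Sum>P\<in>?K - {P0}. w P) = (\<Sum>P\<in>?K. w P) + g"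
    using sum.remove[OF K, of P0 w] by (simp add: w'_def algebra_simps)
  also have "(\<Sum>P\<in>?K. w P) = x" unfolding w(1)
    by (rule sum.mono_neutral_right[OF K]) (use P0 in auto)
  finally have e: "(\<Sum>P\<in>{P\<in>A. w' P \<noteq> 0}. w' P) = x + g" .
  have "\<forall>P\<in>A. w' P \<in> \<D> P" using w P0 by (auto simp: w'_def)
  then show ?thesis unfolding minkowski_sum_def e[symmetric] using finite_subset[OF sub K] by blast
qed

section \<open>Dual cones and cones over polytopes\<close>

lemma dual_cone_closed:
  "0 \<in> dual_cone S" "x \<in> dual_cone S \<Longrightarrow> y \<in> dual_cone S \<Longrightarrow> x + y \<in> dual_cone S"
  "x \<in> dual_cone S \<Longrightarrow> 0 \<le> c \<Longrightarrow> c *\<^sub>R x \<in> dual_cone S"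
  unfolding dual_cone_def mem_Collect_eq inner_add_right inner_scaleR_right inner_zero_right
  by (simp, metis add_nonneg_nonneg, metis mult_nonneg_nonneg)

lemma inner_halfspace:
  "closed {w. 0 \<le> w \<bullet> u}" "convex_cone {w. 0 \<le> w \<bullet> u}"
  using closed_halfspace_ge[of 0 u] convex_cone_halfspace_ge[of u] by (simp_all add: inner_commute)

text \<open>Half-spaces are closed convex cones, so a linear form nonnegative on the generators
  stays nonnegative on the hull.\<close>

lemma dual_cone_closed_hull: "dual_cone (closed_convex_cone_hull X) = dual_cone X"
proof
  show "dual_cone (closed_convex_cone_hull X) \<subseteq> dual_cone X"
    using hull_subset[of X] unfolding dual_cone_def closed_convex_cone_hull_def by blast
  show "dual_cone X \<subseteq> dual_cone (closed_convex_cone_hull X)"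
  proof
    fix u assume u: "u \<in> dual_cone X"
    have "closed_convex_cone_hull X \<subseteq> {w. 0 \<le> w \<bullet> u}" unfolding closed_convex_cone_hull_def
      by (rule hull_minimal) (use u inner_halfspace in \<open>auto simp: dual_cone_def\<close>)
    then show "u \<in> dual_cone (closed_convex_cone_hull X)" unfolding dual_cone_def by blast
  qed
qed

lemma dual_cone_hull: "dual_cone (convex_cone hull G) = dual_cone G"
proof
  show "dual_cone (convex_cone hull G) \<subseteq> dual_cone G"
    using hull_subset[of G] unfolding dual_cone_def by blast
  show "dual_cone G \<subseteq> dual_cone (convex_cone hull G)"
  proof
    fix u assume u: "u \<in> dual_cone G"
    have "convex_cone hull G \<subseteq> {w. 0 \<le> w \<bullet> u}"
      by (rule hull_minimal) (use u inner_halfspace in \<open>auto simp: dual_cone_def\<close>)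
    then show "u \<in> dual_cone (convex_cone hull G)" unfolding dual_cone_def by blast
  qed
qed

lemma closed_convex_cone_hull_cone: "convex_cone (closed_convex_cone_hull X)"
proof -
  have "closed (closed_convex_cone_hull X) \<and> convex_cone (closed_convex_cone_hull X)"
    unfolding closed_convex_cone_hull_def
    by (rule hull_in) (use convex_cone_Inter in \<open>auto intro: closed_Inter\<close>)
  then show ?thesis by blast
qed

lemma cone_over_cases:
  assumes S: "convex S" and z: "z \<in> cone_over S"
  shows "z = 0 \<or> (0 < fst z \<and> snd z /\<^sub>R fst z \<in> S)"
proof -
  define T where "T = {z. z = 0 \<or> (0 < fst z \<and> snd z /\<^sub>R fst z \<in> S)}"
  have "convex_cone T" unfolding convex_cone_iff
  proof (intro conjI ballI allI impI)
    show "0 \<in> T" by (simp add: T_def)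
    show "x + y \<in> T" if xy: "x \<in> T" "y \<in> T" for x y
    proof (cases "x = 0 \<or> y = 0")
      case False
      then have p: "0 < fst x" "0 < fst y" "snd x /\<^sub>R fst x \<in> S" "snd y /\<^sub>R fst y \<in> S" using xy by (auto simp: T_def)
      let ?t = "fst x + fst y"
      have "(fst x / ?t) *\<^sub>R (snd x /\<^sub>R fst x) + (fst y / ?t) *\<^sub>R (snd y /\<^sub>R fst y) \<in> S"
        by (rule convexD[OF S p(3,4)]) (use p in \<open>auto simp: add_divide_distrib[symmetric]\<close>)
      also have "(fst x / ?t) *\<^sub>R (snd x /\<^sub>R fst x) + (fst y / ?t) *\<^sub>R (snd y /\<^sub>R fst y) = snd (x + y) /\<^sub>R fst (x + y)"
        using p by (simp add: scaleR_add_right divide_simps)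
      finally show ?thesis using p by (simp add: T_def)
    qed (use xy in auto)
    show "c *\<^sub>R x \<in> T" if x: "x \<in> T" "0 \<le> c" for x c
    proof (cases "c = 0")
      case False
      then have "inverse c * inverse (fst x) * c = inverse (fst x)" by simp
      then have "snd (c *\<^sub>R x) /\<^sub>R fst (c *\<^sub>R x) = snd x /\<^sub>R fst x" by (simp only: fst_scaleR snd_scaleR scaleR_scaleR real_scaleR_def inverse_mult_distrib)
      then show ?thesis using x False unfolding T_def mem_Collect_eq by (metis fst_scaleR mult_pos_pos order_less_le real_scaleR_def scaleR_zero_right)
    qed (simp add: T_def)
  qed
  then have "cone_over S \<subseteq> T" unfolding cone_over_def
    by (rule hull_minimal[rotated]) (auto simp: T_def)
  then show ?thesis using z by (auto simp: T_def)
qed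

lemma cone_overI: "0 < k \<Longrightarrow> x /\<^sub>R k \<in> S \<Longrightarrow> (k, x) \<in> cone_over S"
proof -
  assume k: "0 < k" and x: "x /\<^sub>R k \<in> S"
  have "(1, x /\<^sub>R k) \<in> cone_over S" unfolding cone_over_def by (rule hull_inc) (simp add: x)
  then have "k *\<^sub>R (1, x /\<^sub>R k) \<in> cone_over S" using k unfolding cone_over_def by (intro convex_cone_hull_mul) auto
  then show ?thesis using k by simp
qed

lemma zero_cone_over: "0 \<in> cone_over S"
  unfolding cone_over_def by (rule convex_cone_hull_contains_0)

locale tc_data =
  fixes M Box :: "'v::real_inner set" and \<Psi> :: "proj_line \<Rightarrow> 'v \<Rightarrow> real"
    and \<sigma> :: "(real \<times> 'v) set" and \<D> :: "proj_line \<Rightarrow> (real \<times> 'v) set"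
    and Q :: proj_line and m :: nat and v :: "real \<times> 'v"
  assumes lattice: "full_lattice M"
    and polytope: "divisorial_polytope M Box \<Psi>"
    and pdiv: "p_divisor (\<int> \<times> dual_lattice M) \<sigma> \<D>"
    and dual: "dual_cone \<sigma> = cone_over Box"
    and vals: "\<forall>P. \<forall>(k, u)\<in>dual_cone \<sigma>. polyhedral_value (\<D> P) (k, u) = k * \<Psi> P (u /\<^sub>R k)"
    and m: "m \<ge> 1"
    and mv: "real m *\<^sub>R v \<in> \<int> \<times> dual_lattice M"
begin

lemma M_0: "0 \<in> M" and M_add: "a \<in> M \<Longrightarrow> b \<in> M \<Longrightarrow> a + b \<in> M"
proof -
  obtain B where B: "M = {\<Sum>b\<in>B. of_int (c b) *\<^sub>R b | c :: 'v \<Rightarrow> int. True}"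
    using lattice unfolding full_lattice_def by blast
  have "(\<Sum>b\<in>B. of_int 0 *\<^sub>R b) = 0" by simp
  then show "0 \<in> M" unfolding B by (intro CollectI exI[of _ "\<lambda>_. 0"]) auto
  assume "a \<in> M" "b \<in> M"
  then obtain c d where "a = (\<Sum>b\<in>B. of_int (c b) *\<^sub>R b)" "b = (\<Sum>b\<in>B. of_int (d b) *\<^sub>R b)" unfolding B by blast
  then show "a + b \<in> M" unfolding B
    by (intro CollectI exI[of _ "\<lambda>x. c x + d x"]) (auto simp: scaleR_add_left sum.distrib)
qed

lemma M_sum: "(\<And>i. i \<in> I \<Longrightarrow> f i \<in> M) \<Longrightarrow> sum f I \<in> M"
  by (induction I rule: infinite_finite_induct) (auto simp: M_0 M_add)

lemma M_nat: "a \<in> M \<Longrightarrow> real n *\<^sub>R a \<in> M"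
  by (induction n) (auto simp: M_0 M_add scaleR_add_left)

definition N' :: "(real \<times> 'v) set" where "N' = \<int> \<times> dual_lattice M"

lemma pairing_int: "x \<in> N' \<Longrightarrow> y \<in> \<int> \<times> M \<Longrightarrow> x \<bullet> y \<in> \<int>"
  by (auto simp: N'_def dual_lattice_def inner_prod_def)

lemma N'_nat: "x \<in> N' \<Longrightarrow> real n *\<^sub>R x \<in> N'"
  by (auto simp: N'_def dual_lattice_def)

definition F :: "proj_line set" where "F = {P. \<D> P \<noteq> \<sigma>}"

lemma finite_F: "finite F" using pdiv by (simp add: F_def p_divisor_def)

definition G :: "(real \<times> 'v) set" where
  "G = (SOME G. finite G \<and> \<sigma> = convex_cone hull G)"

lemma G: "finite G" "\<sigma> = convex_cone hull G"
proof -
  have "\<exists>G. finite G \<and> \<sigma> = convex_cone hull G" using pdiv by (auto simp: p_divisor_def pointed_rational_cone_def)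
  from someI_ex[OF this] show "finite G" "\<sigma> = convex_cone hull G" by (simp_all add: G_def)
qed

definition VP :: "proj_line \<Rightarrow> (real \<times> 'v) set" where
  "VP P = (SOME V. finite V \<and> V \<noteq> {} \<and> (\<forall>x\<in>V. \<exists>k::nat. k > 0 \<and> real k *\<^sub>R x \<in> N') \<and> \<D> P = convex hull V + \<sigma>)"

lemma VP: "finite (VP P)" "VP P \<noteq> {}" "x \<in> VP P \<Longrightarrow> \<exists>k::nat. k > 0 \<and> real k *\<^sub>R x \<in> N'" "\<D> P = convex hull (VP P) + \<sigma>"
proof -
  have "\<exists>V. finite V \<and> V \<noteq> {} \<and> (\<forall>x\<in>V. \<exists>k::nat. k > 0 \<and> real k *\<^sub>R x \<in> N') \<and> \<D> P = convex hull V + \<sigma>"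
    using pdiv by (auto simp: p_divisor_def polyhedron_with_tail_def N'_def)
  from someI_ex[OF this] show "finite (VP P)" "VP P \<noteq> {}" "x \<in> VP P \<Longrightarrow> \<exists>k::nat. k > 0 \<and> real k *\<^sub>R x \<in> N'"
    "\<D> P = convex hull (VP P) + \<sigma>" unfolding VP_def by blast+
qed

lemma sigma_cone: "convex_cone \<sigma>"
  using convex_cone_convex_cone_hull[of G] unfolding G(2)[symmetric] .

lemma sigma_0: "0 \<in> \<sigma>" by (rule convex_cone_contains_0[OF sigma_cone])

lemma D_shift: "z \<in> \<D> P \<Longrightarrow> g \<in> \<sigma> \<Longrightarrow> z + g \<in> \<D> P"
proof -
  assume z: "z \<in> \<D> P" and g: "g \<in> \<sigma>"
  obtain a b where ab: "z = a + b" "a \<in> convex hull (VP P)" "b \<in> \<sigma>"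
    using z unfolding VP(4)[of P] by (rule set_plus_elim)
  have "a + (b + g) \<in> convex hull (VP P) + \<sigma>"
    by (rule set_plus_intro[OF ab(2) convex_cone_add[OF sigma_cone ab(3) g]])
  then show ?thesis by (simp add: VP(4)[of P] ab(1) add.assoc)
qed

lemma VP_D: "w \<in> VP P \<Longrightarrow> w \<in> \<D> P"
  unfolding VP(4)[of P] set_plus_def using sigma_0 hull_inc[of w "VP P" convex]
  by (intro CollectI bexI[of _ w] bexI[of _ 0]) auto

definition vl :: "proj_line \<Rightarrow> real \<times> 'v \<Rightarrow> real" where "vl P y = polyhedral_value (\<D> P) y"

text \<open>A form in the dual of the tail cone takes its minimum over the convex hull at one of the
  finitely many generators, and the tail only increases it. Hence each value function is a minimum
  of finitely many linear forms.\<close>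

lemma vl_attained: "y \<in> dual_cone \<sigma> \<Longrightarrow> \<exists>w\<in>VP P. vl P y = w \<bullet> y"
  and vl_le: "y \<in> dual_cone \<sigma> \<Longrightarrow> x \<in> \<D> P \<Longrightarrow> vl P y \<le> x \<bullet> y"
proof -
  have A: "\<exists>w\<in>VP P. vl P y = w \<bullet> y \<and> (\<forall>x\<in>\<D> P. w \<bullet> y \<le> x \<bullet> y)" if y: "y \<in> dual_cone \<sigma>" for y
  proof -
    have "Min ((\<lambda>w. w \<bullet> y) ` VP P) \<in> (\<lambda>w. w \<bullet> y) ` VP P" using VP(1,2) by (intro Min_in) auto
    then obtain w where w: "w \<in> VP P" "w \<bullet> y = Min ((\<lambda>w. w \<bullet> y) ` VP P)" by auto
    have le: "w \<bullet> y \<le> x \<bullet> y" if "x \<in> VP P" for x using w VP(1)[of P] that by simp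
    have "convex hull (VP P) \<subseteq> {x. y \<bullet> x \<ge> w \<bullet> y}"
      by (rule hull_minimal) (use le in \<open>simp add: inner_commute[of y] subset_iff\<close>, rule convex_halfspace_ge)
    then have hl: "w \<bullet> y \<le> x \<bullet> y" if "x \<in> convex hull (VP P)" for x
      using that by (auto simp: inner_commute)
    have "w \<bullet> y \<le> x \<bullet> y" if "x \<in> \<D> P" for x
    proof -
      obtain a b where ab: "x = a + b" "a \<in> convex hull (VP P)" "b \<in> \<sigma>"
        using set_plus_elim[of x "convex hull (VP P)" \<sigma>] \<open>x \<in> \<D> P\<close> unfolding VP(4)[of P] by metis
      have "0 \<le> b \<bullet> y" using y ab(3) by (simp add: dual_cone_def)
      then show ?thesis using hl[OF ab(2)] by (simp add: ab(1) inner_add_left)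
    qed
    moreover have "polyhedral_value (\<D> P) y = w \<bullet> y" unfolding polyhedral_value_def
      by (rule cInf_eq_minimum) (use VP_D[OF w(1)] calculation in auto)
    ultimately show ?thesis using w(1) by (auto simp: vl_def)
  qed
  show "y \<in> dual_cone \<sigma> \<Longrightarrow> \<exists>w\<in>VP P. vl P y = w \<bullet> y" using A by blast
  show "y \<in> dual_cone \<sigma> \<Longrightarrow> x \<in> \<D> P \<Longrightarrow> vl P y \<le> x \<bullet> y" using A by fastforce
qed

lemma vl_0: "P \<notin> F \<Longrightarrow> y \<in> dual_cone \<sigma> \<Longrightarrow> vl P y = 0"
  unfolding vl_def polyhedral_value_def F_def
  by (rule cInf_eq_minimum) (use sigma_0 in \<open>auto simp: dual_cone_def intro: image_eqI[of _ _ 0]\<close>)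

lemma vl_add:
  assumes "y \<in> dual_cone \<sigma>" "y' \<in> dual_cone \<sigma>"
  shows "vl P y + vl P y' \<le> vl P (y + y')"
proof -
  obtain w where w: "w \<in> VP P" "vl P (y + y') = w \<bullet> (y + y')" using vl_attained[OF dual_cone_closed(2)[OF assms]] by blast
  then show ?thesis using vl_le[OF assms(1) VP_D[OF w(1)]] vl_le[OF assms(2) VP_D[OF w(1)]] by (simp add: inner_add_right)
qed

lemma vl_scale:
  assumes y: "y \<in> dual_cone \<sigma>" and c: "0 \<le> c"
  shows "vl P (c *\<^sub>R y) = c * vl P y"
proof -
  note cy = dual_cone_closed(3)[OF y c]
  obtain w where w: "w \<in> VP P" "vl P y = w \<bullet> y" using vl_attained[OF y] by blast
  obtain w' where w': "w' \<in> VP P" "vl P (c *\<^sub>R y) = w' \<bullet> (c *\<^sub>R y)" using vl_attained[OF cy] by blast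
  have "vl P (c *\<^sub>R y) \<le> c * vl P y" using vl_le[OF cy VP_D[OF w(1)]] w by simp
  moreover have "c * vl P y \<le> vl P (c *\<^sub>R y)" using vl_le[OF y VP_D[OF w'(1)]] w' c by (simp add: mult_left_mono)
  ultimately show ?thesis by simp
qed

text \<open>The degree of \<open>\<D>(y)\<close> without the contribution of
  \<open>Q\<close>.\<close>

definition sm :: "real \<times> 'v \<Rightarrow> real" where "sm y = (\<Sum>P\<in>F - {Q}. vl P y)"

lemma mink_Q:
  assumes y: "y \<in> dual_cone \<sigma>"
  shows "x \<in> minkowski_sum (- {Q}) \<D> \<Longrightarrow> sm y \<le> x \<bullet> y" "\<exists>x\<in>minkowski_sum (- {Q}) \<D>. x \<bullet> y = sm y"
proof -
  have e: "- {Q} \<inter> F = F - {Q}" by auto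
  show "x \<in> minkowski_sum (- {Q}) \<D> \<Longrightarrow> sm y \<le> x \<bullet> y"
    using minkowski_lower[of "- {Q}" \<D> "\<lambda>P. vl P y" y F x] vl_le[OF y] vl_0[OF _ y] finite_F by (simp add: sm_def e)
  show "\<exists>x\<in>minkowski_sum (- {Q}) \<D>. x \<bullet> y = sm y"
    unfolding sm_def e[symmetric]
  proof (rule minkowski_attained[OF _ finite_F])
    fix P show "\<exists>x\<in>\<D> P. x \<bullet> y = vl P y" using vl_attained[OF y, of P] VP_D by metis
  qed (use sigma_0 in \<open>auto simp: F_def\<close>)
qed

lemma mink_all:
  assumes y: "y \<in> dual_cone \<sigma>"
  shows "\<exists>x\<in>minkowski_sum UNIV \<D>. x \<bullet> y = sm y + vl Q y"
proof -
  have "(\<Sum>P\<in>UNIV \<inter> F. vl P y) = sm y + vl Q y"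
    using sum.remove[OF finite_F, of Q "\<lambda>P. vl P y"] vl_0[OF _ y, of Q] by (cases "Q \<in> F") (auto simp: sm_def)
  moreover have "\<exists>x\<in>minkowski_sum UNIV \<D>. x \<bullet> y = (\<Sum>P\<in>UNIV \<inter> F. vl P y)"
  proof (rule minkowski_attained[OF _ finite_F])
    fix P show "\<exists>x\<in>\<D> P. x \<bullet> y = vl P y" using vl_attained[OF y, of P] VP_D by metis
  qed (use sigma_0 in \<open>auto simp: F_def\<close>)
  ultimately show ?thesis by simp
qed

lemma mink_sigma: "minkowski_sum UNIV \<D> \<subseteq> \<sigma>"
  using pdiv by (auto simp: p_divisor_def)

lemma deg_nonneg: "y \<in> dual_cone \<sigma> \<Longrightarrow> 0 \<le> sm y + vl Q y"
proof -
  assume y: "y \<in> dual_cone \<sigma>"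
  obtain x where "x \<in> minkowski_sum UNIV \<D>" "x \<bullet> y = sm y + vl Q y" using mink_all[OF y] by blast
  then show ?thesis using mink_sigma y unfolding dual_cone_def by (metis (mono_tags, lifting) mem_Collect_eq subsetD)
qed

text \<open>The Minkowski sum absorbs directions of \<open>\<sigma>\<close>, so a form that is
  negative on one of them would be unbounded below on the sum.\<close>

lemma dual_of_mink:
  assumes "\<And>x. x \<in> minkowski_sum UNIV \<D> \<Longrightarrow> 0 \<le> x \<bullet> y"
  shows "y \<in> dual_cone \<sigma>"
  unfolding dual_cone_def
proof (intro CollectI ballI, rule ccontr)
  fix g assume g: "g \<in> \<sigma>" and n: "\<not> 0 \<le> g \<bullet> y"
  obtain x where x: "x \<in> minkowski_sum UNIV \<D>" using mink_all[OF dual_cone_closed(1)] by blast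
  obtain k :: nat where k: "x \<bullet> y < real k * - (g \<bullet> y)" using n reals_Archimedean3[of "- (g \<bullet> y)"] by auto
  have "x + real k *\<^sub>R g \<in> minkowski_sum UNIV \<D>"
    by (rule minkowski_shift[OF x UNIV_I D_shift]) (use g sigma_cone in \<open>auto intro: convex_cone_scaleR\<close>)
  from assms[OF this] show False using k by (simp add: inner_add_left)
qed

text \<open>The unshifted generators force \<open>y\<close> into the dual of
  \<open>\<sigma>\<close>, and there their condition holds because the Minkowski sum lies in
  \<open>\<sigma>\<close>. The shifted generators leave a single inequality, by the additivity of
  minima.\<close>

lemma tc_cone_dual:
  "dual_cone (tc_cone \<D> Q v m) = {(y, a). y \<in> dual_cone \<sigma> \<and> 0 \<le> v \<bullet> y + a / real m + sm y}"
proof (intro equalityI subsetI)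
  let ?X = "({(v, 1 / real m)} + minkowski_sum (- {Q}) \<D> \<times> {0}) \<union> minkowski_sum UNIV \<D> \<times> {0}"
  have X: "dual_cone (tc_cone \<D> Q v m) = dual_cone ?X" by (simp add: tc_cone_def dual_cone_closed_hull)
  fix z assume z: "z \<in> dual_cone (tc_cone \<D> Q v m)"
  obtain y a where ya: "z = (y, a)" by (cases z)
  have y: "y \<in> dual_cone \<sigma>"
  proof (rule dual_of_mink)
    fix x assume "x \<in> minkowski_sum UNIV \<D>"
    then have "(x, 0) \<in> ?X" by (intro UnI2 SigmaI) simp_all
    from bspec[OF z[unfolded X, unfolded dual_cone_def mem_Collect_eq] this] have "0 \<le> (x, 0) \<bullet> z" .
    then show "0 \<le> x \<bullet> y" by (simp add: ya inner_Pair)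
  qed
  obtain x where x: "x \<in> minkowski_sum (- {Q}) \<D>" "x \<bullet> y = sm y" using mink_Q(2)[OF y] by blast
  have "(v, 1 / real m) + (x, 0) \<in> ?X" using x(1) unfolding set_plus_def by blast
  from bspec[OF z[unfolded X, unfolded dual_cone_def mem_Collect_eq] this]
  have "0 \<le> ((v, 1 / real m) + (x, 0)) \<bullet> z" .
  then show "z \<in> {(y, a). y \<in> dual_cone \<sigma> \<and> 0 \<le> v \<bullet> y + a / real m + sm y}"
    using y x(2) by (simp add: ya inner_Pair inner_add_left)
next
  let ?X = "({(v, 1 / real m)} + minkowski_sum (- {Q}) \<D> \<times> {0}) \<union> minkowski_sum UNIV \<D> \<times> {0}"
  have X: "dual_cone (tc_cone \<D> Q v m) = dual_cone ?X" by (simp add: tc_cone_def dual_cone_closed_hull)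
  fix z assume "z \<in> {(y, a). y \<in> dual_cone \<sigma> \<and> 0 \<le> v \<bullet> y + a / real m + sm y}"
  then obtain y a where ya: "z = (y, a)" "y \<in> dual_cone \<sigma>" "0 \<le> v \<bullet> y + a / real m + sm y" by auto
  show "z \<in> dual_cone (tc_cone \<D> Q v m)" unfolding X unfolding dual_cone_def
  proof (intro CollectI ballI)
    fix w assume "w \<in> ?X"
    then consider x where "x \<in> minkowski_sum (- {Q}) \<D>" "w = (v, 1 / real m) + (x, 0)" | x where "x \<in> minkowski_sum UNIV \<D>" "w = (x, 0)"
      unfolding set_plus_def by blast
    then show "0 \<le> w \<bullet> z"
    proof cases
      case 1
      then show ?thesis using mink_Q(1)[OF ya(2) 1(1)] ya(3) by (simp add: ya(1) inner_Pair inner_add_left)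
    next
      case 2
      then have "0 \<le> x \<bullet> y" using mink_sigma ya(2) unfolding dual_cone_def by (metis (mono_tags, lifting) mem_Collect_eq subsetD)
      then show ?thesis using 2 by (simp add: ya(1) inner_Pair)
    qed
  qed
qed

text \<open>The candidate for the value of the new divisor. At \<open>Q\<close> the convex hull with
  the extra vertex contributes \<open>j = \<langle>v,y\<rangle> + a/m\<close> next to the old
  value.\<close>

definition E :: "proj_line \<Rightarrow> (real \<times> 'v) \<times> real \<Rightarrow> real" where
  "E P w = (if P = Q then min (v \<bullet> fst w + snd w / real m) (vl Q (fst w)) else vl P (fst w))"

text \<open>The added tail cone contributes nonnegative amounts and contains 0, and a linear form on
  a convex hull is bounded below by its values on the generating set.\<close>

lemma tc_value:
  assumes w: "w \<in> dual_cone (tc_cone \<D> Q v m)"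
  shows "polyhedral_value (tc_divisor \<D> Q v m P) w = E P w"
proof -
  obtain y a where ya: "w = (y, a)" by (cases w)
  have y: "y \<in> dual_cone \<sigma>" using w ya by (simp add: tc_cone_dual)
  have c0: "0 \<in> tc_cone \<D> Q v m" unfolding tc_cone_def by (rule convex_cone_contains_0[OF closed_convex_cone_hull_cone])
  obtain x0 where x0: "x0 \<in> \<D> P" "vl P y = x0 \<bullet> y" using vl_attained[OF y] VP_D by blast
  define T where "T = (if P = Q then convex hull (insert (v, 1 / real m) (\<D> Q \<times> {0})) else \<D> P \<times> {0})"
  have low: "E P w \<le> x \<bullet> w" if x: "x \<in> T" for x
  proof (cases "P = Q")
    case True
    have "convex hull (insert (v, 1 / real m) (\<D> Q \<times> {0})) \<subseteq> {x. w \<bullet> x \<ge> E P w}"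
      by (rule hull_minimal)
        (use True vl_le[OF y] in \<open>auto simp: ya E_def inner_commute[of y] inner_commute[of a] min.coboundedI2\<close>, rule convex_halfspace_ge)
    then show ?thesis using x True by (auto simp: T_def inner_commute)
  next
    case False
    then show ?thesis using x vl_le[OF y] by (auto simp: T_def E_def ya inner_Pair)
  qed
  have "\<exists>x\<in>T. x \<bullet> w = E P w"
  proof (cases "P = Q")
    case True
    have "(v, 1 / real m) \<in> T" "(x0, 0) \<in> T"
      unfolding T_def using True x0(1) by (auto intro!: hull_inc)
    moreover have "(v, 1 / real m) \<bullet> w = v \<bullet> y + a / real m" "(x0, 0) \<bullet> w = vl Q y"
      using x0 True by (simp_all add: ya inner_Pair)
    moreover have "E P w = v \<bullet> y + a / real m \<or> E P w = vl Q y"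
      using True by (simp add: E_def ya min_def)
    ultimately show ?thesis by metis
  next
    case False
    then show ?thesis using x0 by (intro bexI[of _ "(x0, 0)"]) (auto simp: T_def E_def ya inner_Pair)
  qed
  then obtain x where x: "x \<in> T" "x \<bullet> w = E P w" by blast
  have "(INF x\<in>T + tc_cone \<D> Q v m. x \<bullet> w) = E P w"
  proof (rule cInf_eq_minimum)
    have "x \<in> T + tc_cone \<D> Q v m" using x(1) c0 by (metis add.right_neutral set_plus_intro)
    then show "E P w \<in> (\<lambda>x. x \<bullet> w) ` (T + tc_cone \<D> Q v m)" using x(2) by force
    fix t assume "t \<in> (\<lambda>x. x \<bullet> w) ` (T + tc_cone \<D> Q v m)"
    then obtain p q where pq: "p \<in> T" "q \<in> tc_cone \<D> Q v m" "t = (p + q) \<bullet> w" by (auto simp: set_plus_def)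
    have "0 \<le> q \<bullet> w" using w pq(2) by (simp add: dual_cone_def)
    then show "E P w \<le> t" using low[OF pq(1)] pq(3) by (simp add: inner_add_left)
  qed
  then show ?thesis by (simp add: polyhedral_value_def tc_divisor_def T_def)
qed

section \<open>The cone over \<open>\<Delta>\<^sub>Q\<close>\<close>

definition pr :: "real \<times> 'v \<times> real \<Rightarrow> real \<times> 'v" where "pr z = (fst z, fst (snd z))"
definition ht :: "real \<times> 'v \<times> real \<Rightarrow> real" where "ht z = snd (snd z)"

lemma pr_ht: "pr (y + z) = pr y + pr z" "pr (c *\<^sub>R z) = c *\<^sub>R pr z" "ht (y + z) = ht y + ht z" "ht (c *\<^sub>R z) = c * ht z"
    "pr 0 = 0" "ht 0 = 0"
  by (simp_all add: pr_def ht_def zero_prod_def)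

definition T :: "(real \<times> 'v \<times> real) set" where
  "T = {z. pr z \<in> dual_cone \<sigma> \<and> - sm (pr z) \<le> ht z \<and> ht z \<le> vl Q (pr z)}"

lemma Box_convex: "convex Box"
  using polytope by (auto simp: divisorial_polytope_def lattice_polytope_def)

lemma dual_cases: "y \<in> dual_cone \<sigma> \<Longrightarrow> y = 0 \<or> (0 < fst y \<and> snd y /\<^sub>R fst y \<in> Box)"
  using cone_over_cases[OF Box_convex] by (simp add: dual)

lemma dual_1: "u \<in> Box \<Longrightarrow> (1, u) \<in> dual_cone \<sigma>"
  unfolding dual by (rule cone_overI) auto

lemma vl_Psi: "u \<in> Box \<Longrightarrow> vl P (1, u) = \<Psi> P u"
  using vals dual_1[of u] by (fastforce simp: vl_def)

lemma Psi_0: "u \<in> Box \<Longrightarrow> P \<notin> F \<Longrightarrow> \<Psi> P u = 0"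
  using vl_0[OF _ dual_1] vl_Psi by metis

lemma sm_point_sum: "u \<in> Box \<Longrightarrow> sm (1, u) = point_sum (- {Q}) (\<lambda>P. \<Psi> P u)"
proof -
  assume u: "u \<in> Box"
  have "point_sum (- {Q}) (\<lambda>P. \<Psi> P u) = (\<Sum>P\<in>F - {Q}. \<Psi> P u)"
    unfolding point_sum_def
    by (rule sum.mono_neutral_left) (use finite_F Psi_0[OF u] in auto)
  then show ?thesis by (simp add: sm_def vl_Psi[OF u])
qed

lemma deg_point_sum: "u \<in> Box \<Longrightarrow> sm (1, u) + vl Q (1, u) = point_sum UNIV (\<lambda>P. \<Psi> P u)"
proof -
  assume u: "u \<in> Box"
  have "point_sum UNIV (\<lambda>P. \<Psi> P u) = (\<Sum>P\<in>F. \<Psi> P u)"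
    unfolding point_sum_def
    by (rule sum.mono_neutral_left) (use finite_F Psi_0[OF u] in auto)
  moreover have "(\<Sum>P\<in>F. vl P (1, u)) = sm (1, u) + vl Q (1, u)"
    using sum.remove[OF finite_F, of Q "\<lambda>P. vl P (1, u)"] vl_0[OF _ dual_1[OF u], of Q] by (cases "Q \<in> F") (auto simp: sm_def)
  ultimately show ?thesis by (simp add: vl_Psi[OF u])
qed

lemma sm_add: "y \<in> dual_cone \<sigma> \<Longrightarrow> y' \<in> dual_cone \<sigma> \<Longrightarrow> sm y + sm y' \<le> sm (y + y')"
  unfolding sm_def sum.distrib[symmetric] by (rule sum_mono) (rule vl_add)

lemma sm_scale: "y \<in> dual_cone \<sigma> \<Longrightarrow> 0 \<le> c \<Longrightarrow> sm (c *\<^sub>R y) = c * sm y"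
  by (simp add: sm_def vl_scale sum_distrib_left)

lemma T_cone: "convex_cone T"
  unfolding convex_cone_iff
proof (intro conjI ballI allI impI)
  have "vl P 0 = 0" for P using vl_scale[OF dual_cone_closed(1), of 0] by simp
  then show "0 \<in> T" by (simp add: T_def pr_ht dual_cone_closed sm_def)
  show "x + y \<in> T" if "x \<in> T" "y \<in> T" for x y
    using that vl_add[of "pr x" "pr y" Q] sm_add[of "pr x" "pr y"]
    by (auto simp: T_def pr_ht dual_cone_closed)
  show "c *\<^sub>R x \<in> T" if "x \<in> T" "0 \<le> c" for x c
    using that mult_left_mono[of "- sm (pr x)" "ht x" c] mult_left_mono[of "ht x" "vl Q (pr x)" c]
    by (auto simp: T_def pr_ht dual_cone_closed vl_scale sm_scale)
qed

lemma cone_over_Delta: "cone_over (Delta Box \<Psi> Q) = T"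
proof
  show "cone_over (Delta Box \<Psi> Q) \<subseteq> T" unfolding cone_over_def
  proof (rule hull_minimal[where S = convex_cone, OF _ T_cone])
    show "{1} \<times> Delta Box \<Psi> Q \<subseteq> T"
      using vl_Psi sm_point_sum dual_1 by (auto simp: Delta_def T_def pr_def ht_def)
  qed
  show "T \<subseteq> cone_over (Delta Box \<Psi> Q)"
  proof
    fix z assume z: "z \<in> T"
    show "z \<in> cone_over (Delta Box \<Psi> Q)"
    proof (cases "pr z = 0")
      \<comment> \<open>At the apex there is no degree to divide by; both bounds on the height are 0
        there.\<close>
      case True
      have "vl P 0 = 0" for P using vl_scale[OF dual_cone_closed(1), of 0] by simp
      then have "ht z = 0" using z True by (simp add: T_def sm_def)
      then have "z = 0" using True by (auto simp: pr_def ht_def prod_eq_iff zero_prod_def)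
      then show ?thesis using zero_cone_over by simp
    next
      case False
      then have k: "0 < fst z" "fst (snd z) /\<^sub>R fst z \<in> Box" using dual_cases[of "pr z"] z by (auto simp: T_def pr_def)
      have zs: "(1 / fst z) *\<^sub>R z \<in> T" using convex_cone_scaleR[OF T_cone _ z, of "1 / fst z"] k by simp
      have e: "pr ((1 / fst z) *\<^sub>R z) = (1, fst (snd z) /\<^sub>R fst z)" "ht ((1 / fst z) *\<^sub>R z) = snd (snd z) / fst z"
        using k by (simp_all add: pr_def ht_def divide_inverse)
      have "snd z /\<^sub>R fst z \<in> Delta Box \<Psi> Q"
        using zs k unfolding T_def Delta_def mem_Collect_eq e sm_point_sum[OF k(2)] vl_Psi[OF k(2)]
        by (auto simp: case_prod_unfold divide_inverse mult.commute)
      then have "(fst z, snd z) \<in> cone_over (Delta Box \<Psi> Q)" by (rule cone_overI[OF k(1)])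
      then show ?thesis by simp
    qed
  qed
qed

text \<open>The upper bound on the height is concave and the lower one convex, both piecewise
  linear. Writing the values as minima over vertices gives linear inequalities: one for every vertex
  at \<open>Q\<close>, and one for every choice of a vertex at each of the other points.\<close>

definition L0 :: "(real \<times> 'v \<times> real \<Rightarrow> real) set" where
  "L0 = (\<lambda>g z. g \<bullet> pr z) ` G \<union> (\<lambda>w z. w \<bullet> pr z - ht z) ` VP Q \<union>
     (\<lambda>f z. ht z + (\<Sum>P\<in>F - {Q}. f P \<bullet> pr z)) ` (\<Pi>\<^sub>E P\<in>F - {Q}. VP P)"

lemma finite_L0: "finite L0"
  unfolding L0_def using G(1) VP(1) finite_F by (intro finite_UnI finite_imageI finite_PiE) auto

lemma L0_add: "l \<in> L0 \<Longrightarrow> l (x + y) = l x + l y"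
  unfolding L0_def by (elim UnE imageE) (simp_all add: pr_ht inner_add_right sum.distrib)

lemma T_eq: "T = {z. \<forall>l\<in>L0. 0 \<le> l z}"
proof (intro equalityI subsetI)
  fix z assume z: "z \<in> T"
  then have y: "pr z \<in> dual_cone \<sigma>" by (simp add: T_def)
  then have "pr z \<in> dual_cone G" using dual_cone_hull[of G] G(2)[symmetric] by simp
  moreover have "ht z \<le> w \<bullet> pr z" if "w \<in> VP Q" for w using vl_le[OF y VP_D[OF that]] z by (simp add: T_def)
  moreover have "0 \<le> ht z + (\<Sum>P\<in>F - {Q}. f P \<bullet> pr z)" if "f \<in> (\<Pi>\<^sub>E P\<in>F - {Q}. VP P)" for f
  proof -
    have "sm (pr z) \<le> (\<Sum>P\<in>F - {Q}. f P \<bullet> pr z)" unfolding sm_def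
      by (rule sum_mono) (use that in \<open>auto intro!: vl_le[OF y] VP_D\<close>)
    then show ?thesis using z by (simp add: T_def)
  qed
  ultimately show "z \<in> {z. \<forall>l\<in>L0. 0 \<le> l z}" by (auto simp: L0_def dual_cone_def)
next
  fix z assume "z \<in> {z. \<forall>l\<in>L0. 0 \<le> l z}"
  then have 1: "\<forall>g\<in>G. 0 \<le> g \<bullet> pr z" and 2: "\<forall>w\<in>VP Q. 0 \<le> w \<bullet> pr z - ht z"
    and "\<forall>f\<in>(\<Pi>\<^sub>E P\<in>F - {Q}. VP P). 0 \<le> ht z + (\<Sum>P\<in>F - {Q}. f P \<bullet> pr z)"
    unfolding L0_def mem_Collect_eq ball_Un ball_simps by blast+
  then have 3: "0 \<le> ht z + (\<Sum>P\<in>F - {Q}. f P \<bullet> pr z)" if "f \<in> (\<Pi>\<^sub>E P\<in>F - {Q}. VP P)" for f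
    using that by blast
  have y: "pr z \<in> dual_cone \<sigma>" using 1 dual_cone_hull[of G] G(2)[symmetric] by (auto simp: dual_cone_def)
  have "ht z \<le> vl Q (pr z)" using vl_attained[OF y, of Q] 2 by fastforce
  moreover have "- sm (pr z) \<le> ht z"
  proof -
    have "\<forall>P. \<exists>w. w \<in> VP P \<and> vl P (pr z) = w \<bullet> pr z" using vl_attained[OF y] by blast
    then obtain f where f: "\<And>P. f P \<in> VP P" "\<And>P. vl P (pr z) = f P \<bullet> pr z" by metis
    have "restrict f (F - {Q}) \<in> (\<Pi>\<^sub>E P\<in>F - {Q}. VP P)" using f by auto
    from 3[OF this] show ?thesis by (simp add: sm_def f(2))
  qed
  ultimately show "z \<in> T" using y by (simp add: T_def)
qed

section \<open>The monoid of the special fiber\<close>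

definition L :: "(real \<times> 'v \<times> real) set" where "L = \<int> \<times> (M \<times> \<int>)"

definition WL :: "(real \<times> 'v \<times> real) set" where "WL = T \<inter> L"

definition fl :: "real \<times> 'v \<Rightarrow> int" where "fl y = (\<Sum>P\<in>F - {Q}. \<lfloor>vl P y\<rfloor>)"

definition SL :: "(real \<times> 'v \<times> real) set" where "SL = {z \<in> WL. 0 \<le> ht z + of_int (fl (pr z))}"

lemma L_add: "a \<in> L \<Longrightarrow> b \<in> L \<Longrightarrow> a + b \<in> L"
  by (auto simp: L_def M_add)

lemma L_pr: "z \<in> L \<Longrightarrow> pr z \<in> \<int> \<times> M" "z \<in> L \<Longrightarrow> ht z \<in> \<int>"
  by (auto simp: L_def pr_def ht_def)

lemma fl_add: "y \<in> dual_cone \<sigma> \<Longrightarrow> y' \<in> dual_cone \<sigma> \<Longrightarrow> fl y + fl y' \<le> fl (y + y')"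
  unfolding fl_def sum.distrib[symmetric]
  by (rule sum_mono) (use vl_add le_floor_add in \<open>meson floor_mono order_trans\<close>)

lemma fl_le: "of_int (fl y) \<le> sm y"
  by (simp add: fl_def sm_def sum_mono)

lemma WL_add: "a \<in> WL \<Longrightarrow> b \<in> WL \<Longrightarrow> a + b \<in> WL"
  using convex_cone_add[OF T_cone] L_add by (simp add: WL_def)

lemma SL_add: "a \<in> SL \<Longrightarrow> b \<in> SL \<Longrightarrow> a + b \<in> SL"
proof -
  assume ab: "a \<in> SL" "b \<in> SL"
  then have "pr a \<in> dual_cone \<sigma>" "pr b \<in> dual_cone \<sigma>" by (auto simp: SL_def WL_def T_def)
  from fl_add[OF this] have "real_of_int (fl (pr a)) + real_of_int (fl (pr b)) \<le> real_of_int (fl (pr a + pr b))" by linarith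
  then show ?thesis using ab WL_add by (auto simp: SL_def pr_ht)
qed

lemma zero_SL: "0 \<in> SL"
proof -
  have "vl P 0 = 0" for P using vl_scale[OF dual_cone_closed(1), of 0] by simp
  moreover have "(0 :: real \<times> 'v \<times> real) \<in> L" by (auto simp: L_def zero_prod_def M_0)
  ultimately show ?thesis using convex_cone_contains_0[OF T_cone] by (simp add: SL_def WL_def pr_ht fl_def)
qed

section \<open>A common denominator and a conductor\<close>

definition n0 :: nat where "n0 = (SOME n. 0 < n \<and> (\<forall>P\<in>insert Q F. \<forall>w\<in>VP P. real n *\<^sub>R w \<in> N'))"

lemma n0: "0 < n0" "P \<in> insert Q F \<Longrightarrow> w \<in> VP P \<Longrightarrow> real n0 *\<^sub>R w \<in> N'"
proof -
  have common: "\<exists>n>0. \<forall>w\<in>X. real n *\<^sub>R w \<in> N'" if "finite X" "\<And>x. x \<in> X \<Longrightarrow> \<exists>k::nat. k > 0 \<and> real k *\<^sub>R x \<in> N'" for X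
    using that
  proof (induction X)
    case (insert x X)
    then obtain n k :: nat where nk: "n > 0" "\<forall>w\<in>X. real n *\<^sub>R w \<in> N'" "k > 0" "real k *\<^sub>R x \<in> N'" by blast
    have "real (n * k) *\<^sub>R w \<in> N'" if "w \<in> insert x X" for w
    proof (cases "w = x")
      case True then show ?thesis using N'_nat[OF nk(4), of n] by simp
    next
      case False then show ?thesis using that nk(2) N'_nat[of "real n *\<^sub>R w" k] by (simp add: mult.commute)
    qed
    then show ?case using nk by (intro exI[of _ "n * k"]) auto
  qed auto
  have fin: "finite (\<Union>P\<in>insert Q F. VP P)" using finite_F VP(1) by blast
  have den: "\<exists>k::nat. k > 0 \<and> real k *\<^sub>R x \<in> N'" if "x \<in> (\<Union>P\<in>insert Q F. VP P)" for x
    using that VP(3) by (elim UN_E) simp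
  obtain n :: nat where "n > 0" "\<forall>w\<in>(\<Union>P\<in>insert Q F. VP P). real n *\<^sub>R w \<in> N'"
    using common[OF fin den] by blast
  then have "\<exists>n. 0 < n \<and> (\<forall>P\<in>insert Q F. \<forall>w\<in>VP P. real n *\<^sub>R w \<in> N')"
    unfolding UN_ball_bex_simps(1)[symmetric] by blast
  from someI_ex[OF this] show "0 < n0" "P \<in> insert Q F \<Longrightarrow> w \<in> VP P \<Longrightarrow> real n0 *\<^sub>R w \<in> N'"
    unfolding n0_def[symmetric] by blast+
qed

lemma vl_n0_int:
  assumes y: "y \<in> dual_cone \<sigma>" "y \<in> \<int> \<times> M"
  shows "vl P (real n0 *\<^sub>R y) \<in> \<int>"
proof (cases "P \<in> insert Q F")
  case True
  obtain w where w: "w \<in> VP P" "vl P y = w \<bullet> y" using vl_attained[OF y(1)] by blast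
  have "vl P (real n0 *\<^sub>R y) = (real n0 *\<^sub>R w) \<bullet> y" using vl_scale[OF y(1), of "real n0"] w by simp
  then show ?thesis using pairing_int[OF n0(2)[OF True w(1)] y(2)] by simp
next
  case False
  then show ?thesis using vl_0[of P] dual_cone_closed(3)[OF y(1), of "real n0"] by simp
qed

text \<open>On the multiple all values are integers, so rounding changes nothing and the condition
  of \<open>SL\<close> is already part of \<open>T\<close>.\<close>

lemma n0_WL:
  assumes z: "z \<in> WL"
  shows "real n0 *\<^sub>R z \<in> SL"
proof -
  have y: "pr z \<in> dual_cone \<sigma>" "pr z \<in> \<int> \<times> M" using z L_pr by (auto simp: WL_def T_def)
  have nT: "real n0 *\<^sub>R z \<in> T" using convex_cone_scaleR[OF T_cone _, of "real n0" z] z by (simp add: WL_def)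
  have nL: "real n0 *\<^sub>R z \<in> L" using z M_nat by (auto simp: WL_def L_def)
  have "real_of_int (fl (real n0 *\<^sub>R pr z)) = sm (real n0 *\<^sub>R pr z)"
    unfolding fl_def sm_def of_int_sum by (rule sum.cong[OF refl]) (use vl_n0_int[OF y] in \<open>auto elim!: Ints_cases\<close>)
  then show ?thesis using nT nL by (auto simp: SL_def WL_def T_def pr_ht)
qed

lemma conductor:
  obtains c where "c \<in> SL" "0 < fst c" "\<And>z. z \<in> WL \<Longrightarrow> c + z \<in> SL"
proof -
  obtain V where V: "finite V" "V \<noteq> {}" "V \<subseteq> M" "Box = convex hull V"
    using polytope by (auto simp: divisorial_polytope_def lattice_polytope_def)
  have VB: "b \<in> Box" if "b \<in> V" for b unfolding V(4) by (rule hull_inc[OF that])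
  obtain u0 where u0: "u0 \<in> interior Box" using polytope by (auto simp: divisorial_polytope_def)
  then have u0B: "u0 \<in> Box" using interior_subset by blast
  define dg where "dg y = sm y + vl Q y" for y
  have dg0: "0 < dg (1, u0)" using polytope u0 deg_point_sum[OF u0B] by (simp add: divisorial_polytope_def dg_def)
  obtain lam where lam: "\<And>b. b \<in> V \<Longrightarrow> 0 \<le> lam b" "sum lam V = 1" "(\<Sum>b\<in>V. lam b *\<^sub>R b) = u0"
    using u0B unfolding V(4) convex_hull_finite[OF V(1)] by blast
  have lam1: "lam b \<le> 1" if "b \<in> V" for b
    using member_le_sum[of b V lam] lam(1) V(1) that lam(2) by auto
  \<comment> \<open>The interior point \<open>u0\<close> need not be a lattice point. The sum of the
    vertices is one, and it exceeds \<open>(1, u0)\<close> by an element of the dual cone because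
    convex coefficients are at most 1.\<close>
  define y1 where "y1 = (\<Sum>b\<in>V. (1 :: real, b))"
  define y2 where "y2 = (\<Sum>b\<in>V. (1 - lam b) *\<^sub>R (1 :: real, b))"
  have dsum: "(\<Sum>b\<in>X. f b) \<in> dual_cone \<sigma>" if "\<And>b. b \<in> X \<Longrightarrow> f b \<in> dual_cone \<sigma>" for f and X :: "'v set"
    using that by (induction X rule: infinite_finite_induct) (auto simp: dual_cone_closed)
  have y1: "y1 \<in> dual_cone \<sigma>" unfolding y1_def by (rule dsum) (rule dual_1[OF VB])
  have y2: "y2 \<in> dual_cone \<sigma>" unfolding y2_def using lam1
    by (intro dsum dual_cone_closed(3) dual_1 VB) auto
  have "(\<Sum>b\<in>V. lam b *\<^sub>R (1 :: real, b)) = (1, u0)"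
    using lam(2,3) by (simp add: prod_eq_iff fst_sum snd_sum)
  \<comment> \<open>The degree is superadditive and nonnegative, so \<open>y1\<close> inherits
    positive degree from the interior point.\<close>
  then have "y1 = (1, u0) + y2"
    unfolding y1_def y2_def by (simp add: scaleR_diff_left sum_subtractf del: scaleR_Pair) 
  then have "dg (1, u0) + dg y2 \<le> dg y1"
    using sm_add[OF dual_1[OF u0B] y2] vl_add[OF dual_1[OF u0B] y2, of Q] by (simp add: dg_def)
  then have d1: "0 < dg y1" using dg0 deg_nonneg[OF y2] by (simp add: dg_def)
  have y1M: "y1 \<in> \<int> \<times> M" unfolding y1_def using V(3)
    by (auto simp: mem_Times_iff fst_sum snd_sum intro!: M_sum)
  \<comment> \<open>Rounding loses at most one unit at each point of \<open>F\<close>, so a degree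
    of \<open>card F\<close> is enough surplus.\<close>
  obtain N :: nat where N: "real (card F) < real N * dg y1" using reals_Archimedean3[OF d1] by auto
  \<comment> \<open>The additional factor \<open>n0\<close> makes all values at \<open>y0\<close>
    integral, so that they pass through the floors unchanged.\<close>
  define K where "K = N * n0"
  define y0 where "y0 = real K *\<^sub>R y1"
  have y0: "y0 \<in> dual_cone \<sigma>" unfolding y0_def using y1 by (intro dual_cone_closed) auto
  have y0M: "y0 \<in> \<int> \<times> M" unfolding y0_def using y1M M_nat by (auto simp: mem_Times_iff)
  have y0i: "vl P y0 \<in> \<int>" for P
  proof -
    have "y0 = real n0 *\<^sub>R (real N *\<^sub>R y1)" by (simp add: y0_def K_def mult.commute)
    moreover have "real N *\<^sub>R y1 \<in> dual_cone \<sigma>" "real N *\<^sub>R y1 \<in> \<int> \<times> M"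
      using y1 y1M M_nat by (auto simp: mem_Times_iff intro: dual_cone_closed)
    ultimately show ?thesis using vl_n0_int by metis
  qed
  have N0: "0 < N" using N by (cases N) auto
  have dgy0: "real (card F) \<le> dg y0"
  proof -
    have "dg y0 = real K * dg y1" using y1 by (simp add: dg_def y0_def sm_scale vl_scale algebra_simps)
    moreover have "real N \<le> real K" unfolding K_def of_nat_le_iff using n0(1) by simp
    then have "real N * dg y1 \<le> real K * dg y1" using d1 by (intro mult_right_mono) auto
    ultimately show ?thesis using N by simp
  qed
  \<comment> \<open>On the upper boundary the height is as large as possible, and the whole degree
    of \<open>y0\<close> becomes surplus over the lower bound.\<close>
  define c where "c = (fst y0, snd y0, vl Q y0)"
  have pc: "pr c = y0" "ht c = vl Q y0" by (simp_all add: c_def pr_def ht_def)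
  have cL: "c \<in> L" using y0M y0i by (auto simp: c_def L_def)
  have cT: "c \<in> T" using y0 deg_nonneg[OF y0] by (simp add: T_def pc)
  have key: "c + z \<in> SL" if z: "z \<in> WL" for z
  proof -
    have y: "pr z \<in> dual_cone \<sigma>" using z by (simp add: WL_def T_def)
    \<comment> \<open>Only the value at \<open>pr z\<close> is affected by rounding, and by less
      than one unit.\<close>
    have "vl P y0 + vl P (pr z) - 1 \<le> real_of_int \<lfloor>vl P (y0 + pr z)\<rfloor>" for P
    proof -
      have "real_of_int \<lfloor>vl P y0 + vl P (pr z)\<rfloor> = vl P y0 + real_of_int \<lfloor>vl P (pr z)\<rfloor>"
        using y0i[of P] by (auto elim!: Ints_cases)
      moreover have "\<lfloor>vl P y0 + vl P (pr z)\<rfloor> \<le> \<lfloor>vl P (y0 + pr z)\<rfloor>" by (rule floor_mono[OF vl_add[OF y0 y]])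
      ultimately show ?thesis by linarith
    qed
    then have "(\<Sum>P\<in>F - {Q}. vl P y0 + vl P (pr z) - 1) \<le> real_of_int (fl (y0 + pr z))"
      unfolding fl_def of_int_sum by (rule sum_mono)
    then have "sm y0 + sm (pr z) - real (card (F - {Q})) \<le> real_of_int (fl (y0 + pr z))"
      by (simp add: sm_def sum.distrib sum_subtractf)
    moreover have "card (F - {Q}) \<le> card F" by (rule card_mono[OF finite_F]) auto
    moreover have "- sm (pr z) \<le> ht z" using z by (simp add: WL_def T_def)
    ultimately have "0 \<le> ht (c + z) + real_of_int (fl (pr (c + z)))"
      using dgy0 by (simp add: pr_ht pc dg_def)
    moreover have "c + z \<in> WL" using cL cT z by (intro WL_add) (simp_all add: WL_def)
    ultimately show ?thesis by (simp add: SL_def)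
  qed
  have "0 \<in> WL" using zero_SL by (simp add: SL_def)
  from key[OF this] have "c \<in> SL" by simp
  moreover have "0 < fst c"
  proof -
    have "fst y1 = real (card V)" by (simp add: y1_def fst_sum)
    then show ?thesis using V(1,2) N0 n0(1) by (simp add: c_def y0_def K_def card_gt_0_iff)
  qed
  ultimately show ?thesis using key that by blast
qed

end

section \<open>The algebras as monomial algebras\<close>

lemma subring_cring:
  fixes A :: "'a::comm_ring_1 set"
  assumes "\<And>x y. x \<in> A \<Longrightarrow> y \<in> A \<Longrightarrow> x + y \<in> A" "\<And>x y. x \<in> A \<Longrightarrow> y \<in> A \<Longrightarrow> x * y \<in> A"
    "\<And>x. x \<in> A \<Longrightarrow> - x \<in> A" "1 \<in> A" "0 \<in> A"
  shows "cring \<lparr>carrier = A, mult = (*), one = 1, zero = 0, add = (+), \<dots> = r\<rparr>"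
proof (rule cringI)
  show "abelian_group \<lparr>carrier = A, mult = (*), one = 1, zero = 0, add = (+), \<dots> = r\<rparr>"
    by (rule abelian_groupI) (use assms in \<open>auto simp: add_ac intro: bexI[of _ "- x" for x]\<close>)
  show "Group.comm_monoid \<lparr>carrier = A, mult = (*), one = 1, zero = 0, add = (+), \<dots> = r\<rparr>"
    by (rule comm_monoidI) (use assms in \<open>auto simp: mult_ac\<close>)
qed (simp add: algebra_simps)

locale tc_coords = tc_data M Box \<Psi> \<sigma> \<D> Q m v
  for M Box :: "'v::real_inner set" and \<Psi> \<sigma> \<D> Q m v +
  fixes e :: "nat \<Rightarrow> 'v" and rk :: nat
  assumes M_eq: "M = {\<Sum>i<rk. of_int (c i) *\<^sub>R e i | c. True}"
    and e_indep: "(\<Sum>i<rk. x i *\<^sub>R e i) = 0 \<Longrightarrow> i < rk \<Longrightarrow> x i = 0"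
begin

text \<open>Coordinate 0 is the degree and coordinate 1 the height; the lattice \<open>M\<close>
  starts at coordinate 2. In this order the degree is read off in the same way for every rank of
  \<open>M\<close>.\<close>

definition zm :: "grp \<Rightarrow> real \<times> 'v \<times> real" where
  "zm g = (of_int (Poly_Mapping.lookup g 0),
     (\<Sum>i<rk. of_int (Poly_Mapping.lookup g (i + 2)) *\<^sub>R e i), of_int (Poly_Mapping.lookup g 1))"

definition CG :: "grp set" where "CG = coord_grp (rk + 2)"

lemma CG_iff: "g \<in> CG \<longleftrightarrow> (\<forall>i. rk + 2 \<le> i \<longrightarrow> Poly_Mapping.lookup g i = 0)"
  by (auto simp: CG_def coord_grp_def in_keys_iff subset_iff not_le[symmetric])

lemma zm_add: "zm (g + h) = zm g + zm h"
  by (simp add: zm_def lookup_add scaleR_add_left sum.distrib)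

lemma zm_additive: "additive_fun zm"
  by (simp add: additive_fun_def zm_add)

lemma zm_cmul: "zm (frag_cmul (int n) g) = real n *\<^sub>R zm g"
  by (simp add: zm_def lookup_frag_cmul scaleR_sum_right)

lemma zm_bij: "bij_betw zm CG L"
  unfolding bij_betw_def
proof
  show "inj_on zm CG"
  proof (rule inj_onI)
    fix g h assume gh: "g \<in> CG" "h \<in> CG" "zm g = zm h"
    have d: "zm (g - h) = 0" using additive_fun_minus[OF zm_additive, of g h] gh(3) by simp
    have "Poly_Mapping.lookup (g - h) (i + 2) = 0" if "i < rk" for i
      using e_indep[of "\<lambda>i. of_int (Poly_Mapping.lookup (g - h) (i + 2))" i] that d by (simp add: zm_def zero_prod_def)
    moreover have "Poly_Mapping.lookup (g - h) 0 = 0" "Poly_Mapping.lookup (g - h) 1 = 0"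
      using d by (simp_all add: zm_def zero_prod_def)
    moreover have "Poly_Mapping.lookup (g - h) i = 0" if "rk + 2 \<le> i" for i
      using gh(1,2) that by (simp add: CG_iff lookup_minus)
    ultimately have "Poly_Mapping.lookup (g - h) i = 0" for i
      by (metis One_nat_def add_2_eq_Suc' add_less_cancel_right le_add_diff_inverse2 less_2_cases not_less)
    then have "g - h = 0" by (intro poly_mapping_eqI) simp
    then show "g = h" by simp
  qed
  show "zm ` CG = L"
  proof (intro equalityI subsetI)
    have "(\<Sum>i<rk. of_int (c i) *\<^sub>R e i) \<in> M" for c unfolding M_eq by blast
    moreover fix z assume "z \<in> zm ` CG"
    ultimately show "z \<in> L" by (auto simp: L_def zm_def)
  next
    have "\<exists>c. u = (\<Sum>i<rk. of_int (c i) *\<^sub>R e i)" if "u \<in> M" for u using that unfolding M_eq by blast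
    moreover fix z assume "z \<in> L"
    then obtain x u y where z': "z = (x, u, y)" "x \<in> \<int>" "u \<in> M" "y \<in> \<int>" unfolding L_def by blast
    ultimately obtain c where "u = (\<Sum>i<rk. of_int (c i) *\<^sub>R e i)" by blast
    moreover obtain k a where "x = of_int k" "y = of_int a" using z'(2,4) by (auto elim!: Ints_cases)
    ultimately have z: "z = (of_int k, (\<Sum>i<rk. of_int (c i) *\<^sub>R e i), of_int a)" using z'(1) by simp
    define f where "f j = (if j = 0 then k else if j = 1 then a else if j < rk + 2 then c (j - 2) else 0)" for j
    have "{j. f j \<noteq> 0} \<subseteq> {..<rk + 2}" by (auto simp: f_def split: if_splits)
    then have fin: "finite {j. f j \<noteq> 0}" using finite_subset by blast
    then have l: "Poly_Mapping.lookup (Abs_poly_mapping f) = f" by (rule lookup_Abs_poly_mapping)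
    have "Abs_poly_mapping f \<in> CG" using \<open>{j. f j \<noteq> 0} \<subseteq> {..<rk + 2}\<close> by (simp add: CG_iff l f_def)
    moreover have "zm (Abs_poly_mapping f) = z" by (simp add: zm_def l z f_def)
    ultimately show "z \<in> zm ` CG" by blast
  qed
qed

definition \<kappa> :: "real \<times> 'v \<times> real \<Rightarrow> grp" where "\<kappa> z = inv_into CG zm z"

lemma \<kappa>_in: "z \<in> L \<Longrightarrow> \<kappa> z \<in> CG" and zm_\<kappa>: "z \<in> L \<Longrightarrow> zm (\<kappa> z) = z"
  and zm_in: "g \<in> CG \<Longrightarrow> zm g \<in> L" and \<kappa>_zm: "g \<in> CG \<Longrightarrow> \<kappa> (zm g) = g"
  unfolding \<kappa>_def using bij_betw_inv_into_left[OF zm_bij] bij_betw_inv_into_right[OF zm_bij]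
    bij_betw_apply[OF zm_bij] bij_betw_apply[OF bij_betw_inv_into[OF zm_bij]] by blast+

lemma CG_add: "g \<in> CG \<Longrightarrow> h \<in> CG \<Longrightarrow> g + h \<in> CG"
  by (simp add: CG_iff lookup_add)

lemma CG_0: "0 \<in> CG" by (simp add: CG_iff)

lemma \<kappa>_add: "z \<in> L \<Longrightarrow> z' \<in> L \<Longrightarrow> \<kappa> (z + z') = \<kappa> z + \<kappa> z'"
  using \<kappa>_zm[of "\<kappa> z + \<kappa> z'"] by (simp add: zm_add zm_\<kappa> \<kappa>_in CG_add)

lemma \<kappa>_eq_iff: "z \<in> L \<Longrightarrow> g \<in> CG \<Longrightarrow> \<kappa> z = g \<longleftrightarrow> z = zm g"
  using \<kappa>_zm zm_\<kappa> by metis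

lemma zero_L: "0 \<in> L" using zero_SL by (simp add: SL_def WL_def)

lemma \<kappa>_0: "\<kappa> 0 = 0" using \<kappa>_add[OF zero_L zero_L] by simp

lemma fst_zm: "fst (zm g) = of_int (Poly_Mapping.lookup g 0)" by (simp add: zm_def)

lemma lookup_\<kappa>: "z \<in> L \<Longrightarrow> of_int (Poly_Mapping.lookup (\<kappa> z) 0) = fst z"
  using fst_zm[of "\<kappa> z"] by (simp add: zm_\<kappa>)

definition gdeg :: "grp \<Rightarrow> int" where "gdeg g = Poly_Mapping.lookup g 0"
definition WM :: "grp set" where "WM = {g \<in> CG. zm g \<in> T}"
definition SM :: "grp set" where "SM = {g \<in> CG. zm g \<in> SL}"

lemma WM_iff: "g \<in> WM \<longleftrightarrow> g \<in> CG \<and> zm g \<in> WL"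
  using zm_in by (auto simp: WM_def WL_def)

lemma SM_WM: "SM \<subseteq> WM" by (auto simp: SM_def WM_iff SL_def)

lemma gdeg_additive: "additive_fun gdeg"
  by (simp add: additive_fun_def gdeg_def lookup_add)

lemma fst_dual_nonneg: "y \<in> dual_cone \<sigma> \<Longrightarrow> 0 \<le> fst y"
  using dual_cases[of y] by auto

lemma WM_deg: "g \<in> WM \<Longrightarrow> 0 \<le> gdeg g"
  using fst_dual_nonneg[of "pr (zm g)"] by (simp add: WM_def T_def pr_def fst_zm gdeg_def)

lemma WM_monoid: "submonoid_set WM"
  using convex_cone_contains_0[OF T_cone] convex_cone_add[OF T_cone] CG_add CG_0 additive_fun_0[OF zm_additive]
  by (simp add: submonoid_set_def WM_def zm_add)

lemma SM_monoid: "submonoid_set SM"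
  using SL_add zero_SL CG_add CG_0 additive_fun_0[OF zm_additive]
  by (simp add: submonoid_set_def SM_def zm_add)

lemma CG_cmul: "g \<in> CG \<Longrightarrow> frag_cmul (int k) g \<in> CG"
  by (simp add: CG_iff lookup_frag_cmul)

lemma SM_pos: "\<exists>c\<in>SM. 0 < gdeg c \<and> (\<forall>w\<in>WM. c + w \<in> SM)"
proof -
  obtain c where c: "c \<in> SL" "0 < fst c" "\<And>z. z \<in> WL \<Longrightarrow> c + z \<in> SL" by (rule conductor) blast
  have cL: "c \<in> L" using c(1) by (simp add: SL_def WL_def)
  have "\<kappa> c \<in> SM" using c(1) by (simp add: SM_def \<kappa>_in zm_\<kappa> cL)
  moreover have "0 < gdeg (\<kappa> c)" using lookup_\<kappa>[OF cL] c(2) by (simp add: gdeg_def)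
  moreover have "\<kappa> c + w \<in> SM" if "w \<in> WM" for w
    using that c(3)[of "zm w"] by (simp add: SM_def zm_add zm_\<kappa> cL WM_iff CG_add \<kappa>_in)
  ultimately show ?thesis by blast
qed

definition LM :: "(grp \<Rightarrow> real) set" where "LM = (\<lambda>l g. l (zm g)) ` L0"

lemma LM: "finite LM" "l \<in> LM \<Longrightarrow> additive_fun l" "WM = {g \<in> CG. \<forall>l\<in>LM. 0 \<le> l g}"
proof -
  show "finite LM" by (simp add: LM_def finite_L0)
  show "l \<in> LM \<Longrightarrow> additive_fun l" by (auto simp: LM_def additive_fun_def zm_add L0_add)
  show "WM = {g \<in> CG. \<forall>l\<in>LM. 0 \<le> l g}" by (simp add: WM_def LM_def T_eq)
qed

lemma SM_n0: "w \<in> WM \<Longrightarrow> frag_cmul (int n0) w \<in> SM"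
  using n0_WL[of "zm w"] by (simp add: WM_iff SM_def zm_cmul CG_cmul)

subsection \<open>The toric variety\<close>

definition Tor :: "((real \<times> 'v \<times> real) \<Rightarrow>\<^sub>0 complex) gcalg" where
  "Tor = toric_alg (M \<times> \<int>) (Delta Box \<Psi> Q)"

lemma Tor_simps: "carrier Tor = supp_on WL" "mult Tor = (*)" "one Tor = 1" "zero Tor = 0" "add Tor = (+)"
  "scal Tor = Poly_Mapping.single 0"
  "hcomp Tor i = {f \<in> supp_on WL. \<forall>w\<in>Poly_Mapping.keys f. fst w = real i}"
  by (simp_all add: Tor_def toric_alg_def semigroup_alg_def supp_on_def cone_over_Delta WL_def L_def)

lemma WL_monoid: "submonoid_set WL"
  using WL_add zero_SL by (simp add: submonoid_set_def SL_def)

text \<open>The coordinate map is additive on lattice points only, so coefficients at other real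
  exponents are forced to be 0.\<close>

sublocale TX: graded_ext "\<lambda>w. if w \<in> L then UNIV else {0 :: complex}"
  "\<lambda>w c. if w \<in> L then Poly_Mapping.single (\<kappa> w) c else 0"
  by unfold_locales (auto simp: L_add \<kappa>_add mult_single single_add split: if_splits)

definition \<gamma>T :: "((real \<times> 'v \<times> real) \<Rightarrow>\<^sub>0 complex) \<Rightarrow> laurent" where "\<gamma>T = TX.ext"

lemma supp_WL_allowed: "f \<in> supp_on WL \<Longrightarrow> f \<in> TX.allowed"
  by (auto simp: TX.allowed_def supp_on_def WL_def in_keys_iff subset_iff)

lemma lookup_\<gamma>T:
  assumes f: "f \<in> supp_on WL"
  shows "Poly_Mapping.lookup (\<gamma>T f) g = (if g \<in> CG then Poly_Mapping.lookup f (zm g) else 0)"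
proof -
  have k: "w \<in> L" if "w \<in> Poly_Mapping.keys f" for w using f that by (auto simp: supp_on_def WL_def)
  have "Poly_Mapping.lookup (\<gamma>T f) g = (\<Sum>w\<in>Poly_Mapping.keys f. Poly_Mapping.lookup f w when \<kappa> w = g)"
    by (simp add: \<gamma>T_def TX.ext_def lookup_sum k lookup_single)
  also have "\<dots> = (if g \<in> CG then \<Sum>w\<in>Poly_Mapping.keys f. Poly_Mapping.lookup f w when w = zm g else 0)"
    using k by (auto intro!: sum.cong sum.neutral simp: \<kappa>_eq_iff when_def \<kappa>_in)
  also have "(\<Sum>w\<in>Poly_Mapping.keys f. Poly_Mapping.lookup f w when w = zm g) = Poly_Mapping.lookup f (zm g)"
    by (simp add: when_def in_keys_iff)
  finally show ?thesis .
qed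

lemma keys_\<gamma>T: "f \<in> supp_on WL \<Longrightarrow> g \<in> Poly_Mapping.keys (\<gamma>T f) \<longleftrightarrow> g \<in> CG \<and> zm g \<in> Poly_Mapping.keys f"
  by (simp add: in_keys_iff lookup_\<gamma>T)

lemma Tor_cring: "cring Tor"
proof -
  have "Tor = \<lparr>carrier = carrier Tor, mult = (*), one = 1, zero = 0, add = (+), \<dots> = Ring.ring.more Tor\<rparr>"
    using Tor_simps by (cases Tor) simp
  moreover have "cring \<lparr>carrier = carrier Tor, mult = (*), one = 1, zero = 0, add = (+), \<dots> = Ring.ring.more Tor\<rparr>"
    by (rule subring_cring) (simp_all add: Tor_simps supp_on_closed supp_on_monoid[OF WL_monoid])
  ultimately show ?thesis by metis
qed

lemma Tor_mono_alg: "mono_alg Tor \<gamma>T WM gdeg"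
proof (intro mono_alg.intro mono_alg_axioms.intro)
  show "cring Tor" by (rule Tor_cring)
  show "bij_betw \<gamma>T (carrier Tor) (supp_on WM)" unfolding bij_betw_def
  proof
    show "inj_on \<gamma>T (carrier Tor)"
    proof (rule inj_onI)
      fix f h assume fh: "f \<in> carrier Tor" "h \<in> carrier Tor" "\<gamma>T f = \<gamma>T h"
      show "f = h"
      proof (rule poly_mapping_eqI)
        fix w
        show "Poly_Mapping.lookup f w = Poly_Mapping.lookup h w"
        proof (cases "w \<in> L")
          case True
          then show ?thesis using lookup_\<gamma>T[of f "\<kappa> w"] lookup_\<gamma>T[of h "\<kappa> w"] fh by (simp add: Tor_simps \<kappa>_in zm_\<kappa>)
        next
          case False
          then have "w \<notin> Poly_Mapping.keys f" "w \<notin> Poly_Mapping.keys h"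
            using fh by (auto simp: Tor_simps supp_on_def WL_def)
          then show ?thesis by (simp add: in_keys_iff)
        qed
      qed
    qed
    show "\<gamma>T ` carrier Tor = supp_on WM"
    proof (intro equalityI subsetI)
      fix F assume "F \<in> \<gamma>T ` carrier Tor"
      then show "F \<in> supp_on WM" by (auto simp: Tor_simps supp_on_def keys_\<gamma>T WM_iff)
    next
      fix F :: laurent assume F: "F \<in> supp_on WM"
      define f where "f = (\<Sum>g\<in>Poly_Mapping.keys F. Poly_Mapping.single (zm g) (Poly_Mapping.lookup F g))"
      have g: "zm g \<in> L" "zm g \<in> WL" "\<kappa> (zm g) = g" if "g \<in> Poly_Mapping.keys F" for g
        using F that \<kappa>_zm zm_in by (auto simp: supp_on_def WM_iff)
      have "f \<in> supp_on WL" unfolding f_def by (intro supp_on_sum supp_on_single g)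
      moreover have "\<gamma>T f = F"
        unfolding f_def \<gamma>T_def using g
        by (subst TX.ext_sum) (simp_all add: TX.ext_single TX.allowed_single flip: pm_expand)
      ultimately show "F \<in> \<gamma>T ` carrier Tor" by (auto simp: Tor_simps)
    qed
  qed
  show "\<gamma>T (f \<otimes>\<^bsub>Tor\<^esub> h) = \<gamma>T f * \<gamma>T h" "\<gamma>T (f \<oplus>\<^bsub>Tor\<^esub> h) = \<gamma>T f + \<gamma>T h" if "f \<in> carrier Tor" "h \<in> carrier Tor" for f h
    using that by (simp_all add: Tor_simps \<gamma>T_def supp_WL_allowed TX.ext_mult TX.ext_add)
  show "\<gamma>T (scal Tor c) = Poly_Mapping.single 0 c" for c
    by (simp add: Tor_simps \<gamma>T_def TX.ext_single zero_L \<kappa>_0)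
  from this[of 1] show "\<gamma>T \<one>\<^bsub>Tor\<^esub> = 1" by (simp add: Tor_simps)
  show "scal Tor c \<in> carrier Tor" for c
    using WL_monoid by (simp add: Tor_simps supp_on_single submonoid_set_def)
  show "hcomp Tor i = {b \<in> carrier Tor. \<forall>w\<in>Poly_Mapping.keys (\<gamma>T b). gdeg w = int i}" for i
  proof -
    have "(\<forall>w\<in>Poly_Mapping.keys f. fst w = real i) \<longleftrightarrow> (\<forall>g\<in>Poly_Mapping.keys (\<gamma>T f). gdeg g = int i)"
      if f: "f \<in> supp_on WL" for f
    proof
      assume *: "\<forall>w\<in>Poly_Mapping.keys f. fst w = real i"
      show "\<forall>g\<in>Poly_Mapping.keys (\<gamma>T f). gdeg g = int i"
      proof
        fix g assume "g \<in> Poly_Mapping.keys (\<gamma>T f)"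
        then have "fst (zm g) = real i" using * f keys_\<gamma>T by blast
        then show "gdeg g = int i" by (simp add: fst_zm gdeg_def)
      qed
    next
      assume *: "\<forall>g\<in>Poly_Mapping.keys (\<gamma>T f). gdeg g = int i"
      show "\<forall>w\<in>Poly_Mapping.keys f. fst w = real i"
      proof
        fix w assume w: "w \<in> Poly_Mapping.keys f"
        then have wL: "w \<in> L" using f by (auto simp: supp_on_def WL_def)
        then have "\<kappa> w \<in> Poly_Mapping.keys (\<gamma>T f)" using w f by (simp add: keys_\<gamma>T \<kappa>_in zm_\<kappa>)
        then have "gdeg (\<kappa> w) = int i" using * by blast
        then show "fst w = real i" using lookup_\<kappa>[OF wL] by (simp add: gdeg_def)
      qed
    qed
    then show ?thesis by (auto simp: Tor_simps)
  qed
  show "submonoid_set WM" by (rule WM_monoid)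
  show "additive_fun gdeg" by (rule gdeg_additive)
  show "0 \<le> gdeg s" if "s \<in> WM" for s using that by (rule WM_deg)
  show "\<exists>s\<in>WM. 0 < gdeg s" using SM_pos SM_WM by blast
qed

end

context tc_coords
begin

subsection \<open>The special fiber\<close>

definition Lt :: "((real \<times> 'v) \<times> real) set" where "Lt = (\<int> \<times> M) \<times> \<int>"
definition Wt :: "((real \<times> 'v) \<times> real) set" where "Wt = dual_cone (tc_cone \<D> Q v m) \<inter> Lt"
definition At :: "(((real \<times> 'v) \<times> real) \<Rightarrow>\<^sub>0 ratfun) gcalg" where "At = tc_alg M \<D> Q v m"
text \<open>This is \<open>m j\<close> for \<open>j = \<langle>v,y\<rangle> + a/m\<close>, an
  integer on lattice exponents because \<open>m v\<close> is integral. Thus \<open>j\<close> is an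
  integer exactly if \<open>m\<close> divides it, and \<open>jj\<close> is the floor of
  \<open>j\<close>.\<close>

definition bw :: "(real \<times> 'v) \<times> real \<Rightarrow> int" where "bw w = \<lfloor>real m * (v \<bullet> fst w) + snd w\<rfloor>"
definition jj :: "(real \<times> 'v) \<times> real \<Rightarrow> int" where "jj w = bw w div int m"
definition Ef :: "proj_line \<Rightarrow> (real \<times> 'v) \<times> real \<Rightarrow> int" where "Ef P w = \<lfloor>E P w\<rfloor>"
definition zt :: "(real \<times> 'v) \<times> real \<Rightarrow> real \<times> 'v \<times> real" where
  "zt w = (fst (fst w), snd (fst w), of_int (jj w))"
text \<open>Solves \<open>j = \<langle>v,y\<rangle> + a/m\<close> for \<open>a\<close>. It inverts
  \<open>zt\<close> on the exponents with integral \<open>j\<close>, the only ones that survive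
  modulo \<open>t\<close>.\<close>

definition wz :: "real \<times> 'v \<times> real \<Rightarrow> (real \<times> 'v) \<times> real" where
  "wz z = (pr z, real m * ht z - real m * (v \<bullet> pr z))"

section \<open>Integral exponents and roundings\<close>

lemma m_pos: "0 < real m" "0 < int m" using m by simp_all

lemma mv_int: "y \<in> \<int> \<times> M \<Longrightarrow> real m * (v \<bullet> y) \<in> \<int>"
  using pairing_int[of "real m *\<^sub>R v" y] mv by (simp add: N'_def)

lemma Lt_D: "w \<in> Lt \<Longrightarrow> fst w \<in> \<int> \<times> M" "w \<in> Lt \<Longrightarrow> snd w \<in> \<int>"
  by (auto simp: Lt_def)

lemma Lt_I: "y \<in> \<int> \<times> M \<Longrightarrow> a \<in> \<int> \<Longrightarrow> (y, a) \<in> Lt"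
  by (auto simp: Lt_def)

lemma Lt_add: "u \<in> Lt \<Longrightarrow> w \<in> Lt \<Longrightarrow> u + w \<in> Lt"
  by (auto simp: Lt_def M_add)

lemma bw_eq: "w \<in> Lt \<Longrightarrow> real_of_int (bw w) = real m * (v \<bullet> fst w) + snd w"
  using mv_int[OF Lt_D(1)] Lt_D(2) by (simp add: bw_def)

lemma bw_add: "u \<in> Lt \<Longrightarrow> w \<in> Lt \<Longrightarrow> bw (u + w) = bw u + bw w"
proof -
  assume "u \<in> Lt" "w \<in> Lt"
  then have "real_of_int (bw (u + w)) = real_of_int (bw u + bw w)"
    using Lt_add[of u w] by (simp add: bw_eq inner_add_right algebra_simps)
  then show ?thesis by (simp only: of_int_eq_iff)
qed

lemma jj_floor: "w \<in> Lt \<Longrightarrow> \<lfloor>v \<bullet> fst w + snd w / real m\<rfloor> = jj w"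
proof -
  assume "w \<in> Lt"
  then have "v \<bullet> fst w + snd w / real m = real_of_int (bw w) / real_of_int (int m)"
    using m_pos by (simp add: bw_eq field_simps)
  then show ?thesis unfolding jj_def by (simp only: floor_divide_of_int_eq)
qed

lemma Ef: "w \<in> Lt \<Longrightarrow> Ef Q w = min (jj w) \<lfloor>vl Q (fst w)\<rfloor>" "P \<noteq> Q \<Longrightarrow> Ef P w = \<lfloor>vl P (fst w)\<rfloor>"
proof -
  have *: "\<lfloor>min a b\<rfloor> = min \<lfloor>a\<rfloor> \<lfloor>b\<rfloor>" for a b :: real
    by (rule min_of_mono[symmetric]) (simp add: mono_def floor_mono)
  show "w \<in> Lt \<Longrightarrow> Ef Q w = min (jj w) \<lfloor>vl Q (fst w)\<rfloor>" by (simp add: Ef_def E_def * jj_floor)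
  show "P \<noteq> Q \<Longrightarrow> Ef P w = \<lfloor>vl P (fst w)\<rfloor>" by (simp add: Ef_def E_def)
qed

lemma Wt_iff: "w \<in> Wt \<longleftrightarrow> w \<in> Lt \<and> fst w \<in> dual_cone \<sigma> \<and> 0 \<le> v \<bullet> fst w + snd w / real m + sm (fst w)"
  by (cases w) (auto simp: Wt_def tc_cone_dual)

lemma Wt_D: "w \<in> Wt \<Longrightarrow> w \<in> Lt" "w \<in> Wt \<Longrightarrow> fst w \<in> dual_cone \<sigma>"
  by (simp_all add: Wt_iff)

lemma Wt_add: "u \<in> Wt \<Longrightarrow> w \<in> Wt \<Longrightarrow> u + w \<in> Wt"
  using sm_add[OF Wt_D(2) Wt_D(2), of u w]
  by (simp add: Wt_iff Lt_add dual_cone_closed inner_add_right add_divide_distrib)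

lemma zero_Wt: "0 \<in> Wt" and Lt_0: "0 \<in> Lt"
proof -
  have "vl P 0 = 0" for P using vl_scale[OF dual_cone_closed(1), of 0] by simp
  moreover show "0 \<in> Lt" by (auto simp: Lt_def zero_prod_def M_0)
  ultimately show "0 \<in> Wt" by (simp add: Wt_iff dual_cone_closed sm_def)
qed

lemma Ef_add:
  assumes u: "u \<in> Wt" "w \<in> Wt"
  shows "Ef P u + Ef P w \<le> Ef P (u + w)"
proof -
  have "E P u + E P w \<le> E P (u + w)"
    using vl_add[OF Wt_D(2)[OF u(1)] Wt_D(2)[OF u(2)], of P]
    by (auto simp: E_def inner_add_right add_divide_distrib min_def)
  then show ?thesis unfolding Ef_def by (meson floor_mono le_floor_add order_trans)
qed

lemma Ef_outside: "w \<in> Wt \<Longrightarrow> P \<notin> F \<Longrightarrow> P \<noteq> Q \<Longrightarrow> Ef P w = 0"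
  by (simp add: Ef vl_0 Wt_D)

lemma zt: "w \<in> Lt \<Longrightarrow> zt w \<in> L" "pr (zt w) = fst w" "ht (zt w) = of_int (jj w)"
  by (auto simp: zt_def L_def pr_def ht_def Lt_def)

lemma wz_Lt: "z \<in> L \<Longrightarrow> wz z \<in> Lt"
  unfolding wz_def using L_pr[of z] mv_int[of "pr z"] by (intro Lt_I) auto

lemma bw_wz: "z \<in> L \<Longrightarrow> bw (wz z) = int m * \<lfloor>ht z\<rfloor>"
proof -
  assume z: "z \<in> L"
  then obtain k where k: "ht z = of_int k" using L_pr(2)[of z] by (auto elim: Ints_cases)
  have "real_of_int (bw (wz z)) = real_of_int (int m * \<lfloor>ht z\<rfloor>)"
    using bw_eq[OF wz_Lt[OF z]] k by (simp add: wz_def)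
  then show ?thesis by (simp only: of_int_eq_iff)
qed

lemma jj_wz: "z \<in> L \<Longrightarrow> jj (wz z) = \<lfloor>ht z\<rfloor>"
  using m_pos by (simp add: jj_def bw_wz)

lemma zt_wz: "z \<in> L \<Longrightarrow> zt (wz z) = z"
  using L_pr(2)[of z] unfolding zt_def by (simp add: jj_wz) (simp add: wz_def pr_def ht_def)

lemma wz_zt:
  assumes w: "w \<in> Lt" and d: "int m dvd bw w"
  shows "wz (zt w) = w"
proof -
  have "int m * jj w = bw w" using d by (simp add: jj_def)
  then have "real m * of_int (jj w) = real_of_int (bw w)" by (metis of_int_mult of_int_of_nat_eq)
  then show ?thesis using bw_eq[OF w] by (simp add: wz_def zt prod_eq_iff)
qed

lemma H0_Ef_vge: "w \<in> Lt \<Longrightarrow> f \<in> H0 (\<lambda>P. Ef P w) \<Longrightarrow> vge Q (- jj w) f"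
  by (rule vge_mono[of Q "- Ef Q w"]) (simp add: H0_iff, simp add: Ef(1))

text \<open>A nonzero leading coefficient means a pole of order exactly \<open>j\<close> at
  \<open>Q\<close>, so the old value at \<open>Q\<close> is not the smaller one. A nonzero section
  then forces nonnegative degree of the rounded divisor, which is the condition defining
  \<open>SL\<close>.\<close>

lemma lead_SL:
  assumes w: "w \<in> Wt" and d: "int m dvd bw w" and f: "f \<in> H0 (\<lambda>P. Ef P w)" and l: "lead_at Q (jj w) f \<noteq> 0"
  shows "zt w \<in> SL"
proof -
  note wL = Wt_D(1)[OF w] and y = Wt_D(2)[OF w]
  have f0: "f \<noteq> 0" using l by (auto simp: lead_at_0)
  have n: "\<not> vge Q (1 - jj w) f" using lead_at_eq_0_iff[OF H0_Ef_vge[OF wL f]] l by simp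
  have "\<not> Ef Q w \<le> jj w - 1"
  proof
    assume "Ef Q w \<le> jj w - 1"
    then have "vge Q (1 - jj w) f" using f vge_mono[of Q "- Ef Q w" f "1 - jj w"] by (simp add: H0_iff)
    then show False using n by simp
  qed
  then have j: "Ef Q w = jj w" "jj w \<le> \<lfloor>vl Q (fst w)\<rfloor>" using Ef(1)[OF wL] by auto
  have "int m * jj w = bw w" using d by (simp add: jj_def)
  then have "real m * of_int (jj w) = real_of_int (bw w)" by (metis of_int_mult of_int_of_nat_eq)
  then have jr: "v \<bullet> fst w + snd w / real m = of_int (jj w)" using bw_eq[OF wL] m_pos by (simp add: field_simps)
  have "0 \<le> (\<Sum>P\<in>insert Q F. Ef P w)"
    by (rule H0_degree[OF f f0]) (use finite_F Ef_outside[OF w] in auto)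
  also have "(\<Sum>P\<in>insert Q F. Ef P w) = jj w + (\<Sum>P\<in>F - {Q}. Ef P w)"
    using sum.insert_remove[OF finite_F, of "\<lambda>P. Ef P w" Q] by (simp add: j)
  also have "(\<Sum>P\<in>F - {Q}. Ef P w) = fl (fst w)"
    unfolding fl_def by (rule sum.cong) (auto simp: Ef)
  finally have "0 \<le> jj w + fl (fst w)" .
  moreover have "zt w \<in> T" using w j(2) jr by (simp add: T_def zt y Wt_iff le_floor_iff)
  ultimately show ?thesis using zt(1)[OF wL] by (simp add: SL_def WL_def zt flip: of_int_add)
qed

text \<open>The converse of \<open>lead_SL\<close>: nonnegative degree of the rounded divisor is
  enough on the projective line for a section with the full pole order at \<open>Q\<close>, and
  scaling normalizes its leading coefficient.\<close>

lemma section_exists: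
  assumes z: "z \<in> SL"
  shows "wz z \<in> Wt" "\<exists>f\<in>H0 (\<lambda>P. Ef P (wz z)). lead_at Q \<lfloor>ht z\<rfloor> f = 1"
proof -
  have zL: "z \<in> L" "z \<in> T" using z by (simp_all add: SL_def WL_def)
  obtain k where k: "ht z = of_int k" using L_pr(2)[OF zL(1)] by (auto elim: Ints_cases)
  have "v \<bullet> fst (wz z) + snd (wz z) / real m = ht z" using m_pos by (simp add: wz_def field_simps)
  then show W: "wz z \<in> Wt" using wz_Lt[OF zL(1)] zL(2) by (simp add: Wt_iff T_def wz_def)
  have "0 \<le> k + (\<Sum>P\<in>F - {Q}. \<lfloor>vl P (pr z)\<rfloor>)"
    using z k by (simp add: SL_def fl_def flip: of_int_add of_int_sum)
  then have "0 \<le> k + (\<Sum>P\<in>F - {Q}. Ef P (wz z))"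
    by (simp add: Ef wz_def)
  then obtain f where f: "f \<noteq> 0" "ord_at Q f = - k" "\<And>P. P \<noteq> Q \<Longrightarrow> - Ef P (wz z) \<le> ord_at P f"
    using exists_section[of "F - {Q}" Q "\<lambda>P. Ef P (wz z)" k] finite_F Ef_outside[OF W] by auto
  have "Ef Q (wz z) = k"
    using Ef(1)[OF wz_Lt[OF zL(1)]] zL(2) k unfolding jj_wz[OF zL(1)]
    by (simp add: wz_def T_def le_floor_iff min_def)
  then have fH: "vge P (- Ef P (wz z)) f" for P using f by (cases "P = Q") (auto simp: vge_def)
  have vf: "vge Q (- k) f" using f by (simp add: vge_def)
  have l: "lead_at Q k f \<noteq> 0" using lead_at_eq_0_iff[OF vf] f by (simp add: vge_def)
  let ?g = "const_fun (inverse (lead_at Q k f)) * f"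
  have "?g \<in> H0 (\<lambda>P. Ef P (wz z))" using vge_mult[OF vge_const fH] by (simp add: H0_iff)
  moreover have "lead_at Q \<lfloor>ht z\<rfloor> ?g = 1" using lead_at_scale[OF vf] l k by simp
  ultimately show "\<exists>f\<in>H0 (\<lambda>P. Ef P (wz z)). lead_at Q \<lfloor>ht z\<rfloor> f = 1" by blast
qed

text \<open>
  Put \<open>j = \<langle>v,y\<rangle> + a/m\<close> for an exponent \<open>w = (y,a)\<close>.  Dividing by \<open>t = \<chi>\<^bsup>(0,1)\<^esup>\<close> lowers \<open>j\<close> by \<open>1/m\<close> and thus
  the admissible pole order at \<open>Q\<close> only if \<open>j\<close> is an integer.  So \<open>f \<chi>\<^sup>w\<close> is a multiple of \<open>t\<close> unless
  \<open>j\<close> is an integer and \<open>f\<close> has a pole of order exactly \<open>j\<close> at \<open>Q\<close>; its residue modulo \<open>t\<close> is then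
  the leading coefficient of \<open>f\<close> times \<open>\<chi>\<^bsup>(y,j)\<^esup>\<close>.
\<close>

definition CA :: "(real \<times> 'v) \<times> real \<Rightarrow> ratfun set" where
  "CA w = (if w \<in> Wt then H0 (\<lambda>P. Ef P w) else {0})"
definition HA :: "(real \<times> 'v) \<times> real \<Rightarrow> ratfun \<Rightarrow> laurent" where
  "HA w f = (if int m dvd bw w then Poly_Mapping.single (\<kappa> (zt w)) (lead_at Q (jj w) f) else 0)"

lemma HA_mult:
  assumes u: "u \<in> Wt" "w \<in> Wt" and x: "x \<in> H0 (\<lambda>P. Ef P u)" "y \<in> H0 (\<lambda>P. Ef P w)"
  shows "HA (u + w) (x * y) = HA u x * HA w y"
proof -
  note uL = Wt_D(1)[OF u(1)] Wt_D(1)[OF u(2)]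
  note vx = H0_Ef_vge[OF uL(1) x(1)] H0_Ef_vge[OF uL(2) x(2)]
  note b = bw_add[OF uL]
  consider (both) "int m dvd bw u" "int m dvd bw w" | (none) "\<not> int m dvd bw u" "\<not> int m dvd bw w"
    | (one) "(int m dvd bw u) \<noteq> (int m dvd bw w)" by blast
  then show ?thesis
  proof cases
    case both
    then have j: "jj (u + w) = jj u + jj w" by (simp add: jj_def b)
    have "zt (u + w) = zt u + zt w" by (simp add: zt_def j)
    then show ?thesis using both lead_at_mult[OF vx] zt(1)[OF uL(1)] zt(1)[OF uL(2)]
      by (simp add: HA_def b j \<kappa>_add mult_single)
  next
    case none
    have "lead_at Q (jj (u + w)) (x * y) = 0" if d: "int m dvd bw (u + w)"
    proof -
      \<comment> \<open>Two positive fractional parts that add up to an integer push the floor up by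
        one. The product then has a pole of order less than \<open>j\<close>, so its leading
        coefficient vanishes.\<close>
      have "jj (u + w) \<ge> jj u + jj w + 1"
      proof -
        have "0 < bw u mod int m" "0 < bw w mod int m" using none pos_mod_sign[OF m_pos(2)]
          unfolding dvd_eq_mod_eq_0 order_less_le by simp_all
        moreover have "bw u = int m * jj u + bw u mod int m" "bw w = int m * jj w + bw w mod int m"
          by (simp_all only: jj_def mult_div_mod_eq)
        moreover have "bw u + bw w = int m * jj (u + w)" using d by (simp add: jj_def b)
        ultimately have "int m * (jj u + jj w) < int m * jj (u + w)" unfolding distrib_left by linarith
        then show ?thesis using m_pos by simp
      qed
      then have "vge Q (1 - jj (u + w)) (x * y)" using vge_mono[OF vge_mult[OF vx], of "1 - jj (u + w)"] by simp
      moreover from this have "vge Q (- jj (u + w)) (x * y)" by (rule vge_mono) simp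
      ultimately show ?thesis using lead_at_eq_0_iff by blast
    qed
    then show ?thesis using none by (simp add: HA_def)
  next
    \<comment> \<open>The sum of an integral and a nonintegral \<open>j\<close> is not an integer,
      so both sides are 0.\<close>
    case one
    then have "\<not> int m dvd bw (u + w)" by (auto simp: b dvd_add_right_iff dvd_add_left_iff)
    then show ?thesis using one by (auto simp: HA_def)
  qed
qed

sublocale AX: graded_ext CA HA
proof
  show "0 \<in> CA w" for w by (simp add: CA_def H0_iff vge_0)
  show "HA w 0 = 0" for w by (simp add: HA_def lead_at_0)
  show "x + y \<in> CA w" if "x \<in> CA w" "y \<in> CA w" for x y w
    using that by (auto simp: CA_def H0_iff vge_add split: if_splits)
  show "HA w (x + y) = HA w x + HA w y" if "x \<in> CA w" "y \<in> CA w" for x y w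
  proof (cases "w \<in> Wt")
    case True
    then show ?thesis using that H0_Ef_vge[OF Wt_D(1)[OF True]]
      by (simp add: CA_def HA_def lead_at_add single_add)
  qed (use that in \<open>simp add: CA_def HA_def lead_at_0\<close>)
  show "x * y \<in> CA (u + w)" if "x \<in> CA u" "y \<in> CA w" for x y u w
  proof (cases "u \<in> Wt \<and> w \<in> Wt")
    case True
    have "vge P (- Ef P (u + w)) (x * y)" for P
    proof (rule vge_mono)
      show "vge P (- Ef P u + - Ef P w) (x * y)" using that True by (intro vge_mult) (simp_all add: CA_def H0_iff)
      show "- Ef P (u + w) \<le> - Ef P u + - Ef P w" using Ef_add[of u w P] True by simp
    qed
    then show ?thesis using True by (simp add: CA_def H0_iff Wt_add)
  next
    case False
    then have "x = 0 \<or> y = 0" using that by (auto simp: CA_def split: if_splits)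
    then show ?thesis by (auto simp: CA_def H0_iff vge_0)
  qed
  show "HA (u + w) (x * y) = HA u x * HA w y" if "x \<in> CA u" "y \<in> CA w" for x y u w
  proof (cases "u \<in> Wt \<and> w \<in> Wt")
    case True
    then show ?thesis using that HA_mult by (simp add: CA_def)
  next
    case False
    then have "x = 0 \<or> y = 0" using that by (auto simp: CA_def split: if_splits)
    then show ?thesis by (auto simp: HA_def lead_at_0)
  qed
qed

abbreviation hh :: "(((real \<times> 'v) \<times> real) \<Rightarrow>\<^sub>0 ratfun) \<Rightarrow> laurent" where "hh \<equiv> AX.ext"

lemma allowed_iff: "f \<in> AX.allowed \<longleftrightarrow> (\<forall>w\<in>Poly_Mapping.keys f. w \<in> Wt \<and> Poly_Mapping.lookup f w \<in> H0 (\<lambda>P. Ef P w))"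
  by (auto simp: AX.allowed_def CA_def in_keys_iff H0_iff vge_0)

lemma At_simps: "carrier At = AX.allowed" "mult At = (*)" "one At = 1" "zero At = 0" "add At = (+)"
  "scal At = (\<lambda>c. Poly_Mapping.single 0 (const_fun c))"
  "hcomp At i = {f \<in> AX.allowed. \<forall>w\<in>Poly_Mapping.keys f. fst (fst w) = real i}"
proof -
  have "{f. \<forall>w\<in>Poly_Mapping.keys f. w \<in> dual_cone (tc_cone \<D> Q v m) \<inter> (\<int> \<times> M) \<times> \<int> \<and>
      Poly_Mapping.lookup f w \<in> H0 (\<lambda>P. \<lfloor>polyhedral_value (tc_divisor \<D> Q v m P) w\<rfloor>)} = AX.allowed" (is "?A = _")
    unfolding set_eq_iff mem_Collect_eq allowed_iff Wt_def Lt_def Ef_def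
    by (intro allI ball_cong refl conj_cong) (simp add: tc_value)
  then show "carrier At = AX.allowed" "hcomp At i = {f \<in> AX.allowed. \<forall>w\<in>Poly_Mapping.keys f. fst (fst w) = real i}"
    by (simp_all add: At_def tc_alg_def section_alg_def Let_def)
qed (simp_all add: At_def tc_alg_def section_alg_def Let_def)

text \<open>An exponent with integral \<open>j\<close> can be recovered from \<open>(y,j)\<close>,
  so different terms of \<open>f\<close> never meet in one monomial of the image. In particular a
  vanishing image makes every single leading coefficient vanish.\<close>

lemma lookup_hh:
  assumes f: "f \<in> AX.allowed"
  shows "Poly_Mapping.lookup (hh f) g =
    (if g \<in> CG then lead_at Q \<lfloor>ht (zm g)\<rfloor> (Poly_Mapping.lookup f (wz (zm g))) else 0)"
proof -
  have k: "w \<in> Lt" if "w \<in> Poly_Mapping.keys f" for w using f that by (simp add: allowed_iff Wt_D)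
  have e: "Poly_Mapping.lookup (HA w (Poly_Mapping.lookup f w)) g =
      (if g \<in> CG \<and> w = wz (zm g) then lead_at Q \<lfloor>ht (zm g)\<rfloor> (Poly_Mapping.lookup f (wz (zm g))) else 0)"
    if "w \<in> Poly_Mapping.keys f" for w
  proof (cases "g \<in> CG \<and> w = wz (zm g)")
    case True
    then show ?thesis using zm_in[of g] by (simp add: HA_def bw_wz jj_wz zt_wz \<kappa>_zm)
  next
    case False
    have "\<not> (int m dvd bw w \<and> \<kappa> (zt w) = g)"
      using False wz_zt[OF k[OF that]] \<kappa>_in[OF zt(1)[OF k[OF that]]] zm_\<kappa>[OF zt(1)[OF k[OF that]]] by metis
    then show ?thesis using False by (auto simp: HA_def lookup_single)
  qed
  have "Poly_Mapping.lookup (hh f) g = (\<Sum>w\<in>Poly_Mapping.keys f.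
      if g \<in> CG \<and> w = wz (zm g) then lead_at Q \<lfloor>ht (zm g)\<rfloor> (Poly_Mapping.lookup f (wz (zm g))) else 0)"
    unfolding AX.ext_def lookup_sum by (rule sum.cong[OF refl e])
  also have "\<dots> = (if g \<in> CG then lead_at Q \<lfloor>ht (zm g)\<rfloor> (Poly_Mapping.lookup f (wz (zm g))) else 0)"
    by (auto simp: in_keys_iff lead_at_0)
  finally show ?thesis .
qed

lemma keys_hh:
  assumes f: "f \<in> AX.allowed" and g: "g \<in> Poly_Mapping.keys (hh f)"
  shows "g \<in> SM" "wz (zm g) \<in> Poly_Mapping.keys f"
proof -
  have gC: "g \<in> CG" and l: "lead_at Q \<lfloor>ht (zm g)\<rfloor> (Poly_Mapping.lookup f (wz (zm g))) \<noteq> 0"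
    using g by (auto simp: in_keys_iff lookup_hh[OF f] split: if_splits)
  note zL = zm_in[OF gC]
  show k: "wz (zm g) \<in> Poly_Mapping.keys f" using l by (auto simp: in_keys_iff lead_at_0)
  have "zt (wz (zm g)) \<in> SL"
    by (rule lead_SL[of _ "Poly_Mapping.lookup f (wz (zm g))"])
      (use f k l in \<open>auto simp: allowed_iff bw_wz[OF zL] jj_wz[OF zL]\<close>)
  then show "g \<in> SM" by (simp add: SM_def gC zt_wz[OF zL])
qed

text \<open>The information on the exponents of the lift makes it homogeneous whenever the image is;
  this is what identifies the grading of the quotient.\<close>

lemma hh_surj:
  assumes F: "\<phi> \<in> supp_on SM"
  shows "\<exists>f\<in>AX.allowed. hh f = \<phi> \<and> (\<forall>w\<in>Poly_Mapping.keys f. \<exists>g\<in>Poly_Mapping.keys \<phi>. w = wz (zm g))"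
proof -
  have S: "zm g \<in> SL" "zm g \<in> L" "\<kappa> (zm g) = g" if "g \<in> Poly_Mapping.keys \<phi>" for g
    using that F zm_in \<kappa>_zm by (auto simp: supp_on_def SM_def)
  have "\<forall>g\<in>Poly_Mapping.keys \<phi>. \<exists>f. f \<in> H0 (\<lambda>P. Ef P (wz (zm g))) \<and> lead_at Q \<lfloor>ht (zm g)\<rfloor> f = 1"
    using section_exists(2)[OF S(1)] by blast
  from bchoice[OF this] obtain s where s: "\<And>g. g \<in> Poly_Mapping.keys \<phi> \<Longrightarrow> s g \<in> H0 (\<lambda>P. Ef P (wz (zm g)))"
    "\<And>g. g \<in> Poly_Mapping.keys \<phi> \<Longrightarrow> lead_at Q \<lfloor>ht (zm g)\<rfloor> (s g) = 1" by blast
  let ?c = "\<lambda>g. const_fun (Poly_Mapping.lookup \<phi> g) * s g"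
  define f where "f = (\<Sum>g\<in>Poly_Mapping.keys \<phi>. Poly_Mapping.single (wz (zm g)) (?c g))"
  have c: "?c g \<in> CA (wz (zm g))" if "g \<in> Poly_Mapping.keys \<phi>" for g
    using vge_mult[OF vge_const, of _ _ "s g" "Poly_Mapping.lookup \<phi> g"] s(1)[OF that] section_exists(1)[OF S(1)[OF that]]
    by (simp add: CA_def H0_iff)
  have a: "f \<in> AX.allowed" unfolding f_def by (intro AX.allowed_sum AX.allowed_single c)
  have "hh f = (\<Sum>g\<in>Poly_Mapping.keys \<phi>. HA (wz (zm g)) (?c g))"
    unfolding f_def by (simp add: AX.ext_sum AX.allowed_single c AX.ext_single)
  also have "\<dots> = (\<Sum>g\<in>Poly_Mapping.keys \<phi>. Poly_Mapping.single g (Poly_Mapping.lookup \<phi> g))"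
  proof (rule sum.cong[OF refl])
    fix g assume g: "g \<in> Poly_Mapping.keys \<phi>"
    have "vge Q (- \<lfloor>ht (zm g)\<rfloor>) (s g)"
      using H0_Ef_vge[OF wz_Lt[OF S(2)[OF g]] s(1)[OF g]] by (simp add: jj_wz[OF S(2)[OF g]])
    from lead_at_scale[OF this] show "HA (wz (zm g)) (?c g) = Poly_Mapping.single g (Poly_Mapping.lookup \<phi> g)"
      by (simp add: HA_def bw_wz jj_wz zt_wz S[OF g] s(2)[OF g])
  qed
  finally have "hh f = \<phi>" by (simp flip: pm_expand)
  moreover have "\<exists>g\<in>Poly_Mapping.keys \<phi>. w = wz (zm g)" if "w \<in> Poly_Mapping.keys f" for w
  proof -
    have "f \<in> supp_on ((wz \<circ> zm) ` Poly_Mapping.keys \<phi>)" unfolding f_def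
      by (intro supp_on_sum supp_on_single) auto
    then show ?thesis using that by (auto simp: supp_on_def)
  qed
  ultimately show ?thesis using a by blast
qed

end

lemma cring_cong:
  assumes "cring R" and e: "carrier S = carrier R" "mult S = mult R" "one S = one R" "zero S = zero R" "add S = add R"
  shows "cring S"
proof -
  interpret R: cring R by fact
  show ?thesis
  proof (rule cringI)
    show "abelian_group S"
      by (rule abelian_groupI) (auto simp: e R.a_ac intro: bexI[of _ "\<ominus>\<^bsub>R\<^esub> x" for x] R.l_neg)
    show "Group.comm_monoid S"
      by (rule comm_monoidI) (auto simp: e R.m_ac)
  qed (simp add: e R.l_distr)
qed

context tc_coords
begin

section \<open>Division by \<open>t\<close> and the kernel of the reduction\<close>

definition ee :: "(real \<times> 'v) \<times> real" where "ee = ((0, 0), 1)"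
definition tt :: "((real \<times> 'v) \<times> real) \<Rightarrow>\<^sub>0 ratfun" where "tt = Poly_Mapping.single ee 1"

lemma ee_Lt: "ee \<in> Lt" using M_0 by (auto simp: ee_def Lt_def)

lemma fst_ee: "fst ee = 0" by (simp add: ee_def zero_prod_def)

lemma bw_ee: "bw ee = 1" by (simp add: bw_def fst_ee) (simp add: ee_def)

lemma Lt_minus_ee: "w \<in> Lt \<Longrightarrow> w - ee \<in> Lt" by (auto simp: Lt_def ee_def)

lemma jj_minus_ee:
  assumes w: "w \<in> Lt"
  shows "jj (w - ee) = (if int m dvd bw w then jj w - 1 else jj w)"
proof -
  have b: "bw (w - ee) = bw w - 1" using bw_add[OF Lt_minus_ee[OF w] ee_Lt] by (simp add: bw_ee)
  have d: "bw w = int m * jj w + bw w mod int m" by (simp only: jj_def mult_div_mod_eq)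
  show ?thesis
  proof (cases "int m dvd bw w")
    case True
    then have "bw w - 1 = int m * (jj w - 1) + (int m - 1)" using d by (simp add: right_diff_distrib)
    then have "(bw w - 1) div int m = jj w - 1" by (rule int_div_pos_eq) (use m_pos in auto)
    then show ?thesis using True by (simp add: jj_def b)
  next
    case False
    then have "0 < bw w mod int m" using pos_mod_sign[OF m_pos(2), of "bw w"] unfolding dvd_eq_mod_eq_0 by linarith
    then have "0 \<le> bw w mod int m - 1" "bw w mod int m - 1 < int m"
      using pos_mod_bound[OF m_pos(2), of "bw w"] by linarith+
    moreover have "bw w - 1 = int m * jj w + (bw w mod int m - 1)" using d by linarith
    ultimately have "(bw w - 1) div int m = jj w" using int_div_pos_eq by blast
    then show ?thesis using False by (simp add: jj_def[of "w - ee"] b)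
  qed
qed

text \<open>Dividing by \<open>t\<close> needs two things: the smaller pole bound at
  \<open>Q\<close>, which follows from the vanishing leading coefficient, and that the new exponent
  stays in the dual cone.\<close>

lemma hh_eq_0_shift:
  assumes f: "f \<in> AX.allowed" "hh f = 0" and k: "w \<in> Poly_Mapping.keys f"
  shows "Poly_Mapping.lookup f w \<in> CA (w - ee)"
proof -
  let ?x = "Poly_Mapping.lookup f w"
  have w: "w \<in> Wt" and x: "?x \<in> H0 (\<lambda>P. Ef P w)" and x0: "?x \<noteq> 0"
    using f(1) k by (auto simp: allowed_iff in_keys_iff)
  note wL = Wt_D(1)[OF w] and y = Wt_D(2)[OF w] and eL = Lt_minus_ee[OF Wt_D(1)[OF w]]
  have fw: "fst (w - ee) = fst w" by (simp add: fst_ee)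
  have vQ: "vge Q (- jj (w - ee)) ?x"
  proof (cases "int m dvd bw w")
    case True
    note zL = zt(1)[OF wL]
    have "Poly_Mapping.lookup (hh f) (\<kappa> (zt w)) = lead_at Q (jj w) ?x"
      by (simp add: lookup_hh[OF f(1)] \<kappa>_in[OF zL] zm_\<kappa>[OF zL] wz_zt[OF wL True] zt(2,3))
    then have "lead_at Q (jj w) ?x = 0" using f(2) by simp
    then show ?thesis using lead_at_eq_0_iff[OF H0_Ef_vge[OF wL x]] True by (simp add: jj_minus_ee[OF wL])
  next
    case False
    then show ?thesis using H0_Ef_vge[OF wL x] by (simp add: jj_minus_ee[OF wL])
  qed
  have "vge P (- Ef P (w - ee)) ?x" for P
  proof (cases "P = Q")
    case True
    have "vge Q (- Ef Q w) ?x" using x by (simp add: H0_iff)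
    then show ?thesis using vQ unfolding True Ef(1)[OF wL] Ef(1)[OF eL] fw vge_def by linarith
  next
    case False
    have "vge P (- Ef P w) ?x" using x by (simp add: H0_iff)
    then show ?thesis unfolding Ef(2)[OF False] fw .
  qed
  then have xe: "?x \<in> H0 (\<lambda>P. Ef P (w - ee))" by (simp add: H0_iff)
  \<comment> \<open>A nonzero section of the shifted divisor exists, so its degree is nonnegative;
    as rounding down only decreases, this gives the inequality that defines the dual cone.\<close>
  have "0 \<le> (\<Sum>P\<in>insert Q F. Ef P (w - ee))"
    by (rule H0_degree[OF xe x0]) (use finite_F vl_0[OF _ y] in \<open>auto simp: Ef fst_ee\<close>)
  also have "\<dots> = Ef Q (w - ee) + (\<Sum>P\<in>F - {Q}. Ef P (w - ee))"
    by (rule sum.insert_remove[OF finite_F])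
  also have "(\<Sum>P\<in>F - {Q}. Ef P (w - ee)) = fl (fst w)"
    unfolding fl_def by (rule sum.cong) (auto simp: Ef fst_ee)
  also have "Ef Q (w - ee) \<le> jj (w - ee)" by (simp add: Ef(1)[OF eL])
  finally have "0 \<le> real_of_int (jj (w - ee)) + real_of_int (fl (fst w))" by simp
  moreover have "real_of_int (jj (w - ee)) \<le> v \<bullet> fst w + snd (w - ee) / real m"
    using jj_floor[OF eL] fw by (metis of_int_floor_le)
  ultimately have "w - ee \<in> Wt" using fl_le[of "fst w"] eL y by (simp add: Wt_iff fst_ee)
  then show ?thesis using xe by (simp add: CA_def)
qed

lemma hh_eq_0:
  assumes f: "f \<in> AX.allowed" "hh f = 0"
  shows "\<exists>g\<in>AX.allowed. f = g * tt"
proof -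
  define g where "g = (\<Sum>w\<in>Poly_Mapping.keys f. Poly_Mapping.single (w - ee) (Poly_Mapping.lookup f w))"
  have "g \<in> AX.allowed" unfolding g_def by (intro AX.allowed_sum AX.allowed_single hh_eq_0_shift[OF f])
  moreover have "g * tt = f" unfolding g_def tt_def sum_distrib_right mult_single
    by (simp flip: pm_expand)
  ultimately show ?thesis by metis
qed

lemma vl_00: "vl P 0 = 0"
  using vl_scale[OF dual_cone_closed(1), of 0] by simp

lemma tt_allowed: "tt \<in> AX.allowed" and hh_tt: "hh tt = 0"
proof -
  have j: "jj ee = (if m = 1 then 1 else 0)" using m_pos by (simp add: jj_def bw_ee)
  have W: "ee \<in> Wt" using m_pos by (simp add: Wt_iff ee_Lt fst_ee dual_cone_closed vl_00 sm_def) (simp add: ee_def)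
  have "Ef P ee = 0" for P by (cases "P = Q") (simp_all add: Ef(1)[OF ee_Lt] Ef(2) j fst_ee vl_00)
  then have "1 \<in> CA ee" using W by (simp add: CA_def H0_iff vge_def ord_1)
  then show "tt \<in> AX.allowed" unfolding tt_def by (rule AX.allowed_single)
  \<comment> \<open>The exponent of \<open>t\<close> has \<open>j = 1/m\<close>, an integer only for
    \<open>m = 1\<close>; in that case the constant 1 has no pole of order 1 at
    \<open>Q\<close>.\<close>
  have "lead_at Q 1 1 = 0" using lead_at_eq_0_iff[of Q 1 1] by (simp add: vge_def ord_1)
  moreover have "jj ee = 1" if "int m dvd 1" using that j by (simp only: zdvd1_eq abs_of_nat of_nat_eq_1_iff if_True refl)
  ultimately have "HA ee 1 = 0" by (cases "int m dvd 1") (simp_all only: HA_def bw_ee if_True if_False single_zero)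
  then show "hh tt = 0" by (simp add: tt_def AX.ext_single)
qed

lemma const_allowed: "Poly_Mapping.single 0 (const_fun c) \<in> AX.allowed"
  and hh_const: "hh (Poly_Mapping.single 0 (const_fun c)) = Poly_Mapping.single 0 c"
proof -
  have b: "bw 0 = 0" "jj 0 = 0" by (simp_all add: bw_def jj_def)
  have "Ef P 0 = 0" for P by (cases "P = Q") (simp_all add: Ef(1)[OF Lt_0] Ef(2) b vl_00)
  then have "const_fun c \<in> CA 0" using zero_Wt by (simp add: CA_def H0_iff vge_const)
  then show "Poly_Mapping.single 0 (const_fun c) \<in> AX.allowed" by (rule AX.allowed_single)
  have "zt 0 = 0" by (simp add: zt_def b) (simp add: zero_prod_def)
  then show "hh (Poly_Mapping.single 0 (const_fun c)) = Poly_Mapping.single 0 c"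
    by (simp add: AX.ext_single HA_def b \<kappa>_0 lead_at_const)
qed

lemma allowed_1: "1 \<in> AX.allowed" and hh_1: "hh 1 = 1"
  using const_allowed[of 1] hh_const[of 1] by (simp_all add: const_fun_hom)

lemma hh_supp: "f \<in> AX.allowed \<Longrightarrow> hh f \<in> supp_on SM"
  using keys_hh(1) by (auto simp: supp_on_def)

lemma At_cring: "cring At"
proof -
  have "At = \<lparr>carrier = AX.allowed, mult = (*), one = 1, zero = 0, add = (+), \<dots> = Ring.ring.more At\<rparr>"
    using At_simps by (cases At) simp
  moreover have "- f \<in> AX.allowed" if "f \<in> AX.allowed" for f
    using that by (auto simp: allowed_iff H0_iff in_keys_iff vge_uminus)
  then have "cring \<lparr>carrier = AX.allowed, mult = (*), one = 1, zero = 0, add = (+), \<dots> = Ring.ring.more At\<rparr>"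
    by (intro subring_cring AX.allowed_add AX.allowed_mult allowed_1 AX.allowed_0)
  ultimately show ?thesis by metis
qed

definition RS :: "laurent ring" where
  "RS = \<lparr>carrier = supp_on SM, mult = (*), one = 1, zero = 0, add = (+)\<rparr>"

lemma RS_cring: "cring RS"
  unfolding RS_def by (rule subring_cring) (simp_all add: supp_on_closed supp_on_monoid[OF SM_monoid])

sublocale QH: ring_hom_ring At RS hh
proof (rule ring_hom_ringI2)
  show "ring At" "ring RS" using At_cring RS_cring by (simp_all add: cring_def)
  show "hh \<in> ring_hom At RS"
    by (rule ring_hom_memI) (simp_all add: At_simps RS_def AX.ext_mult AX.ext_add hh_1 hh_supp)
qed

definition Ik :: "(((real \<times> 'v) \<times> real) \<Rightarrow>\<^sub>0 ratfun) set" where "Ik = PIdl\<^bsub>At\<^esub> tt"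

lemma kernel_eq: "a_kernel At RS hh = Ik"
  unfolding a_kernel_def' Ik_def cgenideal_def
proof (intro equalityI subsetI)
  fix f assume "f \<in> {x \<in> carrier At. hh x = \<zero>\<^bsub>RS\<^esub>}"
  then have "f \<in> AX.allowed" "hh f = 0" by (simp_all add: At_simps RS_def)
  from hh_eq_0[OF this] show "f \<in> {x \<otimes>\<^bsub>At\<^esub> tt |x. x \<in> carrier At}" by (auto simp: At_simps)
next
  fix f assume "f \<in> {x \<otimes>\<^bsub>At\<^esub> tt |x. x \<in> carrier At}"
  then show "f \<in> {x \<in> carrier At. hh x = \<zero>\<^bsub>RS\<^esub>}"
    by (auto simp: At_simps RS_def AX.allowed_mult AX.ext_mult tt_allowed hh_tt)
qed

text \<open>Elements of the quotient are cosets; seen as fibers of \<open>hh\<close>, they can be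
  compared through their images when gradings and actions are computed.\<close>

lemma coset_eq: "x \<in> AX.allowed \<Longrightarrow> Ik +>\<^bsub>At\<^esub> x = {y \<in> AX.allowed. hh y = hh x}"
proof (intro equalityI subsetI)
  assume x: "x \<in> AX.allowed"
  fix y assume y: "y \<in> Ik +>\<^bsub>At\<^esub> x"
  have "Ik \<subseteq> carrier At" unfolding kernel_eq[symmetric] a_kernel_def' by auto
  then have "y \<in> carrier At" using y x QH.R.a_r_coset_subset_G[of Ik x] by (auto simp: At_simps)
  moreover have "hh y = hh x" using QH.rcos_imp_homeq[of x y] x y by (simp add: At_simps kernel_eq)
  ultimately show "y \<in> {y \<in> AX.allowed. hh y = hh x}" by (simp add: At_simps)
next
  assume x: "x \<in> AX.allowed"
  fix y assume "y \<in> {y \<in> AX.allowed. hh y = hh x}"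
  then show "y \<in> Ik +>\<^bsub>At\<^esub> x" using QH.homeq_imp_rcos[of x y] x by (simp add: At_simps kernel_eq)
qed

section \<open>The fiber algebra as a monoid algebra\<close>

definition Fib :: "(((real \<times> 'v) \<times> real) \<Rightarrow>\<^sub>0 ratfun) set gcalg" where "Fib = tc_fiber_alg M \<D> Q v m"
definition \<gamma>F :: "(((real \<times> 'v) \<times> real) \<Rightarrow>\<^sub>0 ratfun) set \<Rightarrow> laurent" where "\<gamma>F X = the_elem (hh ` X)"

lemma Fib_eq: "Fib = quot_alg At Ik"
  by (simp add: Fib_def tc_fiber_alg_def At_def Ik_def tt_def ee_def Let_def)

lemma Fib_simps: "carrier Fib = (\<lambda>x. Ik +>\<^bsub>At\<^esub> x) ` AX.allowed"
  "mult Fib = mult (At Quot Ik)" "one Fib = one (At Quot Ik)" "zero Fib = zero (At Quot Ik)" "add Fib = add (At Quot Ik)"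
  "scal Fib = (\<lambda>c. Ik +>\<^bsub>At\<^esub> Poly_Mapping.single 0 (const_fun c))"
  "hcomp Fib i = (\<lambda>x. Ik +>\<^bsub>At\<^esub> x) ` hcomp At i" "carrier Fib = carrier (At Quot Ik)"
  unfolding Fib_eq by (auto simp: quot_alg_def FactRing_def A_RCOSETS_def' At_simps)

lemma \<gamma>F_coset: "x \<in> AX.allowed \<Longrightarrow> \<gamma>F (Ik +>\<^bsub>At\<^esub> x) = hh x"
proof -
  assume x: "x \<in> AX.allowed"
  then have "hh ` (Ik +>\<^bsub>At\<^esub> x) = {hh x}" unfolding coset_eq[OF x] by auto
  then show ?thesis by (simp add: \<gamma>F_def)
qed

lemma \<gamma>F_iso: "\<gamma>F \<in> ring_iso (At Quot Ik) RS"
proof -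
  have "hh ` carrier At = carrier RS" using hh_surj hh_supp by (force simp: At_simps RS_def)
  from QH.FactRing_iso_set[OF this] show ?thesis unfolding kernel_eq \<gamma>F_def[abs_def] .
qed

lemma Fib_mono_alg: "mono_alg Fib \<gamma>F SM gdeg"
proof (intro mono_alg.intro mono_alg_axioms.intro)
  interpret A: cring At by (rule At_cring)
  have "ideal Ik At" unfolding Ik_def by (rule A.cgenideal_ideal) (simp add: At_simps tt_allowed)
  then have "cring (At Quot Ik)" by (rule ideal.quotient_is_cring[OF _ At_cring])
  then show "cring Fib" by (rule cring_cong) (rule Fib_simps)+
  show "bij_betw \<gamma>F (carrier Fib) (supp_on SM)"
    using \<gamma>F_iso unfolding Fib_simps(8) by (simp add: ring_iso_def RS_def)
  show "\<gamma>F (a \<otimes>\<^bsub>Fib\<^esub> b) = \<gamma>F a * \<gamma>F b" "\<gamma>F (a \<oplus>\<^bsub>Fib\<^esub> b) = \<gamma>F a + \<gamma>F b"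
    if "a \<in> carrier Fib" "b \<in> carrier Fib" for a b
    using \<gamma>F_iso that unfolding Fib_simps(2-5,8) by (simp_all add: ring_iso_def ring_hom_def RS_def)
  show "\<gamma>F \<one>\<^bsub>Fib\<^esub> = 1"
    using \<gamma>F_iso unfolding Fib_simps(2-5,8) by (simp add: ring_iso_def ring_hom_def RS_def)
  show "\<gamma>F (scal Fib c) = Poly_Mapping.single 0 c" "scal Fib c \<in> carrier Fib" for c
    unfolding Fib_simps(1,6) by (simp_all add: \<gamma>F_coset const_allowed hh_const)
  show "hcomp Fib i = {b \<in> carrier Fib. \<forall>w\<in>Poly_Mapping.keys (\<gamma>F b). gdeg w = int i}" for i
  proof (intro equalityI subsetI)
    fix b assume "b \<in> hcomp Fib i"
    then obtain x where x: "b = Ik +>\<^bsub>At\<^esub> x" "x \<in> AX.allowed" "\<forall>w\<in>Poly_Mapping.keys x. fst (fst w) = real i"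
      by (auto simp: Fib_simps(7) At_simps)
    have "gdeg g = int i" if g: "g \<in> Poly_Mapping.keys (hh x)" for g
    proof -
      have "fst (fst (wz (zm g))) = real i" using x(3) keys_hh(2)[OF x(2) g] by blast
      then show ?thesis by (simp add: wz_def pr_def fst_zm gdeg_def)
    qed
    then show "b \<in> {b \<in> carrier Fib. \<forall>w\<in>Poly_Mapping.keys (\<gamma>F b). gdeg w = int i}"
      using x by (simp add: Fib_simps(1) \<gamma>F_coset)
  next
    fix b assume b: "b \<in> {b \<in> carrier Fib. \<forall>w\<in>Poly_Mapping.keys (\<gamma>F b). gdeg w = int i}"
    then obtain x where x: "b = Ik +>\<^bsub>At\<^esub> x" "x \<in> AX.allowed" by (auto simp: Fib_simps(1))
    \<comment> \<open>The representative \<open>x\<close> may carry multiples of \<open>t\<close> in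
      other degrees, whereas homogeneity of a coset asks for some homogeneous representative.
      Lifting the image of \<open>x\<close> term by term gives one.\<close>
    obtain f where f: "f \<in> AX.allowed" "hh f = hh x" "\<forall>w\<in>Poly_Mapping.keys f. \<exists>g\<in>Poly_Mapping.keys (hh x). w = wz (zm g)"
      using hh_surj[OF hh_supp[OF x(2)]] by blast
    have deg: "\<forall>g\<in>Poly_Mapping.keys (hh x). gdeg g = int i" using b unfolding x(1) mem_Collect_eq \<gamma>F_coset[OF x(2)] by (rule conjunct2)
    have "fst (fst w) = real i" if w: "w \<in> Poly_Mapping.keys f" for w
    proof -
      obtain g where g: "g \<in> Poly_Mapping.keys (hh x)" "w = wz (zm g)" using f(3) w by blast
      then have "gdeg g = int i" using deg by blast
      then show ?thesis unfolding g(2) by (simp add: wz_def pr_def fst_zm gdeg_def)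
    qed
    moreover have "b = Ik +>\<^bsub>At\<^esub> f" using x f by (simp add: coset_eq)
    ultimately show "b \<in> hcomp Fib i" using f(1) unfolding Fib_simps(7) At_simps by blast
  qed
  show "submonoid_set SM" by (rule SM_monoid)
  show "additive_fun gdeg" by (rule gdeg_additive)
  show "0 \<le> gdeg s" if "s \<in> SM" for s using that SM_WM WM_deg by blast
  show "\<exists>s\<in>SM. 0 < gdeg s" using SM_pos by blast
qed

lemma fiber_pair: "c \<in> SM \<Longrightarrow> (\<And>w. w \<in> WM \<Longrightarrow> c + w \<in> SM) \<Longrightarrow>
  mono_pair Fib \<gamma>F SM gdeg Tor \<gamma>T WM (rk + 2) LM n0 c"
  by (intro mono_pair.intro mono_pair_axioms.intro Fib_mono_alg Tor_mono_alg SM_WM LM(1,2) LM(3)[unfolded CG_def] n0(1) SM_n0)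

subsection \<open>The torus actions\<close>

lemma lookup_ops_act: "Poly_Mapping.lookup (ops_act \<iota> l z f) w = \<iota> (z powi \<lfloor>l \<bullet> w\<rfloor>) * Poly_Mapping.lookup f w"
  by (auto simp: ops_act_def lookup_mapp when_def in_keys_iff)

lemma powi_floor_add:
  fixes z :: complex
  assumes "z \<noteq> 0" "a \<in> \<int>" "b \<in> \<int>"
  shows "z powi \<lfloor>a + b :: real\<rfloor> = z powi \<lfloor>a\<rfloor> * z powi \<lfloor>b\<rfloor>"
  using assms by (auto elim!: Ints_cases simp: power_int_add simp flip: of_int_add)

lemma Tor_mono_act:
  assumes z: "z \<noteq> 0" and l: "\<And>w. w \<in> L \<Longrightarrow> l \<bullet> w \<in> \<int>"
  shows "mono_act Tor \<gamma>T WM gdeg (ops_act id l z) (\<lambda>g. z powi \<lfloor>l \<bullet> zm g\<rfloor>)"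
proof (intro mono_act.intro mono_act_axioms.intro Tor_mono_alg)
  show "z powi \<lfloor>l \<bullet> zm (s + t)\<rfloor> = z powi \<lfloor>l \<bullet> zm s\<rfloor> * z powi \<lfloor>l \<bullet> zm t\<rfloor>" if "s \<in> WM" "t \<in> WM" for s t
    unfolding zm_add inner_add_right by (rule powi_floor_add[OF z]) (use that l zm_in in \<open>auto simp: WM_iff\<close>)
  show "z powi \<lfloor>l \<bullet> zm s\<rfloor> \<noteq> 0" for s using z by simp
  show cl: "ops_act id l z f \<in> carrier Tor" if "f \<in> carrier Tor" for f
    using that by (auto simp: Tor_simps supp_on_def in_keys_iff lookup_ops_act subset_iff)
  show "\<gamma>T (ops_act id l z f) = char_twist (\<lambda>g. z powi \<lfloor>l \<bullet> zm g\<rfloor>) (\<gamma>T f)" if "f \<in> carrier Tor" for f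
    using that cl[OF that] by (intro poly_mapping_eqI) (simp add: Tor_simps lookup_char_twist lookup_\<gamma>T lookup_ops_act)
qed

text \<open>Scaling a coefficient scales its leading coefficient. The monomial \<open>g\<close> of
  the image comes from the exponent \<open>wz (zm g)\<close>, so this is where the character has to
  be evaluated.\<close>

lemma hh_ops_act:
  assumes f: "f \<in> AX.allowed"
  shows "ops_act const_fun l z f \<in> AX.allowed"
    "hh (ops_act const_fun l z f) = char_twist (\<lambda>g. z powi \<lfloor>l \<bullet> wz (zm g)\<rfloor>) (hh f)"
proof -
  show a: "ops_act const_fun l z f \<in> AX.allowed"
  proof -
    have "const_fun c * x \<in> CA w" if "x \<in> CA w" for c x w
      using that vge_mult[OF vge_const] by (fastforce simp: CA_def H0_iff split: if_splits)
    then show ?thesis using f by (simp add: AX.allowed_def lookup_ops_act)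
  qed
  show "hh (ops_act const_fun l z f) = char_twist (\<lambda>g. z powi \<lfloor>l \<bullet> wz (zm g)\<rfloor>) (hh f)"
  proof (rule poly_mapping_eqI)
    fix g
    let ?w = "wz (zm g)"
    have "lead_at Q \<lfloor>ht (zm g)\<rfloor> (const_fun c * Poly_Mapping.lookup f ?w) = c * lead_at Q \<lfloor>ht (zm g)\<rfloor> (Poly_Mapping.lookup f ?w)"
      if g: "g \<in> CG" for c
    proof (cases "?w \<in> Poly_Mapping.keys f")
      case True
      then have w: "?w \<in> Wt" "Poly_Mapping.lookup f ?w \<in> H0 (\<lambda>P. Ef P ?w)" using f by (auto simp: allowed_iff)
      have "vge Q (- \<lfloor>ht (zm g)\<rfloor>) (Poly_Mapping.lookup f ?w)"
        using H0_Ef_vge[OF Wt_D(1)[OF w(1)] w(2)] by (simp add: jj_wz[OF zm_in[OF g]])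
      then show ?thesis by (rule lead_at_scale)
    qed (simp add: in_keys_iff lead_at_0)
    then show "Poly_Mapping.lookup (hh (ops_act const_fun l z f)) g =
        Poly_Mapping.lookup (char_twist (\<lambda>g. z powi \<lfloor>l \<bullet> wz (zm g)\<rfloor>) (hh f)) g"
      by (simp add: lookup_char_twist lookup_hh[OF a] lookup_hh[OF f] lookup_ops_act)
  qed
qed

lemma ops_act_inverse:
  assumes "z \<noteq> 0"
  shows "ops_act const_fun l z (ops_act const_fun l (inverse z) f) = f"
  using assms by (intro poly_mapping_eqI)
    (simp add: lookup_ops_act power_int_inverse mult.assoc[symmetric] const_fun_hom(2) flip: const_fun_hom(4))

lemma char_twist_inverse:
  assumes "\<And>g. a g * b g = 1"
  shows "char_twist a (char_twist b f) = f"
  using assms by (intro poly_mapping_eqI) (simp add: lookup_char_twist mult.assoc[symmetric])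

lemma ops_act_coset:
  assumes x: "x \<in> AX.allowed" and z: "z \<noteq> 0"
  shows "ops_act const_fun l z ` (Ik +>\<^bsub>At\<^esub> x) = Ik +>\<^bsub>At\<^esub> ops_act const_fun l z x"
proof (intro equalityI subsetI)
  fix y assume "y \<in> ops_act const_fun l z ` (Ik +>\<^bsub>At\<^esub> x)"
  then show "y \<in> Ik +>\<^bsub>At\<^esub> ops_act const_fun l z x"
    using hh_ops_act[OF x] hh_ops_act[where l = l and z = z] unfolding coset_eq[OF x] coset_eq[OF hh_ops_act(1)[OF x]]
    by (elim imageE) simp
next
  fix y assume "y \<in> Ik +>\<^bsub>At\<^esub> ops_act const_fun l z x"
  then have y: "y \<in> AX.allowed" "hh y = hh (ops_act const_fun l z x)" using hh_ops_act[OF x] by (auto simp: coset_eq)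
  have "hh (ops_act const_fun l (inverse z) y) = hh x"
    unfolding hh_ops_act(2)[OF y(1)] y(2) hh_ops_act(2)[OF x]
    by (rule char_twist_inverse) (use z in \<open>simp add: power_int_inverse\<close>)
  then have "ops_act const_fun l (inverse z) y \<in> Ik +>\<^bsub>At\<^esub> x" using hh_ops_act(1)[OF y(1)] by (simp add: coset_eq x)
  then show "y \<in> ops_act const_fun l z ` (Ik +>\<^bsub>At\<^esub> x)" using ops_act_inverse[OF z] by (metis imageI)
qed

lemma wz_add: "wz (x + y) = wz x + wz y"
  by (simp add: wz_def pr_ht inner_add_right algebra_simps)

lemma Fib_mono_act:
  assumes z: "z \<noteq> 0" and l: "\<And>w. w \<in> Lt \<Longrightarrow> l \<bullet> w \<in> \<int>"
  shows "mono_act Fib \<gamma>F SM gdeg ((`) (ops_act const_fun l z)) (\<lambda>g. z powi \<lfloor>l \<bullet> wz (zm g)\<rfloor>)"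
proof (intro mono_act.intro mono_act_axioms.intro Fib_mono_alg)
  show "z powi \<lfloor>l \<bullet> wz (zm (s + t))\<rfloor> = z powi \<lfloor>l \<bullet> wz (zm s)\<rfloor> * z powi \<lfloor>l \<bullet> wz (zm t)\<rfloor>" if "s \<in> SM" "t \<in> SM" for s t
    unfolding zm_add wz_add inner_add_right by (rule powi_floor_add[OF z]) (use that l zm_in wz_Lt in \<open>auto simp: SM_def\<close>)
  show "z powi \<lfloor>l \<bullet> wz (zm s)\<rfloor> \<noteq> 0" for s using z by simp
  fix b assume "b \<in> carrier Fib"
  then obtain x where x: "b = Ik +>\<^bsub>At\<^esub> x" "x \<in> AX.allowed" by (auto simp: Fib_simps(1))
  show "ops_act const_fun l z ` b \<in> carrier Fib"
    using hh_ops_act(1)[OF x(2)] by (simp add: x(1) ops_act_coset[OF x(2) z] Fib_simps(1))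
  show "\<gamma>F (ops_act const_fun l z ` b) = char_twist (\<lambda>g. z powi \<lfloor>l \<bullet> wz (zm g)\<rfloor>) (\<gamma>F b)"
    using hh_ops_act[OF x(2)] by (simp add: x(1) ops_act_coset[OF x(2) z] \<gamma>F_coset x(2))
qed

theorem fiber_normalization:
  "\<exists>\<nu>. normalization (Proj Tor) (Proj Fib) \<nu> \<and> pullback_polarization Tor Fib \<nu> \<and>
     (\<forall>n\<in>dual_lattice M. \<forall>z. z \<noteq> 0 \<longrightarrow>
        intertwines (Proj Tor) (Proj Fib) (toric_action (M \<times> \<int>) (Delta Box \<Psi> Q) (n, 0) z) \<nu>
          (tc_fiber_action M \<D> Q v m ((0, n), 0) z)) \<and>
     (\<forall>z. z \<noteq> 0 \<longrightarrow>
        intertwines (Proj Tor) (Proj Fib) (toric_action (M \<times> \<int>) (Delta Box \<Psi> Q) (- real m *\<^sub>R snd v, real m) z) \<nu>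
          (tc_fiber_action M \<D> Q v m ((0, 0), 1) z))"
proof -
  obtain c where c: "c \<in> SM" "\<And>w. w \<in> WM \<Longrightarrow> c + w \<in> SM" using SM_pos by blast
  interpret P: mono_pair Fib \<gamma>F SM gdeg Tor \<gamma>T WM "rk + 2" LM n0 c by (rule fiber_pair[OF c])
  \<comment> \<open>The pairings need to agree only up to a multiple of the degree, since a
    rescaling of each degree acts trivially on \<open>Proj\<close>.\<close>
  have equi: "intertwines (Proj Tor) (Proj Fib) (toric_action (M \<times> \<int>) (Delta Box \<Psi> Q) l' z) P.D.mor (tc_fiber_action M \<D> Q v m l z)"
    if z: "z \<noteq> 0" and l: "\<And>w. w \<in> Lt \<Longrightarrow> l \<bullet> w \<in> \<int>" "\<And>w. w \<in> L \<Longrightarrow> (0, l') \<bullet> w \<in> \<int>"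
      and e: "\<And>g. g \<in> SM \<Longrightarrow> l \<bullet> wz (zm g) = (0, l') \<bullet> zm g + of_int (k * gdeg g)" for l l' z k
  proof -
    have ch: "z powi \<lfloor>l \<bullet> wz (zm s)\<rfloor> = z powi \<lfloor>(0, l') \<bullet> zm s\<rfloor> * (z powi k) ^ nat (gdeg s)" if s: "s \<in> SM" for s
    proof -
      have "0 \<le> gdeg s" using s SM_WM WM_deg by blast
      moreover have "zm s \<in> L" using s zm_in by (simp add: SM_def)
      ultimately show ?thesis using z l(2)[of "zm s"] unfolding e[OF s]
        by (subst powi_floor_add[OF z]) (simp_all only: floor_of_int power_int_mult Ints_of_int nat_0_le flip: power_int_of_nat)
    qed
    interpret mono_pair_act Fib \<gamma>F SM gdeg Tor \<gamma>T WM "rk + 2" LM n0 c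
      "(`) (ops_act const_fun l z)" "\<lambda>g. z powi \<lfloor>l \<bullet> wz (zm g)\<rfloor>" "ops_act id (0, l') z" "\<lambda>g. z powi \<lfloor>(0, l') \<bullet> zm g\<rfloor>" "z powi k"
      by (intro mono_pair_act.intro mono_pair_act_axioms.intro P.mono_pair_axioms Fib_mono_act[OF z l(1)] Tor_mono_act[OF z l(2)] ch)
        (use z in simp_all)
    show ?thesis using intertwines_act by (simp add: toric_action_def tc_fiber_action_def Tor_def Fib_def)
  qed
  have 1: "intertwines (Proj Tor) (Proj Fib) (toric_action (M \<times> \<int>) (Delta Box \<Psi> Q) (n, 0) z) P.D.mor
      (tc_fiber_action M \<D> Q v m ((0, n), 0) z)" if n: "n \<in> dual_lattice M" and z: "z \<noteq> 0" for n z
    by (rule equi[where k = 0, OF z])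
      (use n in \<open>auto simp: Lt_def L_def dual_lattice_def wz_def pr_def inner_prod_def\<close>)
  have 2: "intertwines (Proj Tor) (Proj Fib) (toric_action (M \<times> \<int>) (Delta Box \<Psi> Q) (- real m *\<^sub>R snd v, real m) z) P.D.mor
      (tc_fiber_action M \<D> Q v m ((0, 0), 1) z)" if z: "z \<noteq> 0" for z
  proof -
    \<comment> \<open>The component of \<open>m v\<close> in the degree direction. It is missing
      from the toric subgroup and reappears as \<open>- k\<close> times the degree.\<close>
    obtain k where k: "real m * fst v = of_int k" using mv by (auto simp: mem_Times_iff elim!: Ints_cases)
    have d: "real m * (snd v \<bullet> u) \<in> \<int>" if "u \<in> M" for u
      using mv that by (auto simp: mem_Times_iff dual_lattice_def)
    show ?thesis
    proof (rule equi[where k = "- k", OF z])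
      show "((0, 0), 1) \<bullet> w \<in> \<int>" if "w \<in> Lt" for w using that by (auto simp: Lt_def inner_prod_def)
      show "(0, - real m *\<^sub>R snd v, real m) \<bullet> w \<in> \<int>" if "w \<in> L" for w
        using that d by (auto simp: L_def inner_prod_def)
      show "((0, 0), 1) \<bullet> wz (zm g) = (0, - real m *\<^sub>R snd v, real m) \<bullet> zm g + of_int (- k * gdeg g)" for g
        by (simp add: wz_def pr_def ht_def inner_prod_def fst_zm gdeg_def algebra_simps flip: k)
    qed
  qed
  show ?thesis using P.normalization_Proj P.polarization 1 2 by blast
qed

end

lemma full_lattice_coordinates:
  assumes "full_lattice M"
  obtains e :: "nat \<Rightarrow> 'v::real_inner" and n where "M = {\<Sum>i<n. of_int (c i) *\<^sub>R e i | c. True}"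
    "\<And>x i. (\<Sum>i<n. x i *\<^sub>R e i) = 0 \<Longrightarrow> i < n \<Longrightarrow> x i = 0"
proof -
  obtain B where B: "finite B" "independent B" "M = {\<Sum>b\<in>B. of_int (c b) *\<^sub>R b | c :: 'v \<Rightarrow> int. True}"
    using assms unfolding full_lattice_def by blast
  obtain e where e: "bij_betw e {..<card B} B"
    using ex_bij_betw_nat_finite[OF B(1)] by (auto simp: atLeast0LessThan)
  have r: "(\<Sum>b\<in>B. x b *\<^sub>R b) = (\<Sum>i<card B. x (e i) *\<^sub>R e i)" for x :: "'v \<Rightarrow> real"
    by (rule sum.reindex_bij_betw[OF e, symmetric])
  define e' where "e' = inv_into {..<card B} e"
  have e': "e' (e i) = i" if "i < card B" for i using that e by (simp add: e'_def bij_betw_inv_into_left)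
  show thesis
  proof (rule that)
    show "M = {\<Sum>i<card B. of_int (c i) *\<^sub>R e i | c. True}"
    proof (intro equalityI subsetI)
      fix u assume "u \<in> M"
      then obtain c :: "'v \<Rightarrow> int" where "u = (\<Sum>b\<in>B. of_int (c b) *\<^sub>R b)" unfolding B(3) by blast
      then have "u = (\<Sum>i<card B. of_int ((c \<circ> e) i) *\<^sub>R e i)" using r[of "\<lambda>b. of_int (c b)"] by simp
      then show "u \<in> {\<Sum>i<card B. of_int (c i) *\<^sub>R e i | c. True}" by blast
    next
      fix u assume "u \<in> {\<Sum>i<card B. of_int (c i) *\<^sub>R e i | c. True}"
      then obtain c where "u = (\<Sum>i<card B. of_int (c i) *\<^sub>R e i)" by blast
      then have "u = (\<Sum>b\<in>B. of_int ((c \<circ> e') b) *\<^sub>R b)" using r[of "\<lambda>b. of_int ((c \<circ> e') b)"] e' by simp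
      then show "u \<in> M" unfolding B(3) by blast
    qed
    fix x i assume 0: "(\<Sum>i<card B. x i *\<^sub>R e i) = 0" and i: "i < card B"
    have "(\<Sum>b\<in>B. x (e' b) *\<^sub>R b) = 0" using r[of "\<lambda>b. x (e' b)"] e' 0 by simp
    moreover have "e i \<in> B" using e i by (auto simp: bij_betw_def)
    ultimately have "x (e' (e i)) = 0" by (rule independentD[OF B(2,1) order_refl, of "\<lambda>b. x (e' b)"])
    then show "x i = 0" by (simp add: e' i)
  qed
qed

theorem corollary4p6:
  fixes M Box :: "'v::real_inner set"
    and \<Psi> :: "proj_line \<Rightarrow> 'v \<Rightarrow> real"
    and X :: "('x, 's) cspace" and L :: "('x, 's, 'l) omod"
    and act :: "'v \<Rightarrow> complex \<Rightarrow> ('x, 's, 'x, 's) cmorph"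
    and \<sigma> :: "(real \<times> 'v) set" and \<D> :: "proj_line \<Rightarrow> (real \<times> 'v) set"
    and Q :: proj_line and m :: nat and v :: "real \<times> 'v"
  assumes "full_lattice M"
    and "divisorial_polytope M Box \<Psi>"
    and "corresponds_to X L act M Box \<Psi>"
    and "p_divisor (\<int> \<times> dual_lattice M) \<sigma> \<D>"
    and "dual_cone \<sigma> = cone_over Box"
    and "\<forall>P. \<forall>(k, u)\<in>dual_cone \<sigma>. polyhedral_value (\<D> P) (k, u) = k * \<Psi> P (u /\<^sub>R k)"
    and "m \<ge> 1"
    and "real m *\<^sub>R v \<in> \<int> \<times> dual_lattice M"
  shows "let Tor = toric_alg (M \<times> \<int>) (Delta Box \<Psi> Q);
             Fib = tc_fiber_alg M \<D> Q v m
         in \<exists>\<nu>. normalization (Proj Tor) (Proj Fib) \<nu> \<and>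
              pullback_polarization Tor Fib \<nu> \<and>
              (\<forall>n\<in>dual_lattice M. \<forall>z. z \<noteq> 0 \<longrightarrow>
                 intertwines (Proj Tor) (Proj Fib)
                   (toric_action (M \<times> \<int>) (Delta Box \<Psi> Q) (n, 0) z) \<nu>
                   (tc_fiber_action M \<D> Q v m ((0, n), 0) z)) \<and>
              (\<forall>z. z \<noteq> 0 \<longrightarrow>
                 intertwines (Proj Tor) (Proj Fib)
                   (toric_action (M \<times> \<int>) (Delta Box \<Psi> Q) (- real m *\<^sub>R snd v, real m) z) \<nu>
                   (tc_fiber_action M \<D> Q v m ((0, 0), 1) z))"
proof -
  obtain e :: "nat \<Rightarrow> 'v" and n where e: "M = {\<Sum>i<n. of_int (c i) *\<^sub>R e i | c. True}"
    "\<And>x i. (\<Sum>i<n. x i *\<^sub>R e i) = 0 \<Longrightarrow> i < n \<Longrightarrow> x i = 0"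
    using full_lattice_coordinates[OF assms(1)] by blast
  interpret tc_coords M Box \<Psi> \<sigma> \<D> Q m v e n
    by (intro tc_coords.intro tc_data.intro tc_coords_axioms.intro assms e)
  show ?thesis unfolding Let_def using fiber_normalization unfolding Tor_def Fib_def .
qed

end
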